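(* Let $n>2$ be an integer. Let $H$ be a finite dimensional radically graded quasi-Hopf algebra over $\mathbb{C}$ with $H[0]=(\mathbb{C}[\mathbb{Z}/n\mathbb{Z}],\Phi)$, where $\Phi$ is a nontrivial associator, such that the free left $H[0]$-module $H[1]$ has rank $1$. Let $a$ be a generator of $\mathbb{Z}/n\mathbb{Z}$ and $Q$ a primitive root of unity of degree $n$; let $s$ be an integer such that $\Phi$ is twist equivalent to $\Phi_s$ (with respect to $a$ and $Q$), and let $Q^r$ be the scalar by which $\mathrm{Ad}(a)$ acts on $H[1]$. Assume that $r$ and $s$ are coprime to $n$. Then $H$ is isomorphic, up to a twist, to $A(q)$ for some primitive root of unity $q$ of degree $n^2$. Moreover, the quasi-Hopf algebras $A(q)$, for $q$ running over the primitive roots of unity of degree $n^2$, are pairwise nonisomorphic (even up to a twist).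
   Context: Quasi-Hopf algebras are in the sense of Drinfeld, with $(\mathrm{id}\otimes\Delta)\Delta(h)=\Phi(\Delta\otimes\mathrm{id})\Delta(h)\Phi^{-1}$. $H$ is radically graded if $H=\mathrm{gr}\,H$, the associated graded with respect to the filtration by powers of the radical; $H[i]$ is the degree $i$ component (so $H[0]=H/\mathrm{Rad}(H)$). $H[1]$ is automatically free as a left $H[0]$-module. $\mathrm{Ad}(a)(z)=aza^{-1}$. For an integer $i$, $i'$ is the remainder of division of $i$ by $n$. With respect to $a$ and $Q$, ${\bf 1}_i$ ($i\in\mathbb{Z}/n\mathbb{Z}$) are the primitive idempotents of $\mathbb{C}[\mathbb{Z}/n\mathbb{Z}]$ with $a{\bf 1}_i=Q^i{\bf 1}_i$, and $$\Phi_s=\sum_{i,j,l=0}^{n-1}Q^{si(j+l-(j+l)')/n}\,{\bf 1}_i\otimes{\bf 1}_j\otimes{\bf 1}_l .$$ An associator is trivial if it is twist equivalent to $1\otimes 1\otimes 1$. A twist for a quasi-Hopf algebra $H$ is an invertible $J\in H\otimes H$ with $(\varepsilon\otimes\mathrm{id})(J)=(\mathrm{id}\otimes\varepsilon)(J)=1$; the twisted algebra $H_J$ has the same algebra structure and counit, coproduct $\Delta_J(h)=J\Delta(h)J^{-1}$ and associator $\Phi_J=(1\otimes J)(\mathrm{id}\otimes\Delta)(J)\,\Phi\,(\Delta\otimes\mathrm{id})(J^{-1})(J\otimes1)^{-1}$. "$H_1$ and $H_2$ are isomorphic up to a twist" means that there is a twist $K$ of $H_2$ and an algebra isomorphism $H_1\to(H_2)_K$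 compatible with coproducts, counits and associators. Definition of $A(q)$, for $q$ a primitive root of unity of order $n^2$: let $H(q)$ be the Taft Hopf algebra of dimension $n^4$ generated by $g,x$ with $x^{n^2}=0$, $g^{n^2}=1$, $gx=qxg$, $\Delta(g)=g\otimes g$, $\Delta(x)=x\otimes g+1\otimes x$, $\varepsilon(g)=1$, $\varepsilon(x)=0$. Let $1_z$ ($0\le z\le n^2-1$) be the primitive idempotents of $\mathbb{C}[g]$ with $g1_z=q^z1_z$, and $J=\sum_{z,y=0}^{n^2-1}q^{-z(y-y')}1_z\otimes1_y$. Then $A(q)$ is the subalgebra of $H(q)$ generated by $g^n$ and $x$ (of dimension $n^3$), a quasi-Hopf subalgebra of the twist $H(q)_J$, with coproduct $\Delta_J$, counit $\varepsilon$ and associator $\Phi_J$. *)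

theory Defs
  imports "HOL-Algebra.Algebra" "HOL-Algebra.Algebraic_Closure_Type" Complex_Main
begin

section \<open>Algebras over the complex numbers\<close>

abbreviation complex_ring :: "complex ring" where
  "complex_ring \<equiv> ring_of_type_algebra"

text \<open>The library locale \<^locale>\<open>algebra\<close> is restricted to commutative algebras.\<close>

locale complex_algebra = module complex_ring H + ring H for H (structure) +
  assumes smult_mult_left:
      "\<lbrakk> x \<in> carrier H; y \<in> carrier H \<rbrakk> \<Longrightarrow> (c \<odot> x) \<otimes> y = c \<odot> (x \<otimes> y)"
    and smult_mult_right:
      "\<lbrakk> x \<in> carrier H; y \<in> carrier H \<rbrakk> \<Longrightarrow> x \<otimes> (c \<odot> y) = c \<odot> (x \<otimes> y)"

definition finite_dim :: "(complex, 'a, 'm) module_scheme \<Rightarrow> bool" where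
  "finite_dim H \<longleftrightarrow> (\<exists>B. finite B \<and> B \<subseteq> carrier H \<and>
     (\<forall>h \<in> carrier H. \<exists>c. h = (\<Oplus>\<^bsub>H\<^esub> b \<in> B. c b \<odot>\<^bsub>H\<^esub> b)))"

inductive_set generated_subalgebra :: "(complex, 'a, 'm) module_scheme \<Rightarrow> 'a set \<Rightarrow> 'a set"
  for H and S where
    one: "\<one>\<^bsub>H\<^esub> \<in> generated_subalgebra H S"
  | incl: "x \<in> S \<Longrightarrow> x \<in> generated_subalgebra H S"
  | add: "x \<in> generated_subalgebra H S \<Longrightarrow> y \<in> generated_subalgebra H S \<Longrightarrow>
      x \<oplus>\<^bsub>H\<^esub> y \<in> generated_subalgebra H S"
  | smult: "x \<in> generated_subalgebra H S \<Longrightarrow> c \<odot>\<^bsub>H\<^esub> x \<in> generated_subalgebra H S"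
  | mult: "x \<in> generated_subalgebra H S \<Longrightarrow> y \<in> generated_subalgebra H S \<Longrightarrow>
      x \<otimes>\<^bsub>H\<^esub> y \<in> generated_subalgebra H S"

definition left_ideal :: "'a set \<Rightarrow> ('a, 'm) ring_scheme \<Rightarrow> bool" where
  "left_ideal I H \<longleftrightarrow> subgroup I (add_monoid H) \<and>
     (\<forall>h \<in> carrier H. \<forall>x \<in> I. h \<otimes>\<^bsub>H\<^esub> x \<in> I)"

definition maximal_left_ideal :: "'a set \<Rightarrow> ('a, 'm) ring_scheme \<Rightarrow> bool" where
  "maximal_left_ideal I H \<longleftrightarrow> left_ideal I H \<and> I \<noteq> carrier H \<and>
     (\<forall>J. left_ideal J H \<and> I \<subseteq> J \<longrightarrow> J = I \<or> J = carrier H)"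

definition Rad :: "('a, 'm) ring_scheme \<Rightarrow> 'a set" where
  "Rad H = {h \<in> carrier H. \<forall>I. maximal_left_ideal I H \<longrightarrow> h \<in> I}"

fun Rad_power :: "('a, 'm) ring_scheme \<Rightarrow> nat \<Rightarrow> 'a set" where
  "Rad_power H 0 = carrier H"
| "Rad_power H (Suc k) = ideal_prod H (Rad H) (Rad_power H k)"


section \<open>Tensor powers\<close>

text \<open>
  The tensor power \<open>H\<^sup>\<otimes>\<^sup>k\<close> is realised inside the dual of the space of \<open>k\<close>-linear forms on \<open>H\<close>: the
  pure tensor \<open>x\<^sub>1 \<otimes> \<dots> \<otimes> x\<^sub>k\<close> is the evaluation \<open>f \<mapsto> f [x\<^sub>1, \<dots>, x\<^sub>k]\<close>, and \<open>H\<^sup>\<otimes>\<^sup>k\<close> is the span of the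
  pure tensors (over a field multilinear forms separate tensors, so this is the usual tensor
  power, for any vector space). A term of type \<open>'a tensor\<close> also has values on functions that are
  not multilinear; these are irrelevant, and equality of tensors is \<open>tensor_eq\<close>, not \<open>=\<close>.
  With this encoding, \<open>t (\<lambda>xs. F xs)\<close> reads as Sweedler notation: if \<open>t = \<Sum> x \<otimes> y\<close> then
  \<open>t (\<lambda>xs. F xs) = \<Sum> F [x, y]\<close>. If \<open>S\<close> is a subspace of \<open>H\<close>, the inclusion of \<open>S\<^sup>\<otimes>\<^sup>k\<close> into \<open>H\<^sup>\<otimes>\<^sup>k\<close>
  is the identity on representatives.
\<close>

type_synonym 'a tensor = "('a list \<Rightarrow> complex) \<Rightarrow> complex"

definition multilinear :: "(complex, 'a, 'm) module_scheme \<Rightarrow> nat \<Rightarrow> ('a list \<Rightarrow> complex) \<Rightarrow> bool" where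
  "multilinear H k f \<longleftrightarrow>
     (\<forall>xs i x y c. length xs = k \<and> set xs \<subseteq> carrier H \<and> i < k \<and> x \<in> carrier H \<and> y \<in> carrier H \<longrightarrow>
        f (xs[i := x \<oplus>\<^bsub>H\<^esub> y]) = f (xs[i := x]) + f (xs[i := y]) \<and>
        f (xs[i := c \<odot>\<^bsub>H\<^esub> x]) = c * f (xs[i := x]))"

definition tensor_eq :: "(complex, 'a, 'm) module_scheme \<Rightarrow> nat \<Rightarrow> 'a tensor \<Rightarrow> 'a tensor \<Rightarrow> bool" where
  "tensor_eq H k t u \<longleftrightarrow> (\<forall>f. multilinear H k f \<longrightarrow> t f = u f)"

definition pure_tensor :: "'a list \<Rightarrow> 'a tensor" where
  "pure_tensor xs = (\<lambda>f. f xs)"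

definition tensor_sum :: "'a list list \<Rightarrow> 'a tensor" where
  "tensor_sum L = (\<lambda>f. \<Sum>xs\<leftarrow>L. f xs)"

definition tensors :: "(complex, 'a, 'm) module_scheme \<Rightarrow> nat \<Rightarrow> 'a tensor set" where
  "tensors H k = {t. \<exists>L. (\<forall>xs \<in> set L. length xs = k \<and> set xs \<subseteq> carrier H) \<and>
     tensor_eq H k t (tensor_sum L)}"

definition tensor_mult ::
    "(complex, 'a, 'm) module_scheme \<Rightarrow> 'a tensor \<Rightarrow> 'a tensor \<Rightarrow> 'a tensor" (infixl \<open>\<star>\<index>\<close> 70) where
  "t \<star>\<^bsub>H\<^esub> u = (\<lambda>f. t (\<lambda>xs. u (\<lambda>ys. f (map2 (\<lambda>x y. x \<otimes>\<^bsub>H\<^esub> y) xs ys))))"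

definition tensor_one :: "(complex, 'a, 'm) module_scheme \<Rightarrow> nat \<Rightarrow> 'a tensor" where
  "tensor_one H k = pure_tensor (replicate k \<one>\<^bsub>H\<^esub>)"

text \<open>Outer product \<open>H\<^sup>\<otimes>\<^sup>k \<times> H\<^sup>\<otimes>\<^sup>l \<rightarrow> H\<^sup>\<otimes>\<^sup>(\<^sup>k\<^sup>+\<^sup>l\<^sup>)\<close>.\<close>

definition tensor_append :: "'a tensor \<Rightarrow> 'a tensor \<Rightarrow> 'a tensor" where
  "tensor_append t u = (\<lambda>f. t (\<lambda>xs. u (\<lambda>ys. f (xs @ ys))))"

definition tensor_map :: "('a \<Rightarrow> 'b) \<Rightarrow> 'a tensor \<Rightarrow> 'b tensor" where
  "tensor_map \<phi> t = (\<lambda>f. t (\<lambda>xs. f (map \<phi> xs)))"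

definition is_tensor_inverse ::
    "(complex, 'a, 'm) module_scheme \<Rightarrow> nat \<Rightarrow> 'a tensor \<Rightarrow> 'a tensor \<Rightarrow> bool" where
  "is_tensor_inverse H k t u \<longleftrightarrow> u \<in> tensors H k \<and>
     tensor_eq H k (t \<star>\<^bsub>H\<^esub> u) (tensor_one H k) \<and> tensor_eq H k (u \<star>\<^bsub>H\<^esub> t) (tensor_one H k)"

definition tensor_invertible :: "(complex, 'a, 'm) module_scheme \<Rightarrow> nat \<Rightarrow> 'a tensor \<Rightarrow> bool" where
  "tensor_invertible H k t \<longleftrightarrow> t \<in> tensors H k \<and> (\<exists>u. is_tensor_inverse H k t u)"

definition tensor_inv :: "(complex, 'a, 'm) module_scheme \<Rightarrow> nat \<Rightarrow> 'a tensor \<Rightarrow> 'a tensor" where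
  "tensor_inv H k t = (SOME u. is_tensor_inverse H k t u)"


section \<open>Quasi-Hopf algebras\<close>

record 'a quasi_hopf = "(complex, 'a) module" +
  comult :: "'a \<Rightarrow> 'a tensor"
  counit :: "'a \<Rightarrow> complex"
  associator :: "'a tensor"

text \<open>\<open>id \<otimes> \<dots> \<otimes> \<Delta> \<otimes> \<dots> \<otimes> id\<close> and \<open>id \<otimes> \<dots> \<otimes> \<epsilon> \<otimes> \<dots> \<otimes> id\<close>, acting on the factor number \<open>i\<close>
  (counted from 0).\<close>

definition comult_at :: "('a, 'm) quasi_hopf_scheme \<Rightarrow> nat \<Rightarrow> 'a tensor \<Rightarrow> 'a tensor" where
  "comult_at H i t =
     (\<lambda>f. t (\<lambda>xs. comult H (xs ! i) (\<lambda>ys. f (take i xs @ ys @ drop (Suc i) xs))))"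

definition counit_at :: "('a, 'm) quasi_hopf_scheme \<Rightarrow> nat \<Rightarrow> 'a tensor \<Rightarrow> 'a tensor" where
  "counit_at H i t = (\<lambda>f. t (\<lambda>xs. counit H (xs ! i) * f (take i xs @ drop (Suc i) xs)))"

definition is_antipode ::
    "('a, 'm) quasi_hopf_scheme \<Rightarrow> ('a \<Rightarrow> 'a) \<Rightarrow> 'a \<Rightarrow> 'a \<Rightarrow> bool" where
  "is_antipode H S \<alpha> \<beta> \<longleftrightarrow>
     bij_betw S (carrier H) (carrier H) \<and> \<alpha> \<in> carrier H \<and> \<beta> \<in> carrier H \<and>
     (\<forall>x \<in> carrier H. \<forall>y \<in> carrier H. S (x \<oplus>\<^bsub>H\<^esub> y) = S x \<oplus>\<^bsub>H\<^esub> S y) \<and>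
     (\<forall>x \<in> carrier H. \<forall>c. S (c \<odot>\<^bsub>H\<^esub> x) = c \<odot>\<^bsub>H\<^esub> S x) \<and>
     (\<forall>x \<in> carrier H. \<forall>y \<in> carrier H. S (x \<otimes>\<^bsub>H\<^esub> y) = S y \<otimes>\<^bsub>H\<^esub> S x) \<and>
     S \<one>\<^bsub>H\<^esub> = \<one>\<^bsub>H\<^esub> \<and>
     (\<forall>h \<in> carrier H.
        tensor_eq H 1 (\<lambda>f. comult H h (\<lambda>xs. f [S (xs ! 0) \<otimes>\<^bsub>H\<^esub> \<alpha> \<otimes>\<^bsub>H\<^esub> xs ! 1]))
          (pure_tensor [counit H h \<odot>\<^bsub>H\<^esub> \<alpha>])) \<and>
     (\<forall>h \<in> carrier H.
        tensor_eq H 1 (\<lambda>f. comult H h (\<lambda>xs. f [xs ! 0 \<otimes>\<^bsub>H\<^esub> \<beta> \<otimes>\<^bsub>H\<^esub> S (xs ! 1)]))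
          (pure_tensor [counit H h \<odot>\<^bsub>H\<^esub> \<beta>])) \<and>
     tensor_eq H 1
       (\<lambda>f. associator H
          (\<lambda>xs. f [xs ! 0 \<otimes>\<^bsub>H\<^esub> \<beta> \<otimes>\<^bsub>H\<^esub> S (xs ! 1) \<otimes>\<^bsub>H\<^esub> \<alpha> \<otimes>\<^bsub>H\<^esub> xs ! 2]))
       (tensor_one H 1) \<and>
     tensor_eq H 1
       (\<lambda>f. tensor_inv H 3 (associator H)
          (\<lambda>xs. f [S (xs ! 0) \<otimes>\<^bsub>H\<^esub> \<alpha> \<otimes>\<^bsub>H\<^esub> xs ! 1 \<otimes>\<^bsub>H\<^esub> \<beta> \<otimes>\<^bsub>H\<^esub> S (xs ! 2)]))
       (tensor_one H 1)"

text \<open>The antipode is a property and not part of the record: \<open>(S, \<alpha>, \<beta>)\<close> is determined up to an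
  invertible element, and isomorphisms and twists do not refer to it.\<close>

locale quasi_hopf_algebra = complex_algebra H for H :: "'a quasi_hopf" (structure) +
  assumes comult_closed: "h \<in> carrier H \<Longrightarrow> comult H h \<in> tensors H 2"
    and comult_add: "\<lbrakk> x \<in> carrier H; y \<in> carrier H \<rbrakk> \<Longrightarrow>
      tensor_eq H 2 (comult H (x \<oplus> y)) (\<lambda>f. comult H x f + comult H y f)"
    and comult_smult: "x \<in> carrier H \<Longrightarrow>
      tensor_eq H 2 (comult H (c \<odot> x)) (\<lambda>f. c * comult H x f)"
    and comult_mult: "\<lbrakk> x \<in> carrier H; y \<in> carrier H \<rbrakk> \<Longrightarrow>
      tensor_eq H 2 (comult H (x \<otimes> y)) (comult H x \<star> comult H y)"
    and comult_one: "tensor_eq H 2 (comult H \<one>) (tensor_one H 2)"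
    and counit_add: "\<lbrakk> x \<in> carrier H; y \<in> carrier H \<rbrakk> \<Longrightarrow>
      counit H (x \<oplus> y) = counit H x + counit H y"
    and counit_smult: "x \<in> carrier H \<Longrightarrow> counit H (c \<odot> x) = c * counit H x"
    and counit_mult: "\<lbrakk> x \<in> carrier H; y \<in> carrier H \<rbrakk> \<Longrightarrow>
      counit H (x \<otimes> y) = counit H x * counit H y"
    and counit_one: "counit H \<one> = 1"
    and counit_left: "h \<in> carrier H \<Longrightarrow>
      tensor_eq H 1 (counit_at H 0 (comult H h)) (pure_tensor [h])"
    and counit_right: "h \<in> carrier H \<Longrightarrow>
      tensor_eq H 1 (counit_at H 1 (comult H h)) (pure_tensor [h])"
    and associator_invertible: "tensor_invertible H 3 (associator H)"
    and quasi_coassoc: "h \<in> carrier H \<Longrightarrow>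
      tensor_eq H 3 (comult_at H 1 (comult H h))
        (associator H \<star> comult_at H 0 (comult H h) \<star> tensor_inv H 3 (associator H))"
    and pentagon:
      "tensor_eq H 4
        (comult_at H 2 (associator H) \<star> comult_at H 0 (associator H))
        (tensor_append (pure_tensor [\<one>]) (associator H) \<star> comult_at H 1 (associator H) \<star>
           tensor_append (associator H) (pure_tensor [\<one>]))"
    and associator_counit: "tensor_eq H 2 (counit_at H 1 (associator H)) (tensor_one H 2)"
    and antipode: "\<exists>S \<alpha> \<beta>. is_antipode H S \<alpha> \<beta>"

text \<open>The structure induced on a quasi-Hopf subalgebra \<open>S\<close>: the coproduct and the associator are
  re-represented by tensors over \<open>S\<close>.\<close>

definition restrict_quasi_hopf :: "'a quasi_hopf \<Rightarrow> 'a set \<Rightarrow> 'a quasi_hopf" where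
  "restrict_quasi_hopf H S = H\<lparr>
     carrier := S,
     comult := (\<lambda>h. SOME t. t \<in> tensors (H\<lparr>carrier := S\<rparr>) 2 \<and> tensor_eq H 2 t (comult H h)),
     associator := (SOME t. t \<in> tensors (H\<lparr>carrier := S\<rparr>) 3 \<and> tensor_eq H 3 t (associator H))\<rparr>"


section \<open>Twists and isomorphisms\<close>

definition is_twist :: "'a quasi_hopf \<Rightarrow> 'a tensor \<Rightarrow> bool" where
  "is_twist H J \<longleftrightarrow> tensor_invertible H 2 J \<and>
     tensor_eq H 1 (counit_at H 0 J) (tensor_one H 1) \<and>
     tensor_eq H 1 (counit_at H 1 J) (tensor_one H 1)"

definition twist_associator :: "'a quasi_hopf \<Rightarrow> 'a tensor \<Rightarrow> 'a tensor \<Rightarrow> 'a tensor" where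
  "twist_associator H J \<Phi> =
     tensor_append (pure_tensor [\<one>\<^bsub>H\<^esub>]) J \<star>\<^bsub>H\<^esub> comult_at H 1 J \<star>\<^bsub>H\<^esub> \<Phi> \<star>\<^bsub>H\<^esub>
     comult_at H 0 (tensor_inv H 2 J) \<star>\<^bsub>H\<^esub> tensor_inv H 3 (tensor_append J (pure_tensor [\<one>\<^bsub>H\<^esub>]))"

definition twist :: "'a quasi_hopf \<Rightarrow> 'a tensor \<Rightarrow> 'a quasi_hopf" where
  "twist H J = H\<lparr>
     comult := (\<lambda>h. J \<star>\<^bsub>H\<^esub> comult H h \<star>\<^bsub>H\<^esub> tensor_inv H 2 J),
     associator := twist_associator H J (associator H)\<rparr>"

definition quasi_hopf_iso :: "'a quasi_hopf \<Rightarrow> 'b quasi_hopf \<Rightarrow> ('a \<Rightarrow> 'b) \<Rightarrow> bool" where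
  "quasi_hopf_iso H H' \<phi> \<longleftrightarrow>
     \<phi> \<in> ring_iso H H' \<and>
     (\<forall>x \<in> carrier H. \<forall>c. \<phi> (c \<odot>\<^bsub>H\<^esub> x) = c \<odot>\<^bsub>H'\<^esub> \<phi> x) \<and>
     (\<forall>x \<in> carrier H. tensor_eq H' 2 (comult H' (\<phi> x)) (tensor_map \<phi> (comult H x))) \<and>
     (\<forall>x \<in> carrier H. counit H' (\<phi> x) = counit H x) \<and>
     tensor_eq H' 3 (associator H') (tensor_map \<phi> (associator H))"

definition iso_up_to_twist :: "'a quasi_hopf \<Rightarrow> 'b quasi_hopf \<Rightarrow> bool" where
  "iso_up_to_twist H H' \<longleftrightarrow> (\<exists>K \<phi>. is_twist H' K \<and> quasi_hopf_iso H (twist H' K) \<phi>)"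

text \<open>Twist equivalence of two associators for the same commutative bialgebra; by commutativity
  twisting does not change the coproduct.\<close>

definition twist_equivalent :: "'a quasi_hopf \<Rightarrow> 'a tensor \<Rightarrow> 'a tensor \<Rightarrow> bool" where
  "twist_equivalent H \<Phi> \<Psi> \<longleftrightarrow>
     (\<exists>J. is_twist H J \<and> tensor_eq H 3 (twist_associator H J \<Phi>) \<Psi>)"


section \<open>Radically graded quasi-Hopf algebras\<close>

text \<open>\<open>span_of_components H G I\<close> is the subspace \<open>\<Sum>\<^bsub>i\<in>I\<^esub> G i\<close>, and \<open>graded_tensors H G m k\<close> is the
  degree \<open>k\<close> part of \<open>H\<^sup>\<otimes>\<^sup>m\<close>, i.e. the sum of all \<open>G d\<^sub>1 \<otimes> \<dots> \<otimes> G d\<^sub>m\<close> with \<open>d\<^sub>1 + \<dots> + d\<^sub>m = k\<close>.\<close>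

definition span_of_components ::
    "(complex, 'a, 'm) module_scheme \<Rightarrow> (nat \<Rightarrow> 'a set) \<Rightarrow> nat set \<Rightarrow> 'a set" where
  "span_of_components H G I =
     {\<Oplus>\<^bsub>H\<^esub> i \<in> F. c i | F c. finite F \<and> F \<subseteq> I \<and> (\<forall>i \<in> F. c i \<in> G i)}"

definition graded_tensors ::
    "(complex, 'a, 'm) module_scheme \<Rightarrow> (nat \<Rightarrow> 'a set) \<Rightarrow> nat \<Rightarrow> nat \<Rightarrow> 'a tensor set" where
  "graded_tensors H G m k =
     {t. \<exists>L. (\<forall>xs \<in> set L. length xs = m \<and>
           (\<exists>ds. length ds = m \<and> sum_list ds = k \<and> (\<forall>i < m. xs ! i \<in> G (ds ! i)))) \<and>
         tensor_eq H m t (tensor_sum L)}"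

text \<open>\<open>H = gr H\<close>, spelled out: \<open>H\<close> is the direct sum of subspaces \<open>G i\<close> (the components \<open>H[i]\<close>),
  the whole structure is homogeneous for this grading, and the filtration by powers of the radical
  is the one given by the grading, \<open>Rad\<^sup>k = \<Oplus>\<^bsub>i\<ge>k\<^esub> G i\<close>; so \<open>G k\<close> is identified with
  \<open>Rad\<^sup>k / Rad\<^sup>k\<^sup>+\<^sup>1\<close>. The case \<open>k = 0\<close> says that the \<open>G i\<close> span \<open>H\<close>.\<close>

definition radically_graded :: "'a quasi_hopf \<Rightarrow> (nat \<Rightarrow> 'a set) \<Rightarrow> bool" where
  "radically_graded H G \<longleftrightarrow>
     (\<forall>i. submodule (G i) complex_ring H) \<and>
     (\<forall>F c. finite F \<and> (\<forall>i \<in> F. c i \<in> G i) \<and> (\<Oplus>\<^bsub>H\<^esub> i \<in> F. c i) = \<zero>\<^bsub>H\<^esub> \<longrightarrow>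
        (\<forall>i \<in> F. c i = \<zero>\<^bsub>H\<^esub>)) \<and>
     (\<forall>k. Rad_power H k = span_of_components H G {k..}) \<and>
     \<one>\<^bsub>H\<^esub> \<in> G 0 \<and>
     (\<forall>i j. \<forall>x \<in> G i. \<forall>y \<in> G j. x \<otimes>\<^bsub>H\<^esub> y \<in> G (i + j)) \<and>
     (\<forall>k. \<forall>x \<in> G k. comult H x \<in> graded_tensors H G 2 k) \<and>
     (\<forall>k > 0. \<forall>x \<in> G k. counit H x = 0) \<and>
     associator H \<in> graded_tensors H G 3 0"


section \<open>The group algebra of a cyclic group and its associators\<close>

definition primitive_root_of_unity :: "nat \<Rightarrow> complex \<Rightarrow> bool" where
  "primitive_root_of_unity m \<omega> \<longleftrightarrow> m > 0 \<and> \<omega> ^ m = 1 \<and> (\<forall>k. 0 < k \<and> k < m \<longrightarrow> \<omega> ^ k \<noteq> 1)"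

text \<open>As a bialgebra, \<open>K\<close> is \<open>\<complex>[\<int>/n\<int>]\<close>, with \<open>a\<close> corresponding to a generator of \<open>\<int>/n\<int>\<close>; the
  associator of \<open>K\<close> is arbitrary.\<close>

definition is_cyclic_group_algebra :: "'a quasi_hopf \<Rightarrow> nat \<Rightarrow> 'a \<Rightarrow> bool" where
  "is_cyclic_group_algebra K n a \<longleftrightarrow>
     a \<in> carrier K \<and> a [^]\<^bsub>K\<^esub> n = \<one>\<^bsub>K\<^esub> \<and>
     bij_betw (\<lambda>c. \<Oplus>\<^bsub>K\<^esub> i \<in> {..<n}. c i \<odot>\<^bsub>K\<^esub> (a [^]\<^bsub>K\<^esub> i)) ({..<n} \<rightarrow>\<^sub>E UNIV) (carrier K) \<and>
     tensor_eq K 2 (comult K a) (pure_tensor [a, a]) \<and> counit K a = 1"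

text \<open>For \<open>a\<close> with \<open>a\<^sup>m = 1\<close> and a primitive \<open>m\<close>-th root of unity \<open>\<omega>\<close>, the primitive idempotent
  \<open>1\<^sub>i\<close> of \<open>\<complex>[a]\<close> with \<open>a 1\<^sub>i = \<omega>\<^sup>i 1\<^sub>i\<close>, by the Fourier formula
  \<open>1\<^sub>i = (1/m) \<Sum>\<^sub>k \<omega>\<^sup>-\<^sup>i\<^sup>k a\<^sup>k\<close>.\<close>

definition idem :: "(complex, 'a, 'm) module_scheme \<Rightarrow> nat \<Rightarrow> 'a \<Rightarrow> complex \<Rightarrow> nat \<Rightarrow> 'a" where
  "idem H m a \<omega> i =
     (\<Oplus>\<^bsub>H\<^esub> k \<in> {..<m}. (inverse \<omega> ^ (i * k) / of_nat m) \<odot>\<^bsub>H\<^esub> (a [^]\<^bsub>H\<^esub> k))"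

lemma (in complex_algebra) idem_eigen:
  assumes a: "a \<in> carrier H" "a [^] m = \<one>" and w: "\<omega> ^ m = 1" "m > 0"
  shows "a \<otimes> idem H m a \<omega> i = (\<omega> ^ i) \<odot> idem H m a \<omega> i"
proof -
  have w0: "\<omega> \<noteq> 0" using w by (metis zero_neq_one zero_power)
  have C: "carrier complex_ring = UNIV" by (simp add: ring_of_type_algebra_def)
  have mul: "x \<otimes>\<^bsub>complex_ring\<^esub> y = x * y" for x y by (simp add: ring_of_type_algebra_def)
  let ?t = "\<lambda>k. (inverse \<omega> ^ (i * k) / of_nat m) \<odot> (a [^] k)"
  obtain m' where m': "m = Suc m'" using w by (cases m) auto
  have "a \<otimes> idem H m a \<omega> i = (\<Oplus>k\<in>{..<m}. a \<otimes> ?t k)"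
    unfolding idem_def using a by (intro finsum_rdistr) (auto simp: C)
  also have "\<dots> = (\<Oplus>k\<in>{..<m}. (\<omega> ^ i) \<odot> ?t (Suc k))"
  proof (rule finsum_cong')
    fix k
    have e: "\<omega> ^ i * (inverse \<omega> ^ (i * Suc k)) = inverse \<omega> ^ (i * k)"
      using w0 by (simp add: power_add field_simps)
    have "a \<otimes> ?t k = (inverse \<omega> ^ (i * k) / of_nat m) \<odot> (a [^] Suc k)"
      using a by (simp add: smult_mult_right C nat_pow_Suc2[symmetric] del: nat_pow_Suc)
    also have "\<dots> = (\<omega> ^ i) \<odot> ?t (Suc k)"
      using a e by (simp add: smult_assoc1[symmetric] C mul del: nat_pow_Suc)
    finally show "a \<otimes> ?t k = (\<omega> ^ i) \<odot> ?t (Suc k)" .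
  qed (use a in \<open>auto simp: C\<close>)
  also have "\<dots> = (\<omega> ^ i) \<odot> (\<Oplus>k\<in>{..<m}. ?t (Suc k))"
    using a by (subst finsum_smult_ldistr) (auto simp: C)
  also have "(\<Oplus>k\<in>{..<m}. ?t (Suc k)) = (\<Oplus>k\<in>Suc ` {..<m}. ?t k)"
    using a by (subst finsum_reindex) (auto simp: C)
  also have "Suc ` {..<m} = insert m (Suc ` {..<m'})" unfolding m' lessThan_Suc by simp
  also have "(\<Oplus>k\<in>insert m (Suc ` {..<m'}). ?t k) = ?t m \<oplus> (\<Oplus>k\<in>Suc ` {..<m'}. ?t k)"
    using a by (subst finsum_insert) (auto simp: C m')
  also have "?t m = ?t 0" using w a w0
    by (simp add: power_inverse power_mult mult.commute[of i])
  also have "?t 0 \<oplus> (\<Oplus>k\<in>Suc ` {..<m'}. ?t k) = (\<Oplus>k\<in>insert 0 (Suc ` {..<m'}). ?t k)"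
    using a by (subst finsum_insert) (auto simp: C)
  also have "insert 0 (Suc ` {..<m'}) = {..<m}" unfolding m' by (rule lessThan_Suc_eq_insert_0[symmetric])
  finally show ?thesis by (simp add: idem_def)
qed

definition cyclic_associator ::
    "(complex, 'a, 'm) module_scheme \<Rightarrow> nat \<Rightarrow> 'a \<Rightarrow> complex \<Rightarrow> int \<Rightarrow> 'a tensor" where
  "cyclic_associator K n a Q s =
     (\<lambda>f. \<Sum>i<n. \<Sum>j<n. \<Sum>l<n.
        Q powi (s * int i * ((int (j + l) - int ((j + l) mod n)) div int n)) *
        f [idem K n a Q i, idem K n a Q j, idem K n a Q l])"


section \<open>The quasi-Hopf algebras \<open>A(q)\<close>\<close>

text \<open>The Taft algebra with \<open>g\<^sup>N = 1\<close>, \<open>x\<^sup>N = 0\<close>, \<open>g x = q x g\<close>, on its monomial basis: the vector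
  \<open>h\<close> stands for \<open>\<Sum>\<^bsub>i,j<N\<^esub> h (i, j) g\<^sup>i x\<^sup>j\<close>. The relations give
  \<open>(g\<^sup>i x\<^sup>j) (g\<^sup>k x\<^sup>l) = q\<^sup>-\<^sup>j\<^sup>k g\<^sup>i\<^sup>+\<^sup>k x\<^sup>j\<^sup>+\<^sup>l\<close>. The arguments of
  \<^const>\<open>module.make\<close> are carrier, product, one, zero, sum, scalar multiplication.\<close>

definition monomial :: "nat \<times> nat \<Rightarrow> nat \<times> nat \<Rightarrow> complex" where
  "monomial p = (\<lambda>p'. if p' = p then 1 else 0)"

abbreviation "taft_g \<equiv> monomial (1, 0)"
abbreviation "taft_x \<equiv> monomial (0, 1)"

definition taft_algebra :: "nat \<Rightarrow> complex \<Rightarrow> (complex, nat \<times> nat \<Rightarrow> complex) module" where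
  "taft_algebra N q = module.make
     {h. \<forall>p. p \<notin> {..<N} \<times> {..<N} \<longrightarrow> h p = 0}
     (\<lambda>h h' (m, d). \<Sum>(i, j) \<in> {..<N} \<times> {..<N}. \<Sum>(k, l) \<in> {..<N} \<times> {..<N}.
       if (i + k) mod N = m \<and> j + l = d \<and> d < N
       then h (i, j) * h' (k, l) * inverse q ^ (j * k) else 0)
     (monomial (0, 0))
     (\<lambda>p. 0)
     (\<lambda>h h' p. h p + h' p)
     (\<lambda>c h p. c * h p)"

text \<open>\<open>\<Delta>(g\<^sup>i x\<^sup>j) = (g \<otimes> g)\<^sup>i (x \<otimes> g + 1 \<otimes> x)\<^sup>j\<close>\<close>

definition taft_comult_monomial :: "nat \<Rightarrow> complex \<Rightarrow> nat \<times> nat \<Rightarrow> (nat \<times> nat \<Rightarrow> complex) tensor" where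
  "taft_comult_monomial N q = (\<lambda>(i, j).
     let T = taft_algebra N q in
     (((\<lambda>t. tensor_sum [[taft_g, taft_g]] \<star>\<^bsub>T\<^esub> t) ^^ i) (tensor_one T 2)) \<star>\<^bsub>T\<^esub>
     (((\<lambda>t. tensor_sum [[taft_x, taft_g], [\<one>\<^bsub>T\<^esub>, taft_x]] \<star>\<^bsub>T\<^esub> t) ^^ j) (tensor_one T 2)))"

definition taft :: "nat \<Rightarrow> complex \<Rightarrow> (nat \<times> nat \<Rightarrow> complex) quasi_hopf" where
  "taft N q = module.extend (taft_algebra N q) (quasi_hopf.fields
     (\<lambda>h f. \<Sum>p \<in> {..<N} \<times> {..<N}. h p * taft_comult_monomial N q p f)
     (\<lambda>h. \<Sum>i<N. h (i, 0))
     (tensor_one (taft_algebra N q) 3))"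

definition A_twist :: "nat \<Rightarrow> complex \<Rightarrow> (nat \<times> nat \<Rightarrow> complex) tensor" where
  "A_twist n q = (\<lambda>f. \<Sum>z<n^2. \<Sum>y<n^2.
     q powi (- (int z * (int y - int (y mod n)))) *
     f [idem (taft (n^2) q) (n^2) taft_g q z, idem (taft (n^2) q) (n^2) taft_g q y])"

definition A_algebra :: "nat \<Rightarrow> complex \<Rightarrow> (nat \<times> nat \<Rightarrow> complex) quasi_hopf" where
  "A_algebra n q = (let T = taft (n^2) q in
     restrict_quasi_hopf (twist T (A_twist n q))
       (generated_subalgebra T {taft_g [^]\<^bsub>T\<^esub> n, taft_x}))"

end

theory Submission
  imports Defs
begin

text \<open>
  Let \<open>e\<^sub>i\<close> be the primitive idempotents of \<open>H[0]\<close> for which \<open>x e\<^sub>i = e\<^sub>i\<^sub>+\<^sub>1 x\<close>, where \<open>x\<close> generates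
  \<open>H[1]\<close>. By degree reasons \<open>\<Delta>(x) = \<Sum> \<alpha>\<^sub>i\<^sub>j x e\<^sub>i \<otimes> e\<^sub>j + \<beta>\<^sub>i\<^sub>j e\<^sub>i \<otimes> x e\<^sub>j\<close>, and quasi-coassociativity is a
  system of equations for \<open>\<alpha>\<close>, \<open>\<beta>\<close> and the 3-cocycle \<open>\<omega>\<close>. When \<open>\<omega>\<close> is brought to the normal form with
  parameter \<open>R\<close>, a primitive \<open>n\<close>-th root of unity, the solutions are, up to rescaling the vectors
  \<open>x e\<^sub>i\<close>, the structure constants of \<open>A(q)\<close> with \<open>q\<^sup>n = R\<close>. The two summands of \<open>\<Delta>(x)\<close> \<open>q\<close>-commute,
  so the \<open>q\<close>-binomial theorem forces \<open>x\<close> to have nilpotency order \<open>n\<^sup>2\<close>; hence the \<open>x\<^sup>k e\<^sub>i\<close> with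
  \<open>k < n\<^sup>2\<close> form a basis, and \<open>H\<close> is determined by \<open>\<alpha>\<close>, \<open>\<beta>\<close> and \<open>\<omega>\<close>.

  Conversely, an isomorphism up to a twist preserves the characters and the skew derivations of the
  algebra, and the ratio \<open>\<alpha>\<^sub>0\<^sub>1 / \<beta>\<^sub>1\<^sub>0\<close>, in which the twist cancels, equals \<open>q\<close>.
\<close>

section \<open>Algebras and linear forms\<close>

text \<open>Idempotents are indexed by the eigenvalue \<open>W = Q^r\<close> of \<open>Ad(a)\<close>
  on \<open>H[1]\<close>, not by \<open>Q\<close>: coprimality of \<open>r\<close> makes
  \<open>W\<close> primitive, and then all shifts are by one. In this indexing the parameter of the
  associator is, up to a coboundary, \<open>R = Q^(-s r^2)\<close>, one factor \<open>r\<close>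
  coming from the first index and one from the carry. Coprimality of \<open>s\<close> makes
  \<open>R\<close> primitive, so any \<open>q\<close> with \<open>q^n = R\<close> has order exactly
  \<open>n^2\<close>. Such a \<open>q\<close> appears because going once around Z/n multiplies the
  structure constants by \<open>R\<close>, and periodicity of the rescaling requires an
  \<open>n\<close>-th root of that factor.

  Tensors are functionals with an equality of their own, so coefficients cannot be compared
  directly. They are read off by evaluating on products of characters \<open>chi i\<close>, dual to
  \<open>e i\<close>, and skew derivations \<open>der i\<close>, dual to \<open>x e i\<close>. These
  forms obey product rules, exist before a basis of \<open>H\<close> is known, and turn identities
  between tensors into equations between complex numbers.\<close>

lemma complex_ring_simps [simp]:
  "carrier complex_ring = UNIV" "x \<otimes>\<^bsub>complex_ring\<^esub> y = x * y" "x \<oplus>\<^bsub>complex_ring\<^esub> y = x + y"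
  "\<one>\<^bsub>complex_ring\<^esub> = 1" "\<zero>\<^bsub>complex_ring\<^esub> = 0"
  by (simp_all add: ring_of_type_algebra_def)

lemma complex_algebraI:
  fixes H (structure)
  assumes "abelian_group H" "monoid H"
    "\<And>x y z. \<lbrakk>x \<in> carrier H; y \<in> carrier H; z \<in> carrier H\<rbrakk> \<Longrightarrow> (x \<oplus> y) \<otimes> z = x \<otimes> z \<oplus> y \<otimes> z"
    "\<And>x y z. \<lbrakk>x \<in> carrier H; y \<in> carrier H; z \<in> carrier H\<rbrakk> \<Longrightarrow> z \<otimes> (x \<oplus> y) = z \<otimes> x \<oplus> z \<otimes> y"
    "\<And>a x. x \<in> carrier H \<Longrightarrow> a \<odot> x \<in> carrier H"
    "\<And>a b x. x \<in> carrier H \<Longrightarrow> (a + b) \<odot> x = a \<odot> x \<oplus> b \<odot> x"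
    "\<And>a x y. \<lbrakk>x \<in> carrier H; y \<in> carrier H\<rbrakk> \<Longrightarrow> a \<odot> (x \<oplus> y) = a \<odot> x \<oplus> a \<odot> y"
    "\<And>a b x. x \<in> carrier H \<Longrightarrow> (a * b) \<odot> x = a \<odot> (b \<odot> x)"
    "\<And>x. x \<in> carrier H \<Longrightarrow> 1 \<odot> x = x"
    "\<And>c x y. \<lbrakk>x \<in> carrier H; y \<in> carrier H\<rbrakk> \<Longrightarrow> (c \<odot> x) \<otimes> y = c \<odot> (x \<otimes> y)"
    "\<And>c x y. \<lbrakk>x \<in> carrier H; y \<in> carrier H\<rbrakk> \<Longrightarrow> x \<otimes> (c \<odot> y) = c \<odot> (x \<otimes> y)"
  shows "complex_algebra H"
proof -
  have "module complex_ring H"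
    by (rule moduleI) (use assms cring_from_type_algebra in auto)
  moreover have "ring H" by (rule ringI) (use assms in auto)
  ultimately show ?thesis
    by (intro complex_algebra.intro complex_algebra_axioms.intro) (use assms in auto)
qed

context complex_algebra
begin

lemma smult_C [simp, intro]: "x \<in> carrier H \<Longrightarrow> c \<odot> x \<in> carrier H" by simp
lemma smult_add_left: "x \<in> carrier H \<Longrightarrow> (a + b) \<odot> x = a \<odot> x \<oplus> b \<odot> x"
  using smult_l_distr[of a b x] by simp
lemma smult_add_right: "x \<in> carrier H \<Longrightarrow> y \<in> carrier H \<Longrightarrow> c \<odot> (x \<oplus> y) = c \<odot> x \<oplus> c \<odot> y"
  using smult_r_distr[of c x y] by simp
lemma smult_smult: "x \<in> carrier H \<Longrightarrow> a \<odot> (b \<odot> x) = (a * b) \<odot> x"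
  using smult_assoc1[of a b x] by simp
lemma smult_1 [simp]: "x \<in> carrier H \<Longrightarrow> 1 \<odot> x = x" using smult_one[of x] by simp
lemma smult_0 [simp]: "x \<in> carrier H \<Longrightarrow> 0 \<odot> x = \<zero>" using smult_l_null[of x] by simp
lemma smult_zero [simp]: "c \<odot> \<zero> = \<zero>" using smult_r_null[of c] by simp

lemma smult_eq_0_iff: "x \<in> carrier H \<Longrightarrow> c \<odot> x = \<zero> \<longleftrightarrow> c = 0 \<or> x = \<zero>"
proof
  assume x: "x \<in> carrier H" and e: "c \<odot> x = \<zero>"
  { assume "c \<noteq> 0"
    then have "x = (inverse c * c) \<odot> x" using x by simp
    also have "\<dots> = \<zero>" using e smult_smult[of x "inverse c" c] x by simp
    finally have "x = \<zero>" . }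
  then show "c = 0 \<or> x = \<zero>" by blast
qed auto

lemma smult_left_cancel: "x \<in> carrier H \<Longrightarrow> x \<noteq> \<zero> \<Longrightarrow> a \<odot> x = b \<odot> x \<longleftrightarrow> a = b"
proof
  assume x: "x \<in> carrier H" "x \<noteq> \<zero>" and e: "a \<odot> x = b \<odot> x"
  have "(a - b) \<odot> x \<oplus> b \<odot> x = b \<odot> x" using smult_add_left[of x "a - b" b] x e by simp
  then have "(a - b) \<odot> x = \<zero>" using x by (metis M.add.r_cancel_one' smult_C)
  then show "a = b" using x smult_eq_0_iff by auto
qed simp

lemma finsum_smult: "finite A \<Longrightarrow> f \<in> A \<rightarrow> carrier H \<Longrightarrow> c \<odot> (\<Oplus>i\<in>A. f i) = (\<Oplus>i\<in>A. c \<odot> f i)"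
  by (rule finsum_smult_ldistr) auto

lemma sum_smult: "finite A \<Longrightarrow> x \<in> carrier H \<Longrightarrow> (\<Oplus>i\<in>A. c i \<odot> x) = (\<Sum>i\<in>A. c i) \<odot> x"
  by (induction A rule: finite_induct) (auto simp: smult_add_left Pi_def)

lemma finsum_delta:
  "finite A \<Longrightarrow> j \<in> A \<Longrightarrow> g \<in> carrier H \<Longrightarrow> (\<Oplus>i\<in>A. if i = j then g else \<zero>) = g"
  using finsum_singleton[of j A "\<lambda>_. g"] by (auto simp: Pi_def eq_commute cong: if_cong)

lemma finsum_swap:
  "finite A \<Longrightarrow> finite B \<Longrightarrow> (\<And>i j. i \<in> A \<Longrightarrow> j \<in> B \<Longrightarrow> f i j \<in> carrier H) \<Longrightarrow>
    (\<Oplus>i\<in>A. \<Oplus>j\<in>B. f i j) = (\<Oplus>j\<in>B. \<Oplus>i\<in>A. f i j)"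
proof (induction A rule: finite_induct)
  case empty then show ?case by simp
next
  case (insert a A)
  have "(\<Oplus>i\<in>insert a A. \<Oplus>j\<in>B. f i j) = (\<Oplus>j\<in>B. f a j) \<oplus> (\<Oplus>i\<in>A. \<Oplus>j\<in>B. f i j)"
    using insert by (intro M.finsum_insert) (auto intro!: M.finsum_closed)
  also have "\<dots> = (\<Oplus>j\<in>B. f a j) \<oplus> (\<Oplus>j\<in>B. \<Oplus>i\<in>A. f i j)" using insert by simp
  also have "\<dots> = (\<Oplus>j\<in>B. f a j \<oplus> (\<Oplus>i\<in>A. f i j))"
    using insert by (intro M.finsum_addf[symmetric]) (auto intro!: M.finsum_closed)
  also have "\<dots> = (\<Oplus>j\<in>B. \<Oplus>i\<in>insert a A. f i j)"
    using insert by (intro M.finsum_cong' refl)  (auto intro!: M.finsum_closed simp: Pi_def)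
  finally show ?case .
qed

end

definition linear_form :: "(complex, 'a, 'm) module_scheme \<Rightarrow> ('a \<Rightarrow> complex) \<Rightarrow> bool" where
  "linear_form H f \<longleftrightarrow> (\<forall>x\<in>carrier H. \<forall>y\<in>carrier H. f (x \<oplus>\<^bsub>H\<^esub> y) = f x + f y) \<and>
     (\<forall>x\<in>carrier H. \<forall>c. f (c \<odot>\<^bsub>H\<^esub> x) = c * f x)"

definition linear_map ::
    "(complex, 'a, 'm) module_scheme \<Rightarrow> (complex, 'b, 'n) module_scheme \<Rightarrow> ('a \<Rightarrow> 'b) \<Rightarrow> bool" where
  "linear_map H H' p \<longleftrightarrow> p \<in> carrier H \<rightarrow> carrier H' \<and>
     (\<forall>x\<in>carrier H. \<forall>y\<in>carrier H. p (x \<oplus>\<^bsub>H\<^esub> y) = p x \<oplus>\<^bsub>H'\<^esub> p y) \<and>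
     (\<forall>x\<in>carrier H. \<forall>c. p (c \<odot>\<^bsub>H\<^esub> x) = c \<odot>\<^bsub>H'\<^esub> p x)"

lemma (in complex_algebra) linear_form_zero: "linear_form H f \<Longrightarrow> f \<zero> = 0"
  unfolding linear_form_def by (metis M.zero_closed mult_zero_left smult_0)

lemma (in complex_algebra) linear_form_finsum:
  assumes "linear_form H f" "finite A" "g \<in> A \<rightarrow> carrier H"
  shows "f (\<Oplus>i\<in>A. g i) = (\<Sum>i\<in>A. f (g i))"
  using assms(2,3)
proof (induction A rule: finite_induct)
  case empty then show ?case using linear_form_zero[OF assms(1)] by simp
next
  case (insert x F)
  then show ?case using assms(1) by (simp add: linear_form_def Pi_def)
qed

lemma linear_map_finsum:
  assumes "complex_algebra H" "complex_algebra H'" "linear_map H H' p" "finite A" "g \<in> A \<rightarrow> carrier H"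
  shows "p (finsum H g A) = finsum H' (\<lambda>i. p (g i)) A"
proof -
  interpret H: complex_algebra H by fact
  interpret H': complex_algebra H' by fact
  have z: "p \<zero>\<^bsub>H\<^esub> = \<zero>\<^bsub>H'\<^esub>"
    using assms(3) unfolding linear_map_def
    by (metis H.M.zero_closed H.smult_0 H'.smult_0 PiE)
  show ?thesis using assms(4,5)
  proof (induction A rule: finite_induct)
    case empty then show ?case using z by simp
  next
    case (insert x F)
    then show ?case using assms(3) by (simp add: linear_map_def Pi_def)
  qed
qed

section \<open>Multilinear forms, slot by slot\<close>

abbreviation vlists :: "(complex, 'a, 'm) module_scheme \<Rightarrow> nat \<Rightarrow> 'a list set" where
  "vlists H k \<equiv> {xs. length xs = k \<and> set xs \<subseteq> carrier H}"

text \<open>Splitting the argument list around the varying slot replaces list update: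
  \<open>@\<close>, \<open>map\<close> and \<open>map2\<close> distribute over
  \<open>as @ x # bs\<close>, so composed forms can be checked directly.\<close>

lemma multilinear_iff:
  "multilinear H k f \<longleftrightarrow> (\<forall>as bs x y c. length as + length bs + 1 = k \<and> set as \<subseteq> carrier H \<and>
     set bs \<subseteq> carrier H \<and> x \<in> carrier H \<and> y \<in> carrier H \<longrightarrow>
     f (as @ (x \<oplus>\<^bsub>H\<^esub> y) # bs) = f (as @ x # bs) + f (as @ y # bs) \<and>
     f (as @ (c \<odot>\<^bsub>H\<^esub> x) # bs) = c * f (as @ x # bs))" (is "?L \<longleftrightarrow> ?R")
proof
  assume L: ?L
  show ?R
  proof (intro allI impI)
    fix as bs x y c
    assume a: "length as + length bs + 1 = k \<and> set as \<subseteq> carrier H \<and>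
     set bs \<subseteq> carrier H \<and> x \<in> carrier H \<and> y \<in> carrier H"
    then have "length (as @ x # bs) = k \<and> set (as @ x # bs) \<subseteq> carrier H \<and> length as < k" by auto
    then show "f (as @ (x \<oplus>\<^bsub>H\<^esub> y) # bs) = f (as @ x # bs) + f (as @ y # bs) \<and>
     f (as @ (c \<odot>\<^bsub>H\<^esub> x) # bs) = c * f (as @ x # bs)"
      using L[unfolded multilinear_def, rule_format, of "as @ x # bs" "length as" x y c] a
      by (simp add: list_update_append)
  qed
next
  assume R: ?R
  show ?L unfolding multilinear_def
  proof (intro allI impI)
    fix xs i x y c
    assume a: "length xs = k \<and> set xs \<subseteq> carrier H \<and> i < k \<and> x \<in> carrier H \<and> y \<in> carrier H"
    show "f (xs[i := x \<oplus>\<^bsub>H\<^esub> y]) = f (xs[i := x]) + f (xs[i := y]) \<and>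
       f (xs[i := c \<odot>\<^bsub>H\<^esub> x]) = c * f (xs[i := x])"
      using R[rule_format, of "take i xs" "drop (Suc i) xs" x y c] a set_take_subset[of i xs]
        set_drop_subset[of "Suc i" xs]
      by (simp add: upd_conv_take_nth_drop) fastforce
  qed
qed

lemma multilinear_add:
  "multilinear H k f \<Longrightarrow> length as + length bs + 1 = k \<Longrightarrow> set as \<subseteq> carrier H \<Longrightarrow> set bs \<subseteq> carrier H \<Longrightarrow>
   x \<in> carrier H \<Longrightarrow> y \<in> carrier H \<Longrightarrow> f (as @ (x \<oplus>\<^bsub>H\<^esub> y) # bs) = f (as @ x # bs) + f (as @ y # bs)"
  unfolding multilinear_iff by blast

lemma multilinear_smult:
  "multilinear H k f \<Longrightarrow> length as + length bs + 1 = k \<Longrightarrow> set as \<subseteq> carrier H \<Longrightarrow> set bs \<subseteq> carrier H \<Longrightarrow>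
   x \<in> carrier H \<Longrightarrow> f (as @ (c \<odot>\<^bsub>H\<^esub> x) # bs) = c * f (as @ x # bs)"
  unfolding multilinear_iff by blast

lemma multilinear_linear_form:
  "multilinear H k f \<Longrightarrow> length as + length bs + 1 = k \<Longrightarrow> set as \<subseteq> carrier H \<Longrightarrow> set bs \<subseteq> carrier H \<Longrightarrow>
   linear_form H (\<lambda>x. f (as @ x # bs))"
  unfolding linear_form_def by (auto simp: multilinear_add multilinear_smult)

lemma multilinear1_iff: "multilinear H 1 f \<longleftrightarrow> linear_form H (\<lambda>x. f [x])"
proof
  show "multilinear H 1 f \<Longrightarrow> linear_form H (\<lambda>x. f [x])"
    using multilinear_linear_form[of H 1 f "[]" "[]"] by simp
next
  assume a: "linear_form H (\<lambda>x. f [x])"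
  show "multilinear H 1 f" unfolding multilinear_iff using a by (auto simp: linear_form_def)
qed

lemma multilinear2_iff: "multilinear H 2 f \<longleftrightarrow>
   (\<forall>y\<in>carrier H. linear_form H (\<lambda>x. f [x, y])) \<and> (\<forall>x\<in>carrier H. linear_form H (\<lambda>y. f [x, y]))"
   (is "_ \<longleftrightarrow> ?R")
proof
  assume m: "multilinear H 2 f"
  show ?R
    using multilinear_linear_form[OF m, of "[]" "[_]"] multilinear_linear_form[OF m, of "[_]" "[]"] by simp
next
  assume R: ?R
  show "multilinear H 2 f" unfolding multilinear_iff
  proof (intro allI impI)
    fix as bs x y c
    assume a: "length as + length bs + 1 = 2 \<and> set as \<subseteq> carrier H \<and>
       set bs \<subseteq> carrier H \<and> x \<in> carrier H \<and> y \<in> carrier H"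
    then consider u where "as = []" "bs = [u]" | u where "as = [u]" "bs = []"
      by (cases as; cases bs) auto
    then show "f (as @ (x \<oplus>\<^bsub>H\<^esub> y) # bs) = f (as @ x # bs) + f (as @ y # bs) \<and>
       f (as @ (c \<odot>\<^bsub>H\<^esub> x) # bs) = c * f (as @ x # bs)"
      by cases (use a R in \<open>auto simp: linear_form_def\<close>)
  qed
qed

lemma multilinear3_iff: "multilinear H 3 f \<longleftrightarrow>
   (\<forall>y\<in>carrier H. \<forall>z\<in>carrier H. linear_form H (\<lambda>x. f [x, y, z])) \<and>
   (\<forall>x\<in>carrier H. \<forall>z\<in>carrier H. linear_form H (\<lambda>y. f [x, y, z])) \<and>
   (\<forall>x\<in>carrier H. \<forall>y\<in>carrier H. linear_form H (\<lambda>z. f [x, y, z]))"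
   (is "_ \<longleftrightarrow> ?R")
proof
  assume m: "multilinear H 3 f"
  show ?R
    using multilinear_linear_form[OF m, of "[]" "[_,_]"] multilinear_linear_form[OF m, of "[_]" "[_]"]
      multilinear_linear_form[OF m, of "[_,_]" "[]"] by simp
next
  assume R: ?R
  show "multilinear H 3 f" unfolding multilinear_iff
  proof (intro allI impI)
    fix as bs x y c
    assume a: "length as + length bs + 1 = 3 \<and> set as \<subseteq> carrier H \<and>
       set bs \<subseteq> carrier H \<and> x \<in> carrier H \<and> y \<in> carrier H"
    then have "length as = 0 \<and> length bs = 2 \<or> length as = 1 \<and> length bs = 1 \<or> length as = 2 \<and> length bs = 0"
      by linarith
    then consider u v where "as = []" "bs = [u,v]" | u v where "as = [u]" "bs = [v]"
      | u v where "as = [u,v]" "bs = []"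
      by (auto simp: numeral_2_eq_2 length_Suc_conv)
    then show "f (as @ (x \<oplus>\<^bsub>H\<^esub> y) # bs) = f (as @ x # bs) + f (as @ y # bs) \<and>
       f (as @ (c \<odot>\<^bsub>H\<^esub> x) # bs) = c * f (as @ x # bs)"
      by cases (use a R in \<open>auto simp: linear_form_def\<close>)
  qed
qed

section \<open>Tensor powers\<close>

lemma tensor_eq_refl [simp]: "tensor_eq H k t t" by (simp add: tensor_eq_def)
lemma tensor_eq_sym: "tensor_eq H k t u \<Longrightarrow> tensor_eq H k u t" by (simp add: tensor_eq_def)
lemma tensor_eq_trans [trans]: "tensor_eq H k t u \<Longrightarrow> tensor_eq H k u v \<Longrightarrow> tensor_eq H k t v"
  by (simp add: tensor_eq_def)

lemma tensorsE:
  assumes "t \<in> tensors H k"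
  obtains L where "set L \<subseteq> vlists H k" "\<And>f. multilinear H k f \<Longrightarrow> t f = (\<Sum>xs\<leftarrow>L. f xs)"
  using assms by (fastforce simp: tensors_def tensor_eq_def tensor_sum_def)

lemma tensorsI:
  "set L \<subseteq> vlists H k \<Longrightarrow> (\<And>f. multilinear H k f \<Longrightarrow> t f = (\<Sum>xs\<leftarrow>L. f xs)) \<Longrightarrow> t \<in> tensors H k"
  by (fastforce simp: tensors_def tensor_eq_def tensor_sum_def)

lemma tensors_iff: "t \<in> tensors H k \<longleftrightarrow>
    (\<exists>L. set L \<subseteq> vlists H k \<and> (\<forall>f. multilinear H k f \<longrightarrow> t f = (\<Sum>xs\<leftarrow>L. f xs)))"
  by (fastforce simp: tensors_def tensor_eq_def tensor_sum_def)

lemma tensors_eq_closed: "t \<in> tensors H k \<Longrightarrow> tensor_eq H k t u \<Longrightarrow> u \<in> tensors H k"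
  by (elim tensorsE, rule tensorsI) (auto simp: tensor_eq_def)

lemma pure_tensor_closed [simp]: "set xs \<subseteq> carrier H \<Longrightarrow> pure_tensor xs \<in> tensors H (length xs)"
  by (rule tensorsI[of "[xs]"]) (auto simp: pure_tensor_def)

lemma tensors_add: "t \<in> tensors H k \<Longrightarrow> u \<in> tensors H k \<Longrightarrow> (\<lambda>f. t f + u f) \<in> tensors H k"
  apply (elim tensorsE)
  subgoal for L M by (rule tensorsI[of "L @ M"]) auto
  done

lemma tensors_zero: "(\<lambda>f. 0) \<in> tensors H k"
  by (rule tensorsI[of "[]"]) auto

lemma tensors_sum: "(\<And>i. i \<in> I \<Longrightarrow> t i \<in> tensors H k) \<Longrightarrow> (\<lambda>f. \<Sum>i\<in>I. t i f) \<in> tensors H k"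
  by (induction I rule: infinite_finite_induct) (auto simp: tensors_zero tensors_add)

text \<open>A tensor evaluates a multilinear form through finitely many lists over the carrier, so
  values elsewhere cannot matter. Both forms must be multilinear, since on other functions the value
  of \<open>t\<close> is arbitrary.\<close>

lemma tensors_cong_on:
  assumes "t \<in> tensors H k" "multilinear H k f" "multilinear H k g" "\<And>xs. xs \<in> vlists H k \<Longrightarrow> f xs = g xs"
  shows "t f = t g"
proof -
  obtain L where L: "set L \<subseteq> vlists H k" "\<And>f. multilinear H k f \<Longrightarrow> t f = (\<Sum>xs\<leftarrow>L. f xs)"
    using assms(1) by (rule tensorsE) (blast intro: that)
  then show ?thesis using assms(2-4) by (auto intro!: arg_cong[of _ _ sum_list] simp: subset_iff)
qed

text \<open>Only lists over the carrier occur in the definition, and closure under sums and scalars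
  keeps the modified lists there.\<close>

lemma multilinear_cong:
  assumes "\<And>xs. xs \<in> vlists H k \<Longrightarrow> f xs = g xs" "complex_algebra H"
  shows "multilinear H k f \<longleftrightarrow> multilinear H k g"
proof -
  interpret complex_algebra H by fact
  have "multilinear H k g" if "multilinear H k f" "\<And>xs. xs \<in> vlists H k \<Longrightarrow> f xs = g xs" for f g
    unfolding multilinear_iff
  proof (intro allI impI)
    fix as bs x y c
    assume a: "length as + length bs + 1 = k \<and> set as \<subseteq> carrier H \<and>
       set bs \<subseteq> carrier H \<and> x \<in> carrier H \<and> y \<in> carrier H"
    have "as @ z # bs \<in> vlists H k" if "z \<in> carrier H" for z using a that by auto
    with that(2) have "f (as @ z # bs) = g (as @ z # bs)" if "z \<in> carrier H" for z using that by blast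
    then show "g (as @ (x \<oplus>\<^bsub>H\<^esub> y) # bs) = g (as @ x # bs) + g (as @ y # bs) \<and>
       g (as @ (c \<odot>\<^bsub>H\<^esub> x) # bs) = c * g (as @ x # bs)"
      using that(1)[unfolded multilinear_iff, rule_format, OF a] a by simp
  qed
  then show ?thesis using assms(1) by (metis (no_types, lifting))
qed

lemma multilinear_plus: "multilinear H k f \<Longrightarrow> multilinear H k g \<Longrightarrow> multilinear H k (\<lambda>xs. f xs + g xs)"
  unfolding multilinear_def by (auto simp: algebra_simps)

lemma multilinear_times: "multilinear H k f \<Longrightarrow> multilinear H k (\<lambda>xs. c * f xs)"
  unfolding multilinear_def by (auto simp: algebra_simps)

lemma multilinear_0: "multilinear H k (\<lambda>xs. 0)"
  unfolding multilinear_def by simp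

lemma multilinear_sum:
  "(\<And>i. i \<in> I \<Longrightarrow> multilinear H k (f i)) \<Longrightarrow> multilinear H k (\<lambda>xs. \<Sum>i\<in>I. f i xs)"
  by (induction I rule: infinite_finite_induct) (auto simp: multilinear_0 multilinear_plus)

lemma multilinear_sum_list:
  "(\<And>i. i \<in> set L \<Longrightarrow> multilinear H k (f i)) \<Longrightarrow> multilinear H k (\<lambda>xs. \<Sum>i\<leftarrow>L. f i xs)"
  by (induction L) (auto simp: multilinear_0 multilinear_plus)

lemma tensors_apply_plus:
  assumes "t \<in> tensors H k" "multilinear H k f" "multilinear H k g"
  shows "t (\<lambda>xs. f xs + g xs) = t f + t g"
  using assms by (elim tensorsE) (simp add: multilinear_plus sum_list_addf)

lemma tensors_apply_times:
  assumes "t \<in> tensors H k" "multilinear H k f"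
  shows "t (\<lambda>xs. c * f xs) = c * t f"
  using assms by (elim tensorsE) (simp add: multilinear_times sum_list_const_mult)

lemma tensors_apply_0: "t \<in> tensors H k \<Longrightarrow> t (\<lambda>xs. 0) = 0"
  by (elim tensorsE) (simp add: multilinear_0)

lemma tensors_apply_sum:
  assumes "t \<in> tensors H k" "\<And>i. i \<in> I \<Longrightarrow> multilinear H k (f i)"
  shows "t (\<lambda>xs. \<Sum>i\<in>I. f i xs) = (\<Sum>i\<in>I. t (f i))"
  using assms(2)
  by (induction I rule: infinite_finite_induct)
    (auto simp: tensors_apply_0[OF assms(1)] tensors_apply_plus[OF assms(1)] multilinear_sum)

text \<open>Substitution of a tensor for each pure tensor, as in nested Sweedler sums. Products,
  outer products and \<open>comult_at\<close> are instances; the result is represented by the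
  concatenation of the representing lists.\<close>

lemma tensor_bind:
  assumes "t \<in> tensors H k" "\<And>xs. xs \<in> vlists H k \<Longrightarrow> F xs \<in> tensors H' m"
    "\<And>f. multilinear H' m f \<Longrightarrow> multilinear H k (\<lambda>xs. F xs f)"
  shows "(\<lambda>f. t (\<lambda>xs. F xs f)) \<in> tensors H' m"
proof -
  obtain L where L: "set L \<subseteq> vlists H k" "\<And>f. multilinear H k f \<Longrightarrow> t f = (\<Sum>xs\<leftarrow>L. f xs)"
    using assms(1) by (rule tensorsE) (blast intro: that)
  have "\<forall>xs\<in>vlists H k. \<exists>M. set M \<subseteq> vlists H' m \<and> (\<forall>f. multilinear H' m f \<longrightarrow> F xs f = (\<Sum>xs\<leftarrow>M. f xs))"
  proof
    fix xs assume "xs \<in> vlists H k"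
    then show "\<exists>M. set M \<subseteq> vlists H' m \<and> (\<forall>f. multilinear H' m f \<longrightarrow> F xs f = (\<Sum>xs\<leftarrow>M. f xs))"
      using assms(2) unfolding tensors_iff by blast
  qed
  \<comment> \<open>The list representing \<open>F xs\<close> is fixed for all forms at once; chosen
    after \<open>f\<close> it would not represent one tensor.\<close>
  from bchoice[OF this] obtain M where M0: "\<forall>xs\<in>vlists H k. set (M xs) \<subseteq> vlists H' m \<and>
      (\<forall>f. multilinear H' m f \<longrightarrow> F xs f = (\<Sum>xs\<leftarrow>M xs. f xs))"
    by (rule exE)
  have M: "set (M xs) \<subseteq> vlists H' m" "multilinear H' m f \<Longrightarrow> F xs f = (\<Sum>xs\<leftarrow>M xs. f xs)"
    if "xs \<in> vlists H k" for xs f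
    using bspec[OF M0 that] by simp_all
  show ?thesis
  proof (rule tensorsI[of "concat (map M L)"])
    have "set (M xs) \<subseteq> vlists H' m" if "xs \<in> set L" for xs
      by (rule M(1)[OF subsetD[OF L(1) that]])
    then show "set (concat (map M L)) \<subseteq> vlists H' m"
      unfolding set_concat set_map image_image by (rule UN_least)
    fix f assume f: "multilinear H' m f"
    have "t (\<lambda>xs. F xs f) = (\<Sum>xs\<leftarrow>L. F xs f)" using L(2) assms(3) f by simp
    also have "\<dots> = (\<Sum>xs\<leftarrow>L. \<Sum>ys\<leftarrow>M xs. f ys)"
      using L(1) M(2) f by (intro arg_cong[of _ _ sum_list] map_cong refl) auto
    also have "\<dots> = (\<Sum>xs\<leftarrow>concat (map M L). f xs)" by (induction L) auto
    finally show "t (\<lambda>xs. F xs f) = (\<Sum>xs\<leftarrow>concat (map M L). f xs)" .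
  qed
qed

lemma tensor_bind_cong:
  assumes "t \<in> tensors H k"  "tensor_eq H k t t'"
    "\<And>f. multilinear H' m f \<Longrightarrow> multilinear H k (\<lambda>xs. F xs f)"
    "\<And>f. multilinear H' m f \<Longrightarrow> multilinear H k (\<lambda>xs. F' xs f)"
    "\<And>xs. xs \<in> vlists H k \<Longrightarrow> tensor_eq H' m (F xs) (F' xs)"
  shows "tensor_eq H' m (\<lambda>f. t (\<lambda>xs. F xs f)) (\<lambda>f. t' (\<lambda>xs. F' xs f))"
  unfolding tensor_eq_def
proof (intro allI impI)
  fix f assume f: "multilinear H' m f"
  have "t (\<lambda>xs. F xs f) = t (\<lambda>xs. F' xs f)"
    using assms(5) f by (intro tensors_cong_on[OF assms(1)] assms(3,4)) (auto simp: tensor_eq_def)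
  also have "\<dots> = t' (\<lambda>xs. F' xs f)" using assms(2) assms(4)[OF f] by (simp add: tensor_eq_def)
  finally show "t (\<lambda>xs. F xs f) = t' (\<lambda>xs. F' xs f)" .
qed

section \<open>Factorwise multiplication of tensors\<close>

context complex_algebra
begin

lemma multilinear_map2_right:
  assumes "multilinear H k f" "xs \<in> vlists H k"
  shows "multilinear H k (\<lambda>ys. f (map2 (\<otimes>) xs ys))"
  unfolding multilinear_iff
proof (intro allI impI)
  fix as bs x y c
  assume a: "length as + length bs + 1 = k \<and> set as \<subseteq> carrier H \<and>
     set bs \<subseteq> carrier H \<and> x \<in> carrier H \<and> y \<in> carrier H"
  \<comment> \<open>The fixed list is cut at the varying slot, where linearity is distributivity of
    the product.\<close>
  define us u vs where "us = take (length as) xs" "u = xs ! length as" "vs = drop (Suc (length as)) xs"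
  have l: "length as < length xs" using a assms(2) by auto
  have xs: "xs = us @ u # vs" "length us = length as" "length vs = length bs"
    using a assms(2) l unfolding us_u_vs_def by (auto simp: id_take_nth_drop[symmetric])
  have m: "map2 (\<otimes>) xs (as @ z # bs) = map2 (\<otimes>) us as @ (u \<otimes> z) # map2 (\<otimes>) vs bs" for z
    unfolding xs(1) using xs(2,3) by simp
  have c: "set us \<subseteq> carrier H" "u \<in> carrier H" "set vs \<subseteq> carrier H" using xs assms(2) by auto
  have c2: "set (map2 (\<otimes>) us as) \<subseteq> carrier H" "set (map2 (\<otimes>) vs bs) \<subseteq> carrier H"
    using c a by (auto elim!: in_set_zipE)
  show "f (map2 (\<otimes>) xs (as @ (x \<oplus> y) # bs)) = f (map2 (\<otimes>) xs (as @ x # bs)) + f (map2 (\<otimes>) xs (as @ y # bs)) \<and>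
       f (map2 (\<otimes>) xs (as @ (c \<odot> x) # bs)) = c * f (map2 (\<otimes>) xs (as @ x # bs))"
    unfolding m using a c c2 xs(2,3)
    by (simp add: r_distr smult_mult_right multilinear_add[OF assms(1)] multilinear_smult[OF assms(1)])
qed

lemma multilinear_map2_left:
  assumes "multilinear H k f" "ys \<in> vlists H k"
  shows "multilinear H k (\<lambda>xs. f (map2 (\<otimes>) xs ys))"
  unfolding multilinear_iff
proof (intro allI impI)
  fix as bs x y c
  assume a: "length as + length bs + 1 = k \<and> set as \<subseteq> carrier H \<and>
     set bs \<subseteq> carrier H \<and> x \<in> carrier H \<and> y \<in> carrier H"
  define us u vs where "us = take (length as) ys" "u = ys ! length as" "vs = drop (Suc (length as)) ys"
  have l: "length as < length ys" using a assms(2) by auto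
  have ys: "ys = us @ u # vs" "length us = length as" "length vs = length bs"
    using a assms(2) l unfolding us_u_vs_def by (auto simp: id_take_nth_drop[symmetric])
  have m: "map2 (\<otimes>) (as @ z # bs) ys = map2 (\<otimes>) as us @ (z \<otimes> u) # map2 (\<otimes>) bs vs" for z
    unfolding ys(1) using ys(2,3) by simp
  have c: "set us \<subseteq> carrier H" "u \<in> carrier H" "set vs \<subseteq> carrier H" using ys assms(2) by auto
  have c2: "set (map2 (\<otimes>) as us) \<subseteq> carrier H" "set (map2 (\<otimes>) bs vs) \<subseteq> carrier H"
    using c a by (auto elim!: in_set_zipE)
  show "f (map2 (\<otimes>) (as @ (x \<oplus> y) # bs) ys) = f (map2 (\<otimes>) (as @ x # bs) ys) + f (map2 (\<otimes>) (as @ y # bs) ys) \<and>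
       f (map2 (\<otimes>) (as @ (c \<odot> x) # bs) ys) = c * f (map2 (\<otimes>) (as @ x # bs) ys)"
    unfolding m using a c c2 ys(2,3)
    by (simp add: l_distr smult_mult_left multilinear_add[OF assms(1)] multilinear_smult[OF assms(1)])
qed

lemma map2_closed: "xs \<in> vlists H k \<Longrightarrow> ys \<in> vlists H k \<Longrightarrow> map2 (\<otimes>) xs ys \<in> vlists H k"
  by (auto elim!: in_set_zipE)

lemma tensor_mult_inner:
  assumes "u \<in> tensors H k" "xs \<in> vlists H k"
  shows "(\<lambda>f. u (\<lambda>ys. f (map2 (\<otimes>) xs ys))) \<in> tensors H k"
proof -
  have "(\<lambda>f. u (\<lambda>ys. pure_tensor (map2 (\<otimes>) xs ys) f)) \<in> tensors H k"
  proof (rule tensor_bind[OF assms(1)])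
    fix ys assume "ys \<in> vlists H k"
    from map2_closed[OF assms(2) this] show "pure_tensor (map2 (\<otimes>) xs ys) \<in> tensors H k"
      using pure_tensor_closed[of "map2 (\<otimes>) xs ys" H] by blast
  next
    fix f assume "multilinear H k f"
    then show "multilinear H k (\<lambda>ys. pure_tensor (map2 (\<otimes>) xs ys) f)"
      unfolding pure_tensor_def by (rule multilinear_map2_right[OF _ assms(2)])
  qed
  then show ?thesis by (simp add: pure_tensor_def)
qed

text \<open>The inner tensor is replaced by one fixed list \<open>M\<close>; a finite sum of forms
  multilinear in \<open>xs\<close> remains, and \<open>multilinear_cong\<close> carries this back to
  the original expression.\<close>

lemma tensor_mult_multilinear:
  assumes "u \<in> tensors H k" "multilinear H k f"
  shows "multilinear H k (\<lambda>xs. u (\<lambda>ys. f (map2 (\<otimes>) xs ys)))"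
proof -
  obtain M where M: "set M \<subseteq> vlists H k" "\<And>f. multilinear H k f \<Longrightarrow> u f = (\<Sum>xs\<leftarrow>M. f xs)"
    using assms(1) by (rule tensorsE) (blast intro: that)
  have "u (\<lambda>ys. f (map2 (\<otimes>) xs ys)) = (\<Sum>ys\<leftarrow>M. f (map2 (\<otimes>) xs ys))" if "xs \<in> vlists H k" for xs
    by (rule M(2)[OF multilinear_map2_right[OF assms(2) that]])
  moreover have "multilinear H k (\<lambda>xs. \<Sum>ys\<leftarrow>M. f (map2 (\<otimes>) xs ys))"
    using M(1) by (intro multilinear_sum_list multilinear_map2_left[OF assms(2)]) auto
  ultimately show ?thesis
    using multilinear_cong[OF _ complex_algebra_axioms, of k "\<lambda>xs. u (\<lambda>ys. f (map2 (\<otimes>) xs ys))"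
        "\<lambda>xs. \<Sum>ys\<leftarrow>M. f (map2 (\<otimes>) xs ys)"] by blast
qed

lemma tensor_mult_closed:
  "t \<in> tensors H k \<Longrightarrow> u \<in> tensors H k \<Longrightarrow> t \<star> u \<in> tensors H k"
  unfolding tensor_mult_def
  by (rule tensor_bind[of _ _ _ "\<lambda>xs f. u (\<lambda>ys. f (map2 (\<otimes>) xs ys))"])
    (auto intro: tensor_mult_inner tensor_mult_multilinear)

lemma tensor_mult_cong:
  assumes "t \<in> tensors H k" "u \<in> tensors H k" "tensor_eq H k t t'" "tensor_eq H k u u'"
  shows "tensor_eq H k (t \<star> u) (t' \<star> u')"
  unfolding tensor_mult_def
proof (rule tensor_bind_cong[OF assms(1,3), of _ _ "\<lambda>xs f. u (\<lambda>ys. f (map2 (\<otimes>) xs ys))"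
      "\<lambda>xs f. u' (\<lambda>ys. f (map2 (\<otimes>) xs ys))"])
  have "u' \<in> tensors H k" using assms(2,4) by (rule tensors_eq_closed)
  then show "\<And>f. multilinear H k f \<Longrightarrow> multilinear H k (\<lambda>xs. u' (\<lambda>ys. f (map2 (\<otimes>) xs ys)))"
    by (rule tensor_mult_multilinear)
next
  fix xs assume "xs \<in> vlists H k"
  then show "tensor_eq H k (\<lambda>f. u (\<lambda>ys. f (map2 (\<otimes>) xs ys))) (\<lambda>f. u' (\<lambda>ys. f (map2 (\<otimes>) xs ys)))"
    using assms(4) multilinear_map2_right[OF _ \<open>xs \<in> vlists H k\<close>] unfolding tensor_eq_def by blast
qed (use assms in \<open>auto intro: tensor_mult_multilinear\<close>)

lemma tensor_one_closed [simp]: "tensor_one H k \<in> tensors H k"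
  using pure_tensor_closed[of "replicate k \<one>" H] unfolding tensor_one_def by (simp add: subset_iff)

lemma tensor_mult_lists:
  assumes "set L \<subseteq> vlists H k" "\<And>f. multilinear H k f \<Longrightarrow> t f = (\<Sum>xs\<leftarrow>L. f xs)"
    "set M \<subseteq> vlists H k" "\<And>f. multilinear H k f \<Longrightarrow> u f = (\<Sum>xs\<leftarrow>M. f xs)" "multilinear H k f"
  shows "(t \<star> u) f = (\<Sum>xs\<leftarrow>L. \<Sum>ys\<leftarrow>M. f (map2 (\<otimes>) xs ys))"
proof -
  have u: "u \<in> tensors H k" using assms(3,4) by (rule tensorsI)
  have "(t \<star> u) f = (\<Sum>xs\<leftarrow>L. u (\<lambda>ys. f (map2 (\<otimes>) xs ys)))"
    unfolding tensor_mult_def by (rule assms(2)[OF tensor_mult_multilinear[OF u assms(5)]])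
  also have "\<dots> = (\<Sum>xs\<leftarrow>L. \<Sum>ys\<leftarrow>M. f (map2 (\<otimes>) xs ys))"
    using assms(1) by (intro arg_cong[of _ _ sum_list] map_cong refl assms(4) multilinear_map2_right[OF assms(5)]) auto
  finally show ?thesis .
qed

lemma map2_assoc:
  "xs \<in> vlists H k \<Longrightarrow> ys \<in> vlists H k \<Longrightarrow> zs \<in> vlists H k \<Longrightarrow>
    map2 (\<otimes>) (map2 (\<otimes>) xs ys) zs = map2 (\<otimes>) xs (map2 (\<otimes>) ys zs)"
  by (rule nth_equalityI) (auto intro!: m_assoc simp: subset_iff)

text \<open>Factorwise associativity holds on lists over the carrier only, so the three tensors are
  expanded into lists before the brackets are moved, and contracted again afterwards.\<close>

lemma tensor_mult_assoc:
  assumes "t \<in> tensors H k" "u \<in> tensors H k" "v \<in> tensors H k"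
  shows "tensor_eq H k (t \<star> u \<star> v) (t \<star> (u \<star> v))"
  unfolding tensor_eq_def
proof (intro allI impI)
  fix f assume f: "multilinear H k f"
  obtain L where L: "set L \<subseteq> vlists H k" "\<And>f. multilinear H k f \<Longrightarrow> t f = (\<Sum>xs\<leftarrow>L. f xs)"
    using assms(1) by (rule tensorsE) (blast intro: that)
  obtain M where M: "set M \<subseteq> vlists H k" "\<And>f. multilinear H k f \<Longrightarrow> u f = (\<Sum>xs\<leftarrow>M. f xs)"
    using assms(2) by (rule tensorsE) (blast intro: that)
  obtain N where N: "set N \<subseteq> vlists H k" "\<And>f. multilinear H k f \<Longrightarrow> v f = (\<Sum>xs\<leftarrow>N. f xs)"
    using assms(3) by (rule tensorsE) (blast intro: that)
  note mr = multilinear_map2_right and ml = multilinear_map2_left and mm = tensor_mult_multilinear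
  have "(t \<star> u \<star> v) f = t (\<lambda>xs. u (\<lambda>ys. v (\<lambda>zs. f (map2 (\<otimes>) (map2 (\<otimes>) xs ys) zs))))"
    by (simp add: tensor_mult_def)
  also have "\<dots> = (\<Sum>xs\<leftarrow>L. u (\<lambda>ys. v (\<lambda>zs. f (map2 (\<otimes>) (map2 (\<otimes>) xs ys) zs))))"
    by (rule L(2), rule mm[OF assms(2)], rule mm[OF assms(3) f])
  also have "\<dots> = (\<Sum>xs\<leftarrow>L. \<Sum>ys\<leftarrow>M. \<Sum>zs\<leftarrow>N. f (map2 (\<otimes>) (map2 (\<otimes>) xs ys) zs))"
  proof (intro arg_cong[of _ _ sum_list] map_cong refl)
    fix xs assume "xs \<in> set L"
    then have xs: "xs \<in> vlists H k" using L(1) by blast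
    have "u (\<lambda>ys. v (\<lambda>zs. f (map2 (\<otimes>) (map2 (\<otimes>) xs ys) zs))) =
        (\<Sum>ys\<leftarrow>M. v (\<lambda>zs. f (map2 (\<otimes>) (map2 (\<otimes>) xs ys) zs)))"
      by (rule M(2)) (rule mr[OF mm[OF assms(3) f] xs])
    also have "\<dots> = (\<Sum>ys\<leftarrow>M. \<Sum>zs\<leftarrow>N. f (map2 (\<otimes>) (map2 (\<otimes>) xs ys) zs))"
    proof (intro arg_cong[of _ _ sum_list] map_cong refl N(2) mr[OF f])
      fix ys assume "ys \<in> set M"
      then show "map2 (\<otimes>) xs ys \<in> vlists H k" using map2_closed[OF xs] M(1) by blast
    qed
    finally show "u (\<lambda>ys. v (\<lambda>zs. f (map2 (\<otimes>) (map2 (\<otimes>) xs ys) zs))) =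
        (\<Sum>ys\<leftarrow>M. \<Sum>zs\<leftarrow>N. f (map2 (\<otimes>) (map2 (\<otimes>) xs ys) zs))" .
  qed
  also have "\<dots> = (\<Sum>xs\<leftarrow>L. \<Sum>ys\<leftarrow>M. \<Sum>zs\<leftarrow>N. f (map2 (\<otimes>) xs (map2 (\<otimes>) ys zs)))"
    using L(1) M(1) N(1)
    by (intro arg_cong[of _ _ sum_list] map_cong refl arg_cong[of _ _ f] map2_assoc) auto
  also have "\<dots> = (\<Sum>xs\<leftarrow>L. (u \<star> v) (\<lambda>ys. f (map2 (\<otimes>) xs ys)))"
    using L(1)
    by (intro arg_cong[of _ _ sum_list] map_cong refl, subst tensor_mult_lists[OF M N])
     (auto intro: mr[OF f])
  also have "\<dots> = (t \<star> (u \<star> v)) f"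
    unfolding tensor_mult_def[of H t]
    by (rule L(2)[symmetric], rule mm[OF tensor_mult_closed[OF assms(2,3)] f])
  finally show "(t \<star> u \<star> v) f = (t \<star> (u \<star> v)) f" .
qed

lemma map2_one: "ys \<in> vlists H k \<Longrightarrow> map2 (\<otimes>) (replicate k \<one>) ys = ys"
    "ys \<in> vlists H k \<Longrightarrow> map2 (\<otimes>) ys (replicate k \<one>) = ys"
  by (auto intro!: nth_equalityI simp: subset_iff)

lemma tensor_mult_one_left:
  assumes "t \<in> tensors H k"
  shows "tensor_eq H k (tensor_one H k \<star> t) t"
  unfolding tensor_eq_def
proof (intro allI impI)
  fix f assume f: "multilinear H k f"
  have "t (\<lambda>ys. f (map2 (\<otimes>) (replicate k \<one>) ys)) = t f"
    by (rule tensors_cong_on[OF assms multilinear_map2_right[OF f] f])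
     (use map2_one in \<open>auto simp: subset_iff\<close>)
  then show "(tensor_one H k \<star> t) f = t f"
    by (simp add: tensor_mult_def tensor_one_def pure_tensor_def)
qed

lemma tensor_mult_one_right:
  assumes "t \<in> tensors H k"
  shows "tensor_eq H k (t \<star> tensor_one H k) t"
  unfolding tensor_eq_def
proof (intro allI impI)
  fix f assume f: "multilinear H k f"
  have "t (\<lambda>ys. f (map2 (\<otimes>) ys (replicate k \<one>))) = t f"
    by (rule tensors_cong_on[OF assms multilinear_map2_left[OF f] f])
     (use map2_one in \<open>auto simp: subset_iff\<close>)
  then show "(t \<star> tensor_one H k) f = t f"
    by (simp add: tensor_mult_def tensor_one_def pure_tensor_def)
qed

text \<open>The scalar is absorbed into the first factor, which requires \<open>k > 0\<close>: for
  \<open>k = 0\<close> the sums of pure tensors are just natural multiples of one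
  functional.\<close>

lemma tensors_smult:
  assumes "k > 0" "t \<in> tensors H k"
  shows "(\<lambda>f. c * t f) \<in> tensors H k"
proof -
  obtain L where L: "set L \<subseteq> vlists H k" "\<And>f. multilinear H k f \<Longrightarrow> t f = (\<Sum>xs\<leftarrow>L. f xs)"
    using assms(2) by (rule tensorsE) (blast intro: that)
  show ?thesis
  proof (rule tensorsI[of "map (\<lambda>xs. (c \<odot> hd xs) # tl xs) L"])
    have ne: "xs \<noteq> []" "hd xs \<in> carrier H" "set (tl xs) \<subseteq> carrier H" "length xs = k"
      if "xs \<in> set L" for xs
    proof -
      have "xs \<in> vlists H k" using that L(1) by blast
      then show "xs \<noteq> []" "hd xs \<in> carrier H" "set (tl xs) \<subseteq> carrier H" "length xs = k"
        using assms(1) by (cases xs; auto)+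
    qed
    show "set (map (\<lambda>xs. (c \<odot> hd xs) # tl xs) L) \<subseteq> vlists H k"
      using ne assms(1) by fastforce
    fix f assume f: "multilinear H k f"
    have "f ((c \<odot> hd xs) # tl xs) = c * f xs" if "xs \<in> set L" for xs
      using multilinear_smult[OF f, of "[]" "tl xs" "hd xs" c] ne[OF that] assms(1) by simp
    then show "c * t f = (\<Sum>xs\<leftarrow>map (\<lambda>xs. (c \<odot> hd xs) # tl xs) L. f xs)"
      unfolding L(2)[OF f] by (simp add: sum_list_const_mult[symmetric] o_def cong: map_cong)
  qed
qed

end

text \<open>Canonical representative: the irrelevant values are set to 0, so that
  \<open>tensor_eq\<close> becomes equality.\<close>

definition tclass :: "(complex, 'a, 'm) module_scheme \<Rightarrow> nat \<Rightarrow> 'a tensor \<Rightarrow> 'a tensor" where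
  "tclass H k t = (\<lambda>f. if multilinear H k f then t f else 0)"

text \<open>The algebra \<open>H\<^sup>\<otimes>\<^sup>k\<close> with true equality. General ring
  theory (inverses, powers, finite sums, homomorphisms) becomes applicable to tensors.\<close>

definition tensor_algebra :: "(complex, 'a, 'm) module_scheme \<Rightarrow> nat \<Rightarrow> (complex, 'a tensor) module" where
  "tensor_algebra H k = module.make (tclass H k ` tensors H k) (\<lambda>t u. tclass H k (t \<star>\<^bsub>H\<^esub> u))
     (tclass H k (tensor_one H k)) (\<lambda>f. 0) (\<lambda>t u f. t f + u f) (\<lambda>c t f. c * t f)"

lemma tensor_algebra_simps:
  "carrier (tensor_algebra H k) = tclass H k ` tensors H k"
  "t \<otimes>\<^bsub>tensor_algebra H k\<^esub> u = tclass H k (t \<star>\<^bsub>H\<^esub> u)"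
  "\<one>\<^bsub>tensor_algebra H k\<^esub> = tclass H k (tensor_one H k)"
  "\<zero>\<^bsub>tensor_algebra H k\<^esub> = (\<lambda>f. 0)"
  "t \<oplus>\<^bsub>tensor_algebra H k\<^esub> u = (\<lambda>f. t f + u f)"
  "c \<odot>\<^bsub>tensor_algebra H k\<^esub> t = (\<lambda>f. c * t f)"
  by (simp_all add: tensor_algebra_def module.defs)

lemma tclass_eq_iff: "tclass H k t = tclass H k u \<longleftrightarrow> tensor_eq H k t u"
  by (force simp: tclass_def tensor_eq_def fun_eq_iff)

lemma tclass_eq: "tensor_eq H k (tclass H k t) t"
  by (simp add: tclass_def tensor_eq_def)

lemma tclass_idem [simp]: "tclass H k (tclass H k t) = tclass H k t"
  by (rule ext) (simp add: tclass_def)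

lemma tclass_closed: "t \<in> tensors H k \<Longrightarrow> tclass H k t \<in> tensors H k"
  by (erule tensors_eq_closed) (rule tensor_eq_sym[OF tclass_eq])

lemma tclass_in [simp]: "t \<in> tensors H k \<Longrightarrow> tclass H k t \<in> carrier (tensor_algebra H k)"
  by (simp add: tensor_algebra_simps)

lemma carrier_tensor_algebra: "t \<in> carrier (tensor_algebra H k) \<longleftrightarrow> t \<in> tensors H k \<and> tclass H k t = t"
  by (auto simp: tensor_algebra_simps tclass_closed image_iff) metis

lemma tensor_algebra_add: "tclass H k t \<oplus>\<^bsub>tensor_algebra H k\<^esub> tclass H k u = tclass H k (\<lambda>f. t f + u f)"
  by (auto simp: tensor_algebra_simps tclass_def)

lemma tensor_algebra_smult: "c \<odot>\<^bsub>tensor_algebra H k\<^esub> tclass H k u = tclass H k (\<lambda>f. c * u f)"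
  by (auto simp: tensor_algebra_simps tclass_def)

lemma tensor_algebra_one: "\<one>\<^bsub>tensor_algebra H k\<^esub> = tclass H k (tensor_one H k)"
  by (auto simp: tensor_algebra_simps)

lemma tensor_algebra_zero: "\<zero>\<^bsub>tensor_algebra H k\<^esub> = tclass H k (\<lambda>f. 0)"
  by (auto simp: tensor_algebra_simps tclass_def)

context complex_algebra
begin

lemma tensor_algebra_mult:
  "t \<in> tensors H k \<Longrightarrow> u \<in> tensors H k \<Longrightarrow>
    tclass H k t \<otimes>\<^bsub>tensor_algebra H k\<^esub> tclass H k u = tclass H k (t \<star> u)"
  unfolding tensor_algebra_simps
  by (simp add: tclass_eq_iff tensor_eq_sym[OF tensor_mult_cong] tensor_eq_sym[OF tclass_eq])

lemma tensor_algebra_complex_algebra: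
  assumes k: "k > 0"
  shows "complex_algebra (tensor_algebra H k)" (is "complex_algebra ?T")
proof (rule complex_algebraI)
  note cl = tensor_mult_closed tensors_add tensors_zero tensors_smult[OF k]
  show "abelian_group ?T"
  proof (rule abelian_groupI)
    fix x assume "x \<in> carrier ?T"
    then obtain t where t: "t \<in> tensors H k" "x = tclass H k t" by (auto simp: tensor_algebra_simps)
    show "\<exists>y\<in>carrier ?T. y \<oplus>\<^bsub>?T\<^esub> x = \<zero>\<^bsub>?T\<^esub>"
    proof (rule bexI[of _ "tclass H k (\<lambda>f. -1 * t f)"])
      show "tclass H k (\<lambda>f. -1 * t f) \<in> carrier ?T" using cl(4)[OF t(1), of "-1"] by (rule tclass_in)
      show "tclass H k (\<lambda>f. -1 * t f) \<oplus>\<^bsub>?T\<^esub> x = \<zero>\<^bsub>?T\<^esub>"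
        by (simp add: t tensor_algebra_simps tclass_def fun_eq_iff)
    qed
  qed (auto simp: carrier_tensor_algebra tensor_algebra_simps cl tclass_def fun_eq_iff)
  show "monoid ?T"
  proof (rule monoidI)
    fix x y z assume "x \<in> carrier ?T" "y \<in> carrier ?T" "z \<in> carrier ?T"
    then obtain t u v where t: "t \<in> tensors H k" "x = tclass H k t" "u \<in> tensors H k" "y = tclass H k u"
      "v \<in> tensors H k" "z = tclass H k v" by (auto simp: tensor_algebra_simps)
    then show "x \<otimes>\<^bsub>?T\<^esub> y \<otimes>\<^bsub>?T\<^esub> z = x \<otimes>\<^bsub>?T\<^esub> (y \<otimes>\<^bsub>?T\<^esub> z)"
      by (simp add: tensor_algebra_mult cl tclass_eq_iff tensor_mult_assoc)
  qed (auto simp: tensor_algebra_simps tclass_closed cl intro!: tclass_eq_iff[THEN iffD2]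
    intro: tensor_eq_trans[OF tensor_mult_cong[OF _ _ tclass_eq tclass_eq] tensor_mult_one_left]
     tensor_eq_trans[OF tensor_mult_cong[OF _ _ tclass_eq tclass_eq] tensor_mult_one_right])
next
  fix x y z assume "x \<in> carrier ?T" "y \<in> carrier ?T" "z \<in> carrier ?T"
  then obtain t u v where t: "t \<in> tensors H k" "x = tclass H k t" "u \<in> tensors H k" "y = tclass H k u"
    "v \<in> tensors H k" "z = tclass H k v" by (auto simp: tensor_algebra_simps)
  show "(x \<oplus>\<^bsub>?T\<^esub> y) \<otimes>\<^bsub>?T\<^esub> z = x \<otimes>\<^bsub>?T\<^esub> z \<oplus>\<^bsub>?T\<^esub> y \<otimes>\<^bsub>?T\<^esub> z"
    using t by (simp add: tensor_algebra_add tensor_algebra_mult tensors_add) (simp add: tensor_mult_def)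
  \<comment> \<open>Distributivity on the other side is definitional; here the sum has to be pulled
    out of \<open>v\<close>, which is additive on multilinear forms only.\<close>
  have "t \<in> tensors H k \<Longrightarrow> tensor_eq H k (v \<star> (\<lambda>f. t f + u f)) (\<lambda>f. (v \<star> t) f + (v \<star> u) f)"
    unfolding tensor_eq_def tensor_mult_def
    using t by (auto intro!: tensors_apply_plus tensor_mult_multilinear)
  then show "z \<otimes>\<^bsub>?T\<^esub> (x \<oplus>\<^bsub>?T\<^esub> y) = z \<otimes>\<^bsub>?T\<^esub> x \<oplus>\<^bsub>?T\<^esub> z \<otimes>\<^bsub>?T\<^esub> y"
    using t by (simp add: tensor_algebra_add tensor_algebra_mult tensors_add tclass_eq_iff)
next
  fix x y c assume "x \<in> carrier ?T" "y \<in> carrier ?T"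
  then obtain t u where t: "t \<in> tensors H k" "x = tclass H k t" "u \<in> tensors H k" "y = tclass H k u"
     by (auto simp: tensor_algebra_simps)
  show "c \<odot>\<^bsub>?T\<^esub> x \<otimes>\<^bsub>?T\<^esub> y = c \<odot>\<^bsub>?T\<^esub> (x \<otimes>\<^bsub>?T\<^esub> y)"
    using t by (simp add: tensor_algebra_smult tensor_algebra_mult tensors_smult[OF k]) (simp add: tensor_mult_def)
  have "tensor_eq H k (t \<star> (\<lambda>f. c * u f)) (\<lambda>f. c * (t \<star> u) f)"
    unfolding tensor_eq_def tensor_mult_def
    using t by (auto intro!: tensors_apply_times tensor_mult_multilinear)
  then show "x \<otimes>\<^bsub>?T\<^esub> (c \<odot>\<^bsub>?T\<^esub> y) = c \<odot>\<^bsub>?T\<^esub> (x \<otimes>\<^bsub>?T\<^esub> y)"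
    using t by (simp add: tensor_algebra_smult tensor_algebra_mult tensors_smult[OF k] tclass_eq_iff)
qed (auto simp: carrier_tensor_algebra tensor_algebra_simps tclass_def tensors_smult[OF k] algebra_simps fun_eq_iff)

end

section \<open>Twists and quasi-Hopf subalgebras\<close>

text \<open>Stated for two records with equal operations instead of a record update, so that it
  serves twists, which keep the carrier, as well as restrictions.\<close>

lemma subalgebra_complex_algebra:
  fixes H :: "(complex, 'a, 'm) module_scheme" and K :: "(complex, 'a, 'n) module_scheme"
  assumes "complex_algebra H" "carrier K \<subseteq> carrier H"
    "ring.add K = ring.add H" "\<zero>\<^bsub>K\<^esub> = \<zero>\<^bsub>H\<^esub>" "monoid.mult K = monoid.mult H" "monoid.one K = monoid.one H" "module.smult K = module.smult H"
    "\<one>\<^bsub>H\<^esub> \<in> carrier K"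
    "\<And>x y. x \<in> carrier K \<Longrightarrow> y \<in> carrier K \<Longrightarrow> x \<oplus>\<^bsub>H\<^esub> y \<in> carrier K"
    "\<And>x y. x \<in> carrier K \<Longrightarrow> y \<in> carrier K \<Longrightarrow> x \<otimes>\<^bsub>H\<^esub> y \<in> carrier K"
    "\<And>x c. x \<in> carrier K \<Longrightarrow> c \<odot>\<^bsub>H\<^esub> x \<in> carrier K"
  shows "complex_algebra K"
proof -
  interpret complex_algebra H by fact
  note [simp] = assms(3-11) and sub = subsetD[OF assms(2)]
  have z: "\<zero>\<^bsub>H\<^esub> \<in> carrier K" using assms(11)[OF assms(8), of 0] by simp
  show ?thesis
  proof (rule complex_algebraI)
    show "abelian_group K"
    proof (rule abelian_groupI)
      fix x assume x: "x \<in> carrier K"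
      have "(-1 + 1) \<odot>\<^bsub>H\<^esub> x = ((-1) \<odot>\<^bsub>H\<^esub> x) \<oplus>\<^bsub>H\<^esub> x" using smult_add_left[of x "-1" 1] sub[OF x] by simp
      then show "\<exists>y\<in>carrier K. y \<oplus>\<^bsub>K\<^esub> x = \<zero>\<^bsub>K\<^esub>"
        using x sub[OF x] by (intro bexI[of _ "(-1) \<odot>\<^bsub>H\<^esub> x"]) auto
    qed (use sub z M.a_assoc M.a_comm in auto)
    show "monoid K" by (rule monoidI) (use sub m_assoc in auto)
  qed (use sub in \<open>auto simp: l_distr r_distr smult_add_left smult_add_right smult_smult smult_mult_left smult_mult_right\<close>)
qed

section \<open>Outer products and inverses of tensors\<close>

lemma tensor_append_multilinear:
  assumes "multilinear H (k + l) f"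
  shows "ys \<in> vlists H l \<Longrightarrow> multilinear H k (\<lambda>xs. f (xs @ ys))"
    and "xs \<in> vlists H k \<Longrightarrow> multilinear H l (\<lambda>ys. f (xs @ ys))"
proof -
  assume ys: "ys \<in> vlists H l"
  show "multilinear H k (\<lambda>xs. f (xs @ ys))"
    unfolding multilinear_iff
    using multilinear_add[OF assms] multilinear_smult[OF assms] ys by simp
next
  assume xs: "xs \<in> vlists H k"
  show "multilinear H l (\<lambda>ys. f (xs @ ys))"
    unfolding multilinear_iff
    using multilinear_add[OF assms, of "xs @ _"] multilinear_smult[OF assms, of "xs @ _"] xs by simp
qed

lemma tensor_append_multilinear2:
  assumes "complex_algebra H" "multilinear H (k + l) f" "u \<in> tensors H l"
  shows "multilinear H k (\<lambda>xs. u (\<lambda>ys. f (xs @ ys)))"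
proof -
  obtain M where M: "set M \<subseteq> vlists H l" "\<And>f. multilinear H l f \<Longrightarrow> u f = (\<Sum>xs\<leftarrow>M. f xs)"
    using assms(3) by (rule tensorsE) (blast intro: that)
  have "u (\<lambda>ys. f (xs @ ys)) = (\<Sum>ys\<leftarrow>M. f (xs @ ys))" if "xs \<in> vlists H k" for xs
    by (rule M(2)[OF tensor_append_multilinear(2)[OF assms(2) that]])
  moreover have "multilinear H k (\<lambda>xs. \<Sum>ys\<leftarrow>M. f (xs @ ys))"
    using M(1) by (intro multilinear_sum_list tensor_append_multilinear(1)[OF assms(2)]) auto
  ultimately show ?thesis
    using multilinear_cong[OF _ assms(1), of k "\<lambda>xs. u (\<lambda>ys. f (xs @ ys))"
        "\<lambda>xs. \<Sum>ys\<leftarrow>M. f (xs @ ys)"] by blast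
qed

lemma tensor_append_closed:
  assumes "complex_algebra H" "t \<in> tensors H k" "u \<in> tensors H l"
  shows "tensor_append t u \<in> tensors H (k + l)"
  unfolding tensor_append_def
proof (rule tensor_bind[OF assms(2), of "\<lambda>xs f. u (\<lambda>ys. f (xs @ ys))"])
  show "\<And>f. multilinear H (k + l) f \<Longrightarrow> multilinear H k (\<lambda>xs. u (\<lambda>ys. f (xs @ ys)))"
    by (rule tensor_append_multilinear2[OF assms(1) _ assms(3)])
  fix xs assume xs: "xs \<in> vlists H k"
  show "(\<lambda>f. u (\<lambda>ys. f (xs @ ys))) \<in> tensors H (k + l)"
  proof (rule tensor_bind[OF assms(3), of "\<lambda>ys f. f (xs @ ys)"])
    fix ys assume "ys \<in> vlists H l"
    then show "(\<lambda>f. f (xs @ ys)) \<in> tensors H (k + l)"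
      using xs by (intro tensorsI[of "[xs @ ys]"]) auto
  qed (rule tensor_append_multilinear(2)[OF _ xs])
qed

lemma tensor_append_cong:
  assumes "complex_algebra H" "t \<in> tensors H k" "u \<in> tensors H l" "tensor_eq H k t t'" "tensor_eq H l u u'"
  shows "tensor_eq H (k + l) (tensor_append t u) (tensor_append t' u')"
  unfolding tensor_append_def
proof (rule tensor_bind_cong[OF assms(2,4), of H "k + l" "\<lambda>xs f. u (\<lambda>ys. f (xs @ ys))" "\<lambda>xs f. u' (\<lambda>ys. f (xs @ ys))"])
  show "\<And>f. multilinear H (k + l) f \<Longrightarrow> multilinear H k (\<lambda>xs. u (\<lambda>ys. f (xs @ ys)))"
    by (rule tensor_append_multilinear2[OF assms(1) _ assms(3)])
  show "\<And>f. multilinear H (k + l) f \<Longrightarrow> multilinear H k (\<lambda>xs. u' (\<lambda>ys. f (xs @ ys)))"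
    by (rule tensor_append_multilinear2[OF assms(1) _ tensors_eq_closed[OF assms(3,5)]])
  fix xs assume xs: "xs \<in> vlists H k"
  show "tensor_eq H (k + l) (\<lambda>f. u (\<lambda>ys. f (xs @ ys))) (\<lambda>f. u' (\<lambda>ys. f (xs @ ys)))"
    using assms(5) tensor_append_multilinear(2)[OF _ xs, of l] unfolding tensor_eq_def by blast
qed

context complex_algebra
begin

text \<open>Uniqueness of inverses in the algebra of classes; it determines
  \<open>tensor_inv\<close>, which is a Hilbert choice.\<close>

lemma tensor_inverse_unique:
  assumes "k > 0" "t \<in> tensors H k" "is_tensor_inverse H k t u" "is_tensor_inverse H k t v"
  shows "tensor_eq H k u v"
proof -
  interpret T: complex_algebra "tensor_algebra H k" by (rule tensor_algebra_complex_algebra[OF assms(1)])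
  have uv: "u \<in> tensors H k" "v \<in> tensors H k" using assms by (auto simp: is_tensor_inverse_def)
  have "tclass H k u \<otimes>\<^bsub>tensor_algebra H k\<^esub> tclass H k t = \<one>\<^bsub>tensor_algebra H k\<^esub>"
    "tclass H k t \<otimes>\<^bsub>tensor_algebra H k\<^esub> tclass H k v = \<one>\<^bsub>tensor_algebra H k\<^esub>"
    using assms uv by (simp_all add: tensor_algebra_mult tensor_algebra_one tclass_eq_iff is_tensor_inverse_def)
  then have "tclass H k u = tclass H k v"
    using T.inv_unique[of "tclass H k u" "tclass H k t" "tclass H k v"] assms(2) uv by simp
  then show ?thesis by (simp add: tclass_eq_iff)
qed

lemma is_tensor_inverse_cong:
  assumes "is_tensor_inverse H k t u" "t \<in> tensors H k" "tensor_eq H k t t'" "tensor_eq H k u u'"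
  shows "is_tensor_inverse H k t' u'"
proof -
  have u: "u \<in> tensors H k" "u' \<in> tensors H k" "t' \<in> tensors H k"
    using assms by (auto simp: is_tensor_inverse_def tensors_eq_closed)
  show ?thesis
    using assms(1) u tensor_eq_sym[OF tensor_mult_cong[OF assms(2) u(1) assms(3,4)]]
      tensor_eq_sym[OF tensor_mult_cong[OF u(1) assms(2) assms(4,3)]]
    unfolding is_tensor_inverse_def by (blast intro: tensor_eq_trans)
qed

lemma tensor_inv_is_inverse:
  "tensor_invertible H k t \<Longrightarrow> is_tensor_inverse H k t (tensor_inv H k t)"
  unfolding tensor_invertible_def tensor_inv_def by (auto intro: someI[of "is_tensor_inverse H k t"])

text \<open>What allows the chosen \<open>tensor_inv\<close> to be replaced by an explicit inverse
  in computations.\<close>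

lemma tensor_inv_eq:
  assumes "k > 0" "t \<in> tensors H k" "is_tensor_inverse H k t u"
  shows "tensor_eq H k (tensor_inv H k t) u" "tensor_inv H k t \<in> tensors H k" "tensor_invertible H k t"
proof -
  show i: "tensor_invertible H k t" using assms by (auto simp: tensor_invertible_def)
  show "tensor_eq H k (tensor_inv H k t) u"
    by (rule tensor_inverse_unique[OF assms(1,2) tensor_inv_is_inverse[OF i] assms(3)])
  show "tensor_inv H k t \<in> tensors H k"
    using tensor_inv_is_inverse[OF i] by (simp add: is_tensor_inverse_def)
qed

end

text \<open>A twist is a new record, but the tensor notions see only carrier, addition and scalars,
  so they may be identified outright.\<close>

lemma multilinear_ops_cong:
  assumes "carrier K = carrier H" "ring.add K = ring.add H" "module.smult K = module.smult H"
  shows "multilinear K = multilinear H" "tensors K = tensors H" "tensor_eq K = tensor_eq H"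
proof -
  show m: "multilinear K = multilinear H" using assms by (auto simp: fun_eq_iff multilinear_def)
  then show e: "tensor_eq K = tensor_eq H" by (auto simp: fun_eq_iff tensor_eq_def)
  show "tensors K = tensors H" using assms e by (auto simp: fun_eq_iff tensors_def)
qed

lemma tensor_mult_ops_cong: "monoid.mult K = monoid.mult H \<Longrightarrow> tensor_mult K = tensor_mult H"
  by (auto simp: fun_eq_iff tensor_mult_def)

lemma tensor_one_ops_cong: "monoid.one K = monoid.one H \<Longrightarrow> tensor_one K = tensor_one H"
  by (auto simp: fun_eq_iff tensor_one_def)

text \<open>The axioms that pass directly to twists and to subalgebras. The associator enters later
  through its coefficients, in \<open>shift_system\<close>; in this way given algebras, Taft
  algebras and \<open>A(q)\<close> are treated alike.\<close>

locale pre_bialgebra = complex_algebra H for H :: "'a quasi_hopf" (structure) +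
  assumes comult_closed: "h \<in> carrier H \<Longrightarrow> comult H h \<in> tensors H 2"
    and comult_add: "\<lbrakk> x \<in> carrier H; y \<in> carrier H \<rbrakk> \<Longrightarrow>
      tensor_eq H 2 (comult H (x \<oplus> y)) (\<lambda>f. comult H x f + comult H y f)"
    and comult_smult: "x \<in> carrier H \<Longrightarrow>
      tensor_eq H 2 (comult H (c \<odot> x)) (\<lambda>f. c * comult H x f)"
    and comult_mult: "\<lbrakk> x \<in> carrier H; y \<in> carrier H \<rbrakk> \<Longrightarrow>
      tensor_eq H 2 (comult H (x \<otimes> y)) (comult H x \<star> comult H y)"
    and comult_one: "tensor_eq H 2 (comult H \<one>) (tensor_one H 2)"
    and counit_add: "\<lbrakk> x \<in> carrier H; y \<in> carrier H \<rbrakk> \<Longrightarrow>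
      counit H (x \<oplus> y) = counit H x + counit H y"
    and counit_smult: "x \<in> carrier H \<Longrightarrow> counit H (c \<odot> x) = c * counit H x"
    and counit_mult: "\<lbrakk> x \<in> carrier H; y \<in> carrier H \<rbrakk> \<Longrightarrow>
      counit H (x \<otimes> y) = counit H x * counit H y"
    and counit_one: "counit H \<one> = 1"

lemma (in quasi_hopf_algebra) pre_bialgebra: "pre_bialgebra H"
  by unfold_locales
    (use comult_closed comult_add comult_smult comult_mult comult_one counit_add counit_smult
      counit_mult counit_one in auto)

context pre_bialgebra
begin

lemma counit_linear: "linear_form H (counit H)"
  by (auto simp: linear_form_def counit_add counit_smult)

lemma comult_linear_form:
  assumes "multilinear H 2 f" shows "linear_form H (\<lambda>x. comult H x f)"
  using comult_add comult_smult assms by (simp add: linear_form_def tensor_eq_def)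

lemma multilinear_at:
  assumes "multilinear H 3 f" "z \<in> carrier H"
  shows "multilinear H 2 (\<lambda>ys. f (ys @ [z]))" "multilinear H 2 (\<lambda>ys. f (z # ys))"
  using tensor_append_multilinear(1)[of H 2 1 f "[z]"] tensor_append_multilinear(2)[of H 1 2 f "[z]"] assms
  by (simp_all add: numeral_eq_Suc)

lemma comult_at_multilinear:
  assumes "multilinear H 3 f" "i < 2"
  shows "multilinear H 2 (\<lambda>xs. comult H (xs ! i) (\<lambda>ys. f (take i xs @ ys @ drop (Suc i) xs)))"
proof -
  have f1: "linear_form H (\<lambda>z. comult H y (\<lambda>ys. f (z # ys)))" if "y \<in> carrier H" for y
  proof -
    have "multilinear H 1 (\<lambda>xs. comult H y (\<lambda>ys. f (xs @ ys)))"
      by (rule tensor_append_multilinear2[OF complex_algebra_axioms _ comult_closed[OF that]])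
        (use assms(1) in \<open>simp add: numeral_eq_Suc\<close>)
    then show ?thesis unfolding multilinear1_iff by simp
  qed
  \<comment> \<open>The new variable stands to the right of the inner coproduct, the opposite of
    \<open>tensor_append_multilinear2\<close>; linearity is pulled through the tensor
    \<open>comult H y\<close> instead.\<close>
  have f2: "linear_form H (\<lambda>z. comult H y (\<lambda>ys. f (ys @ [z])))" if "y \<in> carrier H" for y
    unfolding linear_form_def
  proof (intro conjI ballI allI)
    fix x z assume xz: "x \<in> carrier H" "z \<in> carrier H"
    have "comult H y (\<lambda>ys. f (ys @ [x \<oplus> z])) = comult H y (\<lambda>ys. f (ys @ [x]) + f (ys @ [z]))"
      using xz multilinear_add[OF assms(1), of _ "[]"]
      by (intro tensors_cong_on[OF comult_closed[OF that]] multilinear_at[OF assms(1)] multilinear_plus) auto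
    then show "comult H y (\<lambda>ys. f (ys @ [x \<oplus> z])) = comult H y (\<lambda>ys. f (ys @ [x])) + comult H y (\<lambda>ys. f (ys @ [z]))"
      using tensors_apply_plus[OF comult_closed[OF that]] multilinear_at[OF assms(1)] xz by simp
  next
    fix x c assume xz: "x \<in> carrier H"
    have "comult H y (\<lambda>ys. f (ys @ [c \<odot> x])) = comult H y (\<lambda>ys. c * f (ys @ [x]))"
      using xz multilinear_smult[OF assms(1), of _ "[]"]
      by (intro tensors_cong_on[OF comult_closed[OF that]] multilinear_at[OF assms(1)] multilinear_times) auto
    then show "comult H y (\<lambda>ys. f (ys @ [c \<odot> x])) = c * comult H y (\<lambda>ys. f (ys @ [x]))"
      using tensors_apply_times[OF comult_closed[OF that]] multilinear_at[OF assms(1)] xz by simp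
  qed
  consider "i = 0" | "i = 1" using assms(2) by linarith
  then show ?thesis
    by cases (auto simp: multilinear2_iff f1 f2 intro!: comult_linear_form multilinear_at[OF assms(1)])
qed

lemma comult_at_closed:
  assumes "t \<in> tensors H 2" "i < 2"
  shows "comult_at H i t \<in> tensors H 3"
  unfolding comult_at_def
proof (rule tensor_bind[OF assms(1), of "\<lambda>xs f. comult H (xs ! i) (\<lambda>ys. f (take i xs @ ys @ drop (Suc i) xs))"])
  fix xs assume xs: "xs \<in> vlists H 2"
  then obtain x y where xy: "xs = [x, y]" "x \<in> carrier H" "y \<in> carrier H"
    by (auto simp: numeral_2_eq_2 length_Suc_conv)
  have 1: "(\<lambda>f. comult H x (\<lambda>ys. f (ys @ [y]))) \<in> tensors H 3"
    using tensor_append_closed[OF complex_algebra_axioms comult_closed[OF xy(2)], of "pure_tensor [y]" 1]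
      pure_tensor_closed[of "[y]" H] xy by (simp add: tensor_append_def pure_tensor_def)
  have 2: "(\<lambda>f. comult H y (\<lambda>ys. f (x # ys))) \<in> tensors H 3"
    using tensor_append_closed[OF complex_algebra_axioms _ comult_closed[OF xy(3)], of "pure_tensor [x]" 1]
      pure_tensor_closed[of "[x]" H] xy by (simp add: tensor_append_def pure_tensor_def numeral_eq_Suc)
  consider "i = 0" | "i = 1" using assms(2) by linarith
  then show "(\<lambda>f. comult H (xs ! i) (\<lambda>ys. f (take i xs @ ys @ drop (Suc i) xs))) \<in> tensors H 3"
    by cases (use xy 1 2 in auto)
qed (rule comult_at_multilinear[OF _ assms(2)])

lemma comult_at_cong:
  assumes "tensor_eq H 2 t u" "i < 2"
  shows "tensor_eq H 3 (comult_at H i t) (comult_at H i u)"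
  unfolding comult_at_def tensor_eq_def
  using assms(1) comult_at_multilinear[OF _ assms(2)] by (simp add: tensor_eq_def)

lemma counit_at_multilinear:
  assumes "multilinear H 1 f" "i < 2"
  shows "multilinear H 2 (\<lambda>xs. counit H (xs ! i) * f (take i xs @ drop (Suc i) xs))"
proof -
  have f: "linear_form H (\<lambda>x. f [x])" using assms(1) unfolding multilinear1_iff .
  consider "i = 0" | "i = 1" using assms(2) by linarith
  then show ?thesis
    by cases (use f counit_linear in \<open>auto simp: multilinear2_iff linear_form_def algebra_simps\<close>)
qed

lemma counit_at_cong:
  assumes "tensor_eq H 2 t u" "i < 2"
  shows "tensor_eq H 1 (counit_at H i t) (counit_at H i u)"
  unfolding counit_at_def tensor_eq_def
  using assms(1) counit_at_multilinear[OF _ assms(2)] by (simp add: tensor_eq_def)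

text \<open>Lets \<open>\<Delta>(x\<^sup>k)\<close> be computed as a power in the tensor
  algebra.\<close>

lemma comult_hom: "(\<lambda>h. tclass H 2 (comult H h)) \<in> ring_hom H (tensor_algebra H 2)"
proof (rule ring_hom_memI)
  fix x y assume "x \<in> carrier H" "y \<in> carrier H"
  then show "tclass H 2 (comult H (x \<otimes> y)) = tclass H 2 (comult H x) \<otimes>\<^bsub>tensor_algebra H 2\<^esub> tclass H 2 (comult H y)"
    "tclass H 2 (comult H (x \<oplus> y)) = tclass H 2 (comult H x) \<oplus>\<^bsub>tensor_algebra H 2\<^esub> tclass H 2 (comult H y)"
    by (simp_all add: tensor_algebra_mult tensor_algebra_add tclass_eq_iff comult_closed comult_add comult_mult)
qed (auto simp: comult_closed tensor_algebra_one tclass_eq_iff comult_one)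

text \<open>Conjugation by the class of \<open>J\<close> is an automorphism of
  \<open>H \<otimes> H\<close>, so its composite with \<open>\<Delta>\<close> is again an algebra
  map.\<close>

lemma twist_pre_bialgebra:
  assumes J: "tensor_invertible H 2 J"
  shows "pre_bialgebra (twist H J)"
proof -
  let ?T = "tensor_algebra H 2" and ?c = "tclass H 2"
  interpret T: complex_algebra ?T by (rule tensor_algebra_complex_algebra) simp
  define J' where "J' = tensor_inv H 2 J"
  have J': "is_tensor_inverse H 2 J J'" unfolding J'_def by (rule tensor_inv_is_inverse[OF J])
  then have jc: "J \<in> tensors H 2" "J' \<in> tensors H 2"
    using J by (auto simp: is_tensor_inverse_def tensor_invertible_def)
  have jj: "?c J \<otimes>\<^bsub>?T\<^esub> ?c J' = \<one>\<^bsub>?T\<^esub>" "?c J' \<otimes>\<^bsub>?T\<^esub> ?c J = \<one>\<^bsub>?T\<^esub>"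
    using J' jc by (simp_all add: tensor_algebra_mult tensor_algebra_one tclass_eq_iff is_tensor_inverse_def)
  let ?t = "twist H J"
  have ops: "carrier ?t = carrier H" "ring.add ?t = ring.add H" "module.smult ?t = module.smult H" "monoid.mult ?t = monoid.mult H"
    "monoid.one ?t = monoid.one H" "\<zero>\<^bsub>?t\<^esub> = \<zero>\<^bsub>H\<^esub>" "counit ?t = counit H"
    by (simp_all add: twist_def)
  note oc = multilinear_ops_cong[OF ops(1-3)] tensor_mult_ops_cong[OF ops(4)] tensor_one_ops_cong[OF ops(5)]
  have ct: "comult ?t h = J \<star> comult H h \<star> J'" for h by (simp add: twist_def J'_def)
  have c: "?c (J \<star> comult H h \<star> J') = ?c J \<otimes>\<^bsub>?T\<^esub> ?c (comult H h) \<otimes>\<^bsub>?T\<^esub> ?c J'"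
    if "h \<in> carrier H" for h
    using jc comult_closed[OF that] by (simp add: tensor_algebra_mult tensor_mult_closed)
  have cl: "J \<star> comult H h \<star> J' \<in> tensors H 2" if "h \<in> carrier H" for h
    using jc comult_closed[OF that] by (simp add: tensor_mult_closed)
  show ?thesis
  proof (intro pre_bialgebra.intro pre_bialgebra_axioms.intro)
    show "complex_algebra ?t"
      by (rule subalgebra_complex_algebra[OF complex_algebra_axioms]) (simp_all add: ops)
    fix x y c assume x: "x \<in> carrier ?t"
    then have x': "x \<in> carrier H" by (simp add: ops)
    show "comult ?t x \<in> tensors ?t 2" using x by (simp add: oc ct cl ops)
    have "?c (J \<star> comult H (c \<odot> x) \<star> J') = ?c (\<lambda>f. c * (J \<star> comult H x \<star> J') f)"
      using x' jc comult_smult[OF x', of c] unfolding tensor_algebra_smult[symmetric]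
      by (simp add: c comult_closed tclass_eq_iff[symmetric] tensor_algebra_smult[symmetric] T.smult_mult_left T.smult_mult_right)
    then show "tensor_eq ?t 2 (comult ?t (c \<odot>\<^bsub>?t\<^esub> x)) (\<lambda>f. c * comult ?t x f)"
      by (simp add: oc ct ops tclass_eq_iff)
    assume y: "y \<in> carrier ?t"
    then have y': "y \<in> carrier H" by (simp add: ops)
    have "?c (J \<star> comult H (x \<oplus> y) \<star> J') = ?c (\<lambda>f. (J \<star> comult H x \<star> J') f + (J \<star> comult H y \<star> J') f)"
      using x' y' jc comult_add[OF x' y'] unfolding tensor_algebra_add[symmetric]
      by (simp add: c comult_closed tclass_eq_iff[symmetric] tensor_algebra_add[symmetric] T.l_distr T.r_distr)
    then show "tensor_eq ?t 2 (comult ?t (x \<oplus>\<^bsub>?t\<^esub> y)) (\<lambda>f. comult ?t x f + comult ?t y f)"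
      by (simp add: oc ct ops tclass_eq_iff)
    have "?c (J \<star> comult H (x \<otimes> y) \<star> J') = ?c J \<otimes>\<^bsub>?T\<^esub> (?c (comult H x) \<otimes>\<^bsub>?T\<^esub> ?c (comult H y)) \<otimes>\<^bsub>?T\<^esub> ?c J'"
      using x' y' comult_mult[OF x' y'] by (simp add: c comult_closed tclass_eq_iff[symmetric] tensor_algebra_mult)
    also have "\<dots> = ?c J \<otimes>\<^bsub>?T\<^esub> (?c (comult H x) \<otimes>\<^bsub>?T\<^esub> (?c J' \<otimes>\<^bsub>?T\<^esub> ?c J) \<otimes>\<^bsub>?T\<^esub> ?c (comult H y)) \<otimes>\<^bsub>?T\<^esub> ?c J'"
      using x' y' jc by (simp add: jj comult_closed)
    also have "\<dots> = ?c (J \<star> comult H x \<star> J') \<otimes>\<^bsub>?T\<^esub> ?c (J \<star> comult H y \<star> J')"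
      using x' y' jc by (simp add: c comult_closed T.m_assoc)
    also have "\<dots> = ?c ((J \<star> comult H x \<star> J') \<star> (J \<star> comult H y \<star> J'))"
      using x' y' by (intro tensor_algebra_mult cl)
    finally show "tensor_eq ?t 2 (comult ?t (x \<otimes>\<^bsub>?t\<^esub> y)) (comult ?t x \<star>\<^bsub>?t\<^esub> comult ?t y)"
      by (simp add: oc ct ops tclass_eq_iff)
  next
    have "?c (J \<star> comult H \<one> \<star> J') = \<one>\<^bsub>?T\<^esub>"
      using comult_one jc by (simp add: c tclass_eq_iff[symmetric] tensor_algebra_one[symmetric] jj)
    then show "tensor_eq ?t 2 (comult ?t \<one>\<^bsub>?t\<^esub>) (tensor_one ?t 2)"
      by (simp add: oc ct ops tclass_eq_iff tensor_algebra_one)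
  qed (simp_all add: ops counit_add counit_smult counit_mult counit_one)
qed

end

section \<open>Retracts and quasi-Hopf subalgebras\<close>

lemma linear_map_multilinear:
  assumes p: "linear_map H K p" and f: "multilinear K k f"
  shows "multilinear H k (\<lambda>xs. f (map p xs))"
  unfolding multilinear_iff
proof (intro allI impI)
  fix as bs x y c
  assume a: "length as + length bs + 1 = k \<and> set as \<subseteq> carrier H \<and>
     set bs \<subseteq> carrier H \<and> x \<in> carrier H \<and> y \<in> carrier H"
  have l: "p z \<in> carrier K" if "z \<in> carrier H" for z using p that by (auto simp: linear_map_def)
  have "set (map p as) \<subseteq> carrier K" "set (map p bs) \<subseteq> carrier K" using a l by auto
  then show "f (map p (as @ (x \<oplus>\<^bsub>H\<^esub> y) # bs)) = f (map p (as @ x # bs)) + f (map p (as @ y # bs)) \<and>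
       f (map p (as @ (c \<odot>\<^bsub>H\<^esub> x) # bs)) = c * f (map p (as @ x # bs))"
    using a l p multilinear_add[OF f, of "map p as" "map p bs"] multilinear_smult[OF f, of "map p as" "map p bs"]
    by (simp add: linear_map_def)
qed

text \<open>The projection \<open>p\<close> extends multilinear forms from \<open>K\<close> to
  \<open>H\<close>; this yields injectivity of \<open>K\<^sup>\<otimes>\<^sup>k\<close> into
  \<open>H\<^sup>\<otimes>\<^sup>k\<close> without a choice of complements. In the applications
  \<open>p\<close> projects to degree 0 or to a set of monomials.\<close>

locale retract =
  fixes K :: "(complex, 'a, 'n) module_scheme" and H :: "(complex, 'a, 'm) module_scheme" and p
  assumes K: "complex_algebra K" and H: "complex_algebra H"
    and sub: "carrier K \<subseteq> carrier H"
    and ops: "ring.add K = ring.add H" "\<zero>\<^bsub>K\<^esub> = \<zero>\<^bsub>H\<^esub>" "monoid.mult K = monoid.mult H" "monoid.one K = monoid.one H" "module.smult K = module.smult H"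
    and p: "linear_map H K p" "\<And>x. x \<in> carrier K \<Longrightarrow> p x = x"
begin

lemma finsum_eq: "finite A \<Longrightarrow> g \<in> A \<rightarrow> carrier K \<Longrightarrow> finsum K g A = finsum H g A"
  using linear_map_finsum[OF K H, of id A g] sub by (simp add: linear_map_def ops Pi_def subset_iff)

lemma pow_eq: "x [^]\<^bsub>K\<^esub> (k::nat) = x [^]\<^bsub>H\<^esub> k"
  by (simp add: nat_pow_def ops)

lemma multilinear_restrict: "multilinear H k f \<Longrightarrow> multilinear K k f"
proof -
  assume f: "multilinear H k f"
  show "multilinear K k f" unfolding multilinear_iff ops
  proof (intro allI impI)
    fix as bs x y c
    assume a: "length as + length bs + 1 = k \<and> set as \<subseteq> carrier K \<and>
       set bs \<subseteq> carrier K \<and> x \<in> carrier K \<and> y \<in> carrier K"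
    then have "length as + length bs + 1 = k" "set as \<subseteq> carrier H" "set bs \<subseteq> carrier H"
      "x \<in> carrier H" "y \<in> carrier H" using sub by auto
    then show "f (as @ (x \<oplus>\<^bsub>H\<^esub> y) # bs) = f (as @ x # bs) + f (as @ y # bs) \<and>
       f (as @ (c \<odot>\<^bsub>H\<^esub> x) # bs) = c * f (as @ x # bs)"
      by (simp add: multilinear_add[OF f] multilinear_smult[OF f])
  qed
qed

lemma tensor_eq_extend: "tensor_eq K k t u \<Longrightarrow> tensor_eq H k t u"
  using multilinear_restrict by (auto simp: tensor_eq_def)

lemma tensors_extend: "t \<in> tensors K k \<Longrightarrow> t \<in> tensors H k"
  unfolding tensors_iff using sub multilinear_restrict by fastforce

lemma tensor_mult_eq: "tensor_mult K = tensor_mult H" by (rule tensor_mult_ops_cong[OF ops(3)])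
lemma tensor_one_eq: "tensor_one K = tensor_one H" by (rule tensor_one_ops_cong[OF ops(4)])

lemma multilinear_extend: "multilinear K k f \<Longrightarrow> multilinear H k (\<lambda>xs. f (map p xs))"
  by (rule linear_map_multilinear[OF p(1)])

lemma tensor_apply_extend:
  assumes "t \<in> tensors K k" "multilinear K k f"
  shows "t (\<lambda>xs. f (map p xs)) = t f"
proof (rule tensors_cong_on[OF assms(1) multilinear_restrict[OF multilinear_extend[OF assms(2)]] assms(2)])
  fix xs assume "xs \<in> vlists K k"
  then have "map p xs = xs" by (auto intro!: map_idI p)
  then show "f (map p xs) = f xs" by simp
qed

text \<open>A form on \<open>K\<close> that separates two tensors over \<open>K\<close> would,
  precomposed with \<open>p\<close>, be a form on \<open>H\<close> separating them.\<close>

lemma tensor_eq_restrict: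
  assumes "t \<in> tensors K k" "u \<in> tensors K k" "tensor_eq H k t u"
  shows "tensor_eq K k t u"
  unfolding tensor_eq_def
proof (intro allI impI)
  fix f assume f: "multilinear K k f"
  show "t f = u f"
    using assms(3) multilinear_extend[OF f]
    unfolding tensor_apply_extend[OF assms(1) f, symmetric] tensor_apply_extend[OF assms(2) f, symmetric] tensor_eq_def
    by blast
qed

end

lemma restrict_quasi_hopf_simps [simp]:
  "carrier (restrict_quasi_hopf H S) = S" "monoid.mult (restrict_quasi_hopf H S) = monoid.mult H"
  "monoid.one (restrict_quasi_hopf H S) = monoid.one H" "\<zero>\<^bsub>restrict_quasi_hopf H S\<^esub> = \<zero>\<^bsub>H\<^esub>"
  "ring.add (restrict_quasi_hopf H S) = ring.add H" "module.smult (restrict_quasi_hopf H S) = module.smult H"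
  "counit (restrict_quasi_hopf H S) = counit H"
  by (simp_all add: restrict_quasi_hopf_def)

lemma tensors_restrict_quasi_hopf: "tensors (H\<lparr>carrier := S\<rparr>) = tensors (restrict_quasi_hopf H S)"
  by (rule multilinear_ops_cong) simp_all

text \<open>\<open>restrict_quasi_hopf\<close> selects a representative over \<open>S\<close> by
  \<open>SOME\<close>; the selection is meaningful once one representative \<open>t\<close> is
  known.\<close>

lemma restrict_comult:
  assumes "t \<in> tensors (restrict_quasi_hopf H S) 2" "tensor_eq H 2 t (comult H h)"
  shows "comult (restrict_quasi_hopf H S) h \<in> tensors (restrict_quasi_hopf H S) 2"
    "tensor_eq H 2 (comult (restrict_quasi_hopf H S) h) (comult H h)"
proof -
  have "comult (restrict_quasi_hopf H S) h =
      (SOME t. t \<in> tensors (restrict_quasi_hopf H S) 2 \<and> tensor_eq H 2 t (comult H h))"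
    unfolding tensors_restrict_quasi_hopf[symmetric] by (simp add: restrict_quasi_hopf_def)
  then show "comult (restrict_quasi_hopf H S) h \<in> tensors (restrict_quasi_hopf H S) 2"
    "tensor_eq H 2 (comult (restrict_quasi_hopf H S) h) (comult H h)"
    using someI[of "\<lambda>t. t \<in> tensors (restrict_quasi_hopf H S) 2 \<and> tensor_eq H 2 t (comult H h)" t] assms
    by auto
qed

lemma restrict_associator:
  assumes "t \<in> tensors (restrict_quasi_hopf H S) 3" "tensor_eq H 3 t (associator H)"
  shows "associator (restrict_quasi_hopf H S) \<in> tensors (restrict_quasi_hopf H S) 3"
    "tensor_eq H 3 (associator (restrict_quasi_hopf H S)) (associator H)"
proof -
  have "associator (restrict_quasi_hopf H S) =
      (SOME t. t \<in> tensors (restrict_quasi_hopf H S) 3 \<and> tensor_eq H 3 t (associator H))"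
    unfolding tensors_restrict_quasi_hopf[symmetric] by (simp add: restrict_quasi_hopf_def)
  then show "associator (restrict_quasi_hopf H S) \<in> tensors (restrict_quasi_hopf H S) 3"
    "tensor_eq H 3 (associator (restrict_quasi_hopf H S)) (associator H)"
    using someI[of "\<lambda>t. t \<in> tensors (restrict_quasi_hopf H S) 3 \<and> tensor_eq H 3 t (associator H)" t] assms
    by auto
qed

lemma (in pre_bialgebra) restrict_retract:
  assumes S: "S \<subseteq> carrier H" "\<one> \<in> S" "\<And>x y. x \<in> S \<Longrightarrow> y \<in> S \<Longrightarrow> x \<oplus> y \<in> S"
    "\<And>x y. x \<in> S \<Longrightarrow> y \<in> S \<Longrightarrow> x \<otimes> y \<in> S" "\<And>x c. x \<in> S \<Longrightarrow> c \<odot> x \<in> S"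
    and p: "p \<in> carrier H \<rightarrow> S" "\<And>x. x \<in> S \<Longrightarrow> p x = x"
    "\<And>x y. x \<in> carrier H \<Longrightarrow> y \<in> carrier H \<Longrightarrow> p (x \<oplus> y) = p x \<oplus> p y"
    "\<And>x c. x \<in> carrier H \<Longrightarrow> p (c \<odot> x) = c \<odot> p x"
  shows "retract (restrict_quasi_hopf H S) H p"
proof (rule retract.intro)
  show "complex_algebra (restrict_quasi_hopf H S)"
    by (rule subalgebra_complex_algebra[OF complex_algebra_axioms]) (use S in auto)
  show "linear_map H (restrict_quasi_hopf H S) p" using p by (auto simp: linear_map_def)
qed (use S p complex_algebra_axioms in auto)

text \<open>Each identity is proved for tensors over \<open>H\<close>, where the chosen coproduct
  equals the given one, and brought down by \<open>tensor_eq_restrict\<close>.\<close>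

lemma (in pre_bialgebra) restrict_pre_bialgebra:
  assumes "retract (restrict_quasi_hopf H S) H p"
    and ex: "\<And>h. h \<in> S \<Longrightarrow> \<exists>t\<in>tensors (restrict_quasi_hopf H S) 2. tensor_eq H 2 t (comult H h)"
  shows "pre_bialgebra (restrict_quasi_hopf H S)"
proof -
  let ?K = "restrict_quasi_hopf H S"
  interpret r: retract ?K H p by fact
  interpret K: complex_algebra ?K by (rule r.K)
  have c: "comult ?K h \<in> tensors ?K 2" "tensor_eq H 2 (comult ?K h) (comult H h)" if hS: "h \<in> S" for h
  proof -
    obtain t where t: "t \<in> tensors ?K 2" "tensor_eq H 2 t (comult H h)" using ex[OF hS] by (rule bexE)
    show "comult ?K h \<in> tensors ?K 2" "tensor_eq H 2 (comult ?K h) (comult H h)"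
      by (rule restrict_comult[OF t])+
  qed
  have S: "S \<subseteq> carrier H" using r.sub by simp
  have cl: "x \<oplus> y \<in> S" "x \<otimes> y \<in> S" "a \<odot> x \<in> S" "\<one> \<in> S" if "x \<in> S" "y \<in> S" for x y a
    using K.M.add.m_closed[of x y] K.m_closed[of x y] K.smult_C[of x a] K.one_closed that by auto
  show ?thesis
  proof (intro pre_bialgebra.intro pre_bialgebra_axioms.intro)
    show "complex_algebra ?K" by (rule r.K)
    fix x y a assume x: "x \<in> carrier ?K"
    show "comult ?K x \<in> tensors ?K 2" using x c by simp
    have xH: "x \<in> carrier H" and xS: "x \<in> S" using x S by auto
    have "tensor_eq H 2 (comult ?K (a \<odot> x)) (comult H (a \<odot> x))" by (rule c(2)[OF cl(3)[OF xS xS]])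
    also have "tensor_eq H 2 \<dots> (\<lambda>f. a * comult H x f)" by (rule comult_smult[OF xH])
    also have "tensor_eq H 2 \<dots> (\<lambda>f. a * comult ?K x f)" using c(2)[OF xS] by (simp add: tensor_eq_def)
    finally show "tensor_eq ?K 2 (comult ?K (a \<odot>\<^bsub>?K\<^esub> x)) (\<lambda>f. a * comult ?K x f)"
      using x c cl by (intro r.tensor_eq_restrict K.tensors_smult) auto
    assume y: "y \<in> carrier ?K"
    have yH: "y \<in> carrier H" and yS: "y \<in> S" using y S by auto
    have "tensor_eq H 2 (comult ?K (x \<oplus> y)) (comult H (x \<oplus> y))" by (rule c(2)[OF cl(1)[OF xS yS]])
    also have "tensor_eq H 2 \<dots> (\<lambda>f. comult H x f + comult H y f)" by (rule comult_add[OF xH yH])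
    also have "tensor_eq H 2 \<dots> (\<lambda>f. comult ?K x f + comult ?K y f)"
      using c(2)[OF xS] c(2)[OF yS] by (simp add: tensor_eq_def)
    finally show "tensor_eq ?K 2 (comult ?K (x \<oplus>\<^bsub>?K\<^esub> y)) (\<lambda>f. comult ?K x f + comult ?K y f)"
      using xS yS c cl by (intro r.tensor_eq_restrict tensors_add) auto
    have "tensor_eq H 2 (comult ?K (x \<otimes> y)) (comult H (x \<otimes> y))" by (rule c(2)[OF cl(2)[OF xS yS]])
    also have "tensor_eq H 2 \<dots> (comult H x \<star> comult H y)" by (rule comult_mult[OF xH yH])
    also have "tensor_eq H 2 \<dots> (comult ?K x \<star> comult ?K y)"
      by (rule tensor_mult_cong[OF comult_closed[OF xH] comult_closed[OF yH]
        tensor_eq_sym[OF c(2)[OF xS]] tensor_eq_sym[OF c(2)[OF yS]]])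
    finally show "tensor_eq ?K 2 (comult ?K (x \<otimes>\<^bsub>?K\<^esub> y)) (comult ?K x \<star>\<^bsub>?K\<^esub> comult ?K y)"
      using xS yS c cl K.tensor_mult_closed[of "comult ?K x" 2 "comult ?K y"]
      by (intro r.tensor_eq_restrict) (auto simp: r.tensor_mult_eq)
  next
    have 1: "\<one> \<in> S" using K.one_closed by simp
    have "tensor_eq H 2 (comult ?K \<one>) (comult H \<one>)" by (rule c(2)[OF 1])
    also have "tensor_eq H 2 \<dots> (tensor_one H 2)" by (rule comult_one)
    finally show "tensor_eq ?K 2 (comult ?K \<one>\<^bsub>?K\<^esub>) (tensor_one ?K 2)"
      using 1 c K.tensor_one_closed[of 2] by (intro r.tensor_eq_restrict) (auto simp: r.tensor_one_eq)
  qed (use subsetD[OF S] counit_add counit_smult counit_mult counit_one in auto)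
qed

section \<open>Weight decompositions\<close>

definition prod2 :: "('a \<Rightarrow> complex) \<Rightarrow> ('a \<Rightarrow> complex) \<Rightarrow> 'a list \<Rightarrow> complex" where
  "prod2 f g = (\<lambda>xs. f (xs ! 0) * g (xs ! 1))"

definition prod3 :: "('a \<Rightarrow> complex) \<Rightarrow> ('a \<Rightarrow> complex) \<Rightarrow> ('a \<Rightarrow> complex) \<Rightarrow> 'a list \<Rightarrow> complex" where
  "prod3 f g h = (\<lambda>xs. f (xs ! 0) * g (xs ! 1) * h (xs ! 2))"

lemma prod2_apply [simp]: "prod2 f g [x, y] = f x * g y" by (simp add: prod2_def)
lemma prod3_apply [simp]: "prod3 f g h [x, y, z] = f x * g y * h z" by (simp add: prod3_def)

lemma prod2_multilinear: "linear_form H f \<Longrightarrow> linear_form H g \<Longrightarrow> multilinear H 2 (prod2 f g)"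
  by (auto simp: multilinear2_iff linear_form_def prod2_def algebra_simps)

lemma prod3_multilinear:
  "linear_form H f \<Longrightarrow> linear_form H g \<Longrightarrow> linear_form H h \<Longrightarrow> multilinear H 3 (prod3 f g h)"
  by (auto simp: multilinear3_iff linear_form_def prod3_def algebra_simps)

text \<open>For primitive idempotents \<open>e i\<close> these tensors form the algebra of functions
  on pairs of indices in Z/n: a twist becomes a 2-cochain and, with \<open>diag3\<close>, an
  associator a 3-cochain.\<close>

definition diag2 :: "nat \<Rightarrow> (nat \<Rightarrow> 'a) \<Rightarrow> (nat \<Rightarrow> nat \<Rightarrow> complex) \<Rightarrow> 'a tensor" where
  "diag2 n e F = (\<lambda>f. \<Sum>i<n. \<Sum>j<n. F i j * f [e i, e j])"

definition diag3 :: "nat \<Rightarrow> (nat \<Rightarrow> 'a) \<Rightarrow> (nat \<Rightarrow> nat \<Rightarrow> nat \<Rightarrow> complex) \<Rightarrow> 'a tensor" where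
  "diag3 n e F = (\<lambda>f. \<Sum>i<n. \<Sum>j<n. \<Sum>k<n. F i j k * f [e i, e j, e k])"

lemma diag2_cong: "(\<And>i j. i < n \<Longrightarrow> j < n \<Longrightarrow> F i j = G i j) \<Longrightarrow> diag2 n e F = diag2 n e G"
  by (auto simp: diag2_def intro!: ext sum.cong)

lemma diag3_cong: "(\<And>i j k. i < n \<Longrightarrow> j < n \<Longrightarrow> k < n \<Longrightarrow> F i j k = G i j k) \<Longrightarrow> diag3 n e F = diag3 n e G"
  by (auto simp: diag3_def intro!: ext sum.cong)

text \<open>Coproduct of a skew primitive element that shifts the weights by one.\<close>

definition skew2 ::
    "('a, 'm) monoid_scheme \<Rightarrow> nat \<Rightarrow> (nat \<Rightarrow> 'a) \<Rightarrow> 'a \<Rightarrow> (nat \<Rightarrow> nat \<Rightarrow> complex) \<Rightarrow> (nat \<Rightarrow> nat \<Rightarrow> complex) \<Rightarrow> 'a tensor" where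
  "skew2 H n e x \<alpha> \<beta> = (\<lambda>f. \<Sum>i<n. \<Sum>j<n.
     \<alpha> i j * f [x \<otimes>\<^bsub>H\<^esub> e i, e j] + \<beta> i j * f [e i, x \<otimes>\<^bsub>H\<^esub> e j])"

lemma skew2_cong: "(\<And>i j. i < n \<Longrightarrow> j < n \<Longrightarrow> \<alpha> i j = \<alpha>' i j) \<Longrightarrow> (\<And>i j. i < n \<Longrightarrow> j < n \<Longrightarrow> \<beta> i j = \<beta>' i j) \<Longrightarrow>
    skew2 H n e x \<alpha> \<beta> = skew2 H n e x \<alpha>' \<beta>'"
  by (auto simp: skew2_def intro!: ext sum.cong)

text \<open>Multiplication of \<open>\<omega>\<close> by the coboundary of \<open>F\<close>, with
  the five factors in the order of \<open>twist_associator\<close>.\<close>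

definition twist3 ::
    "nat \<Rightarrow> (nat \<Rightarrow> nat \<Rightarrow> complex) \<Rightarrow> (nat \<Rightarrow> nat \<Rightarrow> nat \<Rightarrow> complex) \<Rightarrow> nat \<Rightarrow> nat \<Rightarrow> nat \<Rightarrow> complex" where
  "twist3 n F \<omega> i j k = F j k * F i ((j + k) mod n) * \<omega> i j k * (1 / F ((i + j) mod n) k) * (1 / F i j)"

text \<open>The reindexing behind every use of \<open>\<Delta>(e\<^sub>i)\<close>, a sum over pairs
  of indices with prescribed sum modulo \<open>n\<close>.\<close>

lemma sum_mod_collect:
  fixes g :: "nat \<Rightarrow> complex"
  assumes "n > 0"
  shows "(\<Sum>j<n. g j * (\<Sum>k<n. \<Sum>l<n. if (k + l) mod n = j then h k l else 0)) =
    (\<Sum>k<n. \<Sum>l<n. g ((k + l) mod n) * h k l)"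
proof -
  have "(\<Sum>j<n. g j * (\<Sum>k<n. \<Sum>l<n. if (k + l) mod n = j then h k l else 0)) =
     (\<Sum>j<n. \<Sum>k<n. \<Sum>l<n. if (k + l) mod n = j then g j * h k l else 0)"
    by (simp add: sum_distrib_left if_distrib cong: if_cong)
  also have "\<dots> = (\<Sum>k<n. \<Sum>j<n. \<Sum>l<n. if (k + l) mod n = j then g j * h k l else 0)"
    by (rule sum.swap)
  also have "\<dots> = (\<Sum>k<n. \<Sum>l<n. \<Sum>j<n. if (k + l) mod n = j then g j * h k l else 0)"
    by (intro sum.cong refl sum.swap)
  also have "\<dots> = (\<Sum>k<n. \<Sum>l<n. g ((k + l) mod n) * h k l)"
    using assms by (intro sum.cong refl) (simp add: eq_commute cong: if_cong)
  finally show ?thesis .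
qed

lemma sum_swap4:
  fixes g :: "'a \<Rightarrow> 'b \<Rightarrow> 'c \<Rightarrow> 'd \<Rightarrow> complex"
  shows "(\<Sum>i\<in>A. \<Sum>j\<in>B. \<Sum>k\<in>C. \<Sum>l\<in>D. g i j k l) = (\<Sum>k\<in>C. \<Sum>l\<in>D. \<Sum>i\<in>A. \<Sum>j\<in>B. g i j k l)"
proof -
  have "(\<Sum>i\<in>A. \<Sum>j\<in>B. \<Sum>k\<in>C. \<Sum>l\<in>D. g i j k l) = (\<Sum>i\<in>A. \<Sum>k\<in>C. \<Sum>j\<in>B. \<Sum>l\<in>D. g i j k l)"
    by (intro sum.cong refl sum.swap)
  also have "\<dots> = (\<Sum>k\<in>C. \<Sum>i\<in>A. \<Sum>j\<in>B. \<Sum>l\<in>D. g i j k l)" by (rule sum.swap)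
  also have "\<dots> = (\<Sum>k\<in>C. \<Sum>i\<in>A. \<Sum>l\<in>D. \<Sum>j\<in>B. g i j k l)" by (intro sum.cong refl sum.swap)
  also have "\<dots> = (\<Sum>k\<in>C. \<Sum>l\<in>D. \<Sum>i\<in>A. \<Sum>j\<in>B. g i j k l)" by (intro sum.cong refl sum.swap)
  finally show ?thesis .
qed

text \<open>Indices are arbitrary naturals with \<open>e (i mod n) = e i\<close>, so that shifted
  indices such as \<open>Suc i\<close> need no reduction; rules with case distinctions are stated
  for \<open>i < n\<close>.\<close>

locale weight_system = pre_bialgebra H for H :: "'a quasi_hopf" (structure) +
  fixes n :: nat and e :: "nat \<Rightarrow> 'a"
  assumes n_pos: "n > 0"
    and e_closed [simp, intro]: "e i \<in> carrier H"
    and e_mod: "e (i mod n) = e i"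
    and e_mult: "i < n \<Longrightarrow> j < n \<Longrightarrow> e i \<otimes> e j = (if i = j then e i else \<zero>)"
    and e_sum: "(\<Oplus>i\<in>{..<n}. e i) = \<one>"
    and comult_e: "i < n \<Longrightarrow>
      tensor_eq H 2 (comult H (e i)) (diag2 n e (\<lambda>j l. if (j + l) mod n = i then 1 else 0))"
    and counit_e: "i < n \<Longrightarrow> counit H (e i) = (if i = 0 then 1 else 0)"
begin

abbreviation "dg2 \<equiv> diag2 n e"
abbreviation "dg3 \<equiv> diag3 n e"

text \<open>Weights are recorded on each side separately because the left and right weights of
  \<open>x e\<^sub>i\<close> differ.\<close>

definition lweight :: "'a \<Rightarrow> nat \<Rightarrow> bool" where
  "lweight v a \<longleftrightarrow> v \<in> carrier H \<and> a < n \<and> (\<forall>i<n. e i \<otimes> v = (if i = a then v else \<zero>))"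

definition rweight :: "'a \<Rightarrow> nat \<Rightarrow> bool" where
  "rweight v a \<longleftrightarrow> v \<in> carrier H \<and> a < n \<and> (\<forall>i<n. v \<otimes> e i = (if i = a then v else \<zero>))"

lemma lweight_e: "i < n \<Longrightarrow> lweight (e i) i"
  by (auto simp: lweight_def e_mult)

lemma rweight_e: "i < n \<Longrightarrow> rweight (e i) i"
  by (auto simp: rweight_def e_mult)

lemma ml2_zero: "multilinear H 2 f \<Longrightarrow> x \<in> carrier H \<Longrightarrow> f [\<zero>, x] = 0"
  "multilinear H 2 f \<Longrightarrow> x \<in> carrier H \<Longrightarrow> f [x, \<zero>] = 0"
  using linear_form_zero by (auto simp: multilinear2_iff)

lemma ml3_zero: "multilinear H 3 f \<Longrightarrow> x \<in> carrier H \<Longrightarrow> y \<in> carrier H \<Longrightarrow> f [\<zero>, x, y] = 0"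
  "multilinear H 3 f \<Longrightarrow> x \<in> carrier H \<Longrightarrow> y \<in> carrier H \<Longrightarrow> f [x, \<zero>, y] = 0"
  "multilinear H 3 f \<Longrightarrow> x \<in> carrier H \<Longrightarrow> y \<in> carrier H \<Longrightarrow> f [x, y, \<zero>] = 0"
  using linear_form_zero[of "\<lambda>z. f [z, x, y]"] linear_form_zero[of "\<lambda>z. f [x, z, y]"]
    linear_form_zero[of "\<lambda>z. f [x, y, z]"] by (auto simp: multilinear3_iff)

lemma left2_collapse:
  assumes "multilinear H 2 f" "lweight v a" "lweight w b"
  shows "(\<Sum>i<n. \<Sum>j<n. F i j * f [e i \<otimes> v, e j \<otimes> w]) = F a b * f [v, w]"
proof -
  have "(\<Sum>i<n. \<Sum>j<n. F i j * f [e i \<otimes> v, e j \<otimes> w]) =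
    (\<Sum>i<n. \<Sum>j<n. if j = b then (if i = a then F i j * f [v, w] else 0) else 0)"
    using assms ml2_zero by (intro sum.cong refl) (auto simp: lweight_def)
  also have "\<dots> = F a b * f [v, w]" using assms by (simp add: lweight_def)
  finally show ?thesis .
qed

lemma right2_collapse:
  assumes "multilinear H 2 f" "rweight v a" "rweight w b"
  shows "(\<Sum>i<n. \<Sum>j<n. F i j * f [v \<otimes> e i, w \<otimes> e j]) = F a b * f [v, w]"
proof -
  have "(\<Sum>i<n. \<Sum>j<n. F i j * f [v \<otimes> e i, w \<otimes> e j]) =
    (\<Sum>i<n. \<Sum>j<n. if j = b then (if i = a then F i j * f [v, w] else 0) else 0)"
    using assms ml2_zero by (intro sum.cong refl) (auto simp: rweight_def)
  also have "\<dots> = F a b * f [v, w]" using assms by (simp add: rweight_def)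
  finally show ?thesis .
qed

text \<open>Orthogonality of the idempotents leaves one term of the diagonal tensor, which therefore
  acts on each summand by the scalar \<open>F\<close> at its left weights.\<close>

lemma diag2_left:
  assumes "multilinear H 2 f" "\<And>k l. k < n \<Longrightarrow> l < n \<Longrightarrow> lweight (v k l) (a k l)"
    "\<And>k l. k < n \<Longrightarrow> l < n \<Longrightarrow> lweight (w k l) (b k l)"
  shows "(dg2 F \<star> (\<lambda>f. \<Sum>k<n. \<Sum>l<n. c k l * f [v k l, w k l])) f =
    (\<Sum>k<n. \<Sum>l<n. F (a k l) (b k l) * c k l * f [v k l, w k l])"
proof -
  have "(dg2 F \<star> (\<lambda>f. \<Sum>k<n. \<Sum>l<n. c k l * f [v k l, w k l])) f =
     (\<Sum>i<n. \<Sum>j<n. \<Sum>k<n. \<Sum>l<n. F i j * (c k l * f [e i \<otimes> v k l, e j \<otimes> w k l]))"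
    by (simp add: tensor_mult_def diag2_def sum_distrib_left)
  also have "\<dots> = (\<Sum>k<n. \<Sum>l<n. \<Sum>i<n. \<Sum>j<n. F i j * (c k l * f [e i \<otimes> v k l, e j \<otimes> w k l]))"
    by (rule sum_swap4)
  also have "\<dots> = (\<Sum>k<n. \<Sum>l<n. c k l * (\<Sum>i<n. \<Sum>j<n. F i j * f [e i \<otimes> v k l, e j \<otimes> w k l]))"
    by (simp add: sum_distrib_left algebra_simps)
  also have "\<dots> = (\<Sum>k<n. \<Sum>l<n. F (a k l) (b k l) * c k l * f [v k l, w k l])"
    using left2_collapse[OF assms] by (intro sum.cong refl) simp
  finally show ?thesis .
qed

lemma diag2_right:
  assumes "multilinear H 2 f" "\<And>k l. k < n \<Longrightarrow> l < n \<Longrightarrow> rweight (v k l) (a k l)"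
    "\<And>k l. k < n \<Longrightarrow> l < n \<Longrightarrow> rweight (w k l) (b k l)"
  shows "((\<lambda>f. \<Sum>k<n. \<Sum>l<n. c k l * f [v k l, w k l]) \<star> dg2 F) f =
    (\<Sum>k<n. \<Sum>l<n. F (a k l) (b k l) * c k l * f [v k l, w k l])"
  unfolding tensor_mult_def diag2_def
  using right2_collapse[OF assms] by (intro sum.cong refl) simp

lemma diag2_closed [simp]: "dg2 F \<in> tensors H 2"
  unfolding diag2_def
  using pure_tensor_closed[of "[_,_]" H] by (intro tensors_sum tensors_smult) (simp_all add: pure_tensor_def numeral_eq_Suc)

lemma diag3_closed [simp]: "dg3 F \<in> tensors H 3"
  unfolding diag3_def
  using pure_tensor_closed[of "[_,_,_]" H] by (intro tensors_sum tensors_smult) (simp_all add: pure_tensor_def numeral_eq_Suc)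

lemma diag2_mult: "tensor_eq H 2 (dg2 F \<star> dg2 G) (dg2 (\<lambda>i j. F i j * G i j))"
  unfolding tensor_eq_def
proof (intro allI impI)
  fix f assume "multilinear H 2 f"
  from diag2_left[OF this, of "\<lambda>k l. e k" "\<lambda>k l. k" "\<lambda>k l. e l" "\<lambda>k l. l" F G]
  show "(dg2 F \<star> dg2 G) f = dg2 (\<lambda>i j. F i j * G i j) f"
    by (simp add: lweight_e diag2_def)
qed

lemma diag3_mult: "tensor_eq H 3 (dg3 F \<star> dg3 G) (dg3 (\<lambda>i j k. F i j k * G i j k))"
  unfolding tensor_eq_def
proof (intro allI impI)
  fix f assume f: "multilinear H 3 f"
  have "(\<Sum>i'<n. \<Sum>j'<n. \<Sum>k'<n. G i' j' k' * f [e i \<otimes> e i', e j \<otimes> e j', e k \<otimes> e k']) = G i j k * f [e i, e j, e k]"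
    if "i < n" "j < n" "k < n" for i j k
  proof -
    have "(\<Sum>i'<n. \<Sum>j'<n. \<Sum>k'<n. G i' j' k' * f [e i \<otimes> e i', e j \<otimes> e j', e k \<otimes> e k']) =
      (\<Sum>i'<n. \<Sum>j'<n. \<Sum>k'<n. if k' = k then if j' = j then if i' = i then G i' j' k' * f [e i, e j, e k] else 0 else 0 else 0)"
      using that f ml3_zero by (intro sum.cong refl) (auto simp: e_mult)
    then show ?thesis using that by simp
  qed
  then show "(dg3 F \<star> dg3 G) f = dg3 (\<lambda>i j k. F i j k * G i j k) f"
    by (simp add: tensor_mult_def diag3_def sum_distrib_left mult.assoc)
      (simp add: sum_distrib_left[symmetric])
qed

lemma diag2_one: "tensor_eq H 2 (tensor_one H 2) (dg2 (\<lambda>i j. 1))"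
  unfolding tensor_eq_def
proof (intro allI impI)
  fix f assume "multilinear H 2 f"
  then have l: "\<And>x. x \<in> carrier H \<Longrightarrow> linear_form H (\<lambda>y. f [y, x])"
     "\<And>x. x \<in> carrier H \<Longrightarrow> linear_form H (\<lambda>y. f [x, y])" by (auto simp: multilinear2_iff)
  have "f [\<one>, \<one>] = (\<Sum>i<n. f [e i, \<one>])"
    using linear_form_finsum[OF l(1)[of \<one>], of "{..<n}" e] e_sum by simp
  also have "\<dots> = (\<Sum>i<n. \<Sum>j<n. f [e i, e j])"
    using linear_form_finsum[OF l(2), of _ "{..<n}" e] e_sum by simp
  finally show "tensor_one H 2 f = dg2 (\<lambda>i j. 1) f"
    by (simp add: tensor_one_def pure_tensor_def diag2_def numeral_eq_Suc)
qed

lemma diag3_append_one: "tensor_eq H 3 (tensor_append (dg2 F) (pure_tensor [\<one>])) (dg3 (\<lambda>i j k. F i j))"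
  unfolding tensor_eq_def
proof (intro allI impI)
  fix f assume f: "multilinear H 3 f"
  then have "f [e i, e j, \<one>] = (\<Sum>k<n. f [e i, e j, e k])" for i j
    using linear_form_finsum[of "\<lambda>z. f [e i, e j, z]" "{..<n}" e] e_sum by (auto simp: multilinear3_iff)
  then show "tensor_append (dg2 F) (pure_tensor [\<one>]) f = dg3 (\<lambda>i j k. F i j) f"
    by (simp add: tensor_append_def diag2_def diag3_def pure_tensor_def sum_distrib_left)
qed

lemma diag3_one_append: "tensor_eq H 3 (tensor_append (pure_tensor [\<one>]) (dg2 F)) (dg3 (\<lambda>i j k. F j k))"
  unfolding tensor_eq_def
proof (intro allI impI)
  fix f assume f: "multilinear H 3 f"
  then have "f [\<one>, e j, e k] = (\<Sum>i<n. f [e i, e j, e k])" for j k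
    using linear_form_finsum[of "\<lambda>z. f [z, e j, e k]" "{..<n}" e] e_sum by (auto simp: multilinear3_iff)
  then have "tensor_append (pure_tensor [\<one>]) (dg2 F) f = (\<Sum>j<n. \<Sum>k<n. \<Sum>i<n. F j k * f [e i, e j, e k])"
    by (simp add: tensor_append_def diag2_def pure_tensor_def sum_distrib_left)
  also have "\<dots> = (\<Sum>j<n. \<Sum>i<n. \<Sum>k<n. F j k * f [e i, e j, e k])"
    by (intro sum.cong refl sum.swap)
  also have "\<dots> = (\<Sum>i<n. \<Sum>j<n. \<Sum>k<n. F j k * f [e i, e j, e k])"
    by (rule sum.swap)
  finally show "tensor_append (pure_tensor [\<one>]) (dg2 F) f = dg3 (\<lambda>i j k. F j k) f"
    by (simp add: diag3_def)
qed

lemma diag3_one: "tensor_eq H 3 (tensor_one H 3) (dg3 (\<lambda>i j k. 1))"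
proof -
  have "tensor_one H 3 = tensor_append (tensor_one H 2) (pure_tensor [\<one>])"
    by (simp add: tensor_one_def tensor_append_def pure_tensor_def numeral_eq_Suc)
  moreover have "tensor_eq H (2 + 1) (tensor_append (tensor_one H 2) (pure_tensor [\<one>])) (tensor_append (dg2 (\<lambda>i j. 1)) (pure_tensor [\<one>]))"
    using pure_tensor_closed[of "[\<one>]" H]
    by (intro tensor_append_cong[OF complex_algebra_axioms] diag2_one) simp_all
  ultimately show ?thesis using diag3_append_one[of "\<lambda>i j. 1"] by (simp add: tensor_eq_def)
qed

lemma comult_e_apply:
  assumes "i < n" "multilinear H 2 f"
  shows "comult H (e i) f = (\<Sum>k<n. \<Sum>l<n. if (k + l) mod n = i then f [e k, e l] else 0)"
proof -
  have "comult H (e i) f = dg2 (\<lambda>j l. if (j + l) mod n = i then 1 else 0) f"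
    using comult_e[OF assms(1)] assms(2) by (simp add: tensor_eq_def)
  also have "\<dots> = (\<Sum>k<n. \<Sum>l<n. if (k + l) mod n = i then f [e k, e l] else 0)"
    unfolding diag2_def by (intro sum.cong refl) simp
  finally show ?thesis .
qed

text \<open>\<open>\<Delta>\<close> is dual to addition in Z/n, so it pulls cochains back along the
  sum of two indices.\<close>

lemma comult_at_0_diag2: "tensor_eq H 3 (comult_at H 0 (dg2 F)) (dg3 (\<lambda>i j k. F ((i + j) mod n) k))"
  unfolding tensor_eq_def
proof (intro allI impI)
  fix f assume f: "multilinear H 3 f"
  have "comult_at H 0 (dg2 F) f = (\<Sum>i<n. \<Sum>k<n. F i k * comult H (e i) (\<lambda>ys. f (ys @ [e k])))"
    by (simp add: comult_at_def diag2_def)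
  also have "\<dots> = (\<Sum>i<n. \<Sum>k<n. F i k * (\<Sum>a<n. \<Sum>b<n. if (a + b) mod n = i then f [e a, e b, e k] else 0))"
    using multilinear_at(1)[OF f] by (intro sum.cong refl) (simp add: comult_e_apply cong: if_cong)
  also have "\<dots> = (\<Sum>k<n. \<Sum>i<n. F i k * (\<Sum>a<n. \<Sum>b<n. if (a + b) mod n = i then f [e a, e b, e k] else 0))"
    by (rule sum.swap)
  also have "\<dots> = (\<Sum>k<n. \<Sum>a<n. \<Sum>b<n. F ((a + b) mod n) k * f [e a, e b, e k])"
    using n_pos by (simp add: sum_mod_collect)
  also have "\<dots> = (\<Sum>a<n. \<Sum>k<n. \<Sum>b<n. F ((a + b) mod n) k * f [e a, e b, e k])"
    by (rule sum.swap)
  also have "\<dots> = (\<Sum>a<n. \<Sum>b<n. \<Sum>k<n. F ((a + b) mod n) k * f [e a, e b, e k])"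
    by (intro sum.cong refl sum.swap)
  finally show "comult_at H 0 (dg2 F) f = dg3 (\<lambda>i j k. F ((i + j) mod n) k) f"
    by (simp add: diag3_def)
qed

lemma comult_at_1_diag2: "tensor_eq H 3 (comult_at H 1 (dg2 F)) (dg3 (\<lambda>i j k. F i ((j + k) mod n)))"
  unfolding tensor_eq_def
proof (intro allI impI)
  fix f assume f: "multilinear H 3 f"
  have "comult_at H 1 (dg2 F) f = (\<Sum>i<n. \<Sum>k<n. F i k * comult H (e k) (\<lambda>ys. f (e i # ys)))"
    by (simp add: comult_at_def diag2_def)
  also have "\<dots> = (\<Sum>i<n. \<Sum>k<n. F i k * (\<Sum>a<n. \<Sum>b<n. if (a + b) mod n = k then f [e i, e a, e b] else 0))"
    using multilinear_at(2)[OF f] by (intro sum.cong refl) (simp add: comult_e_apply cong: if_cong)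
  also have "\<dots> = (\<Sum>i<n. \<Sum>a<n. \<Sum>b<n. F i ((a + b) mod n) * f [e i, e a, e b])"
    using n_pos by (simp add: sum_mod_collect)
  finally show "comult_at H 1 (dg2 F) f = dg3 (\<lambda>i j k. F i ((j + k) mod n)) f"
    by (simp add: diag3_def)
qed

lemma diag2_inverse:
  assumes "\<And>i j. i < n \<Longrightarrow> j < n \<Longrightarrow> F i j \<noteq> 0"
  shows "is_tensor_inverse H 2 (dg2 F) (dg2 (\<lambda>i j. 1 / F i j))"
proof -
  have "dg2 (\<lambda>i j. F i j * (1 / F i j)) = dg2 (\<lambda>i j. 1)" "dg2 (\<lambda>i j. 1 / F i j * F i j) = dg2 (\<lambda>i j. 1)"
    using assms by (auto intro!: diag2_cong)
  then show ?thesis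
    using diag2_mult[of F "\<lambda>i j. 1 / F i j"] diag2_mult[of "\<lambda>i j. 1 / F i j" F] diag2_one
    by (simp add: is_tensor_inverse_def tensor_eq_def)
qed

lemma diag3_inverse:
  assumes "\<And>i j k. i < n \<Longrightarrow> j < n \<Longrightarrow> k < n \<Longrightarrow> F i j k \<noteq> 0"
  shows "is_tensor_inverse H 3 (dg3 F) (dg3 (\<lambda>i j k. 1 / F i j k))"
proof -
  have "dg3 (\<lambda>i j k. F i j k * (1 / F i j k)) = dg3 (\<lambda>i j k. 1)" "dg3 (\<lambda>i j k. 1 / F i j k * F i j k) = dg3 (\<lambda>i j k. 1)"
    using assms by (auto intro!: diag3_cong)
  then show ?thesis
    using diag3_mult[of F "\<lambda>i j k. 1 / F i j k"] diag3_mult[of "\<lambda>i j k. 1 / F i j k" F] diag3_one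
    by (simp add: is_tensor_inverse_def tensor_eq_def)
qed

lemma diag2_invertible:
  assumes "\<And>i j. i < n \<Longrightarrow> j < n \<Longrightarrow> F i j \<noteq> 0" "J \<in> tensors H 2" "tensor_eq H 2 J (dg2 F)"
  shows "tensor_invertible H 2 J" "tensor_eq H 2 (tensor_inv H 2 J) (dg2 (\<lambda>i j. 1 / F i j))"
    "tensor_inv H 2 J \<in> tensors H 2"
proof -
  have "is_tensor_inverse H 2 J (dg2 (\<lambda>i j. 1 / F i j))"
    by (rule is_tensor_inverse_cong[OF diag2_inverse[OF assms(1)] _ tensor_eq_sym[OF assms(3)]]) auto
  from tensor_inv_eq[OF _ assms(2) this]
  show "tensor_invertible H 2 J" "tensor_eq H 2 (tensor_inv H 2 J) (dg2 (\<lambda>i j. 1 / F i j))"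
    "tensor_inv H 2 J \<in> tensors H 2" by auto
qed

lemma diag3_invertible:
  assumes "\<And>i j k. i < n \<Longrightarrow> j < n \<Longrightarrow> k < n \<Longrightarrow> F i j k \<noteq> 0" "J \<in> tensors H 3" "tensor_eq H 3 J (dg3 F)"
  shows "tensor_invertible H 3 J" "tensor_eq H 3 (tensor_inv H 3 J) (dg3 (\<lambda>i j k. 1 / F i j k))"
    "tensor_inv H 3 J \<in> tensors H 3"
proof -
  have "is_tensor_inverse H 3 J (dg3 (\<lambda>i j k. 1 / F i j k))"
    by (rule is_tensor_inverse_cong[OF diag3_inverse[OF assms(1)] _ tensor_eq_sym[OF assms(3)]]) auto
  from tensor_inv_eq[OF _ assms(2) this]
  show "tensor_invertible H 3 J" "tensor_eq H 3 (tensor_inv H 3 J) (dg3 (\<lambda>i j k. 1 / F i j k))"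
    "tensor_inv H 3 J \<in> tensors H 3" by auto
qed

text \<open>Membership and value are kept in one conjunction because the congruence rule for
  products needs both at every stage.\<close>

lemma diag3_mult_rep:
  assumes "t \<in> tensors H 3 \<and> tensor_eq H 3 t (dg3 F)" "u \<in> tensors H 3 \<and> tensor_eq H 3 u (dg3 G)"
  shows "t \<star> u \<in> tensors H 3 \<and> tensor_eq H 3 (t \<star> u) (dg3 (\<lambda>i j k. F i j k * G i j k))"
  using assms tensor_eq_trans[OF tensor_mult_cong diag3_mult] tensor_mult_closed by blast

lemma twist_associator_diag:
  assumes F: "\<And>i j. i < n \<Longrightarrow> j < n \<Longrightarrow> F i j \<noteq> 0"
    and J: "J \<in> tensors H 2" "tensor_eq H 2 J (dg2 F)"
    and \<Phi>: "\<Phi> \<in> tensors H 3" "tensor_eq H 3 \<Phi> (dg3 \<omega>)"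
  shows "twist_associator H J \<Phi> \<in> tensors H 3"
    "tensor_eq H 3 (twist_associator H J \<Phi>) (dg3 (twist3 n F \<omega>))"
proof -
  have one: "pure_tensor [\<one>] \<in> tensors H 1" using pure_tensor_closed[of "[\<one>]" H] by simp
  have t1: "tensor_append (pure_tensor [\<one>]) J \<in> tensors H 3 \<and>
      tensor_eq H 3 (tensor_append (pure_tensor [\<one>]) J) (dg3 (\<lambda>i j k. F j k))"
    using tensor_append_closed[OF complex_algebra_axioms one J(1)]
      tensor_append_cong[OF complex_algebra_axioms one J(1) tensor_eq_refl J(2)] diag3_one_append[of F]
    by (simp add: tensor_eq_def numeral_eq_Suc)
  have t2: "comult_at H 1 J \<in> tensors H 3 \<and> tensor_eq H 3 (comult_at H 1 J) (dg3 (\<lambda>i j k. F i ((j + k) mod n)))"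
    using comult_at_closed[OF J(1), of 1] tensor_eq_trans[OF comult_at_cong[OF J(2), of 1] comult_at_1_diag2] by simp
  note inv = diag2_invertible[OF F J]
  have t3: "comult_at H 0 (tensor_inv H 2 J) \<in> tensors H 3 \<and>
      tensor_eq H 3 (comult_at H 0 (tensor_inv H 2 J)) (dg3 (\<lambda>i j k. 1 / F ((i + j) mod n) k))"
    using comult_at_closed[OF inv(3), of 0] tensor_eq_trans[OF comult_at_cong[OF inv(2), of 0] comult_at_0_diag2] by simp
  have t4: "tensor_append J (pure_tensor [\<one>]) \<in> tensors H 3"
      "tensor_eq H 3 (tensor_append J (pure_tensor [\<one>])) (dg3 (\<lambda>i j k. F i j))"
    using tensor_append_closed[OF complex_algebra_axioms J(1) one]
      tensor_append_cong[OF complex_algebra_axioms J(1) one J(2) tensor_eq_refl] diag3_append_one[of F]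
    by (simp_all add: tensor_eq_def numeral_eq_Suc)
  have t5: "tensor_inv H 3 (tensor_append J (pure_tensor [\<one>])) \<in> tensors H 3 \<and>
      tensor_eq H 3 (tensor_inv H 3 (tensor_append J (pure_tensor [\<one>]))) (dg3 (\<lambda>i j k. 1 / F i j))"
    using diag3_invertible[OF F t4] by simp
  have "twist_associator H J \<Phi> \<in> tensors H 3 \<and> tensor_eq H 3 (twist_associator H J \<Phi>) (dg3 (twist3 n F \<omega>))"
    unfolding twist_associator_def twist3_def
    by (intro diag3_mult_rep t1 t2 t3 t5 conjI \<Phi>)
  then show "twist_associator H J \<Phi> \<in> tensors H 3"
    "tensor_eq H 3 (twist_associator H J \<Phi>) (dg3 (twist3 n F \<omega>))" by auto
qed

text \<open>The counit is evaluation at index 0, so for diagonal tensors the counit condition on a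
  twist is normalisation of the cochain.\<close>

lemma counit_at_diag2:
  assumes "\<And>i. i < n \<Longrightarrow> F 0 i = 1" "\<And>i. i < n \<Longrightarrow> F i 0 = 1"
  shows "tensor_eq H 1 (counit_at H 0 (dg2 F)) (tensor_one H 1)" "tensor_eq H 1 (counit_at H 1 (dg2 F)) (tensor_one H 1)"
proof -
  have one: "f [\<one>] = (\<Sum>i<n. f [e i])" if "multilinear H 1 f" for f
    using linear_form_finsum[of "\<lambda>z. f [z]" "{..<n}" e] e_sum that unfolding multilinear1_iff by auto
  have "counit_at H 0 (dg2 F) f = f [\<one>]" if "multilinear H 1 f" for f
  proof -
    have "counit_at H 0 (dg2 F) f = (\<Sum>i<n. \<Sum>j<n. F i j * ((if i = 0 then 1 else 0) * f [e j]))"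
      by (simp add: counit_at_def diag2_def counit_e)
    also have "\<dots> = (\<Sum>j<n. \<Sum>i<n. F i j * ((if i = 0 then 1 else 0) * f [e j]))" by (rule sum.swap)
    also have "\<dots> = (\<Sum>j<n. \<Sum>i<n. if i = 0 then F i j * f [e j] else 0)" by (intro sum.cong refl) auto
    also have "\<dots> = f [\<one>]" using assms n_pos one[OF that] by simp
    finally show ?thesis .
  qed
  then show "tensor_eq H 1 (counit_at H 0 (dg2 F)) (tensor_one H 1)"
    by (simp add: tensor_eq_def tensor_one_def pure_tensor_def)
  have "counit_at H 1 (dg2 F) f = f [\<one>]" if "multilinear H 1 f" for f
  proof -
    have "counit_at H 1 (dg2 F) f = (\<Sum>i<n. \<Sum>j<n. F i j * ((if j = 0 then 1 else 0) * f [e i]))"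
      by (simp add: counit_at_def diag2_def counit_e)
    also have "\<dots> = (\<Sum>i<n. \<Sum>j<n. if j = 0 then F i j * f [e i] else 0)" by (intro sum.cong refl) auto
    also have "\<dots> = f [\<one>]" using assms n_pos one[OF that] by simp
    finally show ?thesis .
  qed
  then show "tensor_eq H 1 (counit_at H 1 (dg2 F)) (tensor_one H 1)"
    by (simp add: tensor_eq_def tensor_one_def pure_tensor_def)
qed

lemma diag2_is_twist:
  assumes "\<And>i j. i < n \<Longrightarrow> j < n \<Longrightarrow> F i j \<noteq> 0" "\<And>i. i < n \<Longrightarrow> F 0 i = 1" "\<And>i. i < n \<Longrightarrow> F i 0 = 1"
  shows "is_twist H (dg2 F)"
  using diag2_invertible(1)[of F "dg2 F"] assms counit_at_diag2[of F] by (simp add: is_twist_def)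

end

text \<open>\<open>x\<close> raises weights by one and is skew primitive up to scalars. Here
  \<open>\<alpha>\<close>, \<open>\<beta>\<close> and \<open>\<omega>\<close> are free data;
  quasi-coassociativity, where available, relates them in \<open>coassoc_equations\<close>.\<close>

locale shift_system = weight_system H n e for H :: "'a quasi_hopf" (structure) and n e +
  fixes x :: 'a and \<alpha> \<beta> :: "nat \<Rightarrow> nat \<Rightarrow> complex" and \<omega> :: "nat \<Rightarrow> nat \<Rightarrow> nat \<Rightarrow> complex"
  assumes x_closed [simp, intro]: "x \<in> carrier H"
    and x_e: "x \<otimes> e i = e (Suc i) \<otimes> x"
    and comult_x: "tensor_eq H 2 (comult H x) (skew2 H n e x \<alpha> \<beta>)"
    and counit_x: "counit H x = 0"
    and associator_closed: "associator H \<in> tensors H 3"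
    and associator_eq: "tensor_eq H 3 (associator H) (diag3 n e \<omega>)"
begin

lemma rweight_xe: "i < n \<Longrightarrow> rweight (x \<otimes> e i) i"
  by (auto simp: rweight_def e_mult m_assoc)

lemma lweight_xe: "i < n \<Longrightarrow> lweight (x \<otimes> e i) (Suc i mod n)"
proof -
  assume i: "i < n"
  have "e j \<otimes> (x \<otimes> e i) = (if j = Suc i mod n then x \<otimes> e i else \<zero>)" if "j < n" for j
  proof -
    have "e j \<otimes> (x \<otimes> e i) = e j \<otimes> e (Suc i mod n) \<otimes> x"
      by (simp add: x_e e_mod m_assoc)
    then show ?thesis using that e_mult[of j "Suc i mod n"] n_pos by (auto simp: x_e e_mod)
  qed
  then show ?thesis using i n_pos by (auto simp: lweight_def)
qed

lemma skew2_closed [simp]: "skew2 H n e x a b \<in> tensors H 2"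
proof -
  have 1: "(\<lambda>f. f [x \<otimes> e i, e j]) \<in> tensors H 2" "(\<lambda>f. f [e i, x \<otimes> e j]) \<in> tensors H 2" for i j
    using pure_tensor_closed[of "[x \<otimes> e i, e j]" H] pure_tensor_closed[of "[e i, x \<otimes> e j]" H]
    by (simp_all add: pure_tensor_def numeral_eq_Suc)
  show ?thesis unfolding skew2_def
    by (intro tensors_sum tensors_add tensors_smult 1) simp_all
qed

lemma diag2_skew2:
  "tensor_eq H 2 (dg2 F \<star> skew2 H n e x a b)
     (skew2 H n e x (\<lambda>i j. F (Suc i mod n) j * a i j) (\<lambda>i j. F i (Suc j mod n) * b i j))"
  unfolding tensor_eq_def
proof (intro allI impI)
  fix f assume f: "multilinear H 2 f"
  have "(dg2 F \<star> skew2 H n e x a b) f =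
    (dg2 F \<star> (\<lambda>f. \<Sum>i<n. \<Sum>j<n. a i j * f [x \<otimes> e i, e j])) f +
    (dg2 F \<star> (\<lambda>f. \<Sum>i<n. \<Sum>j<n. b i j * f [e i, x \<otimes> e j])) f"
    by (simp add: tensor_mult_def skew2_def diag2_def sum.distrib distrib_left)
  also have "\<dots> = skew2 H n e x (\<lambda>i j. F (Suc i mod n) j * a i j) (\<lambda>i j. F i (Suc j mod n) * b i j) f"
    using diag2_left[OF f, of "\<lambda>i j. x \<otimes> e i" "\<lambda>i j. Suc i mod n" "\<lambda>i j. e j" "\<lambda>i j. j" F a]
      diag2_left[OF f, of "\<lambda>i j. e i" "\<lambda>i j. i" "\<lambda>i j. x \<otimes> e j" "\<lambda>i j. Suc j mod n" F b]
    by (simp add: lweight_xe lweight_e skew2_def sum.distrib)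
  finally show "(dg2 F \<star> skew2 H n e x a b) f = \<dots>" .
qed

lemma skew2_diag2:
  "tensor_eq H 2 (skew2 H n e x a b \<star> dg2 F)
     (skew2 H n e x (\<lambda>i j. a i j * F i j) (\<lambda>i j. b i j * F i j))"
  unfolding tensor_eq_def
proof (intro allI impI)
  fix f assume f: "multilinear H 2 f"
  have "(skew2 H n e x a b \<star> dg2 F) f =
    ((\<lambda>f. \<Sum>i<n. \<Sum>j<n. a i j * f [x \<otimes> e i, e j]) \<star> dg2 F) f +
    ((\<lambda>f. \<Sum>i<n. \<Sum>j<n. b i j * f [e i, x \<otimes> e j]) \<star> dg2 F) f"
    by (simp add: tensor_mult_def skew2_def sum.distrib)
  also have "\<dots> = skew2 H n e x (\<lambda>i j. a i j * F i j) (\<lambda>i j. b i j * F i j) f"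
    using diag2_right[OF f, of "\<lambda>i j. x \<otimes> e i" "\<lambda>i j. i" "\<lambda>i j. e j" "\<lambda>i j. j" a F]
      diag2_right[OF f, of "\<lambda>i j. e i" "\<lambda>i j. i" "\<lambda>i j. x \<otimes> e j" "\<lambda>i j. j" b F]
    by (simp add: rweight_xe rweight_e skew2_def sum.distrib mult.commute)
  finally show "(skew2 H n e x a b \<star> dg2 F) f = \<dots>" .
qed

text \<open>Conjugation multiplies each summand of \<open>\<Delta>(x)\<close> by \<open>F\<close> at
  its left weights divided by \<open>F\<close> at its right weights; these differ by one in the
  factor that contains \<open>x\<close>.\<close>

theorem twist_shift_system:
  assumes F: "\<And>i j. i < n \<Longrightarrow> j < n \<Longrightarrow> F i j \<noteq> 0"
  shows "shift_system (twist H (dg2 F)) n e x (\<lambda>i j. F (Suc i mod n) j * \<alpha> i j / F i j)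
    (\<lambda>i j. F i (Suc j mod n) * \<beta> i j / F i j) (twist3 n F \<omega>)"
proof -
  let ?t = "twist H (dg2 F)"
  have ops: "carrier ?t = carrier H" "ring.add ?t = ring.add H" "module.smult ?t = module.smult H"
    "monoid.mult ?t = monoid.mult H" "monoid.one ?t = monoid.one H" "\<zero>\<^bsub>?t\<^esub> = \<zero>\<^bsub>H\<^esub>" "counit ?t = counit H"
    "associator ?t = twist_associator H (dg2 F) (associator H)"
    "comult ?t h = dg2 F \<star> comult H h \<star> tensor_inv H 2 (dg2 F)" for h
    by (simp_all add: twist_def)
  note oc = multilinear_ops_cong[OF ops(1-3)]
  note inv = diag2_invertible[OF F diag2_closed tensor_eq_refl]
  interpret t: pre_bialgebra ?t by (rule twist_pre_bialgebra[OF inv(1)])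
  have fs: "finsum ?t g A = finsum H g A" for g :: "nat \<Rightarrow> 'a" and A
    by (simp add: finsum_def finprod_def ops)
  show ?thesis
  proof (intro shift_system.intro weight_system.intro weight_system_axioms.intro shift_system_axioms.intro)
    show "pre_bialgebra ?t" by (rule t.pre_bialgebra_axioms)
    fix i assume i: "i < n"
    let ?d = "\<lambda>j l. if (j + l) mod n = i then 1 else 0"
    have "tensor_eq H 2 (dg2 F \<star> comult H (e i) \<star> tensor_inv H 2 (dg2 F)) (dg2 F \<star> dg2 ?d \<star> dg2 (\<lambda>i j. 1 / F i j))"
      using inv by (intro tensor_mult_cong tensor_mult_closed comult_e[OF i] comult_closed) auto
    also have "tensor_eq H 2 \<dots> (dg2 (\<lambda>i j. F i j * ?d i j) \<star> dg2 (\<lambda>i j. 1 / F i j))"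
      by (intro tensor_mult_cong tensor_mult_closed diag2_mult) auto
    also have "tensor_eq H 2 \<dots> (dg2 (\<lambda>i j. F i j * ?d i j * (1 / F i j)))" by (rule diag2_mult)
    also have "dg2 (\<lambda>i j. F i j * ?d i j * (1 / F i j)) = dg2 ?d" using F by (intro diag2_cong) auto
    finally show "tensor_eq ?t 2 (comult ?t (e i)) (dg2 ?d)" by (simp add: oc ops)
  next
    let ?I = "\<lambda>i j. 1 / F i j"
    have "tensor_eq H 2 (dg2 F \<star> comult H x \<star> tensor_inv H 2 (dg2 F)) (dg2 F \<star> skew2 H n e x \<alpha> \<beta> \<star> dg2 ?I)"
      using inv by (intro tensor_mult_cong tensor_mult_closed comult_x comult_closed) auto
    also have "tensor_eq H 2 \<dots> (skew2 H n e x (\<lambda>i j. F (Suc i mod n) j * \<alpha> i j) (\<lambda>i j. F i (Suc j mod n) * \<beta> i j) \<star> dg2 ?I)"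
      by (intro tensor_mult_cong tensor_mult_closed diag2_skew2) auto
    also have "tensor_eq H 2 \<dots> (skew2 H n e x (\<lambda>i j. F (Suc i mod n) j * \<alpha> i j * ?I i j) (\<lambda>i j. F i (Suc j mod n) * \<beta> i j * ?I i j))"
      by (rule skew2_diag2)
    finally show "tensor_eq ?t 2 (comult ?t x) (skew2 ?t n e x (\<lambda>i j. F (Suc i mod n) j * \<alpha> i j / F i j)
      (\<lambda>i j. F i (Suc j mod n) * \<beta> i j / F i j))" by (simp add: oc ops skew2_def)
  next
    show "associator ?t \<in> tensors ?t 3" "tensor_eq ?t 3 (associator ?t) (dg3 (twist3 n F \<omega>))"
      using twist_associator_diag[OF F diag2_closed tensor_eq_refl associator_closed associator_eq]
      by (simp_all add: oc ops)
  qed (simp_all add: ops fs n_pos e_mod e_mult e_sum counit_e counit_x x_e)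
qed

end

section \<open>Algebras with a basis of monomials\<close>

definition combination ::
    "(complex, 'a, 'm) module_scheme \<Rightarrow> (nat \<Rightarrow> 'a) \<Rightarrow> 'a \<Rightarrow> nat \<Rightarrow> nat \<Rightarrow> (nat \<Rightarrow> nat \<Rightarrow> complex) \<Rightarrow> 'a" where
  "combination H e x M n c = (\<Oplus>\<^bsub>H\<^esub> k\<in>{..<M}. \<Oplus>\<^bsub>H\<^esub> i\<in>{..<n}. c k i \<odot>\<^bsub>H\<^esub> (x [^]\<^bsub>H\<^esub> k \<otimes>\<^bsub>H\<^esub> e i))"

text \<open>Values outside the range are fixed to 0, so that \<open>combination\<close> can be
  injective on functions of all indices.\<close>

definition coefficients :: "nat \<Rightarrow> nat \<Rightarrow> (nat \<Rightarrow> nat \<Rightarrow> complex) set" where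
  "coefficients M n = {c. \<forall>k i. \<not> (k < M \<and> i < n) \<longrightarrow> c k i = 0}"

lemma (in shift_system) x_pow_e: "x [^] (k::nat) \<otimes> e i = e (i + k) \<otimes> x [^] k"
proof (induction k arbitrary: i)
  case (Suc k)
  have "x [^] Suc k \<otimes> e i = x [^] k \<otimes> (x \<otimes> e i)" by (simp add: m_assoc)
  also have "\<dots> = x [^] k \<otimes> e (Suc i) \<otimes> x" by (simp add: x_e m_assoc)
  also have "\<dots> = e (Suc i + k) \<otimes> x [^] k \<otimes> x" using Suc[of "Suc i"] by simp
  finally show ?case by (simp add: m_assoc)
qed simp

lemma (in shift_system) e_xe:
  "i < n \<Longrightarrow> j < n \<Longrightarrow> e i \<otimes> (x \<otimes> e j) = (if i = Suc j mod n then x \<otimes> e j else \<zero>)"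
  using lweight_xe[of j] unfolding lweight_def by blast

lemma (in shift_system) e_x_pow_e:
  assumes "i < n" "j < n"
  shows "e i \<otimes> (x [^] l \<otimes> e j) = (if i = (j + l) mod n then x [^] (l::nat) \<otimes> e j else \<zero>)"
proof -
  have "e i \<otimes> (x [^] l \<otimes> e j) = e i \<otimes> e ((j + l) mod n) \<otimes> x [^] l"
    by (simp add: x_pow_e e_mod m_assoc)
  then show ?thesis using e_mult[of i "(j + l) mod n"] n_pos assms by (auto simp: x_pow_e e_mod)
qed

text \<open>Serves two product rules: multiplicative forms, with the second summand zero, and skew
  derivations, whose value on a product has two terms.\<close>

lemma (in complex_algebra) tensor_mult_apply2:
  assumes t: "t \<in> tensors H k" and u: "u \<in> tensors H k"
    and m: "multilinear H k f" "multilinear H k p1" "multilinear H k p2" "multilinear H k r1" "multilinear H k r2"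
    and e: "\<And>xs ys. xs \<in> vlists H k \<Longrightarrow> ys \<in> vlists H k \<Longrightarrow>
      f (map2 (\<otimes>) xs ys) = p1 xs * r1 ys + p2 xs * r2 ys"
  shows "(t \<star> u) f = t p1 * u r1 + t p2 * u r2"
proof -
  have "(t \<star> u) f = t (\<lambda>xs. u r1 * p1 xs + u r2 * p2 xs)"
    unfolding tensor_mult_def
  proof (rule tensors_cong_on[OF t tensor_mult_multilinear[OF u m(1)] multilinear_plus[OF multilinear_times[OF m(2)] multilinear_times[OF m(3)]]])
    fix xs assume xs: "xs \<in> vlists H k"
    have "u (\<lambda>ys. f (map2 (\<otimes>) xs ys)) = u (\<lambda>ys. p1 xs * r1 ys + p2 xs * r2 ys)"
      by (rule tensors_cong_on[OF u multilinear_map2_right[OF m(1) xs] multilinear_plus[OF multilinear_times[OF m(4)] multilinear_times[OF m(5)]] e[OF xs]])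
    also have "\<dots> = p1 xs * u r1 + p2 xs * u r2"
      using m(4,5) by (simp add: tensors_apply_plus[OF u] tensors_apply_times[OF u] multilinear_times)
    finally show "u (\<lambda>ys. f (map2 (\<otimes>) xs ys)) = u r1 * p1 xs + u r2 * p2 xs" by (simp add: mult.commute)
  qed
  also have "\<dots> = u r1 * t p1 + u r2 * t p2"
    using m(2,3) by (simp add: tensors_apply_plus[OF t] tensors_apply_times[OF t] multilinear_times)
  finally show ?thesis by (simp add: mult.commute)
qed

context shift_system
begin

lemma combination_closed [simp, intro]: "combination H e x M n c \<in> carrier H"
  unfolding combination_def by (intro M.finsum_closed) (auto intro!: M.finsum_closed)

lemma combination_add: "combination H e x M n (\<lambda>k i. c k i + d k i) = combination H e x M n c \<oplus> combination H e x M n d"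
proof -
  have "combination H e x M n (\<lambda>k i. c k i + d k i) =
     (\<Oplus>k\<in>{..<M}. (\<Oplus>i\<in>{..<n}. c k i \<odot> (x [^] k \<otimes> e i)) \<oplus> (\<Oplus>i\<in>{..<n}. d k i \<odot> (x [^] k \<otimes> e i)))"
    unfolding combination_def
    by (intro M.finsum_cong' refl) (auto simp: smult_add_left M.finsum_addf intro!: M.finsum_closed)
  also have "\<dots> = combination H e x M n c \<oplus> combination H e x M n d"
    unfolding combination_def by (intro M.finsum_addf) (auto intro!: M.finsum_closed)
  finally show ?thesis .
qed

lemma combination_smult: "combination H e x M n (\<lambda>k i. a * c k i) = a \<odot> combination H e x M n c"
proof -
  have "a \<odot> combination H e x M n c = (\<Oplus>k\<in>{..<M}. a \<odot> (\<Oplus>i\<in>{..<n}. c k i \<odot> (x [^] k \<otimes> e i)))"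
    unfolding combination_def by (intro finsum_smult) (auto intro!: M.finsum_closed)
  also have "\<dots> = combination H e x M n (\<lambda>k i. a * c k i)"
    unfolding combination_def
    by (intro M.finsum_cong' refl) (auto simp: finsum_smult smult_smult intro!: M.finsum_closed)
  finally show ?thesis ..
qed

lemma combination_mono: "k < M \<Longrightarrow> i < n \<Longrightarrow> combination H e x M n (\<lambda>k' i'. if k' = k \<and> i' = i then 1 else 0) = (x [^] k \<otimes> e i)"
proof -
  assume a: "k < M" "i < n"
  have "combination H e x M n (\<lambda>k' i'. if k' = k \<and> i' = i then 1 else 0) =
     (\<Oplus>k'\<in>{..<M}. if k' = k then (x [^] k \<otimes> e i) else \<zero>)"
    unfolding combination_def
  proof (intro M.finsum_cong' refl)
    fix k' assume "k' \<in> {..<M}"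
    have "(\<Oplus>i'\<in>{..<n}. (if k' = k \<and> i' = i then 1 else 0) \<odot> (x [^] k' \<otimes> e i')) =
      (\<Oplus>i'\<in>{..<n}. if i' = i then (if k' = k then (x [^] k \<otimes> e i) else \<zero>) else \<zero>)"
      by (intro M.finsum_cong' refl) auto
    also have "\<dots> = (if k' = k then (x [^] k \<otimes> e i) else \<zero>)" using a by (intro finsum_delta) auto
    finally show "(\<Oplus>i'\<in>{..<n}. (if k' = k \<and> i' = i then 1 else 0) \<odot> (x [^] k' \<otimes> e i')) = (if k' = k then (x [^] k \<otimes> e i) else \<zero>)" .
  qed auto
  also have "\<dots> = (x [^] k \<otimes> e i)" using a by (intro finsum_delta) auto
  finally show ?thesis .
qed

lemma combination_finsum:
  assumes "finite A" "\<And>a. a \<in> A \<Longrightarrow> \<exists>c. g a = combination H e x M n c"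
  shows "\<exists>c. finsum H g A = combination H e x M n c"
  using assms
proof (induction A rule: finite_induct)
  case empty
  have "combination H e x M n (\<lambda>k i. 0 * 0) = 0 \<odot> combination H e x M n (\<lambda>k i. 0)" by (rule combination_smult)
  then have "finsum H g {} = combination H e x M n (\<lambda>k i. 0)" by simp
  then show ?case by blast
next
  case (insert a A)
  obtain c d where cd: "g a = combination H e x M n c" "finsum H g A = combination H e x M n d"
    using insert by blast
  have "g \<in> A \<rightarrow> carrier H" using insert.prems by force
  then have "finsum H g (insert a A) = combination H e x M n (\<lambda>k i. c k i + d k i)"
    using insert(1,2) cd by (simp add: combination_add)
  then show ?case by blast
qed

lemma combination_smult_mono:
  assumes "k < M" "i < n" shows "\<exists>c'. c \<odot> (x [^] k \<otimes> e i) = combination H e x M n c'"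
  using combination_smult[of M c "\<lambda>k' i'. if k' = k \<and> i' = i then 1 else 0"] combination_mono[OF assms] by metis

end

lemma (in complex_algebra) vlists2E:
  assumes "xs \<in> vlists H 2" obtains y z where "xs = [y, z]" "y \<in> carrier H" "z \<in> carrier H"
  using assms that by (auto simp: numeral_2_eq_2 length_Suc_conv)

text \<open>Kept abstract because such forms arise twice: as basis coefficients in
  \<open>graded_model\<close>, and from degree projections in a radically graded algebra whose basis
  is not yet known.\<close>

locale shift_forms = shift_system H n e x \<alpha> \<beta> \<omega> for H :: "'a quasi_hopf" (structure) and n e x \<alpha> \<beta> \<omega> +
  fixes chi der :: "nat \<Rightarrow> 'a \<Rightarrow> complex"
  assumes chi_linear: "linear_form H (chi i)" and der_linear: "linear_form H (der i)"
    and chi_e: "i < n \<Longrightarrow> j < n \<Longrightarrow> chi i (e j) = (if i = j then 1 else 0)"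
    and der_e: "i < n \<Longrightarrow> j < n \<Longrightarrow> der i (e j) = 0"
    and chi_xe: "i < n \<Longrightarrow> j < n \<Longrightarrow> chi i (x \<otimes> e j) = 0"
    and der_xe: "i < n \<Longrightarrow> j < n \<Longrightarrow> der i (x \<otimes> e j) = (if i = j then 1 else 0)"
    and chi_mult: "i < n \<Longrightarrow> g \<in> carrier H \<Longrightarrow> h \<in> carrier H \<Longrightarrow> chi i (g \<otimes> h) = chi i g * chi i h"
    and der_mult: "i < n \<Longrightarrow> g \<in> carrier H \<Longrightarrow> h \<in> carrier H \<Longrightarrow>
      der i (g \<otimes> h) = chi (Suc i mod n) g * der i h + der i g * chi i h"
begin

lemma chi_one: "i < n \<Longrightarrow> chi i \<one> = 1"
  using linear_form_finsum[OF chi_linear, of "{..<n}" e i] e_sum by (simp add: chi_e)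

lemma chi_x: "i < n \<Longrightarrow> chi i x = 0"
proof -
  assume i: "i < n"
  have "x = (\<Oplus>j\<in>{..<n}. x \<otimes> e j)"
    using finsum_rdistr[of "{..<n}" x e] e_sum by simp
  then have "chi i x = (\<Sum>j<n. chi i (x \<otimes> e j))"
    using linear_form_finsum[OF chi_linear, of "{..<n}" "\<lambda>j. x \<otimes> e j" i] by simp
  then show ?thesis by (simp add: i chi_xe)
qed

lemma prod2_ml [simp]: "multilinear H 2 (prod2 (chi i) (chi j))" "multilinear H 2 (prod2 (der i) (chi j))"
  "multilinear H 2 (prod2 (chi i) (der j))"
  by (intro prod2_multilinear chi_linear der_linear)+

lemma tensor_mult_forms:
  assumes "t \<in> tensors H 2" "u \<in> tensors H 2" "i < n" "j < n"
  shows "(t \<star> u) (prod2 (chi i) (chi j)) = t (prod2 (chi i) (chi j)) * u (prod2 (chi i) (chi j))"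
     "(t \<star> u) (prod2 (der i) (chi j)) = t (prod2 (chi (Suc i mod n)) (chi j)) * u (prod2 (der i) (chi j))
        + t (prod2 (der i) (chi j)) * u (prod2 (chi i) (chi j))"
     "(t \<star> u) (prod2 (chi i) (der j)) = t (prod2 (chi i) (chi (Suc j mod n))) * u (prod2 (chi i) (der j))
        + t (prod2 (chi i) (der j)) * u (prod2 (chi i) (chi j))"
proof -
  note f = tensor_mult_apply2[OF assms(1,2)]
  have "(t \<star> u) (prod2 (chi i) (chi j)) = t (prod2 (chi i) (chi j)) * u (prod2 (chi i) (chi j)) + t (\<lambda>_. 0) * u (\<lambda>_. 0)"
    by (rule f) (simp_all only: prod2_ml multilinear_0, elim vlists2E, simp add: chi_mult assms)
  then show "(t \<star> u) (prod2 (chi i) (chi j)) = t (prod2 (chi i) (chi j)) * u (prod2 (chi i) (chi j))"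
    by (simp add: tensors_apply_0[OF assms(1)])
  show "(t \<star> u) (prod2 (der i) (chi j)) = t (prod2 (chi (Suc i mod n)) (chi j)) * u (prod2 (der i) (chi j))
        + t (prod2 (der i) (chi j)) * u (prod2 (chi i) (chi j))"
    by (rule f) (simp_all only: prod2_ml, elim vlists2E, simp add: chi_mult der_mult assms algebra_simps)
  show "(t \<star> u) (prod2 (chi i) (der j)) = t (prod2 (chi i) (chi (Suc j mod n))) * u (prod2 (chi i) (der j))
        + t (prod2 (chi i) (der j)) * u (prod2 (chi i) (chi j))"
    by (rule f) (simp_all only: prod2_ml, elim vlists2E, simp add: chi_mult der_mult assms algebra_simps)
qed

lemma der_x: "i < n \<Longrightarrow> der i x = 1"
proof -
  assume i: "i < n"
  have "x = (\<Oplus>j\<in>{..<n}. x \<otimes> e j)"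
    using finsum_rdistr[of "{..<n}" x e] e_sum by simp
  then have "der i x = (\<Sum>j<n. der i (x \<otimes> e j))"
    using linear_form_finsum[OF der_linear, of "{..<n}" "\<lambda>j. x \<otimes> e j" i] by simp
  then show ?thesis using i by (simp add: der_xe)
qed

text \<open>How \<open>\<alpha>\<close> and \<open>\<beta>\<close> are recovered from a coproduct;
  all coefficient comparisons for \<open>\<Delta>(x)\<close> go through these evaluations.\<close>

lemma skew2_forms:
  assumes "i < n" "j < n"
  shows "skew2 H n e x a b (prod2 (chi i) (chi j)) = 0"
    "skew2 H n e x a b (prod2 (der i) (chi j)) = a i j"
    "skew2 H n e x a b (prod2 (chi i) (der j)) = b i j"
proof -
  show "skew2 H n e x a b (prod2 (chi i) (chi j)) = 0" using assms by (simp add: skew2_def chi_xe)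
  have "skew2 H n e x a b (prod2 (der i) (chi j)) = (\<Sum>i'<n. \<Sum>j'<n. if j' = j then if i' = i then a i j else 0 else 0)"
    unfolding skew2_def using assms by (intro sum.cong refl) (auto simp: der_xe chi_e der_e)
  then show "skew2 H n e x a b (prod2 (der i) (chi j)) = a i j" using assms by simp
  have "skew2 H n e x a b (prod2 (chi i) (der j)) = (\<Sum>i'<n. \<Sum>j'<n. if j' = j then if i' = i then b i j else 0 else 0)"
    unfolding skew2_def using assms by (intro sum.cong refl) (auto simp: der_xe chi_e der_e)
  then show "skew2 H n e x a b (prod2 (chi i) (der j)) = b i j" using assms by simp
qed

lemma comult_e_forms:
  assumes "i < n" "j < n" "k < n"
  shows "comult H (e k) (prod2 (chi i) (chi j)) = (if (i + j) mod n = k then 1 else 0)"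
    "comult H (e k) (prod2 (der i) (chi j)) = 0" "comult H (e k) (prod2 (chi i) (der j)) = 0"
proof -
  have "comult H (e k) (prod2 (chi i) (chi j)) =
      (\<Sum>i'<n. \<Sum>j'<n. if j' = j then if i' = i then (if (i + j) mod n = k then 1 else 0) else 0 else 0)"
    unfolding comult_e_apply[OF assms(3) prod2_ml(1)] using assms by (intro sum.cong refl) (auto simp: chi_e)
  then show "comult H (e k) (prod2 (chi i) (chi j)) = (if (i + j) mod n = k then 1 else 0)" using assms by simp
  show "comult H (e k) (prod2 (der i) (chi j)) = 0" "comult H (e k) (prod2 (chi i) (der j)) = 0"
    using assms by (auto simp: comult_e_apply der_e intro!: sum.neutral)
qed

end

text \<open>The monomials \<open>x\<^sup>k e\<^sub>i\<close> with \<open>k < M\<close> form a basis,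
  so up to isomorphism the algebra is described by \<open>n\<close>, \<open>M\<close> and the three
  families of constants.\<close>

locale graded_model = shift_system H n e x \<alpha> \<beta> \<omega> for H :: "'a quasi_hopf" (structure) and n e x \<alpha> \<beta> \<omega> +
  fixes M :: nat
  assumes n_gt: "n > 1" and M_gt: "M > 1"
    and x_nilpotent: "x [^] M = \<zero>"
    and basis: "bij_betw (combination H e x M n) (coefficients M n) (carrier H)"
begin

abbreviation "xpe (k::nat) i \<equiv> x [^] k \<otimes> e i"
abbreviation "combi \<equiv> combination H e x M n"

definition coef :: "'a \<Rightarrow> nat \<Rightarrow> nat \<Rightarrow> complex" where
  "coef h = inv_into (coefficients M n) combi h"

lemma coef_combi: "c \<in> coefficients M n \<Longrightarrow> coef (combi c) = c"
  using basis unfolding coef_def bij_betw_def by (simp add: inv_into_f_f)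

lemma combi_coef: "h \<in> carrier H \<Longrightarrow> combi (coef h) = h"
  using basis unfolding coef_def bij_betw_def by (metis f_inv_into_f)

lemma coef_in: "h \<in> carrier H \<Longrightarrow> coef h \<in> coefficients M n"
  using basis unfolding coef_def bij_betw_def by (metis inv_into_into)

lemma coef_add: "g \<in> carrier H \<Longrightarrow> h \<in> carrier H \<Longrightarrow> coef (g \<oplus> h) k i = coef g k i + coef h k i"
proof -
  assume gh: "g \<in> carrier H" "h \<in> carrier H"
  have "coef (g \<oplus> h) = coef (combi (\<lambda>k i. coef g k i + coef h k i))"
    using gh by (simp add: combination_add combi_coef)
  also have "\<dots> = (\<lambda>k i. coef g k i + coef h k i)"
    using coef_in[OF gh(1)] coef_in[OF gh(2)] by (intro coef_combi) (auto simp: coefficients_def)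
  finally show ?thesis by simp
qed

lemma coef_smult: "h \<in> carrier H \<Longrightarrow> coef (a \<odot> h) k i = a * coef h k i"
proof -
  assume h: "h \<in> carrier H"
  have "coef (a \<odot> h) = coef (combi (\<lambda>k i. a * coef h k i))"
    using h by (simp add: combination_smult combi_coef)
  also have "\<dots> = (\<lambda>k i. a * coef h k i)"
    using coef_in[OF h] by (intro coef_combi) (auto simp: coefficients_def)
  finally show ?thesis by simp
qed

lemma coef_linear: "linear_form H (\<lambda>h. coef h k i)"
  by (auto simp: linear_form_def coef_add coef_smult)

lemma coef_zero: "coef \<zero> k i = 0"
  using linear_form_zero[OF coef_linear] .

lemma coef_mono: "k < M \<Longrightarrow> i < n \<Longrightarrow> coef (xpe k i) k' i' = (if k' = k \<and> i' = i then 1 else 0)"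
proof -
  assume a: "k < M" "i < n"
  have "coef (combi (\<lambda>k' i'. if k' = k \<and> i' = i then 1 else 0)) = (\<lambda>k' i'. if k' = k \<and> i' = i then 1 else 0)"
    using a by (intro coef_combi) (auto simp: coefficients_def)
  then show ?thesis using combination_mono[OF a] by simp
qed

lemma x_pow_big: "k \<ge> M \<Longrightarrow> x [^] (k::nat) = \<zero>"
proof -
  assume "k \<ge> M"
  then have "x [^] k = x [^] M \<otimes> x [^] (k - M)" by (simp add: nat_pow_mult)
  then show ?thesis by (simp add: x_nilpotent)
qed

lemma coef_mono_any: "i < n \<Longrightarrow> coef (xpe k i) k' i' = (if k < M \<and> k' = k \<and> i' = i then 1 else 0)"
  using coef_mono[of k i k' i'] x_pow_big[of k] coef_zero by (cases "k < M") auto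

lemma mono_mult:
  assumes "i < n" "j < n"
  shows "xpe k i \<otimes> xpe l j = (if i = (j + l) mod n then xpe (k + l) j else \<zero>)"
proof -
  have "xpe k i \<otimes> xpe l j = x [^] k \<otimes> (e i \<otimes> xpe l j)" by (simp add: m_assoc)
  then show ?thesis using e_x_pow_e[OF assms, of l] by (auto simp: m_assoc[symmetric] nat_pow_mult)
qed

lemma span_induct [consumes 1, case_names add smult mono]:
  assumes "h \<in> carrier H"
    and add: "\<And>g h. g \<in> carrier H \<Longrightarrow> h \<in> carrier H \<Longrightarrow> P g \<Longrightarrow> P h \<Longrightarrow> P (g \<oplus> h)"
    and smult: "\<And>c h. h \<in> carrier H \<Longrightarrow> P h \<Longrightarrow> P (c \<odot> h)"
    and mono: "\<And>k i. k < M \<Longrightarrow> i < n \<Longrightarrow> P (xpe k i)"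
  shows "P h"
proof -
  \<comment> \<open>Zero is reached as a multiple of a monomial, which spares a separate case in the
    induction rule.\<close>
  have "P (0 \<odot> xpe 0 0)" using M_gt n_gt by (intro smult mono) auto
  then have z: "P \<zero>" by simp
  have s: "P (\<Oplus>i\<in>A. g i)" if "finite A" "\<And>i. i \<in> A \<Longrightarrow> g i \<in> carrier H" "\<And>i. i \<in> A \<Longrightarrow> P (g i)"
    for A :: "nat set" and g
    using that by (induction A rule: finite_induct) (auto simp: z Pi_def intro!: add M.finsum_closed)
  have "P (combi (coef h))"
    unfolding combination_def
    by (intro s) (auto intro!: M.finsum_closed smult mono)
  then show ?thesis using assms(1) by (simp add: combi_coef)
qed

text \<open>Properties compatible with products need checking on \<open>e i\<close> and
  \<open>x\<close> only; coproducts, counits and characters are compared in this way.\<close>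

lemma gen_induct [consumes 1, case_names add smult mult e x]:
  assumes "h \<in> carrier H"
    and add: "\<And>g h. g \<in> carrier H \<Longrightarrow> h \<in> carrier H \<Longrightarrow> P g \<Longrightarrow> P h \<Longrightarrow> P (g \<oplus> h)"
    and smult: "\<And>c h. h \<in> carrier H \<Longrightarrow> P h \<Longrightarrow> P (c \<odot> h)"
    and mult: "\<And>g h. g \<in> carrier H \<Longrightarrow> h \<in> carrier H \<Longrightarrow> P g \<Longrightarrow> P h \<Longrightarrow> P (g \<otimes> h)"
    and e: "\<And>i. i < n \<Longrightarrow> P (e i)" and x: "P x"
  shows "P h"
  using assms(1)
proof (induction h rule: span_induct)
  case (mono k i)
  then show ?case
  proof (induction k arbitrary: i)
    case (Suc k)
    \<comment> \<open>Moving one \<open>x\<close> to the right end shifts the idempotent, so the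
      hypothesis is used at a different index.\<close>
    have "x [^] Suc k \<otimes> e i = x [^] k \<otimes> e (Suc i mod n) \<otimes> x"
      by (simp add: m_assoc x_e e_mod)
    moreover have "P (x [^] k \<otimes> e (Suc i mod n) \<otimes> x)"
      by (rule mult[OF _ _ _ x]) (use Suc n_pos in auto)
    ultimately show ?case by simp
  qed (simp add: e)
qed (use add smult in auto)

section \<open>Degrees 0 and 1 of a graded model: characters and skew derivations\<close>

definition chi :: "nat \<Rightarrow> 'a \<Rightarrow> complex" where "chi i h = coef h 0 i"
definition der :: "nat \<Rightarrow> 'a \<Rightarrow> complex" where "der i h = coef h 1 i"

lemma chi_linear: "linear_form H (chi i)" using coef_linear by (simp add: chi_def[abs_def])
lemma der_linear: "linear_form H (der i)" using coef_linear by (simp add: der_def[abs_def])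

lemma chi_e: "j < n \<Longrightarrow> chi i (e j) = (if i = j then 1 else 0)"
  using coef_mono[of 0 j 0 i] M_gt by (simp add: chi_def)

lemma der_e: "j < n \<Longrightarrow> der i (e j) = 0"
  using coef_mono[of 0 j 1 i] M_gt by (simp add: der_def)

lemma der_xe: "j < n \<Longrightarrow> der i (x \<otimes> e j) = (if i = j then 1 else 0)"
  using coef_mono[of 1 j 1 i] M_gt by (simp add: der_def)

lemma chi_xe: "j < n \<Longrightarrow> chi i (x \<otimes> e j) = 0"
  using coef_mono[of 1 j 0 i] M_gt by (simp add: chi_def)

lemmas form_add = chi_linear[unfolded linear_form_def, THEN conjunct1, rule_format]
  der_linear[unfolded linear_form_def, THEN conjunct1, rule_format]
lemmas form_smult = chi_linear[unfolded linear_form_def, THEN conjunct2, rule_format]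
  der_linear[unfolded linear_form_def, THEN conjunct2, rule_format]

text \<open>By bilinearity this is a check on monomials. A nonzero product of degree at most 1 has
  factors of degree at most 1, which leaves the terms displayed.\<close>

lemma coef_mult_degree_le_1:
  assumes "i < n" "g \<in> carrier H" "h \<in> carrier H"
  shows "chi i (g \<otimes> h) = chi i g * chi i h \<and>
    der i (g \<otimes> h) = chi (Suc i mod n) g * der i h + der i g * chi i h"
  using assms(2)
proof (induction g rule: span_induct)
  case (mono k a)
  show ?case using assms(3)
  proof (induction h rule: span_induct)
    case m: (mono l b)
    have "coef (xpe k a \<otimes> xpe l b) k' i = (if a = (b + l) mod n \<and> k + l < M \<and> k' = k + l \<and> i = b then 1 else 0)" for k'
      using mono m by (simp add: mono_mult coef_mono_any coef_zero)
    then show ?case using mono m M_gt assms(1)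
      by (auto simp: chi_def der_def coef_mono_any)
  qed (use assms mono in \<open>auto simp: form_add form_smult r_distr smult_mult_right algebra_simps\<close>)
qed (use assms in \<open>auto simp: form_add form_smult l_distr smult_mult_left algebra_simps\<close>)

lemma chi_mult: "i < n \<Longrightarrow> g \<in> carrier H \<Longrightarrow> h \<in> carrier H \<Longrightarrow> chi i (g \<otimes> h) = chi i g * chi i h"
  using coef_mult_degree_le_1 by blast

lemma der_mult: "i < n \<Longrightarrow> g \<in> carrier H \<Longrightarrow> h \<in> carrier H \<Longrightarrow>
    der i (g \<otimes> h) = chi (Suc i mod n) g * der i h + der i g * chi i h"
  using coef_mult_degree_le_1 by blast

lemma shift_forms: "shift_forms H n e x \<alpha> \<beta> \<omega> chi der"
proof (intro shift_forms.intro shift_forms_axioms.intro)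
  show "shift_system H n e x \<alpha> \<beta> \<omega>" by (rule shift_system_axioms)
qed (fact chi_linear der_linear chi_mult der_mult | rule chi_e der_e chi_xe der_xe, assumption)+

lemmas chi_one = shift_forms.chi_one[OF shift_forms]
  and prod2_ml [simp] = shift_forms.prod2_ml[OF shift_forms]
  and tensor_mult_forms = shift_forms.tensor_mult_forms[OF shift_forms]
  and der_x = shift_forms.der_x[OF shift_forms] and skew2_forms = shift_forms.skew2_forms[OF shift_forms]
  and comult_e_forms = shift_forms.comult_e_forms[OF shift_forms]

lemma chi_x: "chi i x = 0"
proof (cases "i < n")
  case False
  then show ?thesis using coef_in[OF x_closed] by (simp add: chi_def coefficients_def)
qed (rule shift_forms.chi_x[OF shift_forms])

text \<open>Both sides are characters with the same values on the generators.\<close>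

lemma counit_chi: "h \<in> carrier H \<Longrightarrow> counit H h = chi 0 h"
  by (induction h rule: gen_induct)
    (use n_pos in \<open>auto simp: counit_add counit_smult counit_mult form_add form_smult chi_mult counit_e chi_e counit_x chi_x\<close>)

text \<open>A character kills the nilpotent \<open>x\<close>, and its values on orthogonal
  idempotents with sum 1 single out one index.\<close>

lemma character_eq_chi:
  assumes f: "linear_form H f" "\<And>g h. g \<in> carrier H \<Longrightarrow> h \<in> carrier H \<Longrightarrow> f (g \<otimes> h) = f g * f h" "f \<one> = 1"
  obtains t where "t < n" "\<And>h. h \<in> carrier H \<Longrightarrow> f h = chi t h"
proof -
  have "f (x [^] (k::nat)) = f x ^ k" for k by (induction k) (auto simp: f(2,3))
  from this[of M] have fx: "f x = 0" using x_nilpotent linear_form_zero[OF f(1)] by auto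
  have "1 = (\<Sum>i<n. f (e i))" using linear_form_finsum[OF f(1), of "{..<n}" e] e_sum f(3) by simp
  then obtain t where t: "t < n" "f (e t) \<noteq> 0" by (metis (no_types, lifting) lessThan_iff sum.neutral zero_neq_one)
  have fe: "f (e i) = (if i = t then 1 else 0)" if "i < n" for i
    using f(2)[of "e i" "e t"] e_mult[OF that t(1)] t linear_form_zero[OF f(1)] by auto
  have "f h = chi t h" if "h \<in> carrier H" for h
    using that
    by (induction h rule: gen_induct)
      (use t f(1) in \<open>auto simp: linear_form_def f(2) form_add form_smult chi_mult chi_e fe fx chi_x\<close>)
  then show ?thesis using that t(1) by blast
qed

context
  fixes D s t
  assumes D: "linear_form H D" and st: "s < n" "t < n"
    and Dm: "\<And>g h. g \<in> carrier H \<Longrightarrow> h \<in> carrier H \<Longrightarrow> D (g \<otimes> h) = chi s g * D h + D g * chi t h"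
begin

lemma derivation_xe: "j < n \<Longrightarrow> D (x \<otimes> e j) = (if j = t then D x else 0)"
  using Dm[of x "e j"] by (simp add: chi_x chi_e)

text \<open>\<open>x e\<^sub>t\<close> has left weight \<open>t + 1\<close>, so the product rule for
  \<open>e\<^sub>t\<^sub>+\<^sub>1 (x e\<^sub>t)\<close> equates \<open>D x\<close> with
  \<open>\<chi>\<^sub>s(e\<^sub>t\<^sub>+\<^sub>1)\<close> times \<open>D x\<close>.\<close>

lemma derivation_weight: "D x \<noteq> 0 \<Longrightarrow> s = Suc t mod n"
proof (rule ccontr)
  assume "D x \<noteq> 0" "s \<noteq> Suc t mod n"
  have "e (Suc t mod n) \<otimes> (x \<otimes> e t) = x \<otimes> e t"
    using e_xe[of "Suc t mod n" t] st n_pos by simp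
  then have "D (x \<otimes> e t) = chi s (e (Suc t mod n)) * D (x \<otimes> e t) + D (e (Suc t mod n)) * chi t (x \<otimes> e t)"
    using Dm[of "e (Suc t mod n)" "x \<otimes> e t"] by simp
  then show False using \<open>s \<noteq> Suc t mod n\<close> \<open>D x \<noteq> 0\<close> n_pos st
    by (simp add: derivation_xe chi_e chi_xe)
qed

text \<open>Idempotency forces \<open>D (e i) = 0\<close> unless \<open>i\<close> is one of two
  distinct indices \<open>s\<close>, \<open>t\<close>, and there
  \<open>e s \<otimes> e t = \<zero>\<close> makes the values opposite. Hence
  \<open>c = D (e s)\<close> is right on all generators.\<close>

lemma derivation_inner:
  assumes "D x = 0"
  obtains c where "\<And>h. h \<in> carrier H \<Longrightarrow> D h = c * (chi s h - chi t h)"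
proof -
  have De: "D (e i) = D (e s) * (chi s (e i) - chi t (e i))" if i: "i < n" for i
  proof -
    have 1: "D (e i) = chi s (e i) * D (e i) + D (e i) * chi t (e i)"
      using Dm[of "e i" "e i"] e_mult[OF i i] by simp
    have 2: "s \<noteq> t \<Longrightarrow> 0 = D (e t) + D (e s)"
      using Dm[of "e s" "e t"] e_mult[of s t] st linear_form_zero[OF D] by (auto simp: chi_e)
    show ?thesis using 1 2 i st by (cases "i = s"; cases "i = t") (auto simp: chi_e eq_neg_iff_add_eq_0)
  qed
  have "D h = D (e s) * (chi s h - chi t h)" if "h \<in> carrier H" for h
    using that
  proof (induction h rule: gen_induct)
    case (mult g h)
    have "D (g \<otimes> h) = chi s g * (D (e s) * (chi s h - chi t h)) + D (e s) * (chi s g - chi t g) * chi t h"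
      by (simp only: Dm[OF mult(1,2)] mult(3,4))
    then show ?case using mult(1,2) st by (simp add: chi_mult algebra_simps)
  next
    case (add g h)
    have "D (g \<oplus> h) = D (e s) * (chi s g - chi t g) + D (e s) * (chi s h - chi t h)"
      using D add unfolding linear_form_def by simp
    then show ?case using add(1,2) by (simp add: form_add algebra_simps)
  next
    case (smult c h)
    have "D (c \<odot> h) = c * (D (e s) * (chi s h - chi t h))"
      using D smult unfolding linear_form_def by simp
    then show ?case using smult(1) by (simp add: form_smult algebra_simps)
  qed (use assms De in \<open>auto simp: chi_x\<close>)
  then show ?thesis using that by blast
qed

end

text \<open>Composed with \<open>\<Delta>\<close>, a product of such forms obeys the product rule of
  \<open>chi\<close> or \<open>der\<close> at the index \<open>i + j\<close>; the values on the
  generators supply the constants.\<close>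

lemma comult_forms_aux:
  assumes "h \<in> carrier H"
  shows "\<forall>i<n. \<forall>j<n. comult H h (prod2 (chi i) (chi j)) = chi ((i + j) mod n) h \<and>
    comult H h (prod2 (der i) (chi j)) = \<alpha> i j * der ((i + j) mod n) h \<and>
    comult H h (prod2 (chi i) (der j)) = \<beta> i j * der ((i + j) mod n) h"
  using assms
proof (induction h rule: gen_induct)
  case (add g h)
  have "comult H (g \<oplus> h) f = comult H g f + comult H h f" if "multilinear H 2 f" for f
    using comult_linear_form[OF that] add(1,2) by (simp add: linear_form_def)
  then show ?case using add by (auto simp: form_add algebra_simps)
next
  case (smult c h)
  have "comult H (c \<odot> h) f = c * comult H h f" if "multilinear H 2 f" for f
    using comult_linear_form[OF that] smult(1) by (simp add: linear_form_def)
  then show ?case using smult by (auto simp: form_smult algebra_simps)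
next
  case (mult g h)
  have "comult H (g \<otimes> h) f = (comult H g \<star> comult H h) f" if "multilinear H 2 f" for f
    using comult_mult[OF mult(1,2)] that by (simp add: tensor_eq_def)
  then show ?case using mult n_pos
    by (auto simp: tensor_mult_forms comult_closed chi_mult der_mult mod_simps algebra_simps)
next
  case (e k)
  then show ?case by (auto simp: comult_e_forms chi_e der_e)
next
  case x
  have "comult H x f = skew2 H n e x \<alpha> \<beta> f" if "multilinear H 2 f" for f
    using comult_x that by (simp add: tensor_eq_def)
  then show ?case using n_pos by (auto simp: skew2_forms chi_x der_x)
qed

lemma comult_forms:
  assumes "i < n" "j < n" "h \<in> carrier H"
  shows "comult H h (prod2 (chi i) (chi j)) = chi ((i + j) mod n) h"
    "comult H h (prod2 (der i) (chi j)) = \<alpha> i j * der ((i + j) mod n) h"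
    "comult H h (prod2 (chi i) (der j)) = \<beta> i j * der ((i + j) mod n) h"
  using comult_forms_aux[OF assms(3)] assms(1,2) by blast+

end

section \<open>Isomorphisms up to a twist\<close>

lemma tensor_map_cong:
  assumes "linear_map H H' \<phi>" "tensor_eq H k t u"
  shows "tensor_eq H' k (tensor_map \<phi> t) (tensor_map \<phi> u)"
  using assms linear_map_multilinear[OF assms(1)] by (simp add: tensor_map_def tensor_eq_def)

lemma tensor_map_mult:
  assumes "complex_algebra H" "complex_algebra H'" "linear_map H H' \<phi>"
    "\<And>x y. x \<in> carrier H \<Longrightarrow> y \<in> carrier H \<Longrightarrow> \<phi> (x \<otimes>\<^bsub>H\<^esub> y) = \<phi> x \<otimes>\<^bsub>H'\<^esub> \<phi> y"
    and t: "t \<in> tensors H k" and u: "u \<in> tensors H k"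
  shows "tensor_eq H' k (tensor_map \<phi> (t \<star>\<^bsub>H\<^esub> u)) (tensor_map \<phi> t \<star>\<^bsub>H'\<^esub> tensor_map \<phi> u)"
proof -
  interpret H: complex_algebra H by fact
  interpret H': complex_algebra H' by fact
  obtain L where L: "set L \<subseteq> vlists H k" "\<And>f. multilinear H k f \<Longrightarrow> t f = (\<Sum>xs\<leftarrow>L. f xs)"
    using t by (rule tensorsE) (blast intro: that)
  obtain M where M: "set M \<subseteq> vlists H k" "\<And>f. multilinear H k f \<Longrightarrow> u f = (\<Sum>xs\<leftarrow>M. f xs)"
    using u by (rule tensorsE) (blast intro: that)
  have v: "map \<phi> xs \<in> vlists H' k" if "xs \<in> vlists H k" for xs
    using that assms(3) by (auto simp: linear_map_def)
  have m2: "map \<phi> (map2 (\<otimes>\<^bsub>H\<^esub>) xs ys) = map2 (\<otimes>\<^bsub>H'\<^esub>) (map \<phi> xs) (map \<phi> ys)"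
    if "xs \<in> vlists H k" "ys \<in> vlists H k" for xs ys
    using that by (intro nth_equalityI) (auto simp: assms(4) subset_iff)
  show ?thesis
    unfolding tensor_eq_def
  proof (intro allI impI)
    fix f assume f: "multilinear H' k f"
    note mf = linear_map_multilinear[OF assms(3)]
    have "tensor_map \<phi> (t \<star>\<^bsub>H\<^esub> u) f = (\<Sum>xs\<leftarrow>L. \<Sum>ys\<leftarrow>M. f (map \<phi> (map2 (\<otimes>\<^bsub>H\<^esub>) xs ys)))"
      unfolding tensor_map_def by (rule H.tensor_mult_lists[OF L M mf[OF f]])
    also have "\<dots> = (\<Sum>xs\<leftarrow>L. \<Sum>ys\<leftarrow>M. f (map2 (\<otimes>\<^bsub>H'\<^esub>) (map \<phi> xs) (map \<phi> ys)))"
      using L(1) M(1) by (intro arg_cong[of _ _ sum_list] map_cong refl arg_cong[of _ _ f] m2) auto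
    also have "\<dots> = (\<Sum>xs\<leftarrow>map (map \<phi>) L. \<Sum>ys\<leftarrow>map (map \<phi>) M. f (map2 (\<otimes>\<^bsub>H'\<^esub>) xs ys))"
      by (simp add: o_def)
    also have "\<dots> = (tensor_map \<phi> t \<star>\<^bsub>H'\<^esub> tensor_map \<phi> u) f"
    proof (rule H'.tensor_mult_lists[symmetric])
      show "set (map (map \<phi>) L) \<subseteq> vlists H' k" unfolding set_map using L(1) v by (intro image_subsetI) blast
      show "set (map (map \<phi>) M) \<subseteq> vlists H' k" unfolding set_map using M(1) v by (intro image_subsetI) blast
    qed (use L(2)[OF mf] M(2)[OF mf] f in \<open>auto simp: tensor_map_def o_def\<close>)
    finally show "tensor_map \<phi> (t \<star>\<^bsub>H\<^esub> u) f = (tensor_map \<phi> t \<star>\<^bsub>H'\<^esub> tensor_map \<phi> u) f" .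
  qed
qed

text \<open>Matching monomials is an algebra map because their multiplication table involves
  \<open>n\<close> and \<open>M\<close> only. The remaining structure is compared on
  \<open>e i\<close> and \<open>x\<close>, where the common constants give it.\<close>

theorem graded_model_iso:
  assumes "graded_model H n e x \<alpha> \<beta> \<omega> M" "graded_model H' n e' x' \<alpha> \<beta> \<omega> M"
  shows "\<exists>\<phi>. quasi_hopf_iso H H' \<phi>"
proof -
  interpret A: graded_model H n e x \<alpha> \<beta> \<omega> M by fact
  interpret B: graded_model H' n e' x' \<alpha> \<beta> \<omega> M by fact
  define \<phi> where "\<phi> h = B.combi (A.coef h)" for h
  have \<phi>c: "\<phi> h \<in> carrier H'" for h by (simp add: \<phi>_def)
  have add: "\<phi> (g \<oplus>\<^bsub>H\<^esub> h) = \<phi> g \<oplus>\<^bsub>H'\<^esub> \<phi> h" if "g \<in> carrier H" "h \<in> carrier H" for g h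
  proof -
    have "A.coef (g \<oplus>\<^bsub>H\<^esub> h) = (\<lambda>k i. A.coef g k i + A.coef h k i)"
      by (intro ext A.coef_add that)
    then show ?thesis by (simp add: \<phi>_def B.combination_add)
  qed
  have smult: "\<phi> (c \<odot>\<^bsub>H\<^esub> h) = c \<odot>\<^bsub>H'\<^esub> \<phi> h" if "h \<in> carrier H" for c h
  proof -
    have "A.coef (c \<odot>\<^bsub>H\<^esub> h) = (\<lambda>k i. c * A.coef h k i)"
      by (intro ext A.coef_smult that)
    then show ?thesis by (simp add: \<phi>_def B.combination_smult)
  qed
  have lin: "linear_map H H' \<phi>" using \<phi>c add smult by (auto simp: linear_map_def)
  have \<phi>m: "\<phi> (A.xpe k i) = B.xpe k i" if "i < n" for k i
  \<comment> \<open>Products of monomials can reach degrees beyond the basis, where both sides are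
    zero.\<close>
  proof (cases "k < M")
    case True
    have "A.coef (A.xpe k i) = (\<lambda>k' i'. if k' = k \<and> i' = i then 1 else 0)"
      using A.coef_mono[OF True that] by (intro ext)
    then show ?thesis using B.combination_mono[OF True that] by (simp add: \<phi>_def)
  next
    case False
    have "\<phi> \<zero>\<^bsub>H\<^esub> = \<zero>\<^bsub>H'\<^esub>" using smult[of "\<zero>\<^bsub>H\<^esub>" 0] \<phi>c by simp
    then show ?thesis using False A.x_pow_big[of k] B.x_pow_big[of k] by simp
  qed
  have hom: "\<phi> (g \<otimes>\<^bsub>H\<^esub> h) = \<phi> g \<otimes>\<^bsub>H'\<^esub> \<phi> h" if "g \<in> carrier H" "h \<in> carrier H" for g h
    using that(1)
  proof (induction g rule: A.span_induct)
    case (mono k i)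
    show ?case using that(2)
    proof (induction h rule: A.span_induct)
      case m: (mono l j)
      have "\<phi> \<zero>\<^bsub>H\<^esub> = \<zero>\<^bsub>H'\<^esub>" using smult[of "\<zero>\<^bsub>H\<^esub>" 0] \<phi>c by simp
      then show ?case using mono m by (simp add: A.mono_mult B.mono_mult \<phi>m)
    qed (use mono in \<open>auto simp: A.r_distr B.r_distr add smult A.smult_mult_right B.smult_mult_right \<phi>c\<close>)
  qed (use that in \<open>auto simp: A.l_distr B.l_distr add smult A.smult_mult_left B.smult_mult_left \<phi>c\<close>)
  have \<phi>e: "\<phi> (e i) = e' i" if "i < n" for i using \<phi>m[OF that, of 0] by simp
  have \<phi>xe: "\<phi> (x \<otimes>\<^bsub>H\<^esub> e i) = x' \<otimes>\<^bsub>H'\<^esub> e' i" if "i < n" for i using \<phi>m[OF that, of 1] by simp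
  have sume: "\<phi> (finsum H g {..<n}) = finsum H' (\<lambda>i. \<phi> (g i)) {..<n}" if "\<And>i. g i \<in> carrier H" for g
    using linear_map_finsum[OF A.complex_algebra_axioms B.complex_algebra_axioms lin, of "{..<n}" g] that by auto
  have one: "\<phi> \<one>\<^bsub>H\<^esub> = \<one>\<^bsub>H'\<^esub>"
    unfolding A.e_sum[symmetric] B.e_sum[symmetric]
    by (subst sume) (auto intro!: B.M.finsum_cong' simp: \<phi>e)
  have \<phi>x: "\<phi> x = x'"
  proof -
    have "x = finsum H (\<lambda>i. x \<otimes>\<^bsub>H\<^esub> e i) {..<n}" "x' = finsum H' (\<lambda>i. x' \<otimes>\<^bsub>H'\<^esub> e' i) {..<n}"
      using A.finsum_rdistr[of "{..<n}" x e] A.e_sum B.finsum_rdistr[of "{..<n}" x' e'] B.e_sum by simp_all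
    moreover have "\<phi> (finsum H (\<lambda>i. x \<otimes>\<^bsub>H\<^esub> e i) {..<n}) = finsum H' (\<lambda>i. x' \<otimes>\<^bsub>H'\<^esub> e' i) {..<n}"
      by (subst sume) (auto intro!: B.M.finsum_cong' simp: \<phi>xe)
    ultimately show ?thesis by simp
  qed
  have bij: "bij_betw \<phi> (carrier H) (carrier H')"
  proof -
    have "bij_betw A.coef (carrier H) (coefficients M n)"
      unfolding A.coef_def[abs_def] by (rule bij_betw_inv_into[OF A.basis])
    from bij_betw_trans[OF this B.basis] show ?thesis unfolding \<phi>_def[abs_def] by (simp add: o_def)
  qed
  have comult: "tensor_eq H' 2 (comult H' (\<phi> h)) (tensor_map \<phi> (comult H h))" if "h \<in> carrier H" for h
    using that
  proof (induction h rule: A.gen_induct)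
    case (add g h)
    then show ?case using A.comult_add[OF add(1,2)] B.comult_add[OF \<phi>c \<phi>c, of g h]
        linear_map_multilinear[OF lin]
      by (simp add: lin[unfolded linear_map_def] tensor_eq_def tensor_map_def)
  next
    case (smult c h)
    then show ?case using A.comult_smult[OF smult(1), of c] B.comult_smult[OF \<phi>c, of c h]
        linear_map_multilinear[OF lin]
      by (simp add: lin[unfolded linear_map_def] tensor_eq_def tensor_map_def)
  next
    case (mult g h)
    have "\<phi> (g \<otimes>\<^bsub>H\<^esub> h) = \<phi> g \<otimes>\<^bsub>H'\<^esub> \<phi> h" by (rule hom[OF mult(1,2)])
    then have "tensor_eq H' 2 (comult H' (\<phi> (g \<otimes>\<^bsub>H\<^esub> h))) (comult H' (\<phi> g) \<star>\<^bsub>H'\<^esub> comult H' (\<phi> h))"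
      using B.comult_mult[OF \<phi>c \<phi>c] by simp
    also have "tensor_eq H' 2 \<dots> (tensor_map \<phi> (comult H g) \<star>\<^bsub>H'\<^esub> tensor_map \<phi> (comult H h))"
      by (intro B.tensor_mult_cong mult B.comult_closed \<phi>c)
    also have "tensor_eq H' 2 \<dots> (tensor_map \<phi> (comult H g \<star>\<^bsub>H\<^esub> comult H h))"
      by (rule tensor_eq_sym, rule tensor_map_mult[OF A.complex_algebra_axioms B.complex_algebra_axioms lin])
        (use mult A.comult_closed hom in auto)
    also have "tensor_eq H' 2 \<dots> (tensor_map \<phi> (comult H (g \<otimes>\<^bsub>H\<^esub> h)))"
      by (rule tensor_map_cong[OF lin tensor_eq_sym[OF A.comult_mult[OF mult(1,2)]]])
    finally show ?case .
  next
    case (e i)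
    have "tensor_map \<phi> (diag2 n e F) = diag2 n e' F" for F
      by (auto simp: tensor_map_def diag2_def \<phi>e intro!: ext sum.cong)
    then show ?case
      using tensor_map_cong[OF lin A.comult_e[OF e]] B.comult_e[OF e] \<phi>e[OF e] by (simp add: tensor_eq_def)
  next
    case x
    have "tensor_map \<phi> (skew2 H n e x \<alpha> \<beta>) = skew2 H' n e' x' \<alpha> \<beta>"
      by (auto simp: tensor_map_def skew2_def \<phi>e \<phi>xe intro!: ext sum.cong)
    then show ?case
      using tensor_map_cong[OF lin A.comult_x] B.comult_x \<phi>x by (simp add: tensor_eq_def)
  qed
  have counit: "counit H' (\<phi> h) = counit H h" if "h \<in> carrier H" for h
    using that
  proof (induction h rule: A.gen_induct)
    case (mult g h)
    have "\<phi> (g \<otimes>\<^bsub>H\<^esub> h) = \<phi> g \<otimes>\<^bsub>H'\<^esub> \<phi> h" by (rule hom[OF mult(1,2)])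
    then show ?case using mult \<phi>c by (simp add: A.counit_mult B.counit_mult)
  qed (use \<phi>c \<phi>e \<phi>x lin in \<open>auto simp: linear_map_def A.counit_add B.counit_add A.counit_smult B.counit_smult
      A.counit_e B.counit_e A.counit_x B.counit_x\<close>)
  have "tensor_map \<phi> (diag3 n e \<omega>) = diag3 n e' \<omega>"
    by (auto simp: tensor_map_def diag3_def \<phi>e intro!: ext sum.cong)
  then have assoc: "tensor_eq H' 3 (associator H') (tensor_map \<phi> (associator H))"
    using tensor_map_cong[OF lin A.associator_eq] B.associator_eq by (simp add: tensor_eq_def)
  have "quasi_hopf_iso H H' \<phi>"
    unfolding quasi_hopf_iso_def ring_iso_def
    using bij comult counit assoc smult by (auto intro!: ring_hom_memI simp: \<phi>c hom add one)
  then show ?thesis by blast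
qed

text \<open>An isomorphism up to a twist permutes the characters \<open>\<chi>\<^sub>i\<close> and the skew derivations attached
  to neighbouring characters; since \<open>\<chi>\<^sub>0\<close> is the counit, the permutation fixes \<open>0\<close> and \<open>1\<close>,
  and the ratio \<open>\<alpha> 0 1 / \<beta> 1 0\<close> (the scalar of the self-braiding of \<open>x\<close>) can be compared.\<close>

theorem graded_model_invariant:
  assumes "graded_model H n e x \<alpha> \<beta> \<omega> M" "graded_model H' n e' x' \<alpha>' \<beta>' \<omega>' M'"
    and iso: "iso_up_to_twist H H'"
  shows "\<alpha> 0 1 * \<beta>' 1 0 = \<alpha>' 0 1 * \<beta> 1 0"
proof -
  interpret A: graded_model H n e x \<alpha> \<beta> \<omega> M by fact
  interpret B: graded_model H' n e' x' \<alpha>' \<beta>' \<omega>' M' by fact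
  obtain K \<phi> where K: "is_twist H' K" and \<phi>: "quasi_hopf_iso H (twist H' K) \<phi>"
    using iso unfolding iso_up_to_twist_def by blast
  have ops: "carrier (twist H' K) = carrier H'" "ring.add (twist H' K) = ring.add H'"
    "module.smult (twist H' K) = module.smult H'" "monoid.mult (twist H' K) = monoid.mult H'"
    "monoid.one (twist H' K) = monoid.one H'" "counit (twist H' K) = counit H'"
    "comult (twist H' K) h = K \<star>\<^bsub>H'\<^esub> comult H' h \<star>\<^bsub>H'\<^esub> tensor_inv H' 2 K" for h
    by (simp_all add: twist_def)
  note oc = multilinear_ops_cong[OF ops(1-3)]
  have \<phi>c: "\<phi> h \<in> carrier H'" and \<phi>add: "\<phi> (g \<oplus>\<^bsub>H\<^esub> h) = \<phi> g \<oplus>\<^bsub>H'\<^esub> \<phi> h"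
    and \<phi>mult: "\<phi> (g \<otimes>\<^bsub>H\<^esub> h) = \<phi> g \<otimes>\<^bsub>H'\<^esub> \<phi> h" and \<phi>smult: "\<phi> (c \<odot>\<^bsub>H\<^esub> h) = c \<odot>\<^bsub>H'\<^esub> \<phi> h"
    and \<phi>counit: "counit H' (\<phi> h) = counit H h"
    and \<phi>comult: "tensor_eq H' 2 (K \<star>\<^bsub>H'\<^esub> comult H' (\<phi> h) \<star>\<^bsub>H'\<^esub> tensor_inv H' 2 K) (tensor_map \<phi> (comult H h))"
    if "g \<in> carrier H" "h \<in> carrier H" for g h c
    using \<phi> that unfolding quasi_hopf_iso_def ring_iso_def ring_hom_def ops oc by auto
  have \<phi>one: "\<phi> \<one>\<^bsub>H\<^esub> = \<one>\<^bsub>H'\<^esub>" and \<phi>surj: "\<phi> ` carrier H = carrier H'"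
    using \<phi> unfolding quasi_hopf_iso_def ring_iso_def ring_hom_def ops bij_betw_def by auto
  have lin: "linear_map H H' \<phi>" using \<phi>c \<phi>add \<phi>smult by (auto simp: linear_map_def)
  have form: "linear_form H (\<lambda>h. f (\<phi> h))" if "linear_form H' f" for f
    using that \<phi>c \<phi>add \<phi>smult by (simp add: linear_form_def)
  define K' where "K' = tensor_inv H' 2 K"
  have Ki: "is_tensor_inverse H' 2 K K'"
    using K unfolding K'_def is_twist_def by (intro B.tensor_inv_is_inverse) simp
  have Kc: "K \<in> tensors H' 2" "K' \<in> tensors H' 2"
    using K Ki by (auto simp: is_twist_def tensor_invertible_def is_tensor_inverse_def)
  have n: "0 < n" "1 < n" "Suc 0 mod n = 1" using A.n_gt by auto
  have chi0: "B.chi 0 (\<phi> h) = A.chi 0 h" if "h \<in> carrier H" for h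
    using B.counit_chi[OF \<phi>c[OF that that]] A.counit_chi[OF that] \<phi>counit[OF that that] by simp
  have der: "B.der i (\<phi> (g \<otimes>\<^bsub>H\<^esub> h)) = B.chi (Suc i mod n) (\<phi> g) * B.der i (\<phi> h) + B.der i (\<phi> g) * B.chi i (\<phi> h)"
    if "i < n" "g \<in> carrier H" "h \<in> carrier H" for i g h
    using that \<phi>c by (simp add: \<phi>mult B.der_mult)
  \<comment> \<open>The pullback of \<open>B.chi\<close> at \<open>i + 1\<close> is some
    \<open>A.chi s\<close>, and that of \<open>B.der i\<close> is a skew derivation for the pair
    \<open>s\<close>, \<open>i\<close>. Being nonzero at \<open>x\<close> it has the weight
    \<open>s = i + 1\<close>, so the labelling propagates.\<close>
  have step: "(\<forall>h\<in>carrier H. B.chi (Suc i mod n) (\<phi> h) = A.chi (Suc i mod n) h) \<and> B.der i (\<phi> x) \<noteq> 0"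
    if i: "i < n" and c: "\<And>h. h \<in> carrier H \<Longrightarrow> B.chi i (\<phi> h) = A.chi i h" for i
  proof -
    have i': "Suc i mod n < n" using n by simp
    obtain s where s: "s < n" "\<And>h. h \<in> carrier H \<Longrightarrow> B.chi (Suc i mod n) (\<phi> h) = A.chi s h"
      by (rule A.character_eq_chi[OF form[OF B.chi_linear[of "Suc i mod n"]]])
        (auto simp: \<phi>mult \<phi>c B.chi_mult[OF i'] B.chi_one[OF i'] \<phi>one)
    note D = form[OF B.der_linear[of i]] s(1) i
    have Dm: "B.der i (\<phi> (g \<otimes>\<^bsub>H\<^esub> h)) = A.chi s g * B.der i (\<phi> h) + B.der i (\<phi> g) * A.chi i h"
      if "g \<in> carrier H" "h \<in> carrier H" for g h
      using that der[OF i] s(2) c by simp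
    \<comment> \<open>Otherwise it is inner and, \<open>\<phi>\<close> being surjective, so is
      \<open>B.der i\<close> itself; but that form vanishes at \<open>e' i\<close> and not at
      \<open>x' e' i\<close>.\<close>
    have "B.der i (\<phi> x) \<noteq> 0"
    proof
      assume "B.der i (\<phi> x) = 0"
      from A.derivation_inner[OF D Dm this]
      obtain c' where c': "\<And>h. h \<in> carrier H \<Longrightarrow> B.der i (\<phi> h) = c' * (A.chi s h - A.chi i h)" by blast
      have all: "B.der i y = c' * (B.chi (Suc i mod n) y - B.chi i y)" if "y \<in> carrier H'" for y
      proof -
        have "y \<in> \<phi> ` carrier H" using \<phi>surj that by simp
        then obtain h where "h \<in> carrier H" "y = \<phi> h" by blast
        then show ?thesis using c' s(2) c by simp
      qed
      \<comment> \<open>\<open>n > 1\<close> makes the two characters differ at \<open>e' i\<close>,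
        which forces the constant to vanish.\<close>
      have "Suc i mod n \<noteq> i" using n i by (cases "Suc i = n") auto
      with all[of "e' i"] i have "c' = 0" by (simp add: B.der_e B.chi_e)
      then show False using all[of "x' \<otimes>\<^bsub>H'\<^esub> e' i"] i by (simp add: B.der_xe)
    qed
    moreover from A.derivation_weight[OF D Dm this] have "s = Suc i mod n" .
    ultimately show ?thesis using s(2) by simp
  qed
  from step[OF n(1) chi0] have chi1: "B.chi 1 (\<phi> h) = A.chi 1 h" if "h \<in> carrier H" for h
    using that n by simp
  define d0 d1 where "d0 = B.der 0 (\<phi> x)" and "d1 = B.der 1 (\<phi> x)"
  have d: "d0 \<noteq> 0" "d1 \<noteq> 0" using step[OF n(1) chi0] step[OF n(2) chi1] by (auto simp: d0_def d1_def)
  have chi_\<phi>x: "B.chi i (\<phi> x) = 0" if i: "i < n" for i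
  proof -
    obtain s where "\<And>h. h \<in> carrier H \<Longrightarrow> B.chi i (\<phi> h) = A.chi s h"
      by (rule A.character_eq_chi[OF form[OF B.chi_linear[of i]]])
        (auto simp: \<phi>mult \<phi>c B.chi_mult[OF i] B.chi_one[OF i] \<phi>one)
    then show ?thesis by (simp add: A.chi_x)
  qed
  have der0: "B.der 0 (\<phi> (x \<otimes>\<^bsub>H\<^esub> e i)) = (if i = 0 then d0 else 0)" if "i < n" for i
    using der[OF n(1), of x "e i"] that n chi1 chi0 by (simp add: A.chi_x A.chi_e d0_def)
  have der0e: "B.der 0 (\<phi> (e i)) * A.chi 1 (x \<otimes>\<^bsub>H\<^esub> e j) = 0" if "j < n" for i j
    using that by (simp add: A.chi_xe)
  let ?f = "prod2 (B.der 0) (B.chi 1)" and ?g = "prod2 (B.chi 1) (B.der 0)"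
  have ml: "multilinear H 2 (\<lambda>xs. f (map \<phi> xs))" if "multilinear H' 2 f" for f
    by (rule linear_map_multilinear[OF lin that])
  have R: "tensor_map \<phi> (comult H x) f = skew2 H n e x \<alpha> \<beta> (\<lambda>xs. f (map \<phi> xs))" if "multilinear H' 2 f" for f
    using A.comult_x ml[OF that] by (simp add: tensor_map_def tensor_eq_def)
  have "tensor_map \<phi> (comult H x) ?f = (\<Sum>i<n. \<Sum>j<n. if j = 1 then if i = 0 then \<alpha> 0 1 * d0 else 0 else 0)"
    unfolding R[OF B.prod2_ml(2)] skew2_def
    by (intro sum.cong refl) (auto simp: der0 chi1[unfolded One_nat_def] A.chi_e A.chi_xe)
  then have Rf: "tensor_map \<phi> (comult H x) ?f = \<alpha> 0 1 * d0" using n by simp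
  have "tensor_map \<phi> (comult H x) ?g = (\<Sum>i<n. \<Sum>j<n. if j = 0 then if i = 1 then \<beta> 1 0 * d0 else 0 else 0)"
    unfolding R[OF B.prod2_ml(3)] skew2_def
    by (intro sum.cong refl) (auto simp: der0 chi1[unfolded One_nat_def] A.chi_e A.chi_xe)
  then have Rg: "tensor_map \<phi> (comult H x) ?g = \<beta> 1 0 * d0" using n by simp
  \<comment> \<open>The one component of the twist that survives the comparison; those at
    \<open>(0, 1)\<close> and \<open>(1, 0)\<close> equal 1 by the counit condition.\<close>
  define k where "k = K (prod2 (B.chi 1) (B.chi 1))"
  let ?m = "comult H' (\<phi> x)"
  have mc: "?m \<in> tensors H' 2" by (intro B.comult_closed \<phi>c) auto
  have chichi: "?m (prod2 (B.chi i) (B.chi j)) = 0" if "i < n" "j < n" for i j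
    using B.comult_forms(1)[OF that, of "\<phi> x"] chi_\<phi>x \<phi>c[of x x] n by simp
  have one2: "tensor_one H' 2 (prod2 (B.chi i) (B.chi j)) = 1" if "i < n" "j < n" for i j
    using that by (simp add: tensor_one_def pure_tensor_def numeral_2_eq_2 B.chi_one)
  have KK': "K (prod2 (B.chi i) (B.chi j)) * K' (prod2 (B.chi i) (B.chi j)) = 1" if "i < n" "j < n" for i j
  proof -
    have "(K \<star>\<^bsub>H'\<^esub> K') (prod2 (B.chi i) (B.chi j)) = tensor_one H' 2 (prod2 (B.chi i) (B.chi j))"
      using Ki by (simp add: is_tensor_inverse_def tensor_eq_def)
    then show ?thesis using that by (simp add: B.tensor_mult_forms[OF Kc] one2)
  qed
  have counitK: "K (prod2 (B.chi 0) (B.chi 1)) = 1" "K (prod2 (B.chi 1) (B.chi 0)) = 1"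
  proof -
    have f: "multilinear H' 1 (\<lambda>xs. B.chi 1 (xs ! 0))" using B.chi_linear by (simp only: multilinear1_iff) simp
    have c0: "counit_at H' 0 K (\<lambda>xs. B.chi 1 (xs ! 0)) = 1" "counit_at H' 1 K (\<lambda>xs. B.chi 1 (xs ! 0)) = 1"
      using K f n by (simp_all add: is_twist_def tensor_eq_def tensor_one_def pure_tensor_def B.chi_one)
    have "counit_at H' 0 K (\<lambda>xs. B.chi 1 (xs ! 0)) = K (prod2 (B.chi 0) (B.chi 1))"
      unfolding counit_at_def
      by (rule tensors_cong_on[OF Kc(1) B.counit_at_multilinear[OF f] B.prod2_ml(1)])
        (simp, elim B.vlists2E, simp add: B.counit_chi prod2_def)
    then show "K (prod2 (B.chi 0) (B.chi 1)) = 1" using c0 by simp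
    have "counit_at H' 1 K (\<lambda>xs. B.chi 1 (xs ! 0)) = K (prod2 (B.chi 1) (B.chi 0))"
      unfolding counit_at_def
      by (rule tensors_cong_on[OF Kc(1) B.counit_at_multilinear[OF f] B.prod2_ml(1)])
        (simp, elim B.vlists2E, simp add: B.counit_chi prod2_def)
    then show "K (prod2 (B.chi 1) (B.chi 0)) = 1" using c0 by simp
  qed
  have L: "(K \<star>\<^bsub>H'\<^esub> ?m \<star>\<^bsub>H'\<^esub> K') f = tensor_map \<phi> (comult H x) f" if "multilinear H' 2 f" for f
    using \<phi>comult[of x x] that by (simp add: tensor_eq_def K'_def)
  have K'1: "K' (prod2 (B.chi 0) (B.chi 1)) = 1" "K' (prod2 (B.chi 1) (B.chi 0)) = 1"
    using KK'[OF n(1,2)] KK'[OF n(2,1)] counitK by simp_all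
  \<comment> \<open>Terms with \<open>?m\<close> evaluated on two characters vanish,
    \<open>K'\<close> has the value 1 at \<open>(0, 1)\<close>, and \<open>\<Delta>\<close> turns
    the derivation at 0 into the one at 1, whence \<open>d1\<close>.\<close>
  have "(K \<star>\<^bsub>H'\<^esub> ?m \<star>\<^bsub>H'\<^esub> K') ?f = k * (\<alpha>' 0 1 * d1)"
    using n B.comult_forms(2)[OF n(1,2) \<phi>c[of x x]]
    by (simp add: B.tensor_mult_forms[OF B.tensor_mult_closed[OF Kc(1) mc] Kc(2)] B.tensor_mult_forms[OF Kc(1) mc]
        chichi K'1[unfolded One_nat_def] k_def d1_def)
  then have e1: "k * (\<alpha>' 0 1 * d1) = \<alpha> 0 1 * d0" using L[OF B.prod2_ml(2)] Rf by simp
  have "(K \<star>\<^bsub>H'\<^esub> ?m \<star>\<^bsub>H'\<^esub> K') ?g = k * (\<beta>' 1 0 * d1)"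
    using n B.comult_forms(3)[OF n(2,1) \<phi>c[of x x]]
    by (simp add: B.tensor_mult_forms[OF B.tensor_mult_closed[OF Kc(1) mc] Kc(2)] B.tensor_mult_forms[OF Kc(1) mc]
        chichi K'1[unfolded One_nat_def] k_def d1_def)
  then have e2: "k * (\<beta>' 1 0 * d1) = \<beta> 1 0 * d0" using L[OF B.prod2_ml(3)] Rg by simp
  \<comment> \<open>The product \<open>k * d1\<close> occurs in both equations and drops out of the
    cross product; then \<open>d0\<close> is cancelled.\<close>
  have "\<alpha> 0 1 * \<beta>' 1 0 * d0 = \<beta>' 1 0 * (k * (\<alpha>' 0 1 * d1))" unfolding e1 by (simp only: mult_ac)
  also have "\<dots> = \<alpha>' 0 1 * (k * (\<beta>' 1 0 * d1))" by (simp add: algebra_simps)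
  also have "\<dots> = \<alpha>' 0 1 * \<beta> 1 0 * d0" unfolding e2 by (simp only: mult_ac)
  finally show ?thesis using d by simp
qed

section \<open>Roots of unity and the q-binomial theorem\<close>

lemma primitive_root_mod_eq_iff:
  assumes "primitive_root_of_unity m w"
  shows "w ^ a = w ^ b \<longleftrightarrow> a mod m = b mod m"
proof -
  have w: "w ^ m = 1" "m > 0" "w \<noteq> 0"
    using assms unfolding primitive_root_of_unity_def by (auto simp: power_0_left)
  have red: "w ^ a = w ^ (a mod m)" for a
    using w(1) by (metis mod_mult_div_eq mult.commute mult_1 power_add power_mult power_one mult.right_neutral)
  have aux: "a = b" if "w ^ a = w ^ b" "a \<le> b" "b < m" for a b
  proof (rule ccontr)
    assume "a \<noteq> b"
    then have "0 < b - a" "b - a < m" using that by auto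
    moreover have "w ^ (b - a) * w ^ a = w ^ b" using that(2) by (simp flip: power_add)
    then have "w ^ (b - a) * w ^ a = 1 * w ^ a" using that(1) by simp
    ultimately show False using assms w(3) unfolding primitive_root_of_unity_def by simp
  qed
  show ?thesis
    using aux[of "a mod m" "b mod m"] aux[of "b mod m" "a mod m"] red[of a] red[of b] w(2)
    by (metis mod_less_divisor nat_le_linear)
qed

lemma primitive_root_power_mod:
  "primitive_root_of_unity m w \<Longrightarrow> w ^ (a mod m) = w ^ a"
  by (simp add: primitive_root_mod_eq_iff)

lemma primitive_root_nonzero: "primitive_root_of_unity m w \<Longrightarrow> w \<noteq> 0"
  by (auto simp: primitive_root_of_unity_def power_0_left)

text \<open>Orthogonality of the characters of a cyclic group: the sum is geometric, its ratio an
  \<open>m\<close>-th root of unity. The Fourier inversions below rest on it.\<close>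

lemma primitive_root_sum:
  assumes "primitive_root_of_unity m w"
  shows "(\<Sum>k<m. w ^ (a * k) * inverse w ^ (b * k)) = (if a mod m = b mod m then of_nat m else 0)"
proof -
  let ?z = "w ^ a * inverse w ^ b"
  have w: "w ^ m = 1" "w \<noteq> 0" using assms primitive_root_nonzero by (auto simp: primitive_root_of_unity_def)
  have "?z ^ m = 1" using w by (simp add: power_mult_distrib power_mult[symmetric] mult.commute[of _ m] power_mult[of _ m] power_inverse)
  moreover have "(\<Sum>k<m. w ^ (a * k) * inverse w ^ (b * k)) = (\<Sum>k<m. ?z ^ k)"
    by (simp add: power_mult power_mult_distrib)
  moreover have "(?z - 1) * (\<Sum>k<m. ?z ^ k) = ?z ^ m - 1" by (simp add: power_diff_1_eq)
  moreover have "?z = 1 \<longleftrightarrow> w ^ a = w ^ b" using w by (simp add: field_simps)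
  ultimately show ?thesis using primitive_root_mod_eq_iff[OF assms, of a b] by auto
qed

lemma primitive_root_power:
  assumes "primitive_root_of_unity (n\<^sup>2) q" "n > 0"
  shows "primitive_root_of_unity n (q ^ n)"
  unfolding primitive_root_of_unity_def
proof (intro conjI allI impI)
  show "(q ^ n) ^ n = 1"
    using assms(1) by (simp add: primitive_root_of_unity_def power2_eq_square power_mult)
  fix k assume k: "0 < k \<and> k < n"
  then have "0 < n * k \<and> n * k < n\<^sup>2" using assms(2) by (simp add: power2_eq_square)
  then show "(q ^ n) ^ k \<noteq> 1"
    using assms(1) unfolding primitive_root_of_unity_def power_mult[symmetric] by blast
qed (use assms in auto)

context complex_algebra
begin

lemma skew_power:
  assumes "a \<in> carrier H" "x \<in> carrier H" "x \<otimes> a = c \<odot> (a \<otimes> x)"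
  shows "x \<otimes> a [^] (k::nat) = c ^ k \<odot> (a [^] k \<otimes> x)"
proof (induction k)
  case 0 then show ?case using assms by simp
next
  case (Suc k)
  have "x \<otimes> a [^] Suc k = (x \<otimes> a [^] k) \<otimes> a" using assms by (simp add: m_assoc)
  also have "\<dots> = c ^ k \<odot> (a [^] k \<otimes> (x \<otimes> a))" using assms by (simp add: Suc smult_mult_left m_assoc)
  finally show ?case using assms by (simp add: smult_mult_right smult_smult m_assoc mult.commute)
qed

text \<open>Passing \<open>x\<close> through \<open>a\<^sup>k\<close> costs
  \<open>w\<^sup>-\<^sup>k\<close>, which turns the Fourier coefficients of the idempotent
  \<open>i\<close> into those of \<open>i + 1\<close>.\<close>

lemma skew_idem:
  assumes "a \<in> carrier H" "x \<in> carrier H" "x \<otimes> a = inverse w \<odot> (a \<otimes> x)"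
  shows "x \<otimes> idem H m a w i = idem H m a w (Suc i) \<otimes> x"
proof -
  have "x \<otimes> idem H m a w i = (\<Oplus>k\<in>{..<m}. x \<otimes> ((inverse w ^ (i * k) / of_nat m) \<odot> (a [^] k)))"
    unfolding idem_def using assms(1,2) by (intro finsum_rdistr) auto
  also have "\<dots> = (\<Oplus>k\<in>{..<m}. ((inverse w ^ (Suc i * k) / of_nat m) \<odot> (a [^] k)) \<otimes> x)"
    using assms(1,2) by (intro M.finsum_cong' refl)
      (auto simp: smult_mult_right smult_mult_left skew_power[OF assms] smult_smult power_add mult.commute)
  also have "\<dots> = idem H m a w (Suc i) \<otimes> x"
    unfolding idem_def using assms(1,2) by (intro finsum_ldistr[symmetric]) auto
  finally show ?thesis .
qed

end

section \<open>Idempotents attached to a grouplike element of finite order\<close>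

context pre_bialgebra
begin

context
  fixes a m w
  assumes a: "a \<in> carrier H" "a [^] m = \<one>"
    and w: "primitive_root_of_unity m w"
begin

lemma idem_closed [simp, intro]: "idem H m a w i \<in> carrier H"
  unfolding idem_def using a by (intro M.finsum_closed) auto

lemma m_pos: "m > 0" using w by (simp add: primitive_root_of_unity_def)

lemma inverse_power_mod: "inverse w ^ ((i mod m) * k) = inverse w ^ (i * k)"
  using primitive_root_power_mod[OF w, of i] by (simp add: power_mult power_inverse)

lemma idem_mod: "idem H m a w (i mod m) = idem H m a w i"
  unfolding idem_def by (simp only: inverse_power_mod)

lemma power_idem_expansion:
  assumes "l < m"
  shows "a [^] l = (\<Oplus>i\<in>{..<m}. (w ^ (i * l)) \<odot> idem H m a w i)"
proof -
  let ?c = "\<lambda>i k. w ^ (i * l) * (inverse w ^ (i * k) / of_nat m)"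
  have "(\<Oplus>i\<in>{..<m}. (w ^ (i * l)) \<odot> idem H m a w i) =
      (\<Oplus>i\<in>{..<m}. \<Oplus>k\<in>{..<m}. ?c i k \<odot> (a [^] k))"
    unfolding idem_def using a
    by (intro M.finsum_cong' refl) (auto simp: finsum_smult smult_smult intro!: M.finsum_closed M.finsum_cong')
  also have "\<dots> = (\<Oplus>k\<in>{..<m}. \<Oplus>i\<in>{..<m}. ?c i k \<odot> (a [^] k))"
    using a by (intro finsum_swap) auto
  also have "\<dots> = (\<Oplus>k\<in>{..<m}. if k = l then a [^] l else \<zero>)"
  proof (intro M.finsum_cong' refl)
    fix k assume k: "k \<in> {..<m}"
    have "(\<Oplus>i\<in>{..<m}. ?c i k \<odot> (a [^] k)) = (\<Sum>i<m. ?c i k) \<odot> (a [^] k)" using a by (intro sum_smult) auto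
    also have "(\<Sum>i<m. ?c i k) = (\<Sum>i<m. w ^ (l * i) * inverse w ^ (k * i)) / of_nat m"
      by (simp add: sum_divide_distrib mult.commute)
    also have "\<dots> = (if k = l then 1 else 0)" using primitive_root_sum[OF w, of l k] k assms m_pos by auto
    finally show "(\<Oplus>i\<in>{..<m}. ?c i k \<odot> (a [^] k)) = (if k = l then a [^] l else \<zero>)" using a by auto
  qed (use a in auto)
  also have "\<dots> = a [^] l" using a assms by (intro finsum_delta) auto
  finally show ?thesis ..
qed

lemma power_mult_idem: "a [^] k \<otimes> idem H m a w i = (w ^ (i * k)) \<odot> idem H m a w i"
proof (induction k)
  case 0 then show ?case by simp
next
  case (Suc k)
  have "a [^] Suc k \<otimes> idem H m a w i = a [^] k \<otimes> (a \<otimes> idem H m a w i)" using a by (simp add: m_assoc)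
  also have "a \<otimes> idem H m a w i = (w ^ i) \<odot> idem H m a w i"
    using w by (intro idem_eigen a) (auto simp: primitive_root_of_unity_def)
  finally show ?case using Suc a by (simp add: smult_mult_right smult_smult power_add)
qed

lemma idem_mult:
  assumes "i < m" "j < m"
  shows "idem H m a w i \<otimes> idem H m a w j = (if i = j then idem H m a w i else \<zero>)"
proof -
  have "idem H m a w i \<otimes> idem H m a w j =
     (\<Oplus>k\<in>{..<m}. (inverse w ^ (i * k) / of_nat m) \<odot> (a [^] k) \<otimes> idem H m a w j)"
    unfolding idem_def[of H m a w i] using a by (intro finsum_ldistr) auto
  also have "\<dots> = (\<Oplus>k\<in>{..<m}. (w ^ (j * k) * inverse w ^ (i * k) / of_nat m) \<odot> idem H m a w j)"
    using a by (intro M.finsum_cong' refl) (auto simp: smult_mult_left power_mult_idem smult_smult mult.commute)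
  also have "\<dots> = (\<Sum>k<m. w ^ (j * k) * inverse w ^ (i * k) / of_nat m) \<odot> idem H m a w j"
    by (rule sum_smult) auto
  also have "(\<Sum>k<m. w ^ (j * k) * inverse w ^ (i * k) / of_nat m) = (if i = j then 1 else 0)"
    using primitive_root_sum[OF w, of j i] assms m_pos by (simp add: sum_divide_distrib[symmetric])
  finally show ?thesis by auto
qed

lemma comult_power:
  assumes ca: "tensor_eq H 2 (comult H a) (pure_tensor [a, a])"
  shows "tensor_eq H 2 (comult H (a [^] (k::nat))) (pure_tensor [a [^] k, a [^] k])"
proof (induction k)
  case 0 then show ?case using comult_one by (simp add: tensor_one_def numeral_2_eq_2)
next
  case (Suc k)
  have "tensor_eq H 2 (comult H (a [^] Suc k)) (comult H (a [^] k) \<star> comult H a)"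
    using comult_mult[of "a [^] k" a] a by simp
  also have "tensor_eq H 2 \<dots> (pure_tensor [a [^] k, a [^] k] \<star> pure_tensor [a, a])"
    using a by (intro tensor_mult_cong Suc ca comult_closed) auto
  also have "\<dots> = pure_tensor [a [^] Suc k, a [^] Suc k]"
    by (simp add: tensor_mult_def pure_tensor_def)
  finally show ?case .
qed

text \<open>In the Fourier sum for \<open>\<Delta>(e\<^sub>i)\<close> each
  \<open>a\<^sup>k \<otimes> a\<^sup>k\<close> is expanded in idempotents; orthogonality keeps the
  pairs with \<open>j + l\<close> congruent to \<open>i\<close>.\<close>

lemma weight_system_idem:
  assumes ca: "tensor_eq H 2 (comult H a) (pure_tensor [a, a])" "counit H a = 1"
  shows "weight_system H m (idem H m a w)"
proof (intro weight_system.intro weight_system_axioms.intro)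
  show "pre_bialgebra H" by (rule pre_bialgebra_axioms)
  let ?e = "idem H m a w"
  show "(\<Oplus>i\<in>{..<m}. ?e i) = \<one>"
    using power_idem_expansion[OF m_pos] by (simp add: Pi_def)
  note ck = comult_power[OF ca(1)]
  have counit_power: "counit H (a [^] k) = 1" for k :: nat
    by (induction k) (use a ca counit_mult counit_one in auto)
  fix i assume i: "i < m"
  have "counit H (?e i) = (\<Sum>k<m. inverse w ^ (i * k) / of_nat m)"
    unfolding idem_def using a counit_power
    by (subst linear_form_finsum[OF counit_linear]) (auto simp: counit_smult)
  then show "counit H (?e i) = (if i = 0 then 1 else 0)"
    using primitive_root_sum[OF w, of 0 i] i m_pos by (simp add: sum_divide_distrib[symmetric])
  show "tensor_eq H 2 (comult H (?e i)) (diag2 m ?e (\<lambda>j l. if (j + l) mod m = i then 1 else 0))"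
    unfolding tensor_eq_def
  proof (intro allI impI)
    fix f assume f: "multilinear H 2 f"
    have l1: "linear_form H (\<lambda>x. f [x, y])" "linear_form H (\<lambda>x. f [y, x])" if "y \<in> carrier H" for y
      using f that by (auto simp: multilinear2_iff)
    have fa: "f [a [^] k, a [^] k] = (\<Sum>j<m. \<Sum>l<m. w ^ ((j + l) * k) * f [?e j, ?e l])" if "k < m" for k
    proof -
      have e: "f [a [^] k, y] = (\<Sum>j<m. w ^ (j * k) * f [?e j, y])" if "y \<in> carrier H" for y
        unfolding power_idem_expansion[OF \<open>k < m\<close>]
        using l1[OF that] by (subst linear_form_finsum[OF l1(1)[OF that]]) (auto simp: linear_form_def)
      have e': "f [y, a [^] k] = (\<Sum>j<m. w ^ (j * k) * f [y, ?e j])" if "y \<in> carrier H" for y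
        unfolding power_idem_expansion[OF \<open>k < m\<close>]
        using l1[OF that] by (subst linear_form_finsum[OF l1(2)[OF that]]) (auto simp: linear_form_def)
      have "f [a [^] k, a [^] k] = (\<Sum>j<m. w ^ (j * k) * f [?e j, a [^] k])" using a by (intro e) auto
      then show ?thesis by (simp add: e' sum_distrib_left power_add add_mult_distrib mult.assoc)
    qed
    have "comult H (?e i) f = (\<Sum>k<m. inverse w ^ (i * k) / of_nat m * comult H (a [^] k) f)"
      unfolding idem_def using a comult_linear_form[OF f]
      by (subst linear_form_finsum[OF comult_linear_form[OF f]]) (auto simp: linear_form_def)
    also have "\<dots> = (\<Sum>k<m. \<Sum>j<m. \<Sum>l<m. inverse w ^ (i * k) / of_nat m * (w ^ ((j + l) * k) * f [?e j, ?e l]))"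
      using ck f fa by (simp add: tensor_eq_def pure_tensor_def sum_distrib_left)
    also have "\<dots> = (\<Sum>j<m. \<Sum>k<m. \<Sum>l<m. inverse w ^ (i * k) / of_nat m * (w ^ ((j + l) * k) * f [?e j, ?e l]))"
      by (rule sum.swap)
    also have "\<dots> = (\<Sum>j<m. \<Sum>l<m. \<Sum>k<m. inverse w ^ (i * k) / of_nat m * (w ^ ((j + l) * k) * f [?e j, ?e l]))"
      by (intro sum.cong refl sum.swap)
    also have "\<dots> = (\<Sum>j<m. \<Sum>l<m. (\<Sum>k<m. w ^ ((j + l) * k) * inverse w ^ (i * k)) / of_nat m * f [?e j, ?e l])"
      by (intro sum.cong refl) (simp add: sum_divide_distrib sum_distrib_right sum_distrib_left mult_ac)
    also have "\<dots> = diag2 m ?e (\<lambda>j l. if (j + l) mod m = i then 1 else 0) f"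
      unfolding diag2_def primitive_root_sum[OF w] using i m_pos by (intro sum.cong refl) auto
    finally show "comult H (?e i) f = diag2 m ?e (\<lambda>j l. if (j + l) mod m = i then 1 else 0) f" .
  qed
qed (use m_pos idem_mod idem_mult in auto)

end

end

text \<open>Gaussian binomials by their Pascal recursion, which makes sense at roots of unity, where
  the quotient of q-factorials can be 0/0.\<close>

fun qbinomial :: "complex \<Rightarrow> nat \<Rightarrow> nat \<Rightarrow> complex" where
  "qbinomial q k 0 = 1"
| "qbinomial q 0 (Suc m) = 0"
| "qbinomial q (Suc k) (Suc m) = q ^ Suc m * qbinomial q k (Suc m) + qbinomial q k m"

lemma qbinomial_gt: "k < m \<Longrightarrow> qbinomial q k m = 0"
  by (induction q k m rule: qbinomial.induct) auto

lemma qbinomial_diag: "qbinomial q k k = 1"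
  by (induction k) (auto simp: qbinomial_gt)

lemma qbinomial_1: "qbinomial q k 1 = (\<Sum>i<k. q ^ i)"
proof (induction k)
  case (Suc k)
  have "q * (\<Sum>i<k. q ^ i) + 1 = (\<Sum>i<Suc k. q ^ i)"
    by (simp add: sum.lessThan_Suc_shift sum_distrib_left del: sum.lessThan_Suc)
  then show ?case using Suc by simp
qed simp

definition qnumber :: "complex \<Rightarrow> nat \<Rightarrow> complex" where "qnumber q k = (\<Sum>i<k. q ^ i)"
definition qfactorial :: "complex \<Rightarrow> nat \<Rightarrow> complex" where "qfactorial q k = (\<Prod>i<k. qnumber q (Suc i))"

lemma qnumber_add: "qnumber q (a + b) = qnumber q a + q ^ a * qnumber q b"
  by (induction b) (auto simp: qnumber_def algebra_simps power_add)

text \<open>The quotient formula with cleared denominators, so that it holds for every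
  \<open>q\<close>.\<close>

lemma qbinomial_factorial:
  "m \<le> k \<Longrightarrow> qbinomial q k m * qfactorial q m * qfactorial q (k - m) = qfactorial q k"
proof (induction k arbitrary: m)
  case 0 then show ?case by (simp add: qfactorial_def)
next
  case (Suc k)
  show ?case
  proof (cases m)
    case 0 then show ?thesis by (simp add: qfactorial_def)
  next
    case m: (Suc l)
    have l: "l \<le> k" using Suc m by simp
    have 1: "qbinomial q k l * qfactorial q (Suc l) * qfactorial q (k - l) = qnumber q (Suc l) * qfactorial q k"
      using Suc.IH[OF l] by (simp add: qfactorial_def algebra_simps)
    have 2: "qbinomial q k (Suc l) * qfactorial q (Suc l) * qfactorial q (k - l) = qnumber q (k - l) * qfactorial q k"
    proof (cases "l = k")
      case True then show ?thesis by (simp add: qbinomial_gt qnumber_def)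
    next
      case False
      then have "k - l = Suc (k - Suc l)" using l by simp
      then have "qfactorial q (k - l) = qnumber q (k - l) * qfactorial q (k - Suc l)"
        by (simp add: qfactorial_def)
      then show ?thesis using Suc.IH[of "Suc l"] l False by (simp add: algebra_simps)
    qed
    have "qbinomial q (Suc k) m * qfactorial q m * qfactorial q (Suc k - m) =
      q ^ Suc l * (qbinomial q k (Suc l) * qfactorial q (Suc l) * qfactorial q (k - l)) +
      qbinomial q k l * qfactorial q (Suc l) * qfactorial q (k - l)"
      using m by (simp add: algebra_simps)
    also have "\<dots> = (qnumber q (Suc l) + q ^ Suc l * qnumber q (k - l)) * qfactorial q k"
      unfolding 1 2 by (simp add: algebra_simps)
    also have "\<dots> = qnumber q (Suc k) * qfactorial q k"
      using l qnumber_add[of q "Suc l" "k - l"] by simp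
    also have "\<dots> = qfactorial q (Suc k)" by (simp add: qfactorial_def)
    finally show ?thesis .
  qed
qed

lemma qnumber_eq_0_iff:
  assumes "primitive_root_of_unity N q" "N > 1"
  shows "qnumber q k = 0 \<longleftrightarrow> N dvd k"
proof -
  have "q \<noteq> 1" using assms unfolding primitive_root_of_unity_def by force
  moreover have "(q - 1) * qnumber q k = q ^ k - 1" by (simp add: qnumber_def power_diff_1_eq)
  moreover have "q ^ k = 1 \<longleftrightarrow> N dvd k" using primitive_root_mod_eq_iff[OF assms(1), of k 0] by auto
  ultimately show ?thesis by (metis eq_iff_diff_eq_0 mult_eq_0_iff)
qed

text \<open>The q-factorial of \<open>N\<close> contains the vanishing q-number of \<open>N\<close>,
  while those of \<open>m\<close> and \<open>N - m\<close> are nonzero because the order of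
  \<open>q\<close> is exactly \<open>N\<close>.\<close>

lemma qbinomial_vanish:
  assumes "primitive_root_of_unity N q" "N > 1" "0 < m" "m < N"
  shows "qbinomial q N m = 0"
proof -
  have nz: "qfactorial q k \<noteq> 0" if "k < N" for k
    using that qnumber_eq_0_iff[OF assms(1,2)] by (auto simp: qfactorial_def dest: dvd_imp_le)
  have "qfactorial q N = 0"
    using qnumber_eq_0_iff[OF assms(1,2), of N] assms(2) by (cases N) (auto simp: qfactorial_def)
  then show ?thesis using qbinomial_factorial[of m N q] nz[of m] nz[of "N - m"] assms by simp
qed

text \<open>Multiplication by \<open>a + b\<close> on the left moves \<open>a\<close> past
  \<open>b\<^sup>m\<close> at the cost \<open>q\<^sup>m\<close>; this is the Pascal
  recursion.\<close>

lemma (in complex_algebra) q_binomial_theorem: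
  assumes [simp, intro]: "a \<in> carrier H" "b \<in> carrier H" and ab: "a \<otimes> b = q \<odot> (b \<otimes> a)"
  shows "(a \<oplus> b) [^] k = (\<Oplus>m\<in>{..k}. qbinomial q k m \<odot> (b [^] m \<otimes> a [^] (k - m)))"
proof (induction k)
  case 0 then show ?case by simp
next
  case (Suc k)
  have comm: "a \<otimes> b [^] (m::nat) = q ^ m \<odot> (b [^] m \<otimes> a)" for m
  proof (induction m)
    case (Suc m)
    have "a \<otimes> b [^] Suc m = (a \<otimes> b [^] m) \<otimes> b" by (simp add: m_assoc)
    also have "\<dots> = q ^ m \<odot> (b [^] m \<otimes> (a \<otimes> b))" by (simp add: Suc smult_mult_left m_assoc)
    also have "\<dots> = q ^ Suc m \<odot> (b [^] Suc m \<otimes> a)"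
      by (simp add: ab smult_mult_right smult_smult m_assoc mult.commute)
    finally show ?case .
  qed simp
  let ?S = "\<Oplus>m\<in>{..k}. qbinomial q k m \<odot> (b [^] m \<otimes> a [^] (k - m))"
  let ?t = "\<lambda>m. b [^] m \<otimes> a [^] (Suc k - m)"
  have A: "a \<otimes> ?S = (\<Oplus>m\<in>{..Suc k}. (q ^ m * qbinomial q k m) \<odot> ?t m)"
  proof -
    have "a \<otimes> ?S = (\<Oplus>m\<in>{..k}. a \<otimes> (qbinomial q k m \<odot> (b [^] m \<otimes> a [^] (k - m))))"
      by (intro finsum_rdistr) auto
    also have "\<dots> = (\<Oplus>m\<in>{..k}. (q ^ m * qbinomial q k m) \<odot> ?t m)"
    proof (intro M.finsum_cong' refl)
      fix m assume m: "m \<in> {..k}"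
      have "a \<otimes> (qbinomial q k m \<odot> (b [^] m \<otimes> a [^] (k - m))) = qbinomial q k m \<odot> ((a \<otimes> b [^] m) \<otimes> a [^] (k - m))"
        by (simp add: smult_mult_right m_assoc)
      also have "\<dots> = (q ^ m * qbinomial q k m) \<odot> (b [^] m \<otimes> (a \<otimes> a [^] (k - m)))"
        by (simp add: comm smult_mult_left smult_smult m_assoc mult.commute)
      also have "a \<otimes> a [^] (k - m) = a [^] (Suc k - m)"
        using m nat_pow_Suc2[of a "k - m"] by (simp add: Suc_diff_le del: nat_pow_Suc)
      finally show "a \<otimes> (qbinomial q k m \<odot> (b [^] m \<otimes> a [^] (k - m))) = (q ^ m * qbinomial q k m) \<odot> ?t m" .
    qed auto
    also have "\<dots> = (\<Oplus>m\<in>{..Suc k}. (q ^ m * qbinomial q k m) \<odot> ?t m)"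
      by (subst M.finsum_Suc) (auto simp: qbinomial_gt)
    finally show ?thesis .
  qed
  have B: "b \<otimes> ?S = (\<Oplus>m\<in>{..Suc k}. (if m = 0 then 0 else qbinomial q k (m - 1)) \<odot> ?t m)"
  proof -
    have "b \<otimes> ?S = (\<Oplus>m\<in>{..k}. b \<otimes> (qbinomial q k m \<odot> (b [^] m \<otimes> a [^] (k - m))))"
      by (intro finsum_rdistr) auto
    also have "\<dots> = (\<Oplus>m\<in>{..k}. qbinomial q k m \<odot> ?t (Suc m))"
      by (intro M.finsum_cong' refl)
        (auto simp: smult_mult_right m_assoc[symmetric] nat_pow_Suc2[symmetric] simp del: nat_pow_Suc)
    also have "\<dots> = (\<Oplus>m\<in>{..Suc k}. (if m = 0 then 0 else qbinomial q k (m - 1)) \<odot> ?t m)"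
      by (subst M.finsum_Suc2) auto
    finally show ?thesis .
  qed
  have Sc: "?S \<in> carrier H" by (intro M.finsum_closed) auto
  have "(a \<oplus> b) [^] Suc k = (a \<oplus> b) \<otimes> (a \<oplus> b) [^] k" using nat_pow_Suc2[of "a \<oplus> b" k] by simp
  also have "\<dots> = a \<otimes> ?S \<oplus> b \<otimes> ?S" using Suc Sc by (simp add: l_distr)
  also have "\<dots> = (\<Oplus>m\<in>{..Suc k}. (q ^ m * qbinomial q k m) \<odot> ?t m \<oplus>
      (if m = 0 then 0 else qbinomial q k (m - 1)) \<odot> ?t m)"
    unfolding A B by (rule M.finsum_addf[symmetric]) auto
  also have "\<dots> = (\<Oplus>m\<in>{..Suc k}. qbinomial q (Suc k) m \<odot> ?t m)"
  proof (intro M.finsum_cong' refl)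
    fix m
    show "(q ^ m * qbinomial q k m) \<odot> ?t m \<oplus> (if m = 0 then 0 else qbinomial q k (m - 1)) \<odot> ?t m =
      qbinomial q (Suc k) m \<odot> ?t m"
      by (cases m) (auto simp: smult_add_left)
  qed auto
  finally show ?case .
qed

text \<open>Independence follows from nonvanishing of the monomials: the projection to degree
  \<open>k\<close>, followed by right multiplication with \<open>e i\<close>, isolates a single
  coefficient.\<close>

lemma (in shift_system) graded_modelI:
  assumes "n > 1" "M > 1" "x [^] M = \<zero>"
    and nz: "\<And>k i. k < M \<Longrightarrow> i < n \<Longrightarrow> x [^] k \<otimes> e i \<noteq> \<zero>"
    and p: "\<And>k. linear_map H H (p k)"
    "\<And>k l i. k < M \<Longrightarrow> l < M \<Longrightarrow> i < n \<Longrightarrow> p k (x [^] l \<otimes> e i) = (if k = l then x [^] l \<otimes> e i else \<zero>)"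
    and span: "\<And>h. h \<in> carrier H \<Longrightarrow> \<exists>c. h = combination H e x M n c"
  shows "graded_model H n e x \<alpha> \<beta> \<omega> M"
proof (intro graded_model.intro graded_model_axioms.intro)
  let ?f = "combination H e x M n"
  let ?b = "\<lambda>k i. x [^] k \<otimes> e i"
  show "bij_betw ?f (coefficients M n) (carrier H)"
    unfolding bij_betw_def
  proof
    have coef: "p k (?f c) \<otimes> e i = c k i \<odot> ?b k i" if ki: "k < M" "i < n" for c k i
    proof -
      have "p k (?f c) = (\<Oplus>l\<in>{..<M}. p k (\<Oplus>j\<in>{..<n}. c l j \<odot> ?b l j))"
        unfolding combination_def
        by (rule linear_map_finsum[OF complex_algebra_axioms complex_algebra_axioms p(1)])
          (auto intro!: M.finsum_closed)
      also have "\<dots> = (\<Oplus>l\<in>{..<M}. if l = k then (\<Oplus>j\<in>{..<n}. c k j \<odot> ?b k j) else \<zero>)"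
      proof (intro M.finsum_cong' refl)
        fix l assume l: "l \<in> {..<M}"
        have "p k (\<Oplus>j\<in>{..<n}. c l j \<odot> ?b l j) = (\<Oplus>j\<in>{..<n}. p k (c l j \<odot> ?b l j))"
          by (rule linear_map_finsum[OF complex_algebra_axioms complex_algebra_axioms p(1)]) auto
        also have "\<dots> = (\<Oplus>j\<in>{..<n}. if l = k then c l j \<odot> ?b l j else \<zero>)"
          using p(1)[of k] p(2)[of k l] l ki unfolding linear_map_def by (intro M.finsum_cong' refl) auto
        finally show "p k (\<Oplus>j\<in>{..<n}. c l j \<odot> ?b l j) = (if l = k then (\<Oplus>j\<in>{..<n}. c k j \<odot> ?b k j) else \<zero>)"
          by auto
      qed (auto intro!: M.finsum_closed)
      also have "\<dots> = (\<Oplus>j\<in>{..<n}. c k j \<odot> ?b k j)" using ki by (intro finsum_delta) (auto intro!: M.finsum_closed)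
      finally have "p k (?f c) \<otimes> e i = (\<Oplus>j\<in>{..<n}. c k j \<odot> ?b k j \<otimes> e i)"
        by (simp add: finsum_ldistr)
      also have "\<dots> = (\<Oplus>j\<in>{..<n}. if j = i then c k i \<odot> ?b k i else \<zero>)"
        using ki by (intro M.finsum_cong' refl) (auto simp: smult_mult_left m_assoc e_mult)
      also have "\<dots> = c k i \<odot> ?b k i" using ki by (intro finsum_delta) auto
      finally show ?thesis .
    qed
    show "inj_on ?f (coefficients M n)"
    proof (rule inj_onI)
      fix c d assume cd: "c \<in> coefficients M n" "d \<in> coefficients M n" and eq: "?f c = ?f d"
      have "c k i = d k i" for k i
      proof (cases "k < M \<and> i < n")
        case True
        then have "c k i \<odot> ?b k i = d k i \<odot> ?b k i" using coef[of k i c] coef[of k i d] eq by simp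
        then show ?thesis using nz True smult_left_cancel[of "?b k i"] by simp
      qed (use cd in \<open>auto simp: coefficients_def\<close>)
      then show "c = d" by auto
    qed
    show "?f ` coefficients M n = carrier H"
    proof
      show "?f ` coefficients M n \<subseteq> carrier H"
        unfolding combination_def by (auto intro!: M.finsum_closed)
      show "carrier H \<subseteq> ?f ` coefficients M n"
      proof
        fix h assume "h \<in> carrier H"
        then obtain c where c: "h = ?f c" using span by blast
        \<comment> \<open>The spanning coefficients may be nonzero outside the range and are
          truncated to lie in \<open>coefficients\<close>.\<close>
        have "?f c = ?f (\<lambda>k i. if k < M \<and> i < n then c k i else 0)"
          unfolding combination_def by (intro M.finsum_cong' refl) (auto intro!: M.finsum_closed M.finsum_cong')
        then show "h \<in> ?f ` coefficients M n"
          unfolding c by (rule image_eqI[of _ _ "\<lambda>k i. if k < M \<and> i < n then c k i else 0"])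
            (auto simp: coefficients_def)
      qed
    qed
  qed
qed (use assms shift_system_axioms in auto)

section \<open>The Taft algebra\<close>

text \<open>By trilinearity associativity is an identity between structure constants, one for each
  triple of basis elements.\<close>

lemma structure_constants_assoc:
  fixes S :: "'a \<Rightarrow> 'a \<Rightarrow> 'a \<Rightarrow> complex"
  assumes "\<And>p p' p''. p \<in> I \<Longrightarrow> p' \<in> I \<Longrightarrow> p'' \<in> I \<Longrightarrow>
      (\<Sum>s\<in>I. S p p' s * S s p'' r) = (\<Sum>s\<in>I. S p' p'' s * S p s r)"
  shows "(\<Sum>s\<in>I. \<Sum>p''\<in>I. (\<Sum>p\<in>I. \<Sum>p'\<in>I. h p * h' p' * S p p' s) * h'' p'' * S s p'' r) =
    (\<Sum>p\<in>I. \<Sum>s\<in>I. h p * (\<Sum>p'\<in>I. \<Sum>p''\<in>I. h' p' * h'' p'' * S p' p'' s) * S p s r)"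
proof -
  have "(\<Sum>s\<in>I. \<Sum>p''\<in>I. (\<Sum>p\<in>I. \<Sum>p'\<in>I. h p * h' p' * S p p' s) * h'' p'' * S s p'' r) =
     (\<Sum>s\<in>I. \<Sum>p''\<in>I. \<Sum>p\<in>I. \<Sum>p'\<in>I. h p * h' p' * h'' p'' * (S p p' s * S s p'' r))"
    by (intro sum.cong refl) (simp add: sum_distrib_right sum_distrib_left mult_ac)
  also have "\<dots> = (\<Sum>p\<in>I. \<Sum>p'\<in>I. \<Sum>s\<in>I. \<Sum>p''\<in>I. h p * h' p' * h'' p'' * (S p p' s * S s p'' r))"
    by (rule sum_swap4)
  also have "\<dots> = (\<Sum>p\<in>I. \<Sum>p'\<in>I. \<Sum>p''\<in>I. \<Sum>s\<in>I. h p * h' p' * h'' p'' * (S p p' s * S s p'' r))"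
    by (intro sum.cong refl sum.swap)
  also have "\<dots> = (\<Sum>p\<in>I. \<Sum>p'\<in>I. \<Sum>p''\<in>I. \<Sum>s\<in>I. h p * h' p' * h'' p'' * (S p' p'' s * S p s r))"
    by (rule sum.cong[OF refl], rule sum.cong[OF refl], rule sum.cong[OF refl])
      (simp add: assms sum_distrib_left[symmetric])
  also have "\<dots> = (\<Sum>p\<in>I. \<Sum>p'\<in>I. \<Sum>s\<in>I. \<Sum>p''\<in>I. h p * h' p' * h'' p'' * (S p' p'' s * S p s r))"
    by (intro sum.cong refl sum.swap)
  also have "\<dots> = (\<Sum>p\<in>I. \<Sum>s\<in>I. \<Sum>p'\<in>I. \<Sum>p''\<in>I. h p * h' p' * h'' p'' * (S p' p'' s * S p s r))"
    by (intro sum.cong refl sum.swap)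
  also have "\<dots> = (\<Sum>p\<in>I. \<Sum>s\<in>I. h p * (\<Sum>p'\<in>I. \<Sum>p''\<in>I. h' p' * h'' p'' * S p' p'' s) * S p s r)"
    by (intro sum.cong refl) (simp add: sum_distrib_right sum_distrib_left mult_ac)
  finally show ?thesis .
qed

text \<open>Structure constants for the basis \<open>g\<^sup>i x\<^sup>j\<close>, indexed by pairs
  of exponents; the test \<open>snd r < N\<close> encodes \<open>x\<^sup>N = 0\<close>.\<close>

definition taft_constant :: "nat \<Rightarrow> complex \<Rightarrow> nat \<times> nat \<Rightarrow> nat \<times> nat \<Rightarrow> nat \<times> nat \<Rightarrow> complex" where
  "taft_constant N q p p' r = (if (fst p + fst p') mod N = fst r \<and> snd p + snd p' = snd r \<and> snd r < N
     then inverse q ^ (snd p * fst p') else 0)"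

lemma taft_simps:
  "carrier (taft N q) = {h. \<forall>p. p \<notin> {..<N} \<times> {..<N} \<longrightarrow> h p = 0}"
  "h \<otimes>\<^bsub>taft N q\<^esub> h' = (\<lambda>r. \<Sum>p\<in>{..<N} \<times> {..<N}. \<Sum>p'\<in>{..<N} \<times> {..<N}. h p * h' p' * taft_constant N q p p' r)"
  "\<one>\<^bsub>taft N q\<^esub> = monomial (0, 0)" "\<zero>\<^bsub>taft N q\<^esub> = (\<lambda>p. 0)"
  "h \<oplus>\<^bsub>taft N q\<^esub> h' = (\<lambda>p. h p + h' p)" "c \<odot>\<^bsub>taft N q\<^esub> h = (\<lambda>p. c * h p)"
  "comult (taft N q) h = (\<lambda>f. \<Sum>p \<in> {..<N} \<times> {..<N}. h p * taft_comult_monomial N q p f)"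
  "counit (taft N q) h = (\<Sum>i<N. h (i, 0))"
  "associator (taft N q) = tensor_one (taft_algebra N q) 3"
  by (auto simp: taft_def taft_algebra_def module.defs quasi_hopf.defs taft_constant_def fun_eq_iff
      case_prod_unfold intro!: sum.cong)

lemma taft_ops:
  "monoid.mult (taft_algebra N q) = monoid.mult (taft N q)" "monoid.one (taft_algebra N q) = monoid.one (taft N q)"
  by (simp_all add: taft_def module.defs quasi_hopf.defs)

locale taft_root =
  fixes N :: nat and q :: complex
  assumes root: "primitive_root_of_unity N q" and N_gt: "N > 1"
begin

declare One_nat_def [simp del]

abbreviation "T \<equiv> taft N q"
abbreviation "I \<equiv> {..<N} \<times> {..<N}"
abbreviation "W \<equiv> taft_comult_monomial N q"

lemma q_0: "q \<noteq> 0" by (rule primitive_root_nonzero[OF root])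

lemma inverse_q_mod: "inverse q ^ (k * (i mod N)) = inverse q ^ (k * i)"
proof -
  have "q ^ (k * (i mod N)) = q ^ (k * i)"
    unfolding primitive_root_mod_eq_iff[OF root] by (simp add: mod_mult_right_eq)
  then show ?thesis by (simp add: power_inverse)
qed

lemma taft_constant_delta:
  assumes "p \<in> I" "p' \<in> I"
  shows "taft_constant N q p p' r = (if r = ((fst p + fst p') mod N, snd p + snd p') then
     (if snd p + snd p' < N then inverse q ^ (snd p * fst p') else 0) else 0)"
  by (cases r) (auto simp: taft_constant_def)

lemma taft_complex_algebra: "complex_algebra T"
proof (rule complex_algebraI)
  show "abelian_group T"
  proof (rule abelian_groupI)
    fix h assume "h \<in> carrier T"
    then show "\<exists>h'\<in>carrier T. h' \<oplus>\<^bsub>T\<^esub> h = \<zero>\<^bsub>T\<^esub>"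
      by (intro bexI[of _ "\<lambda>p. - h p"]) (auto simp: taft_simps)
  qed (auto simp: taft_simps fun_eq_iff)
  show "monoid T"
  proof (rule monoidI)
    fix h h' assume hh': "h \<in> carrier T" "h' \<in> carrier T"
    show "h \<otimes>\<^bsub>T\<^esub> h' \<in> carrier T"
      using N_gt by (auto simp: taft_simps taft_constant_delta intro!: sum.neutral)
    fix h'' assume h'': "h'' \<in> carrier T"
    have "(\<Sum>s\<in>I. taft_constant N q p p' s * taft_constant N q s p'' r) =
      (\<Sum>s\<in>I. taft_constant N q p' p'' s * taft_constant N q p s r)" if "p \<in> I" "p' \<in> I" "p'' \<in> I" for p p' p'' r
    proof -
      let ?s = "((fst p + fst p') mod N, snd p + snd p')" and ?s' = "((fst p' + fst p'') mod N, snd p' + snd p'')"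
      have "(\<Sum>s\<in>I. taft_constant N q p p' s * taft_constant N q s p'' r) =
        (\<Sum>s\<in>I. if s = ?s then (if snd p + snd p' < N then inverse q ^ (snd p * fst p') else 0) * taft_constant N q ?s p'' r else 0)"
        using that by (intro sum.cong refl) (simp add: taft_constant_delta)
      also have "\<dots> = (if snd p + snd p' < N then inverse q ^ (snd p * fst p') else 0) * taft_constant N q ?s p'' r"
        using N_gt by simp
      \<comment> \<open>The common value of both bracketings. Exponents of \<open>g\<close> may be
        reduced modulo \<open>N\<close> inside the powers of \<open>q\<close> because
        \<open>q\<^sup>N = 1\<close>.\<close>
      also have "\<dots> = (if r = ((fst p + fst p' + fst p'') mod N, snd p + snd p' + snd p'') \<and> snd r < N
          then inverse q ^ (snd p * fst p' + (snd p + snd p') * fst p'') else 0)"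
        by (cases r) (auto simp: taft_constant_def mod_simps power_add)
      also have "\<dots> = (if snd p' + snd p'' < N then inverse q ^ (snd p' * fst p'') else 0) * taft_constant N q p ?s' r"
        by (cases r) (auto simp: taft_constant_def mod_simps power_add add.assoc inverse_q_mod algebra_simps)
      also have "\<dots> = (\<Sum>s\<in>I. if s = ?s' then (if snd p' + snd p'' < N then inverse q ^ (snd p' * fst p'') else 0) * taft_constant N q p ?s' r else 0)"
        using N_gt by simp
      also have "\<dots> = (\<Sum>s\<in>I. taft_constant N q p' p'' s * taft_constant N q p s r)"
        using that by (intro sum.cong refl) (simp add: taft_constant_delta)
      finally show ?thesis .
    qed
    then show "h \<otimes>\<^bsub>T\<^esub> h' \<otimes>\<^bsub>T\<^esub> h'' = h \<otimes>\<^bsub>T\<^esub> (h' \<otimes>\<^bsub>T\<^esub> h'')"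
      unfolding taft_simps by (intro ext structure_constants_assoc) auto
  next
    fix h assume h: "h \<in> carrier T"
    have z: "(0, 0) \<in> I" using N_gt by simp
    have "(\<Sum>p\<in>I. \<Sum>p'\<in>I. monomial (0,0) p * h p' * taft_constant N q p p' r) = h r" for r
    proof -
      have "(\<Sum>p\<in>I. \<Sum>p'\<in>I. monomial (0,0) p * h p' * taft_constant N q p p' r) =
        (\<Sum>p\<in>I. if p = (0,0) then (\<Sum>p'\<in>I. h p' * taft_constant N q (0,0) p' r) else 0)"
        by (intro sum.cong refl) (simp add: monomial_def)
      also have "\<dots> = (\<Sum>p'\<in>I. h p' * taft_constant N q (0,0) p' r)" using z by simp
      also have "\<dots> = (\<Sum>p'\<in>I. if p' = r then h p' else 0)"
        by (intro sum.cong refl) (cases r, auto simp: taft_constant_def)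
      also have "\<dots> = h r" using h by (cases r) (auto simp: taft_simps)
      finally show ?thesis .
    qed
    then show "\<one>\<^bsub>T\<^esub> \<otimes>\<^bsub>T\<^esub> h = h" by (simp add: taft_simps)
    have "(\<Sum>p\<in>I. \<Sum>p'\<in>I. h p * monomial (0,0) p' * taft_constant N q p p' r) = h r" for r
    proof -
      have "(\<Sum>p\<in>I. \<Sum>p'\<in>I. h p * monomial (0,0) p' * taft_constant N q p p' r) =
        (\<Sum>p\<in>I. \<Sum>p'\<in>I. if p' = (0,0) then h p * taft_constant N q p (0,0) r else 0)"
        by (intro sum.cong refl) (simp add: monomial_def)
      also have "\<dots> = (\<Sum>p\<in>I. h p * taft_constant N q p (0,0) r)" using z by simp
      also have "\<dots> = (\<Sum>p'\<in>I. if p' = r then h p' else 0)"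
        by (intro sum.cong refl) (cases r, auto simp: taft_constant_def)
      also have "\<dots> = h r" using h by (cases r) (auto simp: taft_simps)
      finally show ?thesis .
    qed
    then show "h \<otimes>\<^bsub>T\<^esub> \<one>\<^bsub>T\<^esub> = h" by (simp add: taft_simps)
  qed (use N_gt in \<open>auto simp: taft_simps monomial_def\<close>)
qed (auto simp: taft_simps fun_eq_iff algebra_simps sum.distrib sum_distrib_left)

sublocale T: complex_algebra T by (rule taft_complex_algebra)

lemma monomial_closed [simp]: "p \<in> I \<Longrightarrow> monomial p \<in> carrier T"
  by (auto simp: taft_simps monomial_def)

lemma g_closed [simp]: "taft_g \<in> carrier T" and x_closed [simp]: "taft_x \<in> carrier T"
  using N_gt by simp_all

lemma monomial_mult:
  assumes "p \<in> I" "p' \<in> I"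
  shows "monomial p \<otimes>\<^bsub>T\<^esub> monomial p' = (if snd p + snd p' < N
     then inverse q ^ (snd p * fst p') \<odot>\<^bsub>T\<^esub> monomial ((fst p + fst p') mod N, snd p + snd p') else \<zero>\<^bsub>T\<^esub>)"
proof
  fix r
  have "(monomial p \<otimes>\<^bsub>T\<^esub> monomial p') r = (\<Sum>a\<in>I. \<Sum>b\<in>I. if b = p' then if a = p then taft_constant N q p p' r else 0 else 0)"
    unfolding taft_simps by (intro sum.cong refl) (simp add: monomial_def)
  also have "\<dots> = taft_constant N q p p' r" using assms by simp
  finally show "(monomial p \<otimes>\<^bsub>T\<^esub> monomial p') r = (if snd p + snd p' < N
     then inverse q ^ (snd p * fst p') \<odot>\<^bsub>T\<^esub> monomial ((fst p + fst p') mod N, snd p + snd p') else \<zero>\<^bsub>T\<^esub>) r"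
    using assms by (simp add: taft_constant_delta taft_simps monomial_def)
qed

lemma g_power: "taft_g [^]\<^bsub>T\<^esub> (k::nat) = monomial (k mod N, 0)"
proof (induction k)
  case (Suc k)
  then show ?case using N_gt by (simp add: monomial_mult mod_simps Suc_eq_plus1[symmetric])
qed (simp add: taft_simps)

lemma x_power: "taft_x [^]\<^bsub>T\<^esub> (k::nat) = (if k < N then monomial (0, k) else \<zero>\<^bsub>T\<^esub>)"
proof (induction k)
  case 0 then show ?case using N_gt by (simp add: taft_simps)
next
  case (Suc k)
  then show ?case using N_gt by (simp add: monomial_mult Suc_eq_plus1[symmetric])
qed

lemma monomial_eq: "i < N \<Longrightarrow> j < N \<Longrightarrow> monomial (i, j) = taft_g [^]\<^bsub>T\<^esub> i \<otimes>\<^bsub>T\<^esub> taft_x [^]\<^bsub>T\<^esub> j"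
  by (simp add: g_power x_power monomial_mult)

lemma x_g: "taft_x \<otimes>\<^bsub>T\<^esub> taft_g = inverse q \<odot>\<^bsub>T\<^esub> (taft_g \<otimes>\<^bsub>T\<^esub> taft_x)"
  using N_gt by (simp add: monomial_mult)

lemma g_order: "taft_g [^]\<^bsub>T\<^esub> N = \<one>\<^bsub>T\<^esub>" by (simp add: g_power taft_simps)

lemma taft_finsum: "finite A \<Longrightarrow> (\<And>i. i \<in> A \<Longrightarrow> f i \<in> carrier T) \<Longrightarrow> finsum T f A = (\<lambda>p. \<Sum>i\<in>A. f i p)"
proof (induction A rule: finite_induct)
  case empty then show ?case by (simp add: taft_simps)
next
  case (insert a A)
  have "finsum T f (insert a A) = f a \<oplus>\<^bsub>T\<^esub> finsum T f A" using insert by (intro T.M.finsum_insert) auto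
  then show ?case using insert by (simp add: taft_simps)
qed

lemma monomial_expansion: "h \<in> carrier T \<Longrightarrow> h = finsum T (\<lambda>p. h p \<odot>\<^bsub>T\<^esub> monomial p) I"
proof -
  assume h: "h \<in> carrier T"
  have "finsum T (\<lambda>p. h p \<odot>\<^bsub>T\<^esub> monomial p) I = (\<lambda>r. \<Sum>p\<in>I. (h p \<odot>\<^bsub>T\<^esub> monomial p) r)"
    by (rule taft_finsum) auto
  also have "\<dots> = (\<lambda>r. \<Sum>p\<in>I. if p = r then h p else 0)"
    by (intro ext sum.cong refl) (auto simp: taft_simps monomial_def)
  also have "\<dots> = h" using h by (auto simp: taft_simps fun_eq_iff)
  finally show ?thesis ..
qed

section \<open>The coproduct of the Taft algebra\<close>

abbreviation "TT \<equiv> tensor_algebra T 2"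
abbreviation "cl \<equiv> tclass T 2"

sublocale TT: complex_algebra TT by (rule T.tensor_algebra_complex_algebra) simp

text \<open>The prospective images of \<open>g\<close> and \<open>x\<close> under the coproduct; the
  Taft relations are verified for them before multiplicativity is proved.\<close>

definition "GG = tensor_sum [[taft_g, taft_g]]"
definition "YY = tensor_sum [[taft_x, taft_g], [\<one>\<^bsub>T\<^esub>, taft_x]]"

lemma pure2_closed [simp]: "a \<in> carrier T \<Longrightarrow> b \<in> carrier T \<Longrightarrow> pure_tensor [a, b] \<in> tensors T 2"
  using pure_tensor_closed[of "[a, b]" T] by (simp add: numeral_2_eq_2)

lemma tensor_one2: "tensor_one T 2 = pure_tensor [\<one>\<^bsub>T\<^esub>, \<one>\<^bsub>T\<^esub>]"
  by (simp add: tensor_one_def numeral_2_eq_2)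

lemma pure2_mult: "pure_tensor [a, b] \<star>\<^bsub>T\<^esub> pure_tensor [c, d] = pure_tensor [a \<otimes>\<^bsub>T\<^esub> c, b \<otimes>\<^bsub>T\<^esub> d]"
  by (simp add: tensor_mult_def pure_tensor_def)

lemma GG_eq: "GG = pure_tensor [taft_g, taft_g]" by (simp add: GG_def tensor_sum_def pure_tensor_def)

lemma GG_closed [simp]: "GG \<in> tensors T 2" by (simp add: GG_eq)

lemma YY_class: "cl YY = cl (pure_tensor [taft_x, taft_g]) \<oplus>\<^bsub>TT\<^esub> cl (pure_tensor [\<one>\<^bsub>T\<^esub>, taft_x])"
  by (simp add: tensor_algebra_add YY_def tensor_sum_def pure_tensor_def)

lemma YY_closed [simp]: "YY \<in> tensors T 2"
proof -
  have "(\<lambda>f. pure_tensor [taft_x, taft_g] f + pure_tensor [\<one>\<^bsub>T\<^esub>, taft_x] f) \<in> tensors T 2"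
    by (intro tensors_add pure2_closed) auto
  then show ?thesis by (simp add: YY_def tensor_sum_def pure_tensor_def)
qed

lemma W_eq: "W (i, j) = (((\<lambda>t. GG \<star>\<^bsub>T\<^esub> t) ^^ i) (tensor_one T 2)) \<star>\<^bsub>T\<^esub> (((\<lambda>t. YY \<star>\<^bsub>T\<^esub> t) ^^ j) (tensor_one T 2))"
  by (simp add: taft_comult_monomial_def Let_def GG_def YY_def tensor_mult_ops_cong[OF taft_ops(1)]
      tensor_one_ops_cong[OF taft_ops(2)] taft_ops(2))

lemma funpow_class:
  assumes "t \<in> tensors T 2"
  shows "((\<lambda>u. t \<star>\<^bsub>T\<^esub> u) ^^ k) (tensor_one T 2) \<in> tensors T 2"
    "cl (((\<lambda>u. t \<star>\<^bsub>T\<^esub> u) ^^ k) (tensor_one T 2)) = cl t [^]\<^bsub>TT\<^esub> k"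
proof (induction k)
  case 0
  show "((\<lambda>u. t \<star>\<^bsub>T\<^esub> u) ^^ 0) (tensor_one T 2) \<in> tensors T 2"
    "cl (((\<lambda>u. t \<star>\<^bsub>T\<^esub> u) ^^ 0) (tensor_one T 2)) = cl t [^]\<^bsub>TT\<^esub> (0::nat)"
    by (simp_all add: tensor_algebra_one)
next
  case (Suc k)
  show "((\<lambda>u. t \<star>\<^bsub>T\<^esub> u) ^^ Suc k) (tensor_one T 2) \<in> tensors T 2"
    using Suc assms by (simp add: T.tensor_mult_closed)
  show "cl (((\<lambda>u. t \<star>\<^bsub>T\<^esub> u) ^^ Suc k) (tensor_one T 2)) = cl t [^]\<^bsub>TT\<^esub> Suc k"
    using Suc assms TT.nat_pow_Suc2[of "cl t" k] by (simp add: T.tensor_algebra_mult[symmetric] del: TT.nat_pow_Suc)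
qed

lemma W_closed [simp]: "W p \<in> tensors T 2"
  by (cases p) (simp add: W_eq T.tensor_mult_closed funpow_class)

lemma W_class: "cl (W (i, j)) = cl GG [^]\<^bsub>TT\<^esub> i \<otimes>\<^bsub>TT\<^esub> cl YY [^]\<^bsub>TT\<^esub> j"
  by (simp add: W_eq T.tensor_algebra_mult[symmetric] funpow_class)

lemma pure2_power:
  assumes "a \<in> carrier T" "b \<in> carrier T"
  shows "cl (pure_tensor [a, b]) [^]\<^bsub>TT\<^esub> (k::nat) = cl (pure_tensor [a [^]\<^bsub>T\<^esub> k, b [^]\<^bsub>T\<^esub> k])"
proof (induction k)
  case 0 then show ?case by (simp add: tensor_algebra_one tensor_one_def numeral_2_eq_2)
next
  case (Suc k)
  then show ?case using assms by (simp add: T.tensor_algebra_mult pure2_mult)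
qed

lemma GG_order: "cl GG [^]\<^bsub>TT\<^esub> N = \<one>\<^bsub>TT\<^esub>"
  by (simp add: GG_eq pure2_power g_order tensor_algebra_one tensor_one2)

lemma GG_power_mod: "cl GG [^]\<^bsub>TT\<^esub> (k mod N) = cl GG [^]\<^bsub>TT\<^esub> k"
proof -
  have "cl GG [^]\<^bsub>TT\<^esub> k = cl GG [^]\<^bsub>TT\<^esub> (N * (k div N)) \<otimes>\<^bsub>TT\<^esub> cl GG [^]\<^bsub>TT\<^esub> (k mod N)"
    by (simp add: TT.nat_pow_mult)
  also have "cl GG [^]\<^bsub>TT\<^esub> (N * (k div N)) = \<one>\<^bsub>TT\<^esub>"
    by (simp add: TT.nat_pow_pow[symmetric] GG_order TT.nat_pow_one)
  finally show ?thesis by simp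
qed

lemma smult_pure2:
  assumes "a \<in> carrier T" "b \<in> carrier T"
  shows "cl (pure_tensor [c \<odot>\<^bsub>T\<^esub> a, b]) = c \<odot>\<^bsub>TT\<^esub> cl (pure_tensor [a, b])"
    "cl (pure_tensor [a, c \<odot>\<^bsub>T\<^esub> b]) = c \<odot>\<^bsub>TT\<^esub> cl (pure_tensor [a, b])"
  using assms unfolding tensor_algebra_smult tclass_eq_iff tensor_eq_def
  by (auto simp: multilinear2_iff linear_form_def pure_tensor_def)

lemma YY_GG: "cl YY \<otimes>\<^bsub>TT\<^esub> cl GG = inverse q \<odot>\<^bsub>TT\<^esub> (cl GG \<otimes>\<^bsub>TT\<^esub> cl YY)"
  unfolding YY_class GG_eq
  by (simp add: TT.l_distr TT.r_distr T.tensor_algebra_mult pure2_mult x_g smult_pure2 TT.smult_add_right)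

text \<open>The summands \<open>x \<otimes> g\<close> and \<open>1 \<otimes> x\<close> q-commute,
  the middle binomials vanish because \<open>q\<close> has order \<open>N\<close>, and the two outer
  terms contain \<open>x\<^sup>N\<close>.\<close>

lemma YY_nilpotent: "cl YY [^]\<^bsub>TT\<^esub> N = \<zero>\<^bsub>TT\<^esub>"
proof -
  let ?a = "cl (pure_tensor [taft_x, taft_g])" and ?b = "cl (pure_tensor [\<one>\<^bsub>T\<^esub>, taft_x])"
  have gx: "taft_g \<otimes>\<^bsub>T\<^esub> taft_x = q \<odot>\<^bsub>T\<^esub> (taft_x \<otimes>\<^bsub>T\<^esub> taft_g)"
    using q_0 by (simp add: x_g T.smult_smult)
  have ab: "?a \<otimes>\<^bsub>TT\<^esub> ?b = q \<odot>\<^bsub>TT\<^esub> (?b \<otimes>\<^bsub>TT\<^esub> ?a)"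
    by (simp add: T.tensor_algebra_mult pure2_mult gx smult_pure2)
  have z: "cl (pure_tensor [a, \<zero>\<^bsub>T\<^esub>]) = \<zero>\<^bsub>TT\<^esub>" "cl (pure_tensor [\<zero>\<^bsub>T\<^esub>, a]) = \<zero>\<^bsub>TT\<^esub>" if "a \<in> carrier T" for a
    using smult_pure2(1)[of "\<zero>\<^bsub>T\<^esub>" a 0] smult_pure2(2)[of a "\<zero>\<^bsub>T\<^esub>" 0] that by simp_all
  have aN: "?a [^]\<^bsub>TT\<^esub> N = \<zero>\<^bsub>TT\<^esub>" "?b [^]\<^bsub>TT\<^esub> N = \<zero>\<^bsub>TT\<^esub>"
    using x_power[of N] by (simp_all add: pure2_power z)
  have "cl YY [^]\<^bsub>TT\<^esub> N = finsum TT (\<lambda>m. qbinomial q N m \<odot>\<^bsub>TT\<^esub> (?b [^]\<^bsub>TT\<^esub> m \<otimes>\<^bsub>TT\<^esub> ?a [^]\<^bsub>TT\<^esub> (N - m))) {..N}"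
    unfolding YY_class by (rule TT.q_binomial_theorem[OF _ _ ab]) auto
  also have "\<dots> = finsum TT (\<lambda>m. \<zero>\<^bsub>TT\<^esub>) {..N}"
  proof (intro TT.M.finsum_cong' refl)
    fix m assume "m \<in> {..N}"
    then consider "m = 0" | "0 < m" "m < N" | "m = N" by fastforce
    then show "qbinomial q N m \<odot>\<^bsub>TT\<^esub> (?b [^]\<^bsub>TT\<^esub> m \<otimes>\<^bsub>TT\<^esub> ?a [^]\<^bsub>TT\<^esub> (N - m)) = \<zero>\<^bsub>TT\<^esub>"
      by cases (simp_all add: aN qbinomial_vanish[OF root N_gt])
  qed auto
  finally show ?thesis by simp
qed

lemma YY_power_big: "k \<ge> N \<Longrightarrow> cl YY [^]\<^bsub>TT\<^esub> k = \<zero>\<^bsub>TT\<^esub>"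
proof -
  assume "k \<ge> N"
  then have "cl YY [^]\<^bsub>TT\<^esub> k = cl YY [^]\<^bsub>TT\<^esub> N \<otimes>\<^bsub>TT\<^esub> cl YY [^]\<^bsub>TT\<^esub> (k - N)" by (simp add: TT.nat_pow_mult)
  then show ?thesis by (simp add: YY_nilpotent)
qed

lemma YY_GG_power: "cl YY [^]\<^bsub>TT\<^esub> j \<otimes>\<^bsub>TT\<^esub> cl GG [^]\<^bsub>TT\<^esub> k =
    inverse q ^ (j * k) \<odot>\<^bsub>TT\<^esub> (cl GG [^]\<^bsub>TT\<^esub> k \<otimes>\<^bsub>TT\<^esub> cl YY [^]\<^bsub>TT\<^esub> j)"
proof -
  have 1: "cl YY \<otimes>\<^bsub>TT\<^esub> cl GG [^]\<^bsub>TT\<^esub> k = inverse q ^ k \<odot>\<^bsub>TT\<^esub> (cl GG [^]\<^bsub>TT\<^esub> k \<otimes>\<^bsub>TT\<^esub> cl YY)" for k :: nat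
  proof (induction k)
    case (Suc k)
    have "cl YY \<otimes>\<^bsub>TT\<^esub> cl GG [^]\<^bsub>TT\<^esub> Suc k = (cl YY \<otimes>\<^bsub>TT\<^esub> cl GG [^]\<^bsub>TT\<^esub> k) \<otimes>\<^bsub>TT\<^esub> cl GG"
      by (simp add: TT.m_assoc)
    also have "\<dots> = inverse q ^ k \<odot>\<^bsub>TT\<^esub> (cl GG [^]\<^bsub>TT\<^esub> k \<otimes>\<^bsub>TT\<^esub> (cl YY \<otimes>\<^bsub>TT\<^esub> cl GG))"
      by (simp add: Suc TT.smult_mult_left TT.m_assoc)
    finally show ?case by (simp add: YY_GG TT.smult_mult_right TT.smult_smult TT.m_assoc mult.commute)
  qed simp
  show ?thesis
  proof (induction j)
    case (Suc j)
    have "cl YY [^]\<^bsub>TT\<^esub> Suc j \<otimes>\<^bsub>TT\<^esub> cl GG [^]\<^bsub>TT\<^esub> k = cl YY [^]\<^bsub>TT\<^esub> j \<otimes>\<^bsub>TT\<^esub> (cl YY \<otimes>\<^bsub>TT\<^esub> cl GG [^]\<^bsub>TT\<^esub> k)"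
      by (simp add: TT.m_assoc)
    also have "\<dots> = inverse q ^ k \<odot>\<^bsub>TT\<^esub> ((cl YY [^]\<^bsub>TT\<^esub> j \<otimes>\<^bsub>TT\<^esub> cl GG [^]\<^bsub>TT\<^esub> k) \<otimes>\<^bsub>TT\<^esub> cl YY)"
      by (simp add: 1 TT.smult_mult_right TT.m_assoc)
    finally show ?case by (simp add: Suc TT.smult_mult_left TT.smult_smult TT.m_assoc power_add mult.commute)
  qed simp
qed

text \<open>\<open>GG\<close> and \<open>YY\<close> satisfy the Taft relations, so the images of the
  monomials multiply with the same structure constants. Multiplicativity of the coproduct is a
  consequence.\<close>

lemma W_mult:
  assumes "p \<in> I" "p' \<in> I" "multilinear T 2 f"
  shows "(W p \<star>\<^bsub>T\<^esub> W p') f = (\<Sum>r\<in>I. taft_constant N q p p' r * W r f)"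
proof -
  obtain i j k l where p: "p = (i, j)" "p' = (k, l)" by (cases p; cases p')
  let ?c = "if j + l < N then inverse q ^ (j * k) else 0" and ?r = "((i + k) mod N, j + l)"
  have "cl (W p \<star>\<^bsub>T\<^esub> W p') = cl GG [^]\<^bsub>TT\<^esub> i \<otimes>\<^bsub>TT\<^esub> (cl YY [^]\<^bsub>TT\<^esub> j \<otimes>\<^bsub>TT\<^esub> cl GG [^]\<^bsub>TT\<^esub> k) \<otimes>\<^bsub>TT\<^esub> cl YY [^]\<^bsub>TT\<^esub> l"
    by (simp add: T.tensor_algebra_mult[symmetric] W_class p TT.m_assoc)
  also have "\<dots> = inverse q ^ (j * k) \<odot>\<^bsub>TT\<^esub> ((cl GG [^]\<^bsub>TT\<^esub> i \<otimes>\<^bsub>TT\<^esub> cl GG [^]\<^bsub>TT\<^esub> k) \<otimes>\<^bsub>TT\<^esub> (cl YY [^]\<^bsub>TT\<^esub> j \<otimes>\<^bsub>TT\<^esub> cl YY [^]\<^bsub>TT\<^esub> l))"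
    by (simp add: YY_GG_power TT.smult_mult_right TT.smult_mult_left TT.m_assoc)
  also have "\<dots> = ?c \<odot>\<^bsub>TT\<^esub> cl (W ?r)"
    by (simp add: TT.nat_pow_mult W_class GG_power_mod YY_power_big)
  finally have "(W p \<star>\<^bsub>T\<^esub> W p') f = ?c * W ?r f"
    using assms(3) by (simp add: tensor_algebra_smult tclass_eq_iff tensor_eq_def)
  moreover have "(\<Sum>r\<in>I. taft_constant N q p p' r * W r f) = (\<Sum>r\<in>I. if r = ?r then ?c * W ?r f else 0)"
    using assms by (intro sum.cong refl) (simp add: taft_constant_delta p)
  moreover have "(\<Sum>r\<in>I. if r = ?r then ?c * W ?r f else 0) = ?c * W ?r f"
    using N_gt by simp
  ultimately show ?thesis by simp
qed

lemma taft_pre_bialgebra: "pre_bialgebra T"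
proof (intro pre_bialgebra.intro pre_bialgebra_axioms.intro)
  show "complex_algebra T" by (rule taft_complex_algebra)
  fix h h' c assume h: "h \<in> carrier T"
  show "comult T h \<in> tensors T 2"
    unfolding taft_simps by (intro tensors_sum T.tensors_smult) auto
  show "tensor_eq T 2 (comult T (c \<odot>\<^bsub>T\<^esub> h)) (\<lambda>f. c * comult T h f)"
    by (simp add: taft_simps tensor_eq_def sum_distrib_left mult.assoc)
  show "counit T (c \<odot>\<^bsub>T\<^esub> h) = c * counit T h" by (simp add: taft_simps sum_distrib_left)
  assume h': "h' \<in> carrier T"
  show "tensor_eq T 2 (comult T (h \<oplus>\<^bsub>T\<^esub> h')) (\<lambda>f. comult T h f + comult T h' f)"
    by (simp add: taft_simps tensor_eq_def sum.distrib distrib_right)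
  show "counit T (h \<oplus>\<^bsub>T\<^esub> h') = counit T h + counit T h'" by (simp add: taft_simps sum.distrib)
  show "tensor_eq T 2 (comult T (h \<otimes>\<^bsub>T\<^esub> h')) (comult T h \<star>\<^bsub>T\<^esub> comult T h')"
    unfolding tensor_eq_def
  proof (intro allI impI)
    fix f assume f: "multilinear T 2 f"
    have ml: "multilinear T 2 (\<lambda>xs. W p (\<lambda>ys. f (map2 (\<otimes>\<^bsub>T\<^esub>) xs ys)))" for p
      by (rule T.tensor_mult_multilinear[OF W_closed f])
    have "(comult T h \<star>\<^bsub>T\<^esub> comult T h') f =
       (\<Sum>p\<in>I. h p * W p (\<lambda>xs. \<Sum>p'\<in>I. h' p' * W p' (\<lambda>ys. f (map2 (\<otimes>\<^bsub>T\<^esub>) xs ys))))"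
      by (simp add: tensor_mult_def taft_simps(7))
    also have "\<dots> = (\<Sum>p\<in>I. h p * (\<Sum>p'\<in>I. h' p' * (W p \<star>\<^bsub>T\<^esub> W p') f))"
      by (simp add: tensors_apply_sum[OF W_closed] tensors_apply_times[OF W_closed] multilinear_times ml tensor_mult_def)
    also have "\<dots> = (\<Sum>p\<in>I. \<Sum>p'\<in>I. \<Sum>r\<in>I. h p * h' p' * taft_constant N q p p' r * W r f)"
      using f by (simp add: W_mult sum_distrib_left mult.assoc)
    also have "\<dots> = (\<Sum>p\<in>I. \<Sum>r\<in>I. \<Sum>p'\<in>I. h p * h' p' * taft_constant N q p p' r * W r f)"
      by (intro sum.cong refl sum.swap)
    also have "\<dots> = (\<Sum>r\<in>I. \<Sum>p\<in>I. \<Sum>p'\<in>I. h p * h' p' * taft_constant N q p p' r * W r f)"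
      by (rule sum.swap)
    also have "\<dots> = comult T (h \<otimes>\<^bsub>T\<^esub> h') f"
      by (simp add: taft_simps sum_distrib_right)
    finally show "comult T (h \<otimes>\<^bsub>T\<^esub> h') f = (comult T h \<star>\<^bsub>T\<^esub> comult T h') f" ..
  qed
  have s0: "(\<Sum>p\<in>I. if snd p = 0 then u p else 0) = (\<Sum>i<N. u (i, 0))" for u :: "nat \<times> nat \<Rightarrow> complex"
  proof -
    have "(\<Sum>p\<in>I. if snd p = 0 then u p else 0) = (\<Sum>i<N. \<Sum>j<N. if j = 0 then u (i, 0) else 0)"
      unfolding sum.cartesian_product by (intro sum.cong refl) auto
    then show ?thesis using N_gt by simp
  qed
  have "counit T (h \<otimes>\<^bsub>T\<^esub> h') = (\<Sum>m<N. \<Sum>p\<in>I. \<Sum>p'\<in>I. h p * h' p' * taft_constant N q p p' (m, 0))"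
    by (simp add: taft_simps)
  also have "\<dots> = (\<Sum>p\<in>I. \<Sum>m<N. \<Sum>p'\<in>I. h p * h' p' * taft_constant N q p p' (m, 0))" by (rule sum.swap)
  also have "\<dots> = (\<Sum>p\<in>I. \<Sum>p'\<in>I. \<Sum>m<N. h p * h' p' * taft_constant N q p p' (m, 0))"
    by (intro sum.cong refl sum.swap)
  also have "\<dots> = (\<Sum>p\<in>I. \<Sum>p'\<in>I. (if snd p = 0 then h p else 0) * (if snd p' = 0 then h' p' else 0))"
  proof (intro sum.cong refl)
    fix p p' assume "p \<in> I" "p' \<in> I"
    have "(\<Sum>m<N. h p * h' p' * taft_constant N q p p' (m, 0)) =
      (\<Sum>m<N. if m = (fst p + fst p') mod N then (if snd p = 0 then h p else 0) * (if snd p' = 0 then h' p' else 0) else 0)"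
      using N_gt by (intro sum.cong refl) (auto simp: taft_constant_def)
    also have "\<dots> = (if snd p = 0 then h p else 0) * (if snd p' = 0 then h' p' else 0)" using N_gt by simp
    finally show "(\<Sum>m<N. h p * h' p' * taft_constant N q p p' (m, 0)) = (if snd p = 0 then h p else 0) * (if snd p' = 0 then h' p' else 0)" .
  qed
  also have "\<dots> = counit T h * counit T h'"
    by (simp only: sum_product[symmetric] s0 taft_simps)
  finally show "counit T (h \<otimes>\<^bsub>T\<^esub> h') = counit T h * counit T h'" .
next
  have m: "comult T (monomial p) f = W p f" if "p \<in> I" for p f
  proof -
    have "comult T (monomial p) f = (\<Sum>p'\<in>I. if p' = p then W p f else 0)"
      unfolding taft_simps by (intro sum.cong refl) (auto simp: monomial_def)
    then show ?thesis using that by simp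
  qed
  have "cl (W (0, 0)) = cl (tensor_one T 2)" by (simp add: W_class tensor_algebra_one[symmetric])
  then show "tensor_eq T 2 (comult T \<one>\<^bsub>T\<^esub>) (tensor_one T 2)"
    using N_gt by (simp add: tclass_eq_iff tensor_eq_def m taft_simps(3))
  show "counit T \<one>\<^bsub>T\<^esub> = 1" using N_gt by (simp add: taft_simps monomial_def if_distrib cong: if_cong)
qed

sublocale T: pre_bialgebra T by (rule taft_pre_bialgebra)

lemma comult_monomial: "p \<in> I \<Longrightarrow> comult T (monomial p) f = W p f"
proof -
  assume p: "p \<in> I"
  have "comult T (monomial p) f = (\<Sum>p'\<in>I. if p' = p then W p f else 0)"
    unfolding taft_simps by (intro sum.cong refl) (auto simp: monomial_def)
  then show ?thesis using p by simp
qed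

abbreviation "ee \<equiv> idem T N taft_g q"

lemma comult_g: "tensor_eq T 2 (comult T taft_g) (pure_tensor [taft_g, taft_g])"
proof -
  have "cl (W (1, 0)) = cl GG" by (simp add: W_class TT.nat_pow_eone)
  then show ?thesis using N_gt by (simp add: tclass_eq_iff GG_eq tensor_eq_def comult_monomial)
qed

lemma comult_taft_x: "tensor_eq T 2 (comult T taft_x) YY"
proof -
  have "cl (W (0, 1)) = cl YY" by (simp add: W_class TT.nat_pow_eone)
  then show ?thesis using N_gt by (simp add: tclass_eq_iff tensor_eq_def comult_monomial)
qed

lemma taft_weight_system: "weight_system T N ee"
  by (rule T.weight_system_idem[OF g_closed g_order root comult_g])
    (use N_gt in \<open>simp add: taft_simps monomial_def\<close>)

sublocale T: weight_system T N ee by (rule taft_weight_system)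

lemma g_expansion: "taft_g = finsum T (\<lambda>i. (q ^ i) \<odot>\<^bsub>T\<^esub> ee i) {..<N}"
  using T.power_idem_expansion[OF g_closed g_order root N_gt] by (simp add: TT.nat_pow_eone T.nat_pow_eone)

lemma x_idem: "taft_x \<otimes>\<^bsub>T\<^esub> ee i = ee (Suc i) \<otimes>\<^bsub>T\<^esub> taft_x"
  by (rule T.skew_idem) (simp_all add: x_g)

text \<open>Insertion of \<open>g = \<Sum> q\<^sup>j e\<^sub>j\<close> and
  \<open>1 = \<Sum> e\<^sub>i\<close> into \<open>x \<otimes> g + 1 \<otimes> x\<close> gives the
  constants; a Hopf algebra has associator 1.\<close>

lemma taft_shift_system: "shift_system T N ee taft_x (\<lambda>i j. q ^ j) (\<lambda>i j. 1) (\<lambda>i j k. 1)"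
proof (intro shift_system.intro shift_system_axioms.intro)
  show "weight_system T N ee" by (rule taft_weight_system)
  show "tensor_eq T 2 (comult T taft_x) (skew2 T N ee taft_x (\<lambda>i j. q ^ j) (\<lambda>i j. 1))"
  proof (rule tensor_eq_trans[OF comult_taft_x], unfold tensor_eq_def, intro allI impI)
    fix f assume f: "multilinear T 2 f"
    have l: "linear_form T (\<lambda>x. f [x, y])" "linear_form T (\<lambda>x. f [y, x])" if "y \<in> carrier T" for y
      using f that by (auto simp: multilinear2_iff)
    have x: "taft_x = finsum T (\<lambda>i. taft_x \<otimes>\<^bsub>T\<^esub> ee i) {..<N}"
      using T.finsum_rdistr[of "{..<N}" taft_x ee] T.e_sum by simp
    have fx: "f [taft_x, y] = (\<Sum>i<N. f [taft_x \<otimes>\<^bsub>T\<^esub> ee i, y])" "f [y, taft_x] = (\<Sum>i<N. f [y, taft_x \<otimes>\<^bsub>T\<^esub> ee i])"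
      if "y \<in> carrier T" for y
      using T.linear_form_finsum[OF l(1)[OF that], of "{..<N}" "\<lambda>i. taft_x \<otimes>\<^bsub>T\<^esub> ee i"]
        T.linear_form_finsum[OF l(2)[OF that], of "{..<N}" "\<lambda>i. taft_x \<otimes>\<^bsub>T\<^esub> ee i"] x by auto
    have fg: "f [y, taft_g] = (\<Sum>j<N. q ^ j * f [y, ee j])" if "y \<in> carrier T" for y
      using T.linear_form_finsum[OF l(2)[OF that], of "{..<N}" "\<lambda>i. (q ^ i) \<odot>\<^bsub>T\<^esub> ee i"] l[OF that] g_expansion
      by (simp add: linear_form_def)
    have f1: "f [\<one>\<^bsub>T\<^esub>, y] = (\<Sum>j<N. f [ee j, y])" if "y \<in> carrier T" for y
      using T.linear_form_finsum[OF l(1)[OF that], of "{..<N}" ee] T.e_sum by simp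
    have "YY f = f [taft_x, taft_g] + f [\<one>\<^bsub>T\<^esub>, taft_x]" by (simp add: YY_def tensor_sum_def)
    also have "f [taft_x, taft_g] = (\<Sum>i<N. \<Sum>j<N. q ^ j * f [taft_x \<otimes>\<^bsub>T\<^esub> ee i, ee j])"
      unfolding fx(1)[OF g_closed] by (simp add: fg)
    also have "f [\<one>\<^bsub>T\<^esub>, taft_x] = (\<Sum>i<N. \<Sum>j<N. f [ee i, taft_x \<otimes>\<^bsub>T\<^esub> ee j])"
      unfolding f1[OF x_closed] by (simp add: fx(2))
    finally show "YY f = skew2 T N ee taft_x (\<lambda>i j. q ^ j) (\<lambda>i j. 1) f"
      by (simp add: skew2_def sum.distrib)
  qed
  have a: "associator T = tensor_one T 3"
    by (simp add: taft_simps(9) tensor_one_ops_cong[OF taft_ops(2)])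
  show "associator T \<in> tensors T 3" "tensor_eq T 3 (associator T) (diag3 N ee (\<lambda>i j k. 1))"
    unfolding a using T.diag3_one by auto
  show "counit T taft_x = 0" using N_gt by (simp add: taft_simps(8) monomial_def)
qed (use x_idem in auto)

end

section \<open>The algebras A(q)\<close>

lemma twist_simps [simp]:
  "carrier (twist H J) = carrier H" "monoid.mult (twist H J) = monoid.mult H"
  "monoid.one (twist H J) = monoid.one H" "\<zero>\<^bsub>twist H J\<^esub> = \<zero>\<^bsub>H\<^esub>"
  "ring.add (twist H J) = ring.add H" "module.smult (twist H J) = module.smult H"
  "counit (twist H J) = counit H"
  by (simp_all add: twist_def)

lemma finsum_ops_cong:
  assumes "carrier K = carrier H" "ring.add K = ring.add H" "\<zero>\<^bsub>K\<^esub> = \<zero>\<^bsub>H\<^esub>"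
  shows "finsum K = finsum H"
  by (intro ext) (simp add: finsum_def finprod_def assms)

text \<open>The Taft constants \<open>q\<^sup>j\<close>, 1, 1 after twisting by \<open>J\<close>.
  Divisions by \<open>n\<close> are carries: \<open>A_beta\<close> can differ from 1 only if
  \<open>j\<close> has residue \<open>n - 1\<close>, and \<open>A_omega\<close> only if the residues
  of \<open>j\<close> and \<open>k\<close> add up to at least \<open>n\<close>.\<close>

definition A_alpha :: "nat \<Rightarrow> complex \<Rightarrow> nat \<Rightarrow> nat \<Rightarrow> complex" where
  "A_alpha n q i j = q ^ (j mod n)"
definition A_beta :: "nat \<Rightarrow> complex \<Rightarrow> nat \<Rightarrow> nat \<Rightarrow> complex" where
  "A_beta n q i j = inverse (q ^ n) ^ (i * ((j mod n + 1) div n))"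
definition A_omega :: "nat \<Rightarrow> complex \<Rightarrow> nat \<Rightarrow> nat \<Rightarrow> nat \<Rightarrow> complex" where
  "A_omega n R i j k = inverse R ^ (i * ((j mod n + k mod n) div n))"

lemma sum_mod_blocks:
  fixes g :: "nat \<Rightarrow> nat \<Rightarrow> complex"
  assumes "n > 0"
  shows "(\<Sum>i<n. \<Sum>z<N. if z mod n = i then g i z else 0) = (\<Sum>z<N. g (z mod n) z)"
proof -
  have "(\<Sum>i<n. \<Sum>z<N. if z mod n = i then g i z else 0) = (\<Sum>z<N. \<Sum>i<n. if z mod n = i then g i z else 0)"
    by (rule sum.swap)
  also have "\<dots> = (\<Sum>z<N. g (z mod n) z)" using assms by (intro sum.cong refl) simp
  finally show ?thesis .
qed

locale A_root =
  fixes n :: nat and q :: complex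
  assumes root: "primitive_root_of_unity (n\<^sup>2) q" and n_gt: "n > 1"
begin

abbreviation "N \<equiv> n\<^sup>2"

sublocale taft_root N q
proof
  show "primitive_root_of_unity N q" by (rule root)
  have "1 * 1 < n * n" using n_gt by (intro mult_strict_mono) auto
  then show "N > 1" by (simp add: power2_eq_square)
qed

text \<open>The coefficients of \<open>J\<close>, with \<open>y - y'\<close> written as
  \<open>n * (y div n)\<close>.\<close>

definition F :: "nat \<Rightarrow> nat \<Rightarrow> complex" where
  "F z y = inverse q ^ (z * (n * (y div n)))"

lemma F_nonzero: "F z y \<noteq> 0" using q_0 by (simp add: F_def)

lemma A_twist_eq: "A_twist n q = diag2 N ee F"
proof -
  have "q powi (- (int z * (int y - int (y mod n)))) = F z y" for z y
  proof -
    have e: "int z * (int y - int (y mod n)) = int (z * (n * (y div n)))"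
    proof -
      have "int y = int (y mod n) + int (n * (y div n))" by (metis mod_mult_div_eq of_nat_add)
      then show ?thesis by simp
    qed
    show ?thesis unfolding e by (simp add: F_def power_int_minus power_inverse del: of_nat_mult)
  qed
  then show ?thesis by (simp add: A_twist_def diag2_def)
qed

abbreviation "J \<equiv> diag2 N ee F"
abbreviation "TJ \<equiv> twist T J"

lemma inverse_q_mod': "inverse q ^ ((i mod N) * k) = inverse q ^ (i * k)"
  using inverse_q_mod[of k i] by (simp add: mult.commute)

lemma inverse_qn_mod: "inverse (q ^ n) ^ ((i mod n) * k) = inverse (q ^ n) ^ (i * k)"
proof -
  have "(q ^ n) ^ (i mod n) = (q ^ n) ^ i"
    using primitive_root_power_mod[OF primitive_root_power[OF root]] n_gt by simp
  then show ?thesis by (simp add: power_mult power_inverse)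
qed

text \<open>Shifting \<open>i\<close> by one multiplies \<open>F\<close> by \<open>q\<close> to the
  power \<open>- n * (j div n)\<close>, which removes the multiple of \<open>n\<close> from the
  exponent in \<open>q\<^sup>j\<close>. This is the purpose of \<open>J\<close>: constants depending
  on residues modulo \<open>n\<close> make sense for the subalgebra generated by
  \<open>g\<^sup>n\<close> and \<open>x\<close>.\<close>

lemma alpha_J: "F (Suc i mod N) j * q ^ j / F i j = A_alpha n q i j"
proof -
  let ?m = "n * (j div n)"
  have "q ^ j = q ^ (j mod n + ?m)" by simp
  then have 1: "q ^ j = q ^ (j mod n) * q ^ ?m" by (simp only: power_add)
  have 2: "F (Suc i mod N) j = inverse q ^ ?m * F i j"
    unfolding F_def inverse_q_mod' mult_Suc power_add ..
  have 3: "inverse q ^ ?m * q ^ ?m = 1" using q_0 by (simp add: power_mult_distrib[symmetric])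
  have "F (Suc i mod N) j * q ^ j / F i j = (inverse q ^ ?m * q ^ ?m) * q ^ (j mod n) * (F i j / F i j)"
    unfolding 1 2 by (simp only: mult_ac times_divide_eq_right)
  then show ?thesis unfolding 3 using F_nonzero by (simp add: A_alpha_def)
qed

lemma div_carry: "(j + k) div n = j div n + k div n + (j mod n + k mod n) div (n::nat)"
  by (rule div_add1_eq)

text \<open>A full period in the second index changes the exponent by a multiple of
  \<open>N\<close>, so sums of indices may be inserted unreduced.\<close>

lemma F_mod_right: "F i (k mod N) = F i k"
proof -
  have "n * (k div n) = n * ((k mod N) div n) + N * (k div N)"
  proof -
    have "k = k mod N + n * (n * (k div N))"
      by (metis mod_mult_div_eq mult.assoc power2_eq_square)
    then have "k div n = (k mod N) div n + n * (k div N)" using n_gt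
      by (metis add.commute div_mult_self2 less_nat_zero_code not_one_less_zero)
    then show ?thesis by (simp add: algebra_simps power2_eq_square)
  qed
  then have "F i k = F i (k mod N) * inverse q ^ (N * (i * (k div N)))"
    by (simp add: F_def power_add[symmetric] algebra_simps)
  moreover have "inverse q ^ (N * (i * (k div N))) = 1"
    using inverse_q_mod'[of N "i * (k div N)"] by simp
  ultimately show ?thesis by simp
qed

text \<open>In the quotient only the carry of \<open>j + 1\<close> past a multiple of
  \<open>n\<close> survives.\<close>

lemma beta_J: "F i (Suc j mod N) * 1 / F i j = A_beta n q i j"
proof -
  have "(Suc j) div n = j div n + (j mod n + 1) div n"
    using div_carry[of j 1] n_gt unfolding Suc_eq_plus1 by simp
  then have "F i (Suc j mod N) = F i j * inverse q ^ (i * (n * ((j mod n + 1) div n)))"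
    unfolding F_mod_right by (simp add: F_def power_add[symmetric] algebra_simps)
  moreover have "inverse q ^ (i * (n * ((j mod n + 1) div n))) = inverse (q ^ n) ^ (i * ((j mod n + 1) div n))"
    by (simp add: power_inverse power_mult[symmetric] algebra_simps)
  ultimately show ?thesis using F_nonzero by (simp add: A_beta_def)
qed


text \<open>\<open>div n\<close> is additive up to a carry, and that carry is all that remains of
  the coboundary of \<open>F\<close>.\<close>

lemma omega_J:
  "F j k * F i ((j + k) mod N) * 1 * (1 / F ((i + j) mod N) k) * (1 / F i j) = A_omega n (q ^ n) i j k"
proof -
  have "F ((i + j) mod N) k = F (i + j) k" by (simp add: F_def inverse_q_mod')
  moreover have "F j k * F i (j + k) = F (i + j) k * F i j * inverse q ^ (i * (n * ((j mod n + k mod n) div n)))"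
    unfolding F_def div_carry[of j k] by (simp add: power_add[symmetric] algebra_simps)
  moreover have "inverse q ^ (i * (n * ((j mod n + k mod n) div n))) = A_omega n (q ^ n) i j k"
    by (simp add: A_omega_def power_inverse power_mult[symmetric] algebra_simps)
  ultimately show ?thesis using F_nonzero unfolding F_mod_right by (simp add: field_simps)
qed

lemma TJ_shift_system: "shift_system TJ N ee taft_x (A_alpha n q) (A_beta n q) (A_omega n (q ^ n))"
proof -
  interpret S: shift_system T N ee taft_x "\<lambda>i j. q ^ j" "\<lambda>i j. 1" "\<lambda>i j k. 1" by (rule taft_shift_system)
  have "twist3 N F (\<lambda>i j k. 1) = A_omega n (q ^ n)"
    by (intro ext) (simp add: twist3_def omega_J[simplified])
  then show ?thesis using S.twist_shift_system[of F, OF F_nonzero] alpha_J beta_J by simp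
qed

sublocale TJ: shift_system TJ N ee taft_x "A_alpha n q" "A_beta n q" "A_omega n (q ^ n)"
  by (rule TJ_shift_system)

section \<open>The subalgebra generated by the n-th power of g and by x\<close>

abbreviation "gn \<equiv> taft_g [^]\<^bsub>T\<^esub> n"
abbreviation "gens \<equiv> {gn, taft_x}"
abbreviation "S \<equiv> generated_subalgebra T gens"
abbreviation "A \<equiv> A_algebra n q"

lemma A_eq: "A = restrict_quasi_hopf TJ S"
  by (simp add: A_algebra_def Let_def A_twist_eq)

lemma S_T: "h \<in> S \<Longrightarrow> h \<in> carrier T"
  by (induction rule: generated_subalgebra.induct) auto

text \<open>Together with \<open>S_I\<close> this identifies the generated subalgebra with the
  vectors supported on exponents of \<open>g\<close> divisible by \<open>n\<close>, which provides
  the linear projection in \<open>A_retract\<close>.\<close>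

lemma S_support: "h \<in> S \<Longrightarrow> \<not> n dvd fst p \<Longrightarrow> h p = 0"
proof (induction arbitrary: p rule: generated_subalgebra.induct)
  case (incl x)
  have "n mod N = n" using n_gt by (simp add: power2_eq_square)
  then have "x = monomial (n, 0) \<or> x = taft_x" using incl by (auto simp: g_power)
  then show ?case using incl by (auto simp: monomial_def)
next
  case (mult x y)
  have "taft_constant N q a b p = 0" if "n dvd fst a" "n dvd fst b" for a b
  proof -
    have "n dvd (fst a + fst b) mod N" using that by (simp add: dvd_mod power2_eq_square)
    then show ?thesis using mult by (auto simp: taft_constant_def)
  qed
  then have z: "x a * y b * taft_constant N q a b p = 0" for a b
    using mult.IH by (cases "n dvd fst a"; cases "n dvd fst b") auto
  show ?case unfolding taft_simps by (intro sum.neutral ballI z)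
qed (auto simp: taft_simps monomial_def)

lemma monomial_S: "i < n \<Longrightarrow> j < N \<Longrightarrow> monomial (n * i, j) \<in> S"
proof -
  assume ij: "i < n" "j < N"
  have p: "z [^]\<^bsub>T\<^esub> (k::nat) \<in> S" if "z \<in> gens" for z k
    using that by (induction k) (auto intro: generated_subalgebra.intros)
  have "n * i < N" using ij n_gt by (simp add: power2_eq_square)
  then have "monomial (n * i, j) = gn [^]\<^bsub>T\<^esub> i \<otimes>\<^bsub>T\<^esub> taft_x [^]\<^bsub>T\<^esub> j"
    using ij by (simp add: monomial_eq T.nat_pow_pow)
  then show ?thesis using p by (auto intro: generated_subalgebra.intros)
qed

lemma S_finsum: "finite B \<Longrightarrow> (\<And>b. b \<in> B \<Longrightarrow> f b \<in> S) \<Longrightarrow> finsum T f B \<in> S"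
proof (induction B rule: finite_induct)
  case empty
  have "0 \<odot>\<^bsub>T\<^esub> \<one>\<^bsub>T\<^esub> \<in> S" by (intro generated_subalgebra.intros)
  then show ?case by simp
next
  case (insert b B)
  then have "f \<in> insert b B \<rightarrow> carrier T" using S_T by auto
  then show ?case using insert by (auto simp: Pi_def intro: generated_subalgebra.intros)
qed

lemma S_I: "h \<in> carrier T \<Longrightarrow> (\<And>p. \<not> n dvd fst p \<Longrightarrow> h p = 0) \<Longrightarrow> h \<in> S"
proof -
  assume h: "h \<in> carrier T" "\<And>p. \<not> n dvd fst p \<Longrightarrow> h p = 0"
  have "h p \<odot>\<^bsub>T\<^esub> monomial p \<in> S" if "p \<in> I" for p
  proof (cases "n dvd fst p")
    case True
    then obtain i where "fst p = n * i" by blast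
    moreover have "i < n" using that \<open>fst p = n * i\<close> n_gt by (auto simp: power2_eq_square)
    ultimately show ?thesis using monomial_S[of i "snd p"] that
      by (cases p) (auto intro: generated_subalgebra.intros)
  next
    case False
    have "0 \<odot>\<^bsub>T\<^esub> \<one>\<^bsub>T\<^esub> \<in> S" by (intro generated_subalgebra.intros)
    then show ?thesis using h(2)[OF False] that by simp
  qed
  then show "h \<in> S" using S_finsum[of I "\<lambda>p. h p \<odot>\<^bsub>T\<^esub> monomial p"] monomial_expansion[OF h(1)] by auto
qed

lemma A_retract: "retract A TJ (\<lambda>h p. if n dvd fst p then h p else 0)"
  unfolding A_eq
proof (rule TJ.restrict_retract)
  show "S \<subseteq> carrier TJ" using S_T by auto
  show "(\<lambda>h p. if n dvd fst p then h p else 0) \<in> carrier TJ \<rightarrow> S"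
    by (intro funcsetI S_I) (auto simp: taft_simps(1))
  show "(\<lambda>p. if n dvd fst p then h p else 0) = h" if "h \<in> S" for h
    using S_support[OF that] by auto
qed (auto intro: generated_subalgebra.intros simp: taft_simps(5,6) fun_eq_iff
    simp del: One_nat_def intro: generated_subalgebra.add[of _ T, unfolded taft_simps(5)] generated_subalgebra.smult[of _ T, unfolded taft_simps(6)])

sublocale R: retract A TJ "\<lambda>h p. if n dvd fst p then h p else 0" by (rule A_retract)
sublocale A: complex_algebra A by (rule R.K)

lemma A_carrier: "carrier A = S" by (simp add: A_eq)
lemma A_ops: "monoid.mult A = monoid.mult T" "monoid.one A = monoid.one T" "\<zero>\<^bsub>A\<^esub> = \<zero>\<^bsub>T\<^esub>"
  "ring.add A = ring.add T" "module.smult A = module.smult T" "counit A = counit T"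
  by (simp_all add: A_eq)

abbreviation "E \<equiv> idem A n gn (q ^ n)"

lemma T_pow: "z [^]\<^bsub>A\<^esub> (k::nat) = z [^]\<^bsub>T\<^esub> k" by (simp add: nat_pow_def A_ops)

lemma gn_A: "gn \<in> carrier A" "taft_x \<in> carrier A"
  by (auto simp: A_carrier intro: generated_subalgebra.intros)

lemma gn_order: "gn [^]\<^bsub>A\<^esub> n = \<one>\<^bsub>A\<^esub>"
proof -
  have "gn [^]\<^bsub>T\<^esub> n = taft_g [^]\<^bsub>T\<^esub> (n * n)" by (simp add: T.nat_pow_pow)
  also have "\<dots> = taft_g [^]\<^bsub>T\<^esub> N" by (simp only: power2_eq_square)
  finally show ?thesis by (simp add: T_pow A_ops g_order)
qed

lemma root_n: "primitive_root_of_unity n (q ^ n)" using primitive_root_power[OF root] n_gt by simp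

lemma E_closed: "E i \<in> carrier A"
  unfolding idem_def using gn_A by (intro A.M.finsum_closed) auto

lemma T_finsum: "finite B \<Longrightarrow> (\<And>b. b \<in> B \<Longrightarrow> f b \<in> carrier A) \<Longrightarrow> finsum A f B = finsum T f B"
  using R.finsum_eq[of B f] by (simp add: Pi_def finsum_ops_cong[of TJ T])

text \<open>\<open>g\<^sup>n\<close> acts on \<open>e\<^sub>z\<close> by the \<open>z\<close>-th
  power of \<open>q\<^sup>n\<close>, so its idempotent for \<open>i\<close> collects all
  \<open>z\<close> congruent to \<open>i\<close> modulo \<open>n\<close>.\<close>

lemma E_eq: "E i = finsum T (\<lambda>z. if z mod n = i mod n then ee z else \<zero>\<^bsub>T\<^esub>) {..<N}"
proof -
  let ?c = "\<lambda>k z. inverse (q ^ n) ^ (i * k) / of_nat n * q ^ (z * (n * k))"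
  have "E i = finsum T (\<lambda>k. (inverse (q ^ n) ^ (i * k) / of_nat n) \<odot>\<^bsub>T\<^esub> (taft_g [^]\<^bsub>T\<^esub> (n * k))) {..<n}"
  proof -
    have "E i = finsum T (\<lambda>k. (inverse (q ^ n) ^ (i * k) / of_nat n) \<odot>\<^bsub>A\<^esub> (gn [^]\<^bsub>A\<^esub> k)) {..<n}"
      unfolding idem_def by (rule T_finsum) (use gn_A in auto)
    then show ?thesis by (simp add: A_ops T_pow T.nat_pow_pow)
  qed
  also have "\<dots> = finsum T (\<lambda>k. finsum T (\<lambda>z. ?c k z \<odot>\<^bsub>T\<^esub> ee z) {..<N}) {..<n}"
  proof (intro T.M.finsum_cong' refl)
    fix k assume "k \<in> {..<n}"
    then have "n * k < N" using n_gt by (simp add: power2_eq_square)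
    from T.power_idem_expansion[OF g_closed g_order root this]
    show "(inverse (q ^ n) ^ (i * k) / of_nat n) \<odot>\<^bsub>T\<^esub> (taft_g [^]\<^bsub>T\<^esub> (n * k)) = finsum T (\<lambda>z. ?c k z \<odot>\<^bsub>T\<^esub> ee z) {..<N}"
      by (simp add: T.finsum_smult T.smult_smult Pi_def)
  qed (auto intro!: T.M.finsum_closed)
  also have "\<dots> = finsum T (\<lambda>z. finsum T (\<lambda>k. ?c k z \<odot>\<^bsub>T\<^esub> ee z) {..<n}) {..<N}"
    by (rule T.finsum_swap) auto
  also have "\<dots> = finsum T (\<lambda>z. if z mod n = i mod n then ee z else \<zero>\<^bsub>T\<^esub>) {..<N}"
  proof (intro T.M.finsum_cong' refl)
    fix z
    have "finsum T (\<lambda>k. ?c k z \<odot>\<^bsub>T\<^esub> ee z) {..<n} = (\<Sum>k<n. ?c k z) \<odot>\<^bsub>T\<^esub> ee z" by (rule T.sum_smult) auto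
    also have "(\<Sum>k<n. ?c k z) = (\<Sum>k<n. (q ^ n) ^ (z * k) * inverse (q ^ n) ^ (i * k)) / of_nat n"
      unfolding sum_divide_distrib by (intro sum.cong refl) (simp add: power_mult[symmetric] mult_ac)
    also have "\<dots> = (if z mod n = i mod n then 1 else 0)"
      using primitive_root_sum[OF root_n, of z i] n_gt by simp
    finally show "finsum T (\<lambda>k. ?c k z \<odot>\<^bsub>T\<^esub> ee z) {..<n} = (if z mod n = i mod n then ee z else \<zero>\<^bsub>T\<^esub>)" by auto
  qed auto
  finally show ?thesis .
qed

lemma E_T [simp]: "E i \<in> carrier T" using E_closed S_T by (simp add: A_carrier)

lemma linear_E:
  assumes "linear_form T f" "i < n"
  shows "f (E i) = (\<Sum>z<N. if z mod n = i then f (ee z) else 0)"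
  using T.linear_form_finsum[OF assms(1), of "{..<N}" "\<lambda>z. if z mod n = i mod n then ee z else \<zero>\<^bsub>T\<^esub>"]
    T.linear_form_zero[OF assms(1)] assms(2) unfolding E_eq by (auto intro!: sum.cong)

lemma linear_xE:
  assumes "linear_form T f" "i < n"
  shows "f (taft_x \<otimes>\<^bsub>T\<^esub> E i) = (\<Sum>z<N. if z mod n = i then f (taft_x \<otimes>\<^bsub>T\<^esub> ee z) else 0)"
proof -
  have "linear_form T (\<lambda>h. f (taft_x \<otimes>\<^bsub>T\<^esub> h))"
    using assms(1) by (simp add: linear_form_def T.r_distr T.smult_mult_right)
  from linear_E[OF this assms(2)] show ?thesis .
qed

lemma ml_T: "multilinear TJ = multilinear T" "tensors TJ = tensors T" "tensor_eq TJ = tensor_eq T"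
  by (rule multilinear_ops_cong; simp)+

text \<open>Constants that depend on residues are constant on the blocks of idempotents with sum
  \<open>E i\<close>; this is why the twisted coproduct of \<open>x\<close> is a tensor over the
  subalgebra.\<close>

lemma skew2_blocks:
  assumes "\<And>i j. a (i mod n) (j mod n) = a i j" "\<And>i j. b (i mod n) (j mod n) = b i j"
  shows "tensor_eq T 2 (skew2 T N ee taft_x a b) (skew2 A n E taft_x a b)"
  unfolding tensor_eq_def
proof (intro allI impI)
  fix f assume f: "multilinear T 2 f"
  have l: "linear_form T (\<lambda>x. f [x, y])" "linear_form T (\<lambda>x. f [y, x])" if "y \<in> carrier T" for y
    using f that by (auto simp: multilinear2_iff)
  have n0: "n > 0" using n_gt by simp
  have bl: "(\<Sum>i<n. \<Sum>j<n. c i j * (\<Sum>z<N. if z mod n = i then \<Sum>y<N. if y mod n = j then G z y else 0 else 0)) =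
     (\<Sum>z<N. \<Sum>y<N. c (z mod n) (y mod n) * G z y)" for c G :: "nat \<Rightarrow> nat \<Rightarrow> complex"
  proof -
    have "(\<Sum>i<n. \<Sum>j<n. c i j * (\<Sum>z<N. if z mod n = i then \<Sum>y<N. if y mod n = j then G z y else 0 else 0)) =
      (\<Sum>i<n. \<Sum>j<n. \<Sum>z<N. if z mod n = i then \<Sum>y<N. if y mod n = j then c i j * G z y else 0 else 0)"
      by (intro sum.cong refl) (auto simp: sum_distrib_left intro!: sum.cong)
    also have "\<dots> = (\<Sum>i<n. \<Sum>z<N. \<Sum>j<n. if z mod n = i then \<Sum>y<N. if y mod n = j then c i j * G z y else 0 else 0)"
      by (intro sum.cong refl sum.swap)
    also have "\<dots> = (\<Sum>i<n. \<Sum>z<N. if z mod n = i then \<Sum>j<n. \<Sum>y<N. if y mod n = j then c i j * G z y else 0 else 0)"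
      by (intro sum.cong refl) auto
    also have "\<dots> = (\<Sum>z<N. \<Sum>y<N. c (z mod n) (y mod n) * G z y)"
      using n0 by (simp add: sum_mod_blocks)
    finally show ?thesis .
  qed
  have 1: "f [taft_x \<otimes>\<^bsub>T\<^esub> E i, E j] = (\<Sum>z<N. if z mod n = i then \<Sum>y<N. if y mod n = j then f [taft_x \<otimes>\<^bsub>T\<^esub> ee z, ee y] else 0 else 0)"
    if "i < n" "j < n" for i j
    unfolding linear_xE[OF l(1)[OF E_T] that(1)] by (intro sum.cong refl) (simp add: linear_E[OF l(2) that(2)])
  have 2: "f [E i, taft_x \<otimes>\<^bsub>T\<^esub> E j] = (\<Sum>z<N. if z mod n = i then \<Sum>y<N. if y mod n = j then f [ee z, taft_x \<otimes>\<^bsub>T\<^esub> ee y] else 0 else 0)"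
    if "i < n" "j < n" for i j
  proof -
    have "f [E i, taft_x \<otimes>\<^bsub>T\<^esub> E j] = (\<Sum>z<N. if z mod n = i then f [ee z, taft_x \<otimes>\<^bsub>T\<^esub> E j] else 0)"
      by (rule linear_E[OF l(1) that(1)]) auto
    also have "\<dots> = (\<Sum>z<N. if z mod n = i then \<Sum>y<N. if y mod n = j then f [ee z, taft_x \<otimes>\<^bsub>T\<^esub> ee y] else 0 else 0)"
      by (intro sum.cong refl) (simp add: linear_xE[OF l(2) that(2)])
    finally show ?thesis .
  qed
  have "skew2 A n E taft_x a b f = (\<Sum>i<n. \<Sum>j<n. a i j * f [taft_x \<otimes>\<^bsub>T\<^esub> E i, E j]) + (\<Sum>i<n. \<Sum>j<n. b i j * f [E i, taft_x \<otimes>\<^bsub>T\<^esub> E j])"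
    by (simp add: skew2_def A_ops sum.distrib)
  also have "(\<Sum>i<n. \<Sum>j<n. a i j * f [taft_x \<otimes>\<^bsub>T\<^esub> E i, E j]) =
      (\<Sum>z<N. \<Sum>y<N. a (z mod n) (y mod n) * f [taft_x \<otimes>\<^bsub>T\<^esub> ee z, ee y])"
    by (rule trans[OF _ bl[of a "\<lambda>z y. f [taft_x \<otimes>\<^bsub>T\<^esub> ee z, ee y]"]]) (intro sum.cong refl, simp add: 1)
  also have "(\<Sum>i<n. \<Sum>j<n. b i j * f [E i, taft_x \<otimes>\<^bsub>T\<^esub> E j]) =
      (\<Sum>z<N. \<Sum>y<N. b (z mod n) (y mod n) * f [ee z, taft_x \<otimes>\<^bsub>T\<^esub> ee y])"
    by (rule trans[OF _ bl[of b "\<lambda>z y. f [ee z, taft_x \<otimes>\<^bsub>T\<^esub> ee y]"]]) (intro sum.cong refl, simp add: 2)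
  also have "(\<Sum>z<N. \<Sum>y<N. a (z mod n) (y mod n) * f [taft_x \<otimes>\<^bsub>T\<^esub> ee z, ee y]) +
      (\<Sum>z<N. \<Sum>y<N. b (z mod n) (y mod n) * f [ee z, taft_x \<otimes>\<^bsub>T\<^esub> ee y]) = skew2 T N ee taft_x a b f"
    by (simp add: skew2_def assms sum.distrib)
  finally show "skew2 T N ee taft_x a b f = skew2 A n E taft_x a b f" ..
qed

lemma diag3_blocks:
  assumes "\<And>i j k. c (i mod n) (j mod n) (k mod n) = c i j k"
  shows "tensor_eq T 3 (diag3 N ee c) (diag3 n E c)"
  unfolding tensor_eq_def
proof (intro allI impI)
  fix f assume f: "multilinear T 3 f"
  have l: "linear_form T (\<lambda>x. f [x, y, z])" "linear_form T (\<lambda>x. f [y, x, z])" "linear_form T (\<lambda>x. f [y, z, x])"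
    if "y \<in> carrier T" "z \<in> carrier T" for y z
    using f that by (auto simp: multilinear3_iff)
  have n0: "n > 0" using n_gt by simp
  have 1: "(\<Sum>i<n. u i * v (E i)) = (\<Sum>z<N. u (z mod n) * v (ee z))" if "linear_form T v" for u v
  proof -
    have "(\<Sum>i<n. u i * v (E i)) = (\<Sum>i<n. \<Sum>z<N. if z mod n = i then u i * v (ee z) else 0)"
      using linear_E[OF that] by (intro sum.cong refl) (auto simp: sum_distrib_left intro!: sum.cong)
    then show ?thesis using sum_mod_blocks[OF n0, of "\<lambda>i z. u i * v (ee z)" N] by simp
  qed
  have lin_sum: "linear_form T (\<lambda>x. \<Sum>i\<in>B. g i * h i x)" if "\<And>i. linear_form T (h i)" for B :: "nat set" and g h
    using that by (simp add: linear_form_def sum.distrib sum_distrib_left algebra_simps)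
  have "diag3 n E c f = (\<Sum>i<n. \<Sum>j<n. \<Sum>k<N. c i j (k mod n) * f [E i, E j, ee k])"
    unfolding diag3_def by (rule sum.cong[OF refl], rule sum.cong[OF refl], rule 1[OF l(3)]) auto
  also have "\<dots> = (\<Sum>i<n. \<Sum>k<N. \<Sum>j<n. c i j (k mod n) * f [E i, E j, ee k])"
    by (intro sum.cong refl sum.swap)
  also have "\<dots> = (\<Sum>i<n. \<Sum>k<N. \<Sum>j<N. c i (j mod n) (k mod n) * f [E i, ee j, ee k])"
    by (rule sum.cong[OF refl], rule sum.cong[OF refl], rule 1[OF l(2)]) auto
  also have "\<dots> = (\<Sum>k<N. \<Sum>i<n. \<Sum>j<N. c i (j mod n) (k mod n) * f [E i, ee j, ee k])"
    by (rule sum.swap)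
  also have "\<dots> = (\<Sum>k<N. \<Sum>j<N. \<Sum>i<n. c i (j mod n) (k mod n) * f [E i, ee j, ee k])"
    by (intro sum.cong refl sum.swap)
  also have "\<dots> = (\<Sum>k<N. \<Sum>j<N. \<Sum>i<N. c (i mod n) (j mod n) (k mod n) * f [ee i, ee j, ee k])"
    by (rule sum.cong[OF refl], rule sum.cong[OF refl], rule 1[OF l(1)]) auto
  also have "\<dots> = (\<Sum>k<N. \<Sum>i<N. \<Sum>j<N. c i j k * f [ee i, ee j, ee k])"
    unfolding assms by (intro sum.cong refl sum.swap)
  also have "\<dots> = (\<Sum>i<N. \<Sum>k<N. \<Sum>j<N. c i j k * f [ee i, ee j, ee k])" by (rule sum.swap)
  also have "\<dots> = diag3 N ee c f" unfolding diag3_def by (intro sum.cong refl sum.swap)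
  finally show "diag3 N ee c f = diag3 n E c f" ..
qed

lemma A_alpha_mod: "A_alpha n q (i mod n) (j mod n) = A_alpha n q i j"
  and A_beta_mod: "A_beta n q (i mod n) (j mod n) = A_beta n q i j"
  and A_omega_mod: "A_omega n (q ^ n) (i mod n) (j mod n) (k mod n) = A_omega n (q ^ n) i j k"
  by (simp_all only: A_alpha_def A_beta_def A_omega_def inverse_qn_mod mod_mod_trivial)

lemma A_tensor_mult: "tensor_mult A = tensor_mult T" "tensor_mult TJ = tensor_mult T"
  by (rule tensor_mult_ops_cong; simp add: A_ops)+

text \<open>\<open>g\<^sup>n \<otimes> g\<^sup>n\<close> is diagonal in the idempotents, hence
  commutes with \<open>J\<close>, and \<open>g\<^sup>n\<close> stays grouplike after the
  twist.\<close>

lemma comult_gn: "tensor_eq T 2 (comult TJ gn) (pure_tensor [gn, gn])"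
proof -
  have gk: "tensor_eq T 2 (comult T (taft_g [^]\<^bsub>T\<^esub> k)) (pure_tensor [taft_g [^]\<^bsub>T\<^esub> k, taft_g [^]\<^bsub>T\<^esub> k])" for k :: nat
    by (rule T.comult_power[OF g_closed g_order root comult_g])
  have "n < N" using n_gt by (simp add: power2_eq_square)
  from T.power_idem_expansion[OF g_closed g_order root this]
  have ge: "gn = finsum T (\<lambda>i. q ^ (i * n) \<odot>\<^bsub>T\<^esub> ee i) {..<N}" .
  have d: "tensor_eq T 2 (pure_tensor [gn, gn]) (T.dg2 (\<lambda>i j. q ^ (i * n) * q ^ (j * n)))"
    unfolding tensor_eq_def
  proof (intro allI impI)
    fix f assume f: "multilinear T 2 f"
    have l: "linear_form T (\<lambda>x. f [x, y])" "linear_form T (\<lambda>x. f [y, x])" if "y \<in> carrier T" for y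
      using f that by (auto simp: multilinear2_iff)
    have "f [gn, gn] = (\<Sum>i<N. q ^ (i * n) * f [ee i, gn])"
      using T.linear_form_finsum[OF l(1)[of gn], of "{..<N}" "\<lambda>i. q ^ (i * n) \<odot>\<^bsub>T\<^esub> ee i"] l(1)[of gn] ge
      by (simp add: linear_form_def)
    also have "\<dots> = (\<Sum>i<N. q ^ (i * n) * (\<Sum>j<N. q ^ (j * n) * f [ee i, ee j]))"
    proof (intro sum.cong refl arg_cong[of _ _ "(*) (q ^ (_ * n))"])
      fix i
      show "f [ee i, gn] = (\<Sum>j<N. q ^ (j * n) * f [ee i, ee j])"
        using T.linear_form_finsum[OF l(2)[of "ee i"], of "{..<N}" "\<lambda>j. q ^ (j * n) \<odot>\<^bsub>T\<^esub> ee j"] l(2)[of "ee i"] ge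
        by (simp add: linear_form_def)
    qed
    finally show "pure_tensor [gn, gn] f = T.dg2 (\<lambda>i j. q ^ (i * n) * q ^ (j * n)) f"
      by (simp add: pure_tensor_def diag2_def sum_distrib_left mult.assoc)
  qed
  let ?d = "\<lambda>i j. q ^ (i * n) * q ^ (j * n)" and ?I = "\<lambda>i j. 1 / F i j"
  note inv = T.diag2_invertible[of F, OF F_nonzero T.diag2_closed tensor_eq_refl]
  have "tensor_eq T 2 (J \<star>\<^bsub>T\<^esub> comult T gn \<star>\<^bsub>T\<^esub> tensor_inv T 2 J) (J \<star>\<^bsub>T\<^esub> T.dg2 ?d \<star>\<^bsub>T\<^esub> T.dg2 ?I)"
    using inv tensor_eq_trans[OF gk d] by (intro T.tensor_mult_cong T.tensor_mult_closed T.comult_closed) auto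
  also have "tensor_eq T 2 \<dots> (T.dg2 (\<lambda>i j. F i j * ?d i j) \<star>\<^bsub>T\<^esub> T.dg2 ?I)"
    by (intro T.tensor_mult_cong T.tensor_mult_closed T.diag2_mult) auto
  also have "tensor_eq T 2 \<dots> (T.dg2 (\<lambda>i j. F i j * ?d i j * ?I i j))" by (rule T.diag2_mult)
  also have "T.dg2 (\<lambda>i j. F i j * ?d i j * ?I i j) = T.dg2 ?d" using F_nonzero by (intro diag2_cong) simp
  also have "tensor_eq T 2 \<dots> (pure_tensor [gn, gn])" by (rule tensor_eq_sym[OF d])
  finally show ?thesis by (simp add: twist_def)
qed

lemma skew2_A_closed: "skew2 A n E taft_x a b \<in> tensors A 2"
proof -
  have 1: "(\<lambda>f. f [taft_x \<otimes>\<^bsub>A\<^esub> E i, E j]) \<in> tensors A 2" "(\<lambda>f. f [E i, taft_x \<otimes>\<^bsub>A\<^esub> E j]) \<in> tensors A 2" for i j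
    using pure_tensor_closed[of "[taft_x \<otimes>\<^bsub>A\<^esub> E i, E j]" A] pure_tensor_closed[of "[E i, taft_x \<otimes>\<^bsub>A\<^esub> E j]" A] E_closed gn_A
    by (simp_all add: pure_tensor_def numeral_2_eq_2)
  show ?thesis unfolding skew2_def
    by (intro tensors_sum tensors_add A.tensors_smult 1) simp_all
qed

text \<open>Having a coproduct represented over the subalgebra is preserved by sums, scalars and
  products and holds for both generators. It is what gives the chosen coproduct of \<open>A\<close>
  its meaning.\<close>

lemma comult_exists: "h \<in> S \<Longrightarrow> \<exists>t\<in>tensors A 2. tensor_eq TJ 2 t (comult TJ h)"
proof (induction rule: generated_subalgebra.induct)
  case one
  then show ?case using A.tensor_one_closed[of 2] TJ.comult_one R.tensor_one_eq tensor_eq_sym by (force simp: ml_T)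
next
  case (incl y)
  then consider "y = gn" | "y = taft_x" by auto
  then show ?case
  proof cases
    case 1
    have "pure_tensor [gn, gn] \<in> tensors A 2"
      using pure_tensor_closed[of "[gn, gn]" A] gn_A by (simp add: numeral_2_eq_2)
    then show ?thesis using tensor_eq_sym[OF comult_gn] 1 unfolding ml_T by blast
  next
    case 2
    have "skew2 TJ N ee taft_x a b = skew2 T N ee taft_x a b" for a b by (simp add: skew2_def)
    then have "tensor_eq T 2 (comult TJ taft_x) (skew2 A n E taft_x (A_alpha n q) (A_beta n q))"
      using TJ.comult_x tensor_eq_trans[OF _ skew2_blocks[of "A_alpha n q" "A_beta n q", OF A_alpha_mod A_beta_mod]] by (simp add: ml_T)
    then show ?thesis using skew2_A_closed 2 tensor_eq_sym unfolding ml_T by blast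
  qed
next
  case (add y z)
  then obtain t u where tu: "t \<in> tensors A 2" "tensor_eq TJ 2 t (comult TJ y)" "u \<in> tensors A 2" "tensor_eq TJ 2 u (comult TJ z)"
    by blast
  have "tensor_eq TJ 2 (\<lambda>f. t f + u f) (comult TJ (y \<oplus>\<^bsub>T\<^esub> z))"
    using TJ.comult_add[of y z] tu add.hyps S_T by (simp add: tensor_eq_def)
  then show ?case using tensors_add[OF tu(1,3)] by blast
next
  case (smult y c)
  then obtain t where t: "t \<in> tensors A 2" "tensor_eq TJ 2 t (comult TJ y)" by blast
  have "tensor_eq TJ 2 (\<lambda>f. c * t f) (comult TJ (c \<odot>\<^bsub>T\<^esub> y))"
    using TJ.comult_smult[of y c] t smult.hyps S_T by (simp add: tensor_eq_def)
  then show ?case using A.tensors_smult[OF _ t(1), of c] by auto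
next
  case (mult y z)
  then obtain t u where tu: "t \<in> tensors A 2" "tensor_eq TJ 2 t (comult TJ y)" "u \<in> tensors A 2" "tensor_eq TJ 2 u (comult TJ z)"
    by blast
  have "tensor_eq TJ 2 (t \<star>\<^bsub>TJ\<^esub> u) (comult TJ y \<star>\<^bsub>TJ\<^esub> comult TJ z)"
    by (intro TJ.tensor_mult_cong R.tensors_extend tu)
  also have "tensor_eq TJ 2 \<dots> (comult TJ (y \<otimes>\<^bsub>T\<^esub> z))"
    using tensor_eq_sym[OF TJ.comult_mult[of y z]] mult.hyps S_T by simp
  finally show ?case using A.tensor_mult_closed[OF tu(1,3)] by (auto simp: A_tensor_mult)
qed

lemma A_pre_bialgebra: "pre_bialgebra A"
  unfolding A_eq by (rule TJ.restrict_pre_bialgebra[OF A_retract[unfolded A_eq]]) (rule comult_exists[unfolded A_eq])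

sublocale A: pre_bialgebra A by (rule A_pre_bialgebra)

lemma A_comult: "h \<in> S \<Longrightarrow> tensor_eq T 2 (comult A h) (comult TJ h)"
  using comult_exists[of h] restrict_comult(2)[of _ TJ S h] unfolding A_eq ml_T by blast

lemma A_comult_eq:
  assumes "h \<in> S" "tensor_eq T 2 (comult TJ h) t" "t \<in> tensors A 2"
  shows "tensor_eq A 2 (comult A h) t"
  using tensor_eq_trans[OF A_comult[OF assms(1)] assms(2)] assms(1,3)
  by (intro R.tensor_eq_restrict A.comult_closed) (auto simp: ml_T A_carrier)

lemma A_weight_system: "weight_system A n E"
proof (rule A.weight_system_idem[OF gn_A(1) gn_order root_n])
  have "pure_tensor [gn, gn] \<in> tensors A 2"
    using pure_tensor_closed[of "[gn, gn]" A] gn_A by (simp add: numeral_2_eq_2)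
  then show "tensor_eq A 2 (comult A gn) (pure_tensor [gn, gn])"
    using comult_gn gn_A by (intro A_comult_eq) (auto simp: A_carrier)
  have "counit T (taft_g [^]\<^bsub>T\<^esub> k) = 1" for k :: nat
  proof -
    have "k mod N < N" using n_gt by (intro mod_less_divisor) simp
    then show ?thesis unfolding g_power taft_simps(8) by (simp add: monomial_def)
  qed
  then show "counit A gn = 1" by (simp add: A_ops)
qed

text \<open>The idempotents of \<open>g\<^sup>n\<close> are taken with respect to
  \<open>q\<^sup>n\<close>: since \<open>x g\<^sup>n = q\<^sup>-\<^sup>n g\<^sup>n x\<close>,
  \<open>x\<close> shifts their index by one.\<close>

lemma A_shift_system: "shift_system A n E taft_x (A_alpha n q) (A_beta n q) (A_omega n (q ^ n))"
proof (intro shift_system.intro shift_system_axioms.intro)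
  show "weight_system A n E" by (rule A_weight_system)
  show "taft_x \<in> carrier A" by (rule gn_A)
  show "taft_x \<otimes>\<^bsub>A\<^esub> E i = E (Suc i) \<otimes>\<^bsub>A\<^esub> taft_x" for i
  proof (rule A.skew_idem[OF gn_A])
    have "taft_x \<otimes>\<^bsub>T\<^esub> gn = inverse q ^ n \<odot>\<^bsub>T\<^esub> (gn \<otimes>\<^bsub>T\<^esub> taft_x)"
      by (rule T.skew_power) (simp_all add: x_g)
    then show "taft_x \<otimes>\<^bsub>A\<^esub> gn = inverse (q ^ n) \<odot>\<^bsub>A\<^esub> (gn \<otimes>\<^bsub>A\<^esub> taft_x)"
      by (simp add: A_ops power_inverse)
  qed
  have "skew2 TJ N ee taft_x a b = skew2 T N ee taft_x a b" for a b by (simp add: skew2_def)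
  then have "tensor_eq T 2 (comult TJ taft_x) (skew2 A n E taft_x (A_alpha n q) (A_beta n q))"
    using TJ.comult_x tensor_eq_trans[OF _ skew2_blocks[of "A_alpha n q" "A_beta n q", OF A_alpha_mod A_beta_mod]] by (simp add: ml_T)
  then show "tensor_eq A 2 (comult A taft_x) (skew2 A n E taft_x (A_alpha n q) (A_beta n q))"
    using gn_A by (intro A_comult_eq skew2_A_closed) (auto simp: A_carrier)
  show "counit A taft_x = 0" using TJ.counit_x by (simp add: A_ops)
  interpret W: weight_system A n E by (rule A_weight_system)
  have "tensor_eq T 3 (diag3 n E (A_omega n (q ^ n))) (associator TJ)"
    using tensor_eq_trans[OF _ diag3_blocks[of "A_omega n (q ^ n)", OF A_omega_mod]] TJ.associator_eq tensor_eq_sym unfolding ml_T by blast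
  from restrict_associator[of _ TJ S, folded A_eq, OF W.diag3_closed this[folded ml_T]] this
  show "associator A \<in> tensors A 3" "tensor_eq A 3 (associator A) (diag3 n E (A_omega n (q ^ n)))"
    using tensor_eq_sym tensor_eq_trans by (blast, intro R.tensor_eq_restrict) (auto simp: ml_T intro: tensor_eq_trans tensor_eq_sym)
qed

sublocale A: shift_system A n E taft_x "A_alpha n q" "A_beta n q" "A_omega n (q ^ n)"
  by (rule A_shift_system)

lemma xE_expansion:
  assumes "l < N"
  shows "taft_x [^]\<^bsub>A\<^esub> l \<otimes>\<^bsub>A\<^esub> E i =
    (\<lambda>p. \<Sum>k<n. inverse (q ^ n) ^ (i * k) / of_nat n * inverse q ^ (l * (n * k)) * monomial (n * k, l) p)"
proof -
  have kN: "n * k < N" if "k < n" for k using that n_gt by (simp add: power2_eq_square)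
  have "E i = finsum T (\<lambda>k. (inverse (q ^ n) ^ (i * k) / of_nat n) \<odot>\<^bsub>A\<^esub> (gn [^]\<^bsub>A\<^esub> k)) {..<n}"
    unfolding idem_def by (rule T_finsum) (use gn_A in auto)
  also have "\<dots> = finsum T (\<lambda>k. (inverse (q ^ n) ^ (i * k) / of_nat n) \<odot>\<^bsub>T\<^esub> monomial (n * k, 0)) {..<n}"
  proof (intro T.M.finsum_cong' refl)
    fix k assume "k \<in> {..<n}"
    then have gk: "gn [^]\<^bsub>T\<^esub> k = monomial (n * k, 0)"
      using T.nat_pow_pow[OF g_closed, of n k] g_power[of "n * k"] kN[of k] by (simp only: lessThan_iff mod_less)
    show "(inverse (q ^ n) ^ (i * k) / of_nat n) \<odot>\<^bsub>A\<^esub> (gn [^]\<^bsub>A\<^esub> k) = (inverse (q ^ n) ^ (i * k) / of_nat n) \<odot>\<^bsub>T\<^esub> monomial (n * k, 0)"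
      unfolding A_ops T_pow gk ..
  qed (use kN in auto)
  finally have "taft_x [^]\<^bsub>A\<^esub> l \<otimes>\<^bsub>A\<^esub> E i = monomial (0, l) \<otimes>\<^bsub>T\<^esub>
      finsum T (\<lambda>k. (inverse (q ^ n) ^ (i * k) / of_nat n) \<odot>\<^bsub>T\<^esub> monomial (n * k, 0)) {..<n}"
    using assms by (simp only: A_ops(1) T_pow x_power if_True)
  also have "\<dots> = finsum T (\<lambda>k. monomial (0, l) \<otimes>\<^bsub>T\<^esub> ((inverse (q ^ n) ^ (i * k) / of_nat n) \<odot>\<^bsub>T\<^esub> monomial (n * k, 0))) {..<n}"
    by (rule T.finsum_rdistr) (use assms kN n_gt in auto)
  also have "\<dots> = finsum T (\<lambda>k. (inverse (q ^ n) ^ (i * k) / of_nat n * inverse q ^ (l * (n * k))) \<odot>\<^bsub>T\<^esub> monomial (n * k, l)) {..<n}"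
    using assms kN by (intro T.M.finsum_cong' refl) (auto simp: T.smult_mult_right monomial_mult T.smult_smult)
  also have "\<dots> = (\<lambda>p. \<Sum>k<n. ((inverse (q ^ n) ^ (i * k) / of_nat n * inverse q ^ (l * (n * k))) \<odot>\<^bsub>T\<^esub> monomial (n * k, l)) p)"
    using assms kN by (intro taft_finsum) auto
  finally show ?thesis by (simp add: taft_simps(6))
qed

lemma xN: "taft_x [^]\<^bsub>A\<^esub> N = \<zero>\<^bsub>A\<^esub>" by (simp add: T_pow x_power A_ops)

theorem A_graded_model: "graded_model A n E taft_x (A_alpha n q) (A_beta n q) (A_omega n (q ^ n)) N"
proof (rule A.graded_modelI[of N "\<lambda>k h p. if snd p = k then h p else 0"])
  show "n > 1" "N > 1" by (rule n_gt, rule N_gt)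
  show "taft_x [^]\<^bsub>A\<^esub> N = \<zero>\<^bsub>A\<^esub>" by (rule xN)
  fix k
  show "linear_map A A (\<lambda>h p. if snd p = k then h p else 0)"
    using S_T S_support unfolding linear_map_def A_carrier A_ops
    by (auto simp: taft_simps(5,6) intro!: S_I) (auto simp: taft_simps(1))
  fix l i
  show "(\<lambda>p. if snd p = k then (taft_x [^]\<^bsub>A\<^esub> l \<otimes>\<^bsub>A\<^esub> E i) p else 0) =
      (if k = l then taft_x [^]\<^bsub>A\<^esub> l \<otimes>\<^bsub>A\<^esub> E i else \<zero>\<^bsub>A\<^esub>)" if "l < N"
  proof -
    have "(taft_x [^]\<^bsub>A\<^esub> l \<otimes>\<^bsub>A\<^esub> E i) p = 0" if "snd p \<noteq> l" for p
      unfolding xE_expansion[OF \<open>l < N\<close>] using that by (auto simp: monomial_def intro!: sum.neutral)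
    then show ?thesis unfolding A_ops(3) taft_simps(4) by (auto simp: fun_eq_iff )
  qed
next
  fix k i assume "k < N"
  \<comment> \<open>One nonzero coordinate suffices: at the monomial \<open>(0, k)\<close> only
    \<open>l = 0\<close> contributes, with value \<open>1/n\<close>.\<close>
  have "(taft_x [^]\<^bsub>A\<^esub> k \<otimes>\<^bsub>A\<^esub> E i) (0, k) =
     (\<Sum>l<n. if l = 0 then inverse (q ^ n) ^ (i * l) / of_nat n * inverse q ^ (k * (n * l)) else 0)"
    unfolding xE_expansion[OF \<open>k < N\<close>] using n_gt by (intro sum.cong refl) (auto simp: monomial_def)
  also have "\<dots> \<noteq> 0" using n_gt by simp
  finally show "taft_x [^]\<^bsub>A\<^esub> k \<otimes>\<^bsub>A\<^esub> E i \<noteq> \<zero>\<^bsub>A\<^esub>" by (auto simp: A_ops(3) taft_simps(4))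
next
  fix h assume "h \<in> carrier A"
  \<comment> \<open>The span of the monomials is stable under left multiplication by both generators
    and contains 1, so it is everything.\<close>
  define V where "V = {v. \<exists>c. v = combination A E taft_x N n c}"
  have V_add: "u \<oplus>\<^bsub>A\<^esub> v \<in> V" if uv: "u \<in> V" "v \<in> V" for u v
  proof -
    obtain c d where "u = combination A E taft_x N n c" "v = combination A E taft_x N n d"
      using uv unfolding V_def by blast
    then have "u \<oplus>\<^bsub>A\<^esub> v = combination A E taft_x N n (\<lambda>k i. c k i + d k i)" by (simp only: A.combination_add)
    then show ?thesis unfolding V_def by blast
  qed
  have V_smult: "c \<odot>\<^bsub>A\<^esub> v \<in> V" if v: "v \<in> V" for c v
  proof -
    obtain d where "v = combination A E taft_x N n d" using v unfolding V_def by blast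
    then have "c \<odot>\<^bsub>A\<^esub> v = combination A E taft_x N n (\<lambda>k i. c * d k i)" by (simp only: A.combination_smult)
    then show ?thesis unfolding V_def by blast
  qed
  have V_mono: "c \<odot>\<^bsub>A\<^esub> (taft_x [^]\<^bsub>A\<^esub> k \<otimes>\<^bsub>A\<^esub> E i) \<in> V" if "k < N" "i < n" for c k i
    using A.combination_smult_mono[OF that] by (simp add: V_def)
  have V_finsum: "finsum A g B \<in> V" if "finite B" "\<And>b. b \<in> B \<Longrightarrow> g b \<in> V" for g and B :: "nat set"
    using A.combination_finsum[of B g N] that by (auto simp: V_def)
  have V_A: "v \<in> carrier A" if "v \<in> V" for v using that by (auto simp: V_def)
  have V_left: "y \<otimes>\<^bsub>A\<^esub> v \<in> V" if v: "v \<in> V" and y: "y \<in> carrier A"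
    and m: "\<And>k i. k < N \<Longrightarrow> i < n \<Longrightarrow> y \<otimes>\<^bsub>A\<^esub> (taft_x [^]\<^bsub>A\<^esub> k \<otimes>\<^bsub>A\<^esub> E i) \<in> V" for y v
  proof -
    obtain c where c: "v = combination A E taft_x N n c" using v unfolding V_def by blast
    have "y \<otimes>\<^bsub>A\<^esub> v = finsum A (\<lambda>k. finsum A (\<lambda>i. c k i \<odot>\<^bsub>A\<^esub> (y \<otimes>\<^bsub>A\<^esub> (taft_x [^]\<^bsub>A\<^esub> k \<otimes>\<^bsub>A\<^esub> E i))) {..<n}) {..<N}"
      unfolding c combination_def using y
      by (simp add: A.finsum_rdistr A.smult_mult_right Pi_def A.M.finsum_closed)
    also have "\<dots> \<in> V" by (intro V_finsum V_smult m) auto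
    finally show ?thesis .
  qed
  have "\<forall>v\<in>V. h \<otimes>\<^bsub>A\<^esub> v \<in> V"
    using \<open>h \<in> carrier A\<close> unfolding A_carrier
  proof (induction rule: generated_subalgebra.induct)
    case one then show ?case using V_A by (auto simp flip: A_ops)
  next
    case (incl y)
    have "y \<otimes>\<^bsub>A\<^esub> (taft_x [^]\<^bsub>A\<^esub> k \<otimes>\<^bsub>A\<^esub> E i) \<in> V" if "k < N" "i < n" for k i
    proof (cases "y = taft_x")
      case True
      have e: "y \<otimes>\<^bsub>A\<^esub> (taft_x [^]\<^bsub>A\<^esub> k \<otimes>\<^bsub>A\<^esub> E i) = taft_x [^]\<^bsub>A\<^esub> Suc k \<otimes>\<^bsub>A\<^esub> E i"
        using A.nat_pow_Suc2[of taft_x k] gn_A E_closed[of i] by (simp add: True A.m_assoc)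
      show ?thesis
      proof (cases "Suc k < N")
        case True then show ?thesis using V_mono[of "Suc k" i 1] that e gn_A E_closed[of i] by simp
      next
        case False
        \<comment> \<open>At the top degree the product is \<open>x\<^sup>N = 0\<close>, written as
          the zero multiple of a monomial.\<close>
        then have "Suc k = N" using that by simp
        then show ?thesis using e xN V_smult[OF V_mono[of 0 0 0], of 0] N_gt n_gt E_closed by simp
      qed
    next
      case False
      then have y: "y = gn" using incl by simp
      have "y \<otimes>\<^bsub>A\<^esub> (taft_x [^]\<^bsub>A\<^esub> k \<otimes>\<^bsub>A\<^esub> E i) = y \<otimes>\<^bsub>A\<^esub> E (i + k) \<otimes>\<^bsub>A\<^esub> taft_x [^]\<^bsub>A\<^esub> k"
        using gn_A E_closed y by (simp add: A.x_pow_e A.m_assoc)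
      also have "y \<otimes>\<^bsub>A\<^esub> E (i + k) = (q ^ n) ^ (i + k) \<odot>\<^bsub>A\<^esub> E (i + k)"
        unfolding y using root_n by (intro A.idem_eigen gn_A gn_order) (auto simp: primitive_root_of_unity_def)
      also have "\<dots> \<otimes>\<^bsub>A\<^esub> taft_x [^]\<^bsub>A\<^esub> k = (q ^ n) ^ (i + k) \<odot>\<^bsub>A\<^esub> (taft_x [^]\<^bsub>A\<^esub> k \<otimes>\<^bsub>A\<^esub> E i)"
        using gn_A E_closed by (simp add: A.smult_mult_left A.x_pow_e)
      finally show ?thesis using V_mono[OF that] by simp
    qed
    then show ?case using V_left incl gn_A by auto
  next
    case (add y z)
    then show ?case using V_add V_A by (auto simp: A.l_distr A_carrier simp flip: A_ops)
  next
    case (smult y c)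
    then show ?case using V_smult V_A by (auto simp: A.smult_mult_left A_carrier simp flip: A_ops)
  next
    case (mult y z)
    then show ?case using V_A by (auto simp: A.m_assoc A_carrier simp flip: A_ops)
  qed
  moreover have "\<one>\<^bsub>A\<^esub> \<in> V"
  proof -
    have "E i \<in> V" if "i < n" for i using V_mono[of 0 i 1] that N_gt E_closed[of i] by simp
    then show ?thesis unfolding A.e_sum[symmetric] by (intro V_finsum) auto
  qed
  ultimately have "h \<otimes>\<^bsub>A\<^esub> \<one>\<^bsub>A\<^esub> \<in> V" by blast
  then show "\<exists>c. h = combination A E taft_x N n c" using \<open>h \<in> carrier A\<close> by (simp add: V_def)
qed

end

section \<open>Coassociativity of a skew primitive element\<close>

lemma (in complex_algebra) vlists3E:
  assumes "xs \<in> vlists H 3" obtains y z v where "xs = [y, z, v]" "y \<in> carrier H" "z \<in> carrier H" "v \<in> carrier H"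
  using assms that by (auto simp: numeral_3_eq_3 length_Suc_conv)

section \<open>Components of the iterated coproducts of x\<close>

context shift_forms
begin

lemma prod3_ml [simp]:
  "multilinear H 3 (prod3 (chi i) (chi j) (chi k))" "multilinear H 3 (prod3 (der i) (chi j) (chi k))"
  "multilinear H 3 (prod3 (chi i) (der j) (chi k))" "multilinear H 3 (prod3 (chi i) (chi j) (der k))"
  by (intro prod3_multilinear chi_linear der_linear)+

lemma tensor_mult_forms3:
  assumes "t \<in> tensors H 3" "u \<in> tensors H 3" "i < n" "j < n" "k < n"
  shows "(t \<star> u) (prod3 (chi i) (chi j) (chi k)) = t (prod3 (chi i) (chi j) (chi k)) * u (prod3 (chi i) (chi j) (chi k))"
     "(t \<star> u) (prod3 (der i) (chi j) (chi k)) =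
        t (prod3 (chi (Suc i mod n)) (chi j) (chi k)) * u (prod3 (der i) (chi j) (chi k))
        + t (prod3 (der i) (chi j) (chi k)) * u (prod3 (chi i) (chi j) (chi k))"
     "(t \<star> u) (prod3 (chi i) (der j) (chi k)) =
        t (prod3 (chi i) (chi (Suc j mod n)) (chi k)) * u (prod3 (chi i) (der j) (chi k))
        + t (prod3 (chi i) (der j) (chi k)) * u (prod3 (chi i) (chi j) (chi k))"
     "(t \<star> u) (prod3 (chi i) (chi j) (der k)) =
        t (prod3 (chi i) (chi j) (chi (Suc k mod n))) * u (prod3 (chi i) (chi j) (der k))
        + t (prod3 (chi i) (chi j) (der k)) * u (prod3 (chi i) (chi j) (chi k))"
proof -
  note f = tensor_mult_apply2[OF assms(1,2)]
  have "(t \<star> u) (prod3 (chi i) (chi j) (chi k)) =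
      t (prod3 (chi i) (chi j) (chi k)) * u (prod3 (chi i) (chi j) (chi k)) + t (\<lambda>_. 0) * u (\<lambda>_. 0)"
    by (rule f) (simp_all only: prod3_ml multilinear_0, elim vlists3E, simp add: chi_mult assms)
  then show "(t \<star> u) (prod3 (chi i) (chi j) (chi k)) = t (prod3 (chi i) (chi j) (chi k)) * u (prod3 (chi i) (chi j) (chi k))"
    by (simp add: tensors_apply_0[OF assms(1)])
  show "(t \<star> u) (prod3 (der i) (chi j) (chi k)) =
        t (prod3 (chi (Suc i mod n)) (chi j) (chi k)) * u (prod3 (der i) (chi j) (chi k))
        + t (prod3 (der i) (chi j) (chi k)) * u (prod3 (chi i) (chi j) (chi k))"
    by (rule f) (simp_all only: prod3_ml, elim vlists3E, simp add: chi_mult der_mult assms algebra_simps)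
  show "(t \<star> u) (prod3 (chi i) (der j) (chi k)) =
        t (prod3 (chi i) (chi (Suc j mod n)) (chi k)) * u (prod3 (chi i) (der j) (chi k))
        + t (prod3 (chi i) (der j) (chi k)) * u (prod3 (chi i) (chi j) (chi k))"
    by (rule f) (simp_all only: prod3_ml, elim vlists3E, simp add: chi_mult der_mult assms algebra_simps)
  show "(t \<star> u) (prod3 (chi i) (chi j) (der k)) =
        t (prod3 (chi i) (chi j) (chi (Suc k mod n))) * u (prod3 (chi i) (chi j) (der k))
        + t (prod3 (chi i) (chi j) (der k)) * u (prod3 (chi i) (chi j) (chi k))"
    by (rule f) (simp_all only: prod3_ml, elim vlists3E, simp add: chi_mult der_mult assms algebra_simps)
qed

lemma diag3_forms:
  assumes "i < n" "j < n" "k < n"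
  shows "dg3 w (prod3 (chi i) (chi j) (chi k)) = w i j k" "dg3 w (prod3 (der i) (chi j) (chi k)) = 0"
    "dg3 w (prod3 (chi i) (der j) (chi k)) = 0" "dg3 w (prod3 (chi i) (chi j) (der k)) = 0"
proof -
  have "dg3 w (prod3 (chi i) (chi j) (chi k)) =
      (\<Sum>i'<n. \<Sum>j'<n. \<Sum>k'<n. if k' = k then if j' = j then if i' = i then w i j k else 0 else 0 else 0)"
    unfolding diag3_def using assms by (intro sum.cong refl) (auto simp: chi_e)
  then show "dg3 w (prod3 (chi i) (chi j) (chi k)) = w i j k" using assms by simp
qed (use assms in \<open>simp_all add: diag3_def der_e\<close>)

lemma comult_xe_forms:
  assumes "i < n" "j < n" "k < n"
  shows "comult H (x \<otimes> e k) (prod2 (chi i) (chi j)) = 0"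
    "comult H (x \<otimes> e k) (prod2 (der i) (chi j)) = (if (i + j) mod n = k then \<alpha> i j else 0)"
    "comult H (x \<otimes> e k) (prod2 (chi i) (der j)) = (if (i + j) mod n = k then \<beta> i j else 0)"
proof -
  have m: "comult H (x \<otimes> e k) f = (comult H x \<star> comult H (e k)) f" if "multilinear H 2 f" for f
    using comult_mult[of x "e k"] that by (simp add: tensor_eq_def)
  have x: "comult H x f = skew2 H n e x \<alpha> \<beta> f" if "multilinear H 2 f" for f
    using comult_x that by (simp add: tensor_eq_def)
  note s = tensor_mult_forms[OF comult_closed comult_closed, OF x_closed e_closed, of i j]
    comult_e_forms skew2_forms
  show "comult H (x \<otimes> e k) (prod2 (chi i) (chi j)) = 0"
    "comult H (x \<otimes> e k) (prod2 (der i) (chi j)) = (if (i + j) mod n = k then \<alpha> i j else 0)"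
    "comult H (x \<otimes> e k) (prod2 (chi i) (der j)) = (if (i + j) mod n = k then \<beta> i j else 0)"
    using assms by (simp_all add: m s x n_pos)
qed

lemma counit_xe: "counit H (x \<otimes> e k) = 0"
  by (simp add: counit_mult counit_x)

text \<open>A triple of forms with exactly one derivation picks out the summands of
  \<open>(\<Delta> \<otimes> id)\<Delta>(x)\<close> that carry \<open>x\<close> in that
  factor.\<close>

lemma comult_at_0_x:
  assumes "i < n" "j < n" "k < n"
  shows "comult_at H 0 (comult H x) (prod3 (der i) (chi j) (chi k)) = \<alpha> ((i + j) mod n) k * \<alpha> i j"
    "comult_at H 0 (comult H x) (prod3 (chi i) (der j) (chi k)) = \<alpha> ((i + j) mod n) k * \<beta> i j"
    "comult_at H 0 (comult H x) (prod3 (chi i) (chi j) (der k)) = \<beta> ((i + j) mod n) k"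
    "comult_at H 0 (comult H x) (prod3 (chi i) (chi j) (chi k)) = 0"
proof -
  have x: "comult_at H 0 (comult H x) f = comult_at H 0 (skew2 H n e x \<alpha> \<beta>) f" if "multilinear H 3 f" for f
    using comult_at_cong[OF comult_x, of 0] that by (simp add: tensor_eq_def)
  have E: "comult_at H 0 (comult H x) (prod3 f g h) =
      (\<Sum>a<n. \<Sum>b<n. \<alpha> a b * (comult H (x \<otimes> e a) (prod2 f g) * h (e b)) + \<beta> a b * (comult H (e a) (prod2 f g) * h (x \<otimes> e b)))"
    if f: "linear_form H f" "linear_form H g" "linear_form H h" for f g h
  proof -
    have c: "comult H c (\<lambda>ys. prod3 f g h (ys @ [y])) = comult H c (prod2 f g) * h y"
      if c: "c \<in> carrier H" and y: "y \<in> carrier H" for c y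
    proof -
      have "comult H c (\<lambda>ys. prod3 f g h (ys @ [y])) = comult H c (\<lambda>ys. h y * prod2 f g ys)"
      proof (rule tensors_cong_on[OF comult_closed[OF c]])
        show "multilinear H 2 (\<lambda>ys. prod3 f g h (ys @ [y]))"
          using multilinear_at(1)[OF prod3_multilinear[OF f]] y by simp
        show "multilinear H 2 (\<lambda>ys. h y * prod2 f g ys)"
          by (intro multilinear_times prod2_multilinear f)
        fix ys assume "ys \<in> vlists H 2"
        then show "prod3 f g h (ys @ [y]) = h y * prod2 f g ys" by (elim vlists2E) simp
      qed
      then show ?thesis using tensors_apply_times[OF comult_closed[OF c] prod2_multilinear[OF f(1,2)]] by simp
    qed
    have "comult_at H 0 (comult H x) (prod3 f g h) = (\<Sum>a<n. \<Sum>b<n.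
        \<alpha> a b * comult H (x \<otimes> e a) (\<lambda>ys. prod3 f g h (ys @ [e b])) + \<beta> a b * comult H (e a) (\<lambda>ys. prod3 f g h (ys @ [x \<otimes> e b])))"
      using x[OF prod3_multilinear[OF f]] by (simp add: comult_at_def skew2_def)
    then show ?thesis by (simp only: c e_closed x_closed m_closed)
  qed
  note E = E[OF chi_linear chi_linear chi_linear] E[OF der_linear chi_linear chi_linear]
    E[OF chi_linear der_linear chi_linear] E[OF chi_linear chi_linear der_linear]
  have D: "(\<Sum>a<n. \<Sum>b<n. if b = k then if a = (i + j) mod n then c a b else 0 else 0) = c ((i + j) mod n) k" for c :: "nat \<Rightarrow> nat \<Rightarrow> complex"
    using assms n_pos by simp
  have "comult_at H 0 (comult H x) (prod3 (der i) (chi j) (chi k)) =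
     (\<Sum>a<n. \<Sum>b<n. if b = k then if a = (i + j) mod n then \<alpha> a b * \<alpha> i j else 0 else 0)"
    unfolding E using assms
    by (intro sum.cong refl) (auto simp: comult_xe_forms comult_e_forms chi_e chi_xe der_e der_xe)
  then show "comult_at H 0 (comult H x) (prod3 (der i) (chi j) (chi k)) = \<alpha> ((i + j) mod n) k * \<alpha> i j" using assms by (simp add: D)
  have "comult_at H 0 (comult H x) (prod3 (chi i) (der j) (chi k)) =
     (\<Sum>a<n. \<Sum>b<n. if b = k then if a = (i + j) mod n then \<alpha> a b * \<beta> i j else 0 else 0)"
    unfolding E using assms
    by (intro sum.cong refl) (auto simp: comult_xe_forms comult_e_forms chi_e chi_xe der_e der_xe)
  then show "comult_at H 0 (comult H x) (prod3 (chi i) (der j) (chi k)) = \<alpha> ((i + j) mod n) k * \<beta> i j" using assms by (simp add: D)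
  have "comult_at H 0 (comult H x) (prod3 (chi i) (chi j) (der k)) =
     (\<Sum>a<n. \<Sum>b<n. if b = k then if a = (i + j) mod n then \<beta> a b else 0 else 0)"
    unfolding E using assms
    by (intro sum.cong refl) (auto simp: comult_xe_forms comult_e_forms chi_e chi_xe der_e der_xe)
  then show "comult_at H 0 (comult H x) (prod3 (chi i) (chi j) (der k)) = \<beta> ((i + j) mod n) k" using assms by (simp add: D)
  show "comult_at H 0 (comult H x) (prod3 (chi i) (chi j) (chi k)) = 0"
    unfolding E using assms by (simp add: comult_xe_forms chi_xe)
qed

lemma comult_at_1_x:
  assumes "i < n" "j < n" "k < n"
  shows "comult_at H 1 (comult H x) (prod3 (der i) (chi j) (chi k)) = \<alpha> i ((j + k) mod n)"
    "comult_at H 1 (comult H x) (prod3 (chi i) (der j) (chi k)) = \<beta> i ((j + k) mod n) * \<alpha> j k"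
    "comult_at H 1 (comult H x) (prod3 (chi i) (chi j) (der k)) = \<beta> i ((j + k) mod n) * \<beta> j k"
proof -
  have x: "comult_at H 1 (comult H x) f = comult_at H 1 (skew2 H n e x \<alpha> \<beta>) f" if "multilinear H 3 f" for f
    using comult_at_cong[OF comult_x, of 1] that by (simp add: tensor_eq_def)
  have E: "comult_at H 1 (comult H x) (prod3 f g h) =
      (\<Sum>a<n. \<Sum>b<n. \<alpha> a b * (f (x \<otimes> e a) * comult H (e b) (prod2 g h)) + \<beta> a b * (f (e a) * comult H (x \<otimes> e b) (prod2 g h)))"
    if f: "linear_form H f" "linear_form H g" "linear_form H h" for f g h
  proof -
    have c: "comult H c (\<lambda>ys. prod3 f g h (y # ys)) = f y * comult H c (prod2 g h)"
      if c: "c \<in> carrier H" and y: "y \<in> carrier H" for c y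
    proof -
      have "comult H c (\<lambda>ys. prod3 f g h (y # ys)) = comult H c (\<lambda>ys. f y * prod2 g h ys)"
      proof (rule tensors_cong_on[OF comult_closed[OF c]])
        show "multilinear H 2 (\<lambda>ys. prod3 f g h (y # ys))"
          using multilinear_at(2)[OF prod3_multilinear[OF f]] y by simp
        show "multilinear H 2 (\<lambda>ys. f y * prod2 g h ys)"
          by (intro multilinear_times prod2_multilinear f)
        fix ys assume "ys \<in> vlists H 2"
        then show "prod3 f g h (y # ys) = f y * prod2 g h ys" by (elim vlists2E) simp
      qed
      then show ?thesis using tensors_apply_times[OF comult_closed[OF c] prod2_multilinear[OF f(2,3)]] by simp
    qed
    have "comult_at H 1 (comult H x) (prod3 f g h) = (\<Sum>a<n. \<Sum>b<n.
        \<alpha> a b * comult H (e b) (\<lambda>ys. prod3 f g h ((x \<otimes> e a) # ys)) + \<beta> a b * comult H (x \<otimes> e b) (\<lambda>ys. prod3 f g h (e a # ys)))"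
      using x[OF prod3_multilinear[OF f]] by (simp add: comult_at_def skew2_def)
    then show ?thesis by (simp only: c e_closed x_closed m_closed)
  qed
  note E = E[OF der_linear chi_linear chi_linear]
    E[OF chi_linear der_linear chi_linear] E[OF chi_linear chi_linear der_linear]
  have D: "(\<Sum>a<n. \<Sum>b<n. if b = (j + k) mod n then if a = i then c a b else 0 else 0) = c i ((j + k) mod n)" for c :: "nat \<Rightarrow> nat \<Rightarrow> complex"
    using assms n_pos by simp
  have "comult_at H 1 (comult H x) (prod3 (der i) (chi j) (chi k)) =
     (\<Sum>a<n. \<Sum>b<n. if b = (j + k) mod n then if a = i then \<alpha> a b else 0 else 0)"
    unfolding E using assms
    by (intro sum.cong refl) (auto simp: comult_xe_forms comult_e_forms chi_e chi_xe der_e der_xe)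
  then show "comult_at H 1 (comult H x) (prod3 (der i) (chi j) (chi k)) = \<alpha> i ((j + k) mod n)" using assms by (simp add: D)
  have "comult_at H 1 (comult H x) (prod3 (chi i) (der j) (chi k)) =
     (\<Sum>a<n. \<Sum>b<n. if b = (j + k) mod n then if a = i then \<beta> a b * \<alpha> j k else 0 else 0)"
    unfolding E using assms
    by (intro sum.cong refl) (auto simp: comult_xe_forms comult_e_forms chi_e chi_xe der_e der_xe)
  then show "comult_at H 1 (comult H x) (prod3 (chi i) (der j) (chi k)) = \<beta> i ((j + k) mod n) * \<alpha> j k" using assms by (simp add: D)
  have "comult_at H 1 (comult H x) (prod3 (chi i) (chi j) (der k)) =
     (\<Sum>a<n. \<Sum>b<n. if b = (j + k) mod n then if a = i then \<beta> a b * \<beta> j k else 0 else 0)"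
    unfolding E using assms
    by (intro sum.cong refl) (auto simp: comult_xe_forms comult_e_forms chi_e chi_xe der_e der_xe)
  then show "comult_at H 1 (comult H x) (prod3 (chi i) (chi j) (der k)) = \<beta> i ((j + k) mod n) * \<beta> j k" using assms by (simp add: D)
qed

text \<open>On such triples the associator acts from the left with the index of the
  \<open>x\<close>-factor shifted by one, its inverse from the right with the unshifted indices;
  clearing the denominator gives three scalar equations, one for each position of
  \<open>x\<close>.\<close>

theorem coassoc_equations:
  assumes H: "quasi_hopf_algebra H" and w: "\<And>i j k. i < n \<Longrightarrow> j < n \<Longrightarrow> k < n \<Longrightarrow> \<omega> i j k \<noteq> 0"
    and ijk: "i < n" "j < n" "k < n"
  shows "\<alpha> i ((j + k) mod n) * \<omega> i j k = \<omega> (Suc i mod n) j k * (\<alpha> ((i + j) mod n) k * \<alpha> i j)"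
    "\<beta> i ((j + k) mod n) * \<alpha> j k * \<omega> i j k = \<omega> i (Suc j mod n) k * (\<alpha> ((i + j) mod n) k * \<beta> i j)"
    "\<beta> i ((j + k) mod n) * \<beta> j k * \<omega> i j k = \<omega> i j (Suc k mod n) * \<beta> ((i + j) mod n) k"
proof -
  let ?c = "comult_at H 0 (comult H x)"
  note inv = diag3_invertible[OF w associator_closed associator_eq]
  have c: "?c \<in> tensors H 3" using comult_at_closed[OF comult_closed[OF x_closed], of 0] by simp
  have "tensor_eq H 3 (comult_at H 1 (comult H x)) (associator H \<star> ?c \<star> tensor_inv H 3 (associator H))"
    by (rule quasi_hopf_algebra.quasi_coassoc[OF H x_closed])
  also have "tensor_eq H 3 \<dots> (dg3 \<omega> \<star> ?c \<star> dg3 (\<lambda>i j k. 1 / \<omega> i j k))"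
    by (intro tensor_mult_cong tensor_mult_closed tensor_eq_refl associator_eq inv associator_closed c diag3_closed)
  finally have E: "comult_at H 1 (comult H x) f = (dg3 \<omega> \<star> ?c \<star> dg3 (\<lambda>i j k. 1 / \<omega> i j k)) f" if "multilinear H 3 f" for f
    using that by (simp add: tensor_eq_def)
  note s = E[unfolded One_nat_def] tensor_mult_forms3[OF tensor_mult_closed[OF diag3_closed c] diag3_closed ijk]
    tensor_mult_forms3[OF diag3_closed c ijk] diag3_forms[OF ijk] comult_at_0_x[OF ijk] diag3_forms
  show "\<alpha> i ((j + k) mod n) * \<omega> i j k = \<omega> (Suc i mod n) j k * (\<alpha> ((i + j) mod n) k * \<alpha> i j)"
    using comult_at_1_x(1)[OF ijk] ijk n_pos w[OF ijk] by (simp add: s field_simps)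
  show "\<beta> i ((j + k) mod n) * \<alpha> j k * \<omega> i j k = \<omega> i (Suc j mod n) k * (\<alpha> ((i + j) mod n) k * \<beta> i j)"
    using comult_at_1_x(2)[OF ijk] ijk n_pos w[OF ijk] by (simp add: s field_simps)
  show "\<beta> i ((j + k) mod n) * \<beta> j k * \<omega> i j k = \<omega> i j (Suc k mod n) * \<beta> ((i + j) mod n) k"
    using comult_at_1_x(3)[OF ijk] ijk n_pos w[OF ijk] by (simp add: s field_simps)
qed

lemma counit_equations:
  assumes H: "quasi_hopf_algebra H" and i: "i < n"
  shows "\<alpha> i 0 = 1" "\<beta> 0 i = 1"
proof -
  have d: "multilinear H 1 (\<lambda>xs. der i (xs ! 0))" by (simp add: multilinear1_iff der_linear del: One_nat_def)
  note c = counit_at_cong[OF comult_x] quasi_hopf_algebra.counit_left[OF H x_closed] quasi_hopf_algebra.counit_right[OF H x_closed]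
  have "counit_at H 0 (skew2 H n e x \<alpha> \<beta>) (\<lambda>xs. der i (xs ! 0)) = 1"
    using c(1)[of 0, unfolded One_nat_def] c(2)[unfolded One_nat_def] d[unfolded One_nat_def] der_x[OF i] unfolding tensor_eq_def by (simp add: pure_tensor_def)
  moreover have "counit_at H 0 (skew2 H n e x \<alpha> \<beta>) (\<lambda>xs. der i (xs ! 0)) =
      (\<Sum>a<n. \<Sum>b<n. if b = i then if a = 0 then \<beta> a b else 0 else 0)"
    unfolding counit_at_def skew2_def using i by (intro sum.cong refl) (auto simp: counit_e counit_xe der_xe der_e)
  ultimately show "\<beta> 0 i = 1" using i by simp
  have "counit_at H 1 (skew2 H n e x \<alpha> \<beta>) (\<lambda>xs. der i (xs ! 0)) = 1"
    using c(1)[of 1, unfolded One_nat_def] c(3)[unfolded One_nat_def] d[unfolded One_nat_def] der_x[OF i] unfolding tensor_eq_def by (simp add: pure_tensor_def)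
  moreover have "counit_at H 1 (skew2 H n e x \<alpha> \<beta>) (\<lambda>xs. der i (xs ! 0)) =
      (\<Sum>a<n. \<Sum>b<n. if b = 0 then if a = i then \<alpha> a b else 0 else 0)"
    unfolding counit_at_def skew2_def using i by (intro sum.cong refl) (auto simp: counit_e counit_xe der_xe der_e)
  ultimately show "\<alpha> i 0 = 1" using i n_pos by simp
qed

end


text \<open>The quasi-coassociativity of \<open>\<Delta>(x)\<close> makes \<open>\<alpha>\<close> and \<open>\<beta>\<close> cocycles up to powers of \<open>R\<close>; rescaling the
  weight vectors \<open>x e\<^sub>i\<close> by \<open>u\<close> trivialises them up to the parameter \<open>q\<close>.\<close>

lemma coassoc_equations_solution:
  fixes \<alpha> \<beta> :: "nat \<Rightarrow> nat \<Rightarrow> complex"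
  assumes n: "n > 1" and R: "R ^ n = 1"
    and c1: "\<And>i j k. i < n \<Longrightarrow> j < n \<Longrightarrow> k < n \<Longrightarrow>
      \<alpha> i ((j + k) mod n) * A_omega n R i j k = A_omega n R (Suc i mod n) j k * (\<alpha> ((i + j) mod n) k * \<alpha> i j)"
    and c2: "\<And>i j k. i < n \<Longrightarrow> j < n \<Longrightarrow> k < n \<Longrightarrow>
      \<beta> i ((j + k) mod n) * \<alpha> j k * A_omega n R i j k = A_omega n R i (Suc j mod n) k * (\<alpha> ((i + j) mod n) k * \<beta> i j)"
    and c3: "\<And>i j k. i < n \<Longrightarrow> j < n \<Longrightarrow> k < n \<Longrightarrow>
      \<beta> i ((j + k) mod n) * \<beta> j k * A_omega n R i j k = A_omega n R i j (Suc k mod n) * \<beta> ((i + j) mod n) k"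
    and a0: "\<And>i. i < n \<Longrightarrow> \<alpha> i 0 = 1" and b0: "\<And>j. j < n \<Longrightarrow> \<beta> 0 j = 1"
  obtains q u where "q ^ n = R" "\<And>i. u i \<noteq> 0" "\<And>i. u (i mod n) = u i"
    "\<And>i j. i < n \<Longrightarrow> j < n \<Longrightarrow> \<alpha> i j * u (i + j) / u i = A_alpha n q i j"
    "\<And>i j. i < n \<Longrightarrow> j < n \<Longrightarrow> \<beta> i j * u (i + j) / u j = A_beta n q i j"
proof -
  have n0: "n > 0" and R0: "R \<noteq> 0" using n R by (auto simp: power_0_left)
  have sn: "Suc 0 mod n = 1" "Suc 0 div n = 0" using n by auto
  \<comment> \<open>The first row of \<open>\<alpha>\<close> continued to all naturals with a factor
    \<open>R\<close> for each turn around Z/n. This absorbs the carries, and the first equation at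
    \<open>i = 0\<close> becomes \<open>\<alpha> i j * A i = A (i + j)\<close>.\<close>
  define A where "A i = \<alpha> 0 (i mod n) * R ^ (i div n)" for i
  define d where "d k = Suc k div n" for k
  have \<omega>: "A_omega n R 0 j k = 1" "A_omega n R i 0 k = 1" "A_omega n R i j 0 = 1"
    "A_omega n R (Suc 0) i j = 1 / R ^ ((i mod n + j mod n) div n)" for i j k
    using n0 by (simp_all add: A_omega_def div_eq_0_iff power_inverse power_one_over divide_inverse)
  have \<omega>1: "A_omega n R i (Suc 0) k = 1 / R ^ (i * d k)" "A_omega n R i k (Suc 0) = 1 / R ^ (i * d k)" if "k < n" for i k
    using that n by (simp_all add: A_omega_def d_def power_inverse divide_inverse)
  have aA: "\<alpha> i j * A i = A (i + j)" if "i < n" "j < n" for i j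
    using c1[of 0 i j] that n R0 by (simp add: \<omega> sn A_def field_simps)
  have A0: "A 0 = 1" using a0[of 0] n by (simp add: A_def)
  \<comment> \<open>\<open>A i\<close> is a factor of \<open>A n = R\<close>, hence nonzero.\<close>
  have \<alpha>0: "\<alpha> 0 i \<noteq> 0" if "i < n" for i
  proof (cases "i = 0")
    case False
    then show ?thesis using aA[of i "n - i"] that n0 R0 a0[of 0] by (auto simp: A_def)
  qed (use a0 n0 in simp)
  have A_nz: "A i \<noteq> 0" for i using \<alpha>0[of "i mod n"] n0 R0 by (simp add: A_def)
  have A_n: "A (i + n) = R * A i" for i using n0 by (simp add: A_def)
  \<comment> \<open>The first column of \<open>\<beta>\<close> normalised by \<open>A\<close>; the
    other two equations make it multiplicative in \<open>i\<close>.\<close>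
  define b where "b i = \<beta> i 0 / A i" for i
  have bA: "\<beta> i k * R ^ (i * d k) * A k = A (i + k) * b i" if "i < n" "k < n" for i k
  proof -
    have "\<beta> i k * \<alpha> 0 k = \<alpha> i k * \<beta> i 0 / R ^ (i * d k)"
      using c2[of i 0 k] that n \<omega>1(1)[of k i] by (simp add: \<omega> sn)
    moreover have "A k = \<alpha> 0 k" "\<alpha> i k = A (i + k) / A i"
      using that aA[of i k] A_nz[of i] by (auto simp: A_def field_simps)
    ultimately have "\<beta> i k * A k = A (i + k) * b i / R ^ (i * d k)" by (simp add: b_def)
    then show ?thesis using R0 by (simp add: field_simps)
  qed
  have bb: "A (i + j) * (b i * b j) = \<beta> ((i + j) mod n) 0" if "i < n" "j < n" for i j
  proof -
    have "\<beta> i j * \<beta> j 0 = \<beta> ((i + j) mod n) 0 / R ^ (i * d j)"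
      using c3[of i j 0] that n \<omega>1(2)[of j i] by (simp add: \<omega> sn)
    then have "\<beta> i j * R ^ (i * d j) * \<beta> j 0 = \<beta> ((i + j) mod n) 0" using R0 by (simp add: field_simps)
    moreover have "\<beta> j 0 = A j * b j" using A_nz by (simp add: b_def)
    ultimately have "\<beta> i j * R ^ (i * d j) * A j * b j = \<beta> ((i + j) mod n) 0" by (simp add: mult.assoc)
    then show ?thesis unfolding bA[OF that] by (simp only: mult.assoc)
  qed
  have b_pow: "i < n \<Longrightarrow> b i = b 1 ^ i" for i
  proof (induction i)
    case 0
    then show ?case using b0[of 0] A0 by (simp add: b_def)
  next
    case (Suc i)
    have "A (1 + i) * (b 1 * b i) = \<beta> (1 + i) 0" using bb[of 1 i] Suc(2) n by simp
    then show ?case using Suc A_nz[of "Suc i"] by (simp add: b_def[of "Suc i"] field_simps)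
  qed
  \<comment> \<open>Closing the turn at \<open>n\<close>: the factor \<open>R\<close> gained by
    \<open>A\<close> has to be compensated by the \<open>n\<close>-th power of \<open>b 1\<close>,
    so the inverse of \<open>b 1\<close> is an \<open>n\<close>-th root of \<open>R\<close>.\<close>
  have "A n * (b 1 * b (n - 1)) = \<beta> 0 0" using bb[of 1 "n - 1"] n by simp
  then have Rb: "R * b 1 ^ n = 1"
    using b_pow[of "n - 1"] A_n[of 0] A0 b0[of 0] n by (cases n) auto
  then have b1: "b 1 \<noteq> 0" using n0 by (auto simp: power_0_left)
  define q where "q = 1 / b 1"
  have qn: "q ^ n = R" using Rb b1 by (simp add: q_def power_divide field_simps)
  have q0: "q \<noteq> 0" using b1 by (simp add: q_def)
  \<comment> \<open>Numerator and denominator both gain \<open>R\<close> over a period, so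
    \<open>u\<close> is periodic, as a rescaling of the weight vectors has to be.\<close>
  define u where "u i = q ^ i / A i" for i
  have u_per: "u (i mod n + m * n) = u (i mod n)" for i m
  proof (induction m)
    case (Suc m)
    have "u (i mod n + m * n + n) = u (i mod n + m * n)"
      unfolding u_def A_n power_add qn using R0 by simp
    then show ?case using Suc by (simp add: add.assoc add.commute add.left_commute)
  qed simp
  show ?thesis
  proof (rule that[OF qn])
    show "u i \<noteq> 0" "u (i mod n) = u i" for i
      using q0 A_nz u_per[of i "i div n"] by (simp_all add: u_def)
    fix i j assume ij: "i < n" "j < n"
    show "\<alpha> i j * u (i + j) / u i = A_alpha n q i j"
      using aA[OF ij] A_nz[of i] A_nz[of "i + j"] q0 ij by (simp add: u_def A_alpha_def power_add field_simps)
    have "q ^ i * b i = 1" using b_pow[OF ij(1)] b1 by (simp add: q_def power_divide)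
    moreover have "\<beta> i j * u (i + j) / u j * R ^ (i * d j) = (\<beta> i j * R ^ (i * d j) * A j) * q ^ i / A (i + j)"
      using q0 A_nz by (simp add: u_def power_add field_simps)
    moreover have "\<dots> = b i * q ^ i" unfolding bA[OF ij] using A_nz[of "i + j"] by simp
    ultimately have "\<beta> i j * u (i + j) / u j * R ^ (i * d j) = 1" by (simp only: mult.commute)
    then show "\<beta> i j * u (i + j) / u j = A_beta n q i j"
      using R0 ij by (simp add: A_beta_def qn d_def power_inverse field_simps)
  qed
qed

text \<open>Removing from \<open>\<alpha>\<close> and \<open>\<beta>\<close> the factors that a
  twist by \<open>F\<close> introduces makes the coboundary of \<open>F\<close> cancel in all three
  equations, which leaves the normal form.\<close>

lemma twisted_coassoc_equations_solution:
  fixes \<alpha> \<beta> F :: "nat \<Rightarrow> nat \<Rightarrow> complex"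
  assumes n: "n > 1" and R: "R ^ n = 1"
    and w: "\<And>i j k. i < n \<Longrightarrow> j < n \<Longrightarrow> k < n \<Longrightarrow> \<omega> i j k = twist3 n F (A_omega n R) i j k"
    and F: "\<And>i j. i < n \<Longrightarrow> j < n \<Longrightarrow> F i j \<noteq> 0" "\<And>j. j < n \<Longrightarrow> F 0 j = 1" "\<And>i. i < n \<Longrightarrow> F i 0 = 1"
    and c1: "\<And>i j k. i < n \<Longrightarrow> j < n \<Longrightarrow> k < n \<Longrightarrow>
      \<alpha> i ((j + k) mod n) * \<omega> i j k = \<omega> (Suc i mod n) j k * (\<alpha> ((i + j) mod n) k * \<alpha> i j)"
    and c2: "\<And>i j k. i < n \<Longrightarrow> j < n \<Longrightarrow> k < n \<Longrightarrow>
      \<beta> i ((j + k) mod n) * \<alpha> j k * \<omega> i j k = \<omega> i (Suc j mod n) k * (\<alpha> ((i + j) mod n) k * \<beta> i j)"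
    and c3: "\<And>i j k. i < n \<Longrightarrow> j < n \<Longrightarrow> k < n \<Longrightarrow>
      \<beta> i ((j + k) mod n) * \<beta> j k * \<omega> i j k = \<omega> i j (Suc k mod n) * \<beta> ((i + j) mod n) k"
    and a0: "\<And>i. i < n \<Longrightarrow> \<alpha> i 0 = 1" and b0: "\<And>j. j < n \<Longrightarrow> \<beta> 0 j = 1"
  obtains q u where "q ^ n = R" "\<And>i. u i \<noteq> 0" "\<And>i. u (i mod n) = u i"
    "\<And>i j. i < n \<Longrightarrow> j < n \<Longrightarrow> \<alpha> i j * u (i + j) / u i = F (Suc i mod n) j * A_alpha n q i j / F i j"
    "\<And>i j. i < n \<Longrightarrow> j < n \<Longrightarrow> \<beta> i j * u (i + j) / u j = F i (Suc j mod n) * A_beta n q i j / F i j"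
proof -
  have n0: "n > 0" using n by simp
  let ?a = "\<lambda>i j. \<alpha> i j * F i j / F (Suc i mod n) j" and ?b = "\<lambda>i j. \<beta> i j * F i j / F i (Suc j mod n)"
  have e1: "?a i ((j + k) mod n) * A_omega n R i j k = A_omega n R (Suc i mod n) j k * (?a ((i + j) mod n) k * ?a i j)"
    if ijk: "i < n" "j < n" "k < n" for i j k
  proof -
    have m: "(Suc i mod n + j) mod n = Suc ((i + j) mod n) mod n" by (simp add: mod_simps)
    have nz: "F j k \<noteq> 0" "F i j \<noteq> 0" "F i ((j + k) mod n) \<noteq> 0" "F ((i + j) mod n) k \<noteq> 0" "F (Suc i mod n) j \<noteq> 0"
      "F (Suc i mod n) ((j + k) mod n) \<noteq> 0" "F (Suc ((i + j) mod n) mod n) k \<noteq> 0"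
      using F(1) ijk n0 by simp_all
    show ?thesis
      using c1[OF ijk] nz ijk n0 by (simp only: w twist3_def mod_less_divisor m) (simp add: divide_simps mult_ac)
  qed
  have e2: "?b i ((j + k) mod n) * ?a j k * A_omega n R i j k = A_omega n R i (Suc j mod n) k * (?a ((i + j) mod n) k * ?b i j)"
    if ijk: "i < n" "j < n" "k < n" for i j k
  proof -
    have m: "(i + Suc j mod n) mod n = Suc ((i + j) mod n) mod n" "(Suc j mod n + k) mod n = Suc ((j + k) mod n) mod n"
      by (simp_all add: mod_simps)
    have nz: "F j k \<noteq> 0" "F i j \<noteq> 0" "F i ((j + k) mod n) \<noteq> 0" "F ((i + j) mod n) k \<noteq> 0" "F (Suc j mod n) k \<noteq> 0"
      "F i (Suc j mod n) \<noteq> 0" "F i (Suc ((j + k) mod n) mod n) \<noteq> 0" "F (Suc ((i + j) mod n) mod n) k \<noteq> 0"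
      using F(1) ijk n0 by simp_all
    show ?thesis
      using c2[OF ijk] nz ijk n0 by (simp only: w twist3_def mod_less_divisor m) (simp add: divide_simps mult_ac)
  qed
  have e3: "?b i ((j + k) mod n) * ?b j k * A_omega n R i j k = A_omega n R i j (Suc k mod n) * ?b ((i + j) mod n) k"
    if ijk: "i < n" "j < n" "k < n" for i j k
  proof -
    have m: "(j + Suc k mod n) mod n = Suc ((j + k) mod n) mod n" by (simp add: mod_simps)
    have nz: "F j k \<noteq> 0" "F i j \<noteq> 0" "F i ((j + k) mod n) \<noteq> 0" "F ((i + j) mod n) k \<noteq> 0" "F j (Suc k mod n) \<noteq> 0"
      "F i (Suc ((j + k) mod n) mod n) \<noteq> 0" "F ((i + j) mod n) (Suc k mod n) \<noteq> 0"
      using F(1) ijk n0 by simp_all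
    show ?thesis
      using c3[OF ijk] nz ijk n0 by (simp only: w twist3_def mod_less_divisor m) (simp add: divide_simps mult_ac)
  qed
  have a: "?a i 0 = 1" "?b 0 i = 1" if "i < n" for i using that n0 by (simp_all add: a0 b0 F)
  obtain q u where q: "q ^ n = R" and u: "\<And>i. u i \<noteq> 0" "\<And>i. u (i mod n) = u i"
    and s: "\<And>i j. i < n \<Longrightarrow> j < n \<Longrightarrow> ?a i j * u (i + j) / u i = A_alpha n q i j"
    "\<And>i j. i < n \<Longrightarrow> j < n \<Longrightarrow> ?b i j * u (i + j) / u j = A_beta n q i j"
    using coassoc_equations_solution[of n R ?a ?b, OF n R e1 e2 e3 a] by blast
  show ?thesis
  proof (rule that[of q u, OF q u])
    fix i j assume ij: "i < n" "j < n"
    have nz: "F i j \<noteq> 0" "F (Suc i mod n) j \<noteq> 0" "F i (Suc j mod n) \<noteq> 0" using F(1) ij n0 by simp_all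
    show "\<alpha> i j * u (i + j) / u i = F (Suc i mod n) j * A_alpha n q i j / F i j"
      using s(1)[OF ij, symmetric] nz by simp
    show "\<beta> i j * u (i + j) / u j = F i (Suc j mod n) * A_beta n q i j / F i j"
      using s(2)[OF ij, symmetric] nz by simp
  qed
qed

section \<open>Rescaling the generator by a diagonal element\<close>

context shift_system
begin

lemma weight_sum_mult:
  assumes "\<And>i. u (i mod n) = u i"
  shows "(\<Oplus>i\<in>{..<n}. u i \<odot> e i) \<otimes> e i = u i \<odot> e i" "e i \<otimes> (\<Oplus>i\<in>{..<n}. u i \<odot> e i) = u i \<odot> e i"
proof -
  have j: "i mod n < n" using n_pos by simp
  have "(\<Oplus>k\<in>{..<n}. u k \<odot> e k) \<otimes> e (i mod n) = (\<Oplus>k\<in>{..<n}. if k = i mod n then u (i mod n) \<odot> e (i mod n) else \<zero>)"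
    using j by (subst finsum_ldistr) (auto intro!: M.finsum_cong' simp: smult_mult_left e_mult)
  also have "\<dots> = u (i mod n) \<odot> e (i mod n)" using j by (intro finsum_delta) auto
  finally show "(\<Oplus>i\<in>{..<n}. u i \<odot> e i) \<otimes> e i = u i \<odot> e i" by (simp add: assms e_mod)
  have "e (i mod n) \<otimes> (\<Oplus>k\<in>{..<n}. u k \<odot> e k) = (\<Oplus>k\<in>{..<n}. if k = i mod n then u (i mod n) \<odot> e (i mod n) else \<zero>)"
    using j by (subst finsum_rdistr) (auto intro!: M.finsum_cong' simp: smult_mult_right e_mult)
  also have "\<dots> = u (i mod n) \<odot> e (i mod n)" using j by (intro finsum_delta) auto
  finally show "e i \<otimes> (\<Oplus>i\<in>{..<n}. u i \<odot> e i) = u i \<odot> e i" by (simp add: assms e_mod)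
qed

lemma comult_weight_sum:
  assumes "multilinear H 2 f"
  shows "comult H (\<Oplus>i\<in>{..<n}. u i \<odot> e i) f = dg2 (\<lambda>i j. u ((i + j) mod n)) f"
proof -
  have "comult H (\<Oplus>i\<in>{..<n}. u i \<odot> e i) f = (\<Sum>i<n. comult H (u i \<odot> e i) f)"
    using linear_form_finsum[OF comult_linear_form[OF assms], of "{..<n}" "\<lambda>i. u i \<odot> e i"] by simp
  also have "\<dots> = (\<Sum>i<n. u i * (\<Sum>k<n. \<Sum>l<n. if (k + l) mod n = i then f [e k, e l] else 0))"
    using comult_linear_form[OF assms] assms by (intro sum.cong refl) (simp add: linear_form_def comult_e_apply)
  finally show ?thesis using sum_mod_collect[OF n_pos] by (simp add: diag2_def)
qed

text \<open>With \<open>U = \<Sum> u\<^sub>i e\<^sub>i\<close> one has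
  \<open>x U e\<^sub>i = u\<^sub>i x e\<^sub>i\<close>, while \<open>\<Delta>(U)\<close> has the
  coefficients \<open>u\<^sub>i\<^sub>+\<^sub>j\<close>; the quotient of the two changes the
  constants.\<close>

theorem rescaled_shift_system:
  assumes u: "\<And>i. u i \<noteq> 0" "\<And>i. u (i mod n) = u i"
  shows "shift_system H n e (x \<otimes> (\<Oplus>i\<in>{..<n}. u i \<odot> e i))
    (\<lambda>i j. \<alpha> i j * u (i + j) / u i) (\<lambda>i j. \<beta> i j * u (i + j) / u j) \<omega>"
proof (intro shift_system.intro shift_system_axioms.intro weight_system_axioms)
  let ?U = "\<Oplus>i\<in>{..<n}. u i \<odot> e i"
  have U: "?U \<in> carrier H" by (intro M.finsum_closed) auto
  then show xU: "x \<otimes> ?U \<in> carrier H" by simp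
  have xUe: "x \<otimes> ?U \<otimes> e i = u i \<odot> (x \<otimes> e i)" for i
    using U by (simp add: m_assoc weight_sum_mult[of u, OF u(2)] smult_mult_right)
  show "x \<otimes> ?U \<otimes> e i = e (Suc i) \<otimes> (x \<otimes> ?U)" for i
  proof -
    have "e (Suc i) \<otimes> (x \<otimes> ?U) = x \<otimes> (e i \<otimes> ?U)" using U by (simp add: m_assoc[symmetric] x_e)
    then show ?thesis by (simp add: xUe weight_sum_mult[of u, OF u(2)] smult_mult_right)
  qed
  have "tensor_eq H 2 (comult H (x \<otimes> ?U)) (comult H x \<star> comult H ?U)"
    using U by (simp add: comult_mult)
  also have "tensor_eq H 2 \<dots> (skew2 H n e x \<alpha> \<beta> \<star> dg2 (\<lambda>i j. u ((i + j) mod n)))"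
    using comult_weight_sum U by (intro tensor_mult_cong comult_x comult_closed) (auto simp: tensor_eq_def)
  also have "tensor_eq H 2 \<dots> (skew2 H n e x (\<lambda>i j. \<alpha> i j * u ((i + j) mod n)) (\<lambda>i j. \<beta> i j * u ((i + j) mod n)))"
    by (rule skew2_diag2)
  also have "tensor_eq H 2 \<dots> (skew2 H n e (x \<otimes> ?U) (\<lambda>i j. \<alpha> i j * u (i + j) / u i) (\<lambda>i j. \<beta> i j * u (i + j) / u j))"
    unfolding tensor_eq_def
  proof (intro allI impI)
    fix f assume f: "multilinear H 2 f"
    then show "skew2 H n e x (\<lambda>i j. \<alpha> i j * u ((i + j) mod n)) (\<lambda>i j. \<beta> i j * u ((i + j) mod n)) f =
        skew2 H n e (x \<otimes> ?U) (\<lambda>i j. \<alpha> i j * u (i + j) / u i) (\<lambda>i j. \<beta> i j * u (i + j) / u j) f"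
      unfolding skew2_def xUe
      by (intro sum.cong refl) (auto simp: multilinear2_iff linear_form_def u)
  qed
  finally show "tensor_eq H 2 (comult H (x \<otimes> ?U)) (skew2 H n e (x \<otimes> ?U) (\<lambda>i j. \<alpha> i j * u (i + j) / u i) (\<lambda>i j. \<beta> i j * u (i + j) / u j))" .
  show "counit H (x \<otimes> ?U) = 0" using U by (simp add: counit_mult counit_x)
qed (rule associator_closed associator_eq)+

end

text \<open>A twist leaves the product and the monomials alone, so the basis persists and only the
  constants change.\<close>

lemma (in graded_model) twist_graded_model:
  assumes F: "\<And>i j. i < n \<Longrightarrow> j < n \<Longrightarrow> F i j \<noteq> 0"
  shows "graded_model (twist H (dg2 F)) n e x (\<lambda>i j. F (Suc i mod n) j * \<alpha> i j / F i j)
    (\<lambda>i j. F i (Suc j mod n) * \<beta> i j / F i j) (twist3 n F \<omega>) M"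
proof (intro graded_model.intro graded_model_axioms.intro twist_shift_system F)
  let ?t = "twist H (dg2 F)"
  have ops: "carrier ?t = carrier H" "ring.add ?t = ring.add H" "module.smult ?t = module.smult H"
    "monoid.mult ?t = monoid.mult H" "monoid.one ?t = monoid.one H" "\<zero>\<^bsub>?t\<^esub> = \<zero>\<^bsub>H\<^esub>"
    by (simp_all add: twist_def)
  have fs: "finsum ?t g A = finsum H g A" for g :: "nat \<Rightarrow> 'a" and A
    by (simp add: finsum_def finprod_def ops)
  have pw: "y [^]\<^bsub>?t\<^esub> (k::nat) = y [^] k" for y k
    by (simp add: nat_pow_def ops)
  show "x [^]\<^bsub>?t\<^esub> M = \<zero>\<^bsub>?t\<^esub>" by (simp add: pw ops x_nilpotent)
  have "combination ?t e x M n = combination H e x M n"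
    by (rule ext) (simp add: combination_def fs pw ops)
  then show "bij_betw (combination ?t e x M n) (coefficients M n) (carrier ?t)" using basis by (simp add: ops)
qed (assumption | rule n_gt M_gt)+

section \<open>The order of nilpotency\<close>

context shift_system
begin

text \<open>Tensors of bidegree \<open>(a, b)\<close> in \<open>x\<close>; in bidegree
  \<open>(0, 0)\<close> they are the diagonal tensors.\<close>

definition monomials2 :: "nat \<Rightarrow> nat \<Rightarrow> (nat \<Rightarrow> nat \<Rightarrow> complex) \<Rightarrow> 'a tensor" where
  "monomials2 a b \<gamma> = (\<lambda>f. \<Sum>i<n. \<Sum>j<n. \<gamma> i j * f [x [^] a \<otimes> e i, x [^] b \<otimes> e j])"

lemma monomials2_closed [simp]: "monomials2 a b \<gamma> \<in> tensors H 2"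
  unfolding monomials2_def
  using pure_tensor_closed[of "[_,_]" H] by (intro tensors_sum tensors_smult) (simp_all add: pure_tensor_def numeral_eq_Suc)

lemma monomials2_cong: "(\<And>i j. i < n \<Longrightarrow> j < n \<Longrightarrow> \<gamma> i j = \<delta> i j) \<Longrightarrow> monomials2 a b \<gamma> = monomials2 a b \<delta>"
  by (auto simp: monomials2_def intro!: ext sum.cong)

lemma monomials2_0: "monomials2 0 0 \<gamma> = dg2 \<gamma>"
  by (simp add: monomials2_def diag2_def)

lemma x_pow_e_mult:
  assumes "i < n" "j < n"
  shows "(x [^] (k::nat) \<otimes> e i) \<otimes> (x [^] (l::nat) \<otimes> e j) = (if i = (j + l) mod n then x [^] (k + l) \<otimes> e j else \<zero>)"
proof -
  have "(x [^] k \<otimes> e i) \<otimes> (x [^] l \<otimes> e j) = x [^] k \<otimes> (e i \<otimes> (x [^] l \<otimes> e j))" by (simp add: m_assoc)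
  then show ?thesis using e_x_pow_e[OF assms, of l] by (auto simp: m_assoc[symmetric] nat_pow_mult)
qed

text \<open>Moving the idempotents of the left factor past \<open>x\<^sup>c\<close> and
  \<open>x\<^sup>d\<close> shifts the arguments of its coefficients.\<close>

lemma monomials2_mult:
  "tensor_eq H 2 (monomials2 a b \<gamma> \<star> monomials2 c d \<delta>)
     (monomials2 (a + c) (b + d) (\<lambda>i j. \<gamma> ((i + c) mod n) ((j + d) mod n) * \<delta> i j))"
  unfolding tensor_eq_def
proof (intro allI impI)
  fix f assume f: "multilinear H 2 f"
  let ?v = "\<lambda>i i'. (x [^] a \<otimes> e i) \<otimes> (x [^] c \<otimes> e i')" and ?w = "\<lambda>j j'. (x [^] b \<otimes> e j) \<otimes> (x [^] d \<otimes> e j')"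
  have "(monomials2 a b \<gamma> \<star> monomials2 c d \<delta>) f =
      (\<Sum>i<n. \<Sum>j<n. \<Sum>i'<n. \<Sum>j'<n. \<gamma> i j * (\<delta> i' j' * f [?v i i', ?w j j']))"
    by (simp add: tensor_mult_def monomials2_def sum_distrib_left)
  also have "\<dots> = (\<Sum>i'<n. \<Sum>j'<n. \<Sum>i<n. \<Sum>j<n. \<gamma> i j * (\<delta> i' j' * f [?v i i', ?w j j']))"
    by (rule sum_swap4)
  also have "\<dots> = (\<Sum>i'<n. \<Sum>j'<n. \<Sum>i<n. \<Sum>j<n. if j = (j' + d) mod n then if i = (i' + c) mod n then
      \<gamma> i j * (\<delta> i' j' * f [x [^] (a + c) \<otimes> e i', x [^] (b + d) \<otimes> e j']) else 0 else 0)"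
    using f ml2_zero by (intro sum.cong refl) (auto simp: x_pow_e_mult)
  also have "\<dots> = (\<Sum>i'<n. \<Sum>j'<n. \<gamma> ((i' + c) mod n) ((j' + d) mod n) * \<delta> i' j' *
      f [x [^] (a + c) \<otimes> e i', x [^] (b + d) \<otimes> e j'])"
    using n_pos by (simp add: mult.assoc)
  finally show "(monomials2 a b \<gamma> \<star> monomials2 c d \<delta>) f =
      monomials2 (a + c) (b + d) (\<lambda>i j. \<gamma> ((i + c) mod n) ((j + d) mod n) * \<delta> i j) f"
    by (simp add: monomials2_def)
qed

abbreviation "TT \<equiv> tensor_algebra H 2"

lemma TT_mult:
  "tclass H 2 (monomials2 a b \<gamma>) \<otimes>\<^bsub>TT\<^esub> tclass H 2 (monomials2 c d \<delta>) =
     tclass H 2 (monomials2 (a + c) (b + d) (\<lambda>i j. \<gamma> ((i + c) mod n) ((j + d) mod n) * \<delta> i j))"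
  by (simp add: tensor_algebra_mult tclass_eq_iff monomials2_mult)

text \<open>Coefficients of a power are products of shifted coefficients; what matters later is that
  none of them vanishes.\<close>

lemma TT_power:
  assumes \<gamma>: "\<And>i j. i < n \<Longrightarrow> j < n \<Longrightarrow> \<gamma> i j \<noteq> 0"
  shows "\<exists>\<delta>. (\<forall>i<n. \<forall>j<n. \<delta> i j \<noteq> 0) \<and>
    tclass H 2 (monomials2 a b \<gamma>) [^]\<^bsub>TT\<^esub> (k::nat) = tclass H 2 (monomials2 (a * k) (b * k) \<delta>)"
proof (induction k)
  interpret T: complex_algebra TT by (rule tensor_algebra_complex_algebra) simp
  case 0
  have "tclass H 2 (monomials2 a b \<gamma>) [^]\<^bsub>TT\<^esub> (0::nat) = tclass H 2 (monomials2 0 0 (\<lambda>i j. 1))"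
    using diag2_one by (simp add: tensor_algebra_one tclass_eq_iff monomials2_0)
  then show ?case by (intro exI[of _ "\<lambda>i j. 1"]) simp
next
  interpret T: complex_algebra TT by (rule tensor_algebra_complex_algebra) simp
  case (Suc k)
  then obtain \<delta> where \<delta>: "\<forall>i<n. \<forall>j<n. \<delta> i j \<noteq> 0"
    "tclass H 2 (monomials2 a b \<gamma>) [^]\<^bsub>TT\<^esub> k = tclass H 2 (monomials2 (a * k) (b * k) \<delta>)" by blast
  then show ?case using \<gamma> n_pos
    by (intro exI[of _ "\<lambda>i j. \<delta> ((i + a) mod n) ((j + b) mod n) * \<gamma> i j"])
      (simp add: TT_mult add.commute)
qed

text \<open>In \<open>(A + B)\<^sup>k\<close> bidegree \<open>(d(k - m), dm)\<close> comes from the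
  term with \<open>m\<close> factors \<open>B\<close> alone, so its coefficient is the binomial
  times a nonzero scalar. The parameters \<open>d\<close> and \<open>q\<close> permit the use for
  \<open>x\<close> itself and for \<open>x\<^sup>N\<close> with \<open>q = 1\<close>.\<close>

lemma comult_x_power_forms:
  fixes \<phi> \<psi> :: "'a \<Rightarrow> complex"
  assumes \<gamma>: "\<And>i j. i < n \<Longrightarrow> j < n \<Longrightarrow> \<gamma> i j \<noteq> 0" "\<And>i j. i < n \<Longrightarrow> j < n \<Longrightarrow> \<delta> i j \<noteq> 0"
    and AB: "A = tclass H 2 (monomials2 d 0 \<gamma>)" "B = tclass H 2 (monomials2 0 d \<delta>)"
    and comm: "A \<otimes>\<^bsub>TT\<^esub> B = q \<odot>\<^bsub>TT\<^esub> (B \<otimes>\<^bsub>TT\<^esub> A)"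
    and cx: "tclass H 2 (comult H (x [^] d)) = A \<oplus>\<^bsub>TT\<^esub> B"
    and d: "d > 0" and m: "m \<le> k" and ij: "i < n" "j < n"
    and \<phi>: "linear_form H \<phi>" "\<And>l i'. i' < n \<Longrightarrow> \<phi> (x [^] (l::nat) \<otimes> e i') = (if l = d * (k - m) \<and> i' = i then 1 else 0)"
    and \<psi>: "linear_form H \<psi>" "\<And>l j'. j' < n \<Longrightarrow> \<psi> (x [^] (l::nat) \<otimes> e j') = (if l = d * m \<and> j' = j then 1 else 0)"
  obtains \<epsilon> where "\<epsilon> \<noteq> 0"
    "comult H (x [^] (d * k) \<otimes> e ((i + j) mod n)) (prod2 \<phi> \<psi>) = qbinomial q k m * \<epsilon>"
proof -
  interpret T: complex_algebra TT by (rule tensor_algebra_complex_algebra) simp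
  interpret h: ring_hom_ring H TT "\<lambda>h. tclass H 2 (comult H h)"
    by (intro ring_hom_ring.intro ring_hom_ring_axioms.intro ring_axioms T.ring_axioms comult_hom)
  have ABc: "A \<in> carrier TT" "B \<in> carrier TT" by (simp_all add: AB)
  let ?f = "prod2 \<phi> \<psi>"
  have f: "multilinear H 2 ?f" using \<phi> \<psi> by (intro prod2_multilinear)
  have "\<exists>\<eta>. (\<forall>i<n. \<forall>j<n. \<eta> i j \<noteq> 0) \<and>
      B [^]\<^bsub>TT\<^esub> m \<otimes>\<^bsub>TT\<^esub> A [^]\<^bsub>TT\<^esub> (k - m) = tclass H 2 (monomials2 (d * (k - m)) (d * m) \<eta>)" for m
  proof -
    obtain \<delta>' where \<delta>': "\<forall>i<n. \<forall>j<n. \<delta>' i j \<noteq> 0" "B [^]\<^bsub>TT\<^esub> m = tclass H 2 (monomials2 (0 * m) (d * m) \<delta>')"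
      using TT_power[of \<delta> 0 d m] \<gamma> unfolding AB by blast
    obtain \<gamma>' where \<gamma>': "\<forall>i<n. \<forall>j<n. \<gamma>' i j \<noteq> 0" "A [^]\<^bsub>TT\<^esub> (k - m) = tclass H 2 (monomials2 (d * (k - m)) (0 * (k - m)) \<gamma>')"
      using TT_power[of \<gamma> d 0 "k - m"] \<gamma> unfolding AB by blast
    show ?thesis unfolding \<delta>' \<gamma>' TT_mult using \<delta>'(1) \<gamma>'(1) n_pos
      by (intro exI[of _ "\<lambda>i j. \<delta>' ((i + d * (k - m)) mod n) ((j + 0 * (k - m)) mod n) * \<gamma>' i j"]) simp
  qed
  then obtain \<eta> where \<eta>: "\<And>m i j. i < n \<Longrightarrow> j < n \<Longrightarrow> \<eta> m i j \<noteq> 0"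
    "\<And>m. B [^]\<^bsub>TT\<^esub> m \<otimes>\<^bsub>TT\<^esub> A [^]\<^bsub>TT\<^esub> (k - m) = tclass H 2 (monomials2 (d * (k - m)) (d * m) (\<eta> m))" by metis
  let ?t = "\<lambda>f. \<Sum>m\<le>k. qbinomial q k m * monomials2 (d * (k - m)) (d * m) (\<eta> m) f"
  have tc: "?t \<in> tensors H 2" by (intro tensors_sum tensors_smult) simp_all
  have sum: "(\<Oplus>\<^bsub>TT\<^esub>m\<in>S. c m \<odot>\<^bsub>TT\<^esub> tclass H 2 (g m)) = tclass H 2 (\<lambda>f. \<Sum>m\<in>S. c m * g m f)"
    if "finite S" "\<And>m. g m \<in> tensors H 2" for S :: "nat set" and c g
    using that
  proof (induction S rule: finite_induct)
    case (insert m S)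
    then show ?case by (simp add: tensor_algebra_add tensor_algebra_smult Pi_def tensors_smult tclass_in)
  qed (simp add: tensor_algebra_zero)
  have "tclass H 2 (comult H (x [^] (d * k))) = (A \<oplus>\<^bsub>TT\<^esub> B) [^]\<^bsub>TT\<^esub> k"
    using h.hom_nat_pow[of "x [^] d" k] by (simp add: cx nat_pow_pow)
  also have "\<dots> = tclass H 2 ?t"
    unfolding T.q_binomial_theorem[OF ABc comm] \<eta> by (rule sum) simp_all
  finally have ct: "tensor_eq H 2 (comult H (x [^] (d * k))) ?t" by (simp add: tclass_eq_iff)
  let ?b = "(i + j) mod n"
  let ?D = "\<lambda>j l. if (j + l) mod n = ?b then 1 else (0::complex)"
  have b: "?b < n" using n_pos by simp
  have "tensor_eq H 2 (comult H (x [^] (d * k) \<otimes> e ?b)) (comult H (x [^] (d * k)) \<star> comult H (e ?b))"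
    by (rule comult_mult) auto
  also have "tensor_eq H 2 \<dots> (?t \<star> monomials2 0 0 ?D)"
    using ct comult_e[OF b] by (intro tensor_mult_cong comult_closed) (auto simp: monomials2_0)
  finally have "comult H (x [^] (d * k) \<otimes> e ?b) ?f = (?t \<star> monomials2 0 0 ?D) ?f"
    using f by (simp add: tensor_eq_def)
  also have "\<dots> = (\<Sum>m\<le>k. qbinomial q k m * (monomials2 (d * (k - m)) (d * m) (\<eta> m) \<star> monomials2 0 0 ?D) ?f)"
    by (simp add: tensor_mult_def)
  also have "\<dots> = (\<Sum>m'\<le>k. if m' = m then qbinomial q k m * \<eta> m i j else 0)"
  proof (intro sum.cong refl)
    fix m' assume "m' \<in> {..k}"
    \<comment> \<open>As \<open>d > 0\<close>, the bidegree determines the summation index.\<close>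
    then have mm: "d * (k - m') = d * (k - m) \<longleftrightarrow> m' = m" "d * m' = d * m \<longleftrightarrow> m' = m" using d m by auto
    have mc: "monomials2 (d * (k - m') + 0) (d * m' + 0) (\<lambda>i j. \<eta> m' ((i + 0) mod n) ((j + 0) mod n) * ?D i j) =
        monomials2 (d * (k - m')) (d * m') (\<lambda>i j. \<eta> m' i j * ?D i j)"
      unfolding add_0_right by (intro monomials2_cong) (simp only: mod_less)
    have "(monomials2 (d * (k - m')) (d * m') (\<eta> m') \<star> monomials2 0 0 ?D) ?f =
        monomials2 (d * (k - m')) (d * m') (\<lambda>i j. \<eta> m' i j * ?D i j) ?f"
      using monomials2_mult[of "d * (k - m')" "d * m'" "\<eta> m'" 0 0 ?D] f unfolding mc tensor_eq_def by blast
    also have "\<dots> = (\<Sum>i'<n. \<Sum>j'<n. if j' = j then if i' = i then if m' = m then \<eta> m i j else 0 else 0 else 0)"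
      unfolding monomials2_def using d by (intro sum.cong refl) (auto simp: \<phi>(2) \<psi>(2) mm)
    also have "\<dots> = (if m' = m then \<eta> m i j else 0)" using ij by simp
    finally show "qbinomial q k m' * (monomials2 (d * (k - m')) (d * m') (\<eta> m') \<star> monomials2 0 0 ?D) ?f =
        (if m' = m then qbinomial q k m * \<eta> m i j else 0)" by simp
  qed
  also have "\<dots> = qbinomial q k m * \<eta> m i j" using m by simp
  finally show ?thesis by (rule that[OF \<eta>(1)[OF ij]])
qed

text \<open>Comparing the components of \<open>\<Delta>(x)\<^sup>k\<close>, the least \<open>k\<close> with \<open>x\<^sup>k = 0\<close> makes all \<open>q\<close>-binomial
  coefficients \<open>(k choose m)\<close> with \<open>0 < m < k\<close> vanish. The same holds with \<open>x\<^sup>N\<close> and \<open>1\<close> in place of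
  \<open>x\<close> and \<open>q\<close> when \<open>N\<close> is the order of \<open>q\<close>, which excludes proper multiples of \<open>N\<close>.\<close>

theorem nilpotency_order:
  assumes q: "primitive_root_of_unity N q" and N: "N > 1"
    and nz: "\<And>i j. i < n \<Longrightarrow> j < n \<Longrightarrow> \<alpha> i j \<noteq> 0" "\<And>i j. i < n \<Longrightarrow> j < n \<Longrightarrow> \<beta> i j \<noteq> 0"
    and comm: "\<And>i j. i < n \<Longrightarrow> j < n \<Longrightarrow> \<alpha> i (Suc j mod n) * \<beta> i j = q * (\<beta> (Suc i mod n) j * \<alpha> i j)"
    and forms: "\<And>k i. i < n \<Longrightarrow> x [^] (k::nat) \<otimes> e i \<noteq> \<zero> \<Longrightarrow>
      \<exists>\<phi>. linear_form H \<phi> \<and> (\<forall>l j. j < n \<longrightarrow> \<phi> (x [^] (l::nat) \<otimes> e j) = (if l = k \<and> j = i then 1 else 0))"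
    and e_nz: "\<And>i. i < n \<Longrightarrow> e i \<noteq> \<zero>" and x_nz: "x \<noteq> \<zero>" and nil: "\<exists>k. x [^] (k::nat) = \<zero>"
  shows "x [^] N = \<zero>" "\<And>k i. k < N \<Longrightarrow> i < n \<Longrightarrow> x [^] k \<otimes> e i \<noteq> \<zero>"
proof -
  interpret T: complex_algebra TT by (rule tensor_algebra_complex_algebra) simp
  interpret h: ring_hom_ring H TT "\<lambda>h. tclass H 2 (comult H h)"
    by (intro ring_hom_ring.intro ring_hom_ring_axioms.intro ring_axioms T.ring_axioms comult_hom)
  define A where "A = tclass H 2 (monomials2 1 0 \<alpha>)"
  define B where "B = tclass H 2 (monomials2 0 1 \<beta>)"
  have ABc [simp]: "A \<in> carrier TT" "B \<in> carrier TT" by (simp_all add: A_def B_def)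
  have AB: "A \<otimes>\<^bsub>TT\<^esub> B = q \<odot>\<^bsub>TT\<^esub> (B \<otimes>\<^bsub>TT\<^esub> A)"
  proof -
    have "A \<otimes>\<^bsub>TT\<^esub> B = tclass H 2 (monomials2 1 1 (\<lambda>i j. q * (\<beta> (Suc i mod n) j * \<alpha> i j)))"
      unfolding A_def B_def TT_mult using comm
      by (intro arg_cong[where f = "tclass H 2"]) (simp, intro monomials2_cong, simp)
    also have "\<dots> = q \<odot>\<^bsub>TT\<^esub> tclass H 2 (monomials2 1 1 (\<lambda>i j. \<beta> (Suc i mod n) j * \<alpha> i j))"
      unfolding tensor_algebra_smult
      by (intro arg_cong[where f = "tclass H 2"]) (simp add: monomials2_def sum_distrib_left mult.assoc)
    also have "tclass H 2 (monomials2 1 1 (\<lambda>i j. \<beta> (Suc i mod n) j * \<alpha> i j)) = B \<otimes>\<^bsub>TT\<^esub> A"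
      unfolding A_def B_def TT_mult
      by (intro arg_cong[where f = "tclass H 2"]) (simp, intro monomials2_cong, simp)
    finally show ?thesis .
  qed
  have cx: "tclass H 2 (comult H x) = A \<oplus>\<^bsub>TT\<^esub> B"
  proof -
    have "A \<oplus>\<^bsub>TT\<^esub> B = tclass H 2 (skew2 H n e x \<alpha> \<beta>)"
      unfolding A_def B_def tensor_algebra_add
      by (intro arg_cong[where f = "tclass H 2"]) (simp add: monomials2_def skew2_def sum.distrib)
    then show ?thesis using comult_x by (simp add: tclass_eq_iff)
  qed
  have cx1: "tclass H 2 (comult H (x [^] (1::nat))) = A \<oplus>\<^bsub>TT\<^esub> B" using cx by simp
  have qN: "q ^ N = 1" using q by (simp add: primitive_root_of_unity_def)
  define A' where "A' = A [^]\<^bsub>TT\<^esub> N"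
  define B' where "B' = B [^]\<^bsub>TT\<^esub> N"
  have ABc' [simp]: "A' \<in> carrier TT" "B' \<in> carrier TT" by (simp_all add: A'_def B'_def)
  obtain \<gamma> where \<gamma>: "\<And>i j. i < n \<Longrightarrow> j < n \<Longrightarrow> \<gamma> i j \<noteq> 0" "A' = tclass H 2 (monomials2 N 0 \<gamma>)"
    using TT_power[of \<alpha> 1 0 N, OF nz(1)] unfolding A'_def A_def by auto
  obtain \<delta> where \<delta>: "\<And>i j. i < n \<Longrightarrow> j < n \<Longrightarrow> \<delta> i j \<noteq> 0" "B' = tclass H 2 (monomials2 0 N \<delta>)"
    using TT_power[of \<beta> 0 1 N, OF nz(2)] unfolding B'_def B_def by auto
  \<comment> \<open>\<open>B'\<close> commutes with \<open>A\<close> because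
    \<open>q\<^sup>N = 1\<close>, hence also with \<open>A'\<close>.\<close>
  have AB': "A' \<otimes>\<^bsub>TT\<^esub> B' = 1 \<odot>\<^bsub>TT\<^esub> (B' \<otimes>\<^bsub>TT\<^esub> A')"
  proof -
    have "A \<otimes>\<^bsub>TT\<^esub> B' = B' \<otimes>\<^bsub>TT\<^esub> A"
      using T.skew_power[OF ABc(2,1) AB, of N] by (simp add: qN B'_def)
    then have "B' \<otimes>\<^bsub>TT\<^esub> A = 1 \<odot>\<^bsub>TT\<^esub> (A \<otimes>\<^bsub>TT\<^esub> B')" by simp
    from T.skew_power[OF ABc(1) ABc'(2) this, of N] show ?thesis by (simp add: A'_def)
  qed
  \<comment> \<open>At the order of \<open>q\<close> all middle binomials vanish, so
    \<open>x\<^sup>N\<close> again has a coproduct with one part in bidegree \<open>(N, 0)\<close>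
    and one in \<open>(0, N)\<close>.\<close>
  have cx': "tclass H 2 (comult H (x [^] N)) = A' \<oplus>\<^bsub>TT\<^esub> B'"
  proof -
    have "tclass H 2 (comult H (x [^] N)) = (A \<oplus>\<^bsub>TT\<^esub> B) [^]\<^bsub>TT\<^esub> N"
      using h.hom_nat_pow[of x N] by (simp add: cx)
    also have "\<dots> = (\<Oplus>\<^bsub>TT\<^esub>m\<in>{..N}. (if m = 0 then A' else \<zero>\<^bsub>TT\<^esub>) \<oplus>\<^bsub>TT\<^esub> (if m = N then B' else \<zero>\<^bsub>TT\<^esub>))"
      unfolding T.q_binomial_theorem[OF ABc AB]
    proof (intro T.M.finsum_cong' refl)
      fix m assume "m \<in> {..N}"
      then show "qbinomial q N m \<odot>\<^bsub>TT\<^esub> (B [^]\<^bsub>TT\<^esub> m \<otimes>\<^bsub>TT\<^esub> A [^]\<^bsub>TT\<^esub> (N - m)) =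
          (if m = 0 then A' else \<zero>\<^bsub>TT\<^esub>) \<oplus>\<^bsub>TT\<^esub> (if m = N then B' else \<zero>\<^bsub>TT\<^esub>)"
        using N qbinomial_vanish[OF q N, of m] by (cases "m = 0"; cases "m = N") (auto simp: A'_def B'_def qbinomial_diag)
    qed auto
    also have "\<dots> = (\<Oplus>\<^bsub>TT\<^esub>m\<in>{..N}. if m = 0 then A' else \<zero>\<^bsub>TT\<^esub>) \<oplus>\<^bsub>TT\<^esub> (\<Oplus>\<^bsub>TT\<^esub>m\<in>{..N}. if m = N then B' else \<zero>\<^bsub>TT\<^esub>)"
      by (rule T.M.finsum_addf) auto
    also have "\<dots> = A' \<oplus>\<^bsub>TT\<^esub> B'"
      using T.finsum_delta[of "{..N}" 0 A'] T.finsum_delta[of "{..N}" N B'] by simp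
    finally show ?thesis .
  qed
  have x_sum: "x [^] (k::nat) = (\<Oplus>j\<in>{..<n}. x [^] k \<otimes> e j)" for k
    using finsum_rdistr[of "{..<n}" "x [^] k" e] e_sum by simp
  have comult_0: "comult H \<zero> (prod2 \<phi> \<psi>) = 0" if "linear_form H \<phi>" "linear_form H \<psi>" for \<phi> \<psi>
    using linear_form_zero[OF comult_linear_form[OF prod2_multilinear[OF that]]] .
  \<comment> \<open>If \<open>x\<^sup>k e\<^sub>i\<close> were zero and
    \<open>x\<^sup>k e\<^sub>j\<close> were not, then for \<open>j + l = i\<close> the component of
    \<open>\<Delta>(x\<^sup>k e\<^sub>i)\<close> at
    \<open>x\<^sup>k e\<^sub>j \<otimes> e\<^sub>l\<close> would have binomial 1 and be
    nonzero.\<close>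
  have xe_nz: "x [^] k \<otimes> e i \<noteq> \<zero>" if k: "x [^] k \<noteq> \<zero>" and i: "i < n" for k :: nat and i
  proof
    assume z: "x [^] k \<otimes> e i = \<zero>"
    obtain j where j: "j < n" "x [^] k \<otimes> e j \<noteq> \<zero>"
    proof (rule ccontr)
      assume "\<not> thesis"
      then have "\<And>j. j < n \<Longrightarrow> x [^] k \<otimes> e j = \<zero>" using that by blast
      then have "(\<Oplus>j\<in>{..<n}. x [^] k \<otimes> e j) = (\<Oplus>j\<in>{..<n}. \<zero>)" by (intro M.finsum_cong') auto
      then show False using k x_sum[of k] by simp
    qed
    define l where "l = (i + (n - j)) mod n"
    have l: "l < n" "(j + l) mod n = i" using i j n_pos by (simp_all add: l_def mod_simps)
    have l0: "x [^] (0::nat) \<otimes> e l \<noteq> \<zero>" using e_nz[OF l(1)] by simp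
    obtain \<phi> where \<phi>: "linear_form H \<phi>" "\<And>l i'. i' < n \<Longrightarrow> \<phi> (x [^] (l::nat) \<otimes> e i') = (if l = k \<and> i' = j then 1 else 0)"
      using forms[OF j] by blast
    obtain \<psi> where \<psi>: "linear_form H \<psi>" "\<And>l' i'. i' < n \<Longrightarrow> \<psi> (x [^] (l'::nat) \<otimes> e i') = (if l' = 0 \<and> i' = l then 1 else 0)"
      using forms[OF l(1) l0] by blast
    obtain \<epsilon> where "\<epsilon> \<noteq> 0" "comult H (x [^] (1 * k) \<otimes> e ((j + l) mod n)) (prod2 \<phi> \<psi>) = qbinomial q k 0 * \<epsilon>"
      by (rule comult_x_power_forms[OF nz A_def B_def AB cx1, of 0 k j l \<phi> \<psi>])
        (use \<phi> \<psi> j l in simp_all)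
    then show False using comult_0[OF \<phi>(1) \<psi>(1)] z l by simp
  qed
  \<comment> \<open>The component of \<open>\<Delta>(0)\<close> vanishes although its scalar factor
    does not, so the binomial is zero.\<close>
  have qb0: "qbinomial p k m = 0"
    if g: "\<And>i j. i < n \<Longrightarrow> j < n \<Longrightarrow> \<gamma> i j \<noteq> 0" "\<And>i j. i < n \<Longrightarrow> j < n \<Longrightarrow> \<delta> i j \<noteq> 0"
      "C = tclass H 2 (monomials2 d 0 \<gamma>)" "D = tclass H 2 (monomials2 0 d \<delta>)"
      "C \<otimes>\<^bsub>TT\<^esub> D = p \<odot>\<^bsub>TT\<^esub> (D \<otimes>\<^bsub>TT\<^esub> C)" "tclass H 2 (comult H (x [^] d)) = C \<oplus>\<^bsub>TT\<^esub> D"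
      and d: "d > 0" "m \<le> k" and z: "x [^] (d * k) = \<zero>" "x [^] (d * (k - m)) \<noteq> \<zero>" "x [^] (d * m) \<noteq> \<zero>"
    for p k m C D d \<gamma> \<delta>
  proof -
    obtain \<phi> where \<phi>: "linear_form H \<phi>" "\<And>l i'. i' < n \<Longrightarrow> \<phi> (x [^] (l::nat) \<otimes> e i') = (if l = d * (k - m) \<and> i' = 0 then 1 else 0)"
      using forms[OF n_pos xe_nz[OF z(2) n_pos]] by blast
    obtain \<psi> where \<psi>: "linear_form H \<psi>" "\<And>l' i'. i' < n \<Longrightarrow> \<psi> (x [^] (l'::nat) \<otimes> e i') = (if l' = d * m \<and> i' = 0 then 1 else 0)"
      using forms[OF n_pos xe_nz[OF z(3) n_pos]] by blast
    obtain \<epsilon> where "\<epsilon> \<noteq> 0" "comult H (x [^] (d * k) \<otimes> e ((0 + 0) mod n)) (prod2 \<phi> \<psi>) = qbinomial p k m * \<epsilon>"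
      by (rule comult_x_power_forms[OF g d n_pos n_pos \<phi> \<psi>])
    then show ?thesis using comult_0[OF \<phi>(1) \<psi>(1)] z(1) by simp
  qed
  define K where "K = (LEAST k::nat. x [^] k = \<zero>)"
  have K: "x [^] K = \<zero>" using nil unfolding K_def by (rule LeastI_ex)
  have K_min: "x [^] k \<noteq> \<zero>" if "k < K" for k using not_less_Least[of k "\<lambda>k. x [^] k = \<zero>"] that by (simp add: K_def)
  have one_nz: "\<one> \<noteq> \<zero>"
  proof
    assume "\<one> = \<zero>"
    then have "e 0 \<otimes> \<one> = e 0 \<otimes> \<zero>" by (rule arg_cong)
    then show False using e_nz[OF n_pos] by simp
  qed
  have K1: "K > 1"
  proof (rule ccontr)
    assume "\<not> K > 1"
    then consider "K = 0" | "K = 1" by linarith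
    then show False using K one_nz x_nz by cases auto
  qed
  \<comment> \<open>\<open>m = 1\<close> is enough: this binomial is the q-number of
    \<open>K\<close>, which vanishes only at multiples of \<open>N\<close>.\<close>
  have "qbinomial q K 1 = 0"
    by (rule qb0[OF nz A_def B_def AB cx1]) (use K K1 K_min x_nz in auto)
  then have "N dvd K" unfolding qbinomial_1 using qnumber_eq_0_iff[OF q N, of K] by (simp add: qnumber_def)
  then obtain t where t: "K = N * t" by blast
  have "t = 1"
  proof (rule ccontr)
    assume t1: "t \<noteq> 1"
    have "t \<noteq> 0" using t K1 by (cases t) simp_all
    then have "t > 1" using t1 by simp
    then have "N * (t - 1) < K" "N * 1 < K" using N by (auto simp: t)
    \<comment> \<open>At \<open>q = 1\<close> this binomial is the number \<open>t\<close>, nonzero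
      in characteristic 0.\<close>
    have "qbinomial 1 t 1 = 0"
      by (rule qb0[OF \<gamma>(1) \<delta>(1) \<gamma>(2) \<delta>(2) AB' cx'])
        (use \<open>t > 1\<close> N K K_min[OF \<open>N * (t - 1) < K\<close>] K_min[OF \<open>N * 1 < K\<close>] in \<open>simp_all add: t\<close>)
    then show False using \<open>t > 1\<close> unfolding qbinomial_1 by simp
  qed
  then have KN: "K = N" using t by simp
  show "x [^] N = \<zero>" using K KN by simp
  show "x [^] k \<otimes> e i \<noteq> \<zero>" if "k < N" "i < n" for k i using xe_nz K_min KN that by simp
qed

end

section \<open>Radically graded quasi-Hopf algebras\<close>

locale graded_quasi_hopf = pre_bialgebra H for H :: "'a quasi_hopf" (structure) +
  fixes G :: "nat \<Rightarrow> 'a set"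
  assumes quasi_hopf: "quasi_hopf_algebra H" and graded: "radically_graded H G"
begin

lemma G_submodule: "submodule (G i) complex_ring H"
  and G_direct: "finite F \<Longrightarrow> (\<And>i. i \<in> F \<Longrightarrow> c i \<in> G i) \<Longrightarrow> (\<Oplus>i\<in>F. c i) = \<zero> \<Longrightarrow> i \<in> F \<Longrightarrow> c i = \<zero>"
  and Rad_power_span: "Rad_power H k = span_of_components H G {k..}"
  and one_G: "\<one> \<in> G 0"
  and G_mult: "g \<in> G i \<Longrightarrow> h \<in> G j \<Longrightarrow> g \<otimes> h \<in> G (i + j)"
  and comult_G: "h \<in> G k \<Longrightarrow> comult H h \<in> graded_tensors H G 2 k"
  and counit_G: "k > 0 \<Longrightarrow> h \<in> G k \<Longrightarrow> counit H h = 0"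
  and associator_G: "associator H \<in> graded_tensors H G 3 0"
proof -
  note g = graded[unfolded radically_graded_def]
  note g1 = g[THEN conjunct2] note g2 = g1[THEN conjunct2] note g3 = g2[THEN conjunct2]
  note g4 = g3[THEN conjunct2] note g5 = g4[THEN conjunct2] note g6 = g5[THEN conjunct2]
  show "submodule (G i) complex_ring H" using g[THEN conjunct1] by (rule spec)
  show "c i = \<zero>" if "finite F" "\<And>i. i \<in> F \<Longrightarrow> c i \<in> G i" "(\<Oplus>i\<in>F. c i) = \<zero>" "i \<in> F"
    using g1[THEN conjunct1, rule_format, OF conjI, OF that(1) conjI, OF ballI that(3) that(4), OF that(2)] .
  show "Rad_power H k = span_of_components H G {k..}" using g2[THEN conjunct1] by (rule spec)
  show "\<one> \<in> G 0" by (rule g3[THEN conjunct1])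
  show "g \<otimes> h \<in> G (i + j)" if "g \<in> G i" "h \<in> G j" by (rule g4[THEN conjunct1, rule_format, OF that])
  show "comult H h \<in> graded_tensors H G 2 k" if "h \<in> G k" by (rule g5[THEN conjunct1, rule_format, OF that])
  show "counit H h = 0" if "k > 0" "h \<in> G k" by (rule g6[THEN conjunct1, rule_format, OF that])
  show "associator H \<in> graded_tensors H G 3 0" by (rule g6[THEN conjunct2])
qed

lemma G_sub: "G i \<subseteq> carrier H"
  and G_add: "g \<in> G i \<Longrightarrow> h \<in> G i \<Longrightarrow> g \<oplus> h \<in> G i"
  and G_zero [simp]: "\<zero> \<in> G i"
  and G_smult: "h \<in> G i \<Longrightarrow> c \<odot> h \<in> G i"
proof -
  interpret s: submodule "G i" complex_ring H by (rule G_submodule)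
  show "G i \<subseteq> carrier H" "\<zero> \<in> G i" using s.subset s.one_closed by simp_all
  show "g \<in> G i \<Longrightarrow> h \<in> G i \<Longrightarrow> g \<oplus> h \<in> G i" using s.m_closed by simp
  show "h \<in> G i \<Longrightarrow> c \<odot> h \<in> G i" using s.smult_closed by simp
qed

lemma G_carrier: "h \<in> G i \<Longrightarrow> h \<in> carrier H" using G_sub by blast

lemma G_finsum: "finite F \<Longrightarrow> (\<And>j. j \<in> F \<Longrightarrow> c j \<in> G i) \<Longrightarrow> (\<Oplus>j\<in>F. c j) \<in> G i"
proof (induction F rule: finite_induct)
  case (insert j F)
  then have "c j \<in> carrier H" "c \<in> F \<rightarrow> carrier H" by (auto intro: G_carrier)
  then show ?case using insert by (simp add: G_add)
qed simp

lemma G_pow: "h \<in> G 1 \<Longrightarrow> h [^] (k::nat) \<in> G k"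
proof (induction k)
  case (Suc k)
  then show ?case using G_mult[of "h [^] k" k h 1] by simp
qed (simp add: one_G)

lemma G_pow_0: "h \<in> G 0 \<Longrightarrow> h [^] (k::nat) \<in> G 0"
proof (induction k)
  case (Suc k)
  then show ?case using G_mult[of "h [^] k" 0 h 0] by simp
qed (simp add: one_G)

text \<open>The finite support is existential, so that decompositions add index by index;
  \<open>proj\<close> is then defined by uniqueness.\<close>

definition decomposition :: "'a \<Rightarrow> (nat \<Rightarrow> 'a) \<Rightarrow> bool" where
  "decomposition h c \<longleftrightarrow> (\<forall>i. c i \<in> G i) \<and> (\<exists>F. finite F \<and> (\<forall>i. i \<notin> F \<longrightarrow> c i = \<zero>) \<and> h = (\<Oplus>i\<in>F. c i))"

lemma decomposition_support:
  assumes "decomposition h c"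
  obtains F where "finite F" "\<And>F'. finite F' \<Longrightarrow> F \<subseteq> F' \<Longrightarrow> h = (\<Oplus>i\<in>F'. c i)" "\<And>i. i \<notin> F \<Longrightarrow> c i = \<zero>"
proof -
  obtain F where F: "finite F" "\<forall>i. i \<notin> F \<longrightarrow> c i = \<zero>" "h = (\<Oplus>i\<in>F. c i)" and c: "\<forall>i. c i \<in> G i"
    using assms unfolding decomposition_def by blast
  have cc: "c i \<in> carrier H" for i using c G_carrier by blast
  have E: "h = (\<Oplus>i\<in>F'. c i)" if F': "finite F'" "F \<subseteq> F'" for F'
  proof -
    have "(\<Oplus>i\<in>F \<union> (F' - F). c i) = (\<Oplus>i\<in>F. c i) \<oplus> (\<Oplus>i\<in>F' - F. c i)"
      using F(1) F' cc by (intro M.finsum_Un_disjoint) auto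
    also have "(\<Oplus>i\<in>F' - F. c i) = (\<Oplus>i\<in>F' - F. \<zero>)" using F(2) by (intro M.finsum_cong') auto
    finally show ?thesis using F(3) F' cc by (simp add: Un_absorb1)
  qed
  show ?thesis
  proof (rule that[OF F(1)])
    show "h = (\<Oplus>i\<in>F'. c i)" if "finite F'" "F \<subseteq> F'" for F' using that by (rule E)
    show "c i = \<zero>" if "i \<notin> F" for i using F(2) that by blast
  qed
qed

lemma decomposition_G: "decomposition h c \<Longrightarrow> c i \<in> G i" "decomposition h c \<Longrightarrow> h \<in> carrier H"
  unfolding decomposition_def by (auto intro!: M.finsum_closed intro: G_carrier)

lemma decompositionI:
  assumes "finite F" "\<And>i. i \<in> F \<Longrightarrow> c i \<in> G i"
  shows "decomposition (\<Oplus>i\<in>F. c i) (\<lambda>i. if i \<in> F then c i else \<zero>)"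
proof -
  have "c \<in> F \<rightarrow> carrier H" using G_carrier[OF assms(2)] by blast
  then show ?thesis
    unfolding decomposition_def using assms by (auto intro!: exI[of _ F] M.finsum_cong')
qed

lemma decomposition_homogeneous:
  assumes "h \<in> G k" shows "decomposition h (\<lambda>i. if i = k then h else \<zero>)"
  using assms G_carrier[OF assms] unfolding decomposition_def by (auto intro!: exI[of _ "{k}"])

lemma span_decomposition:
  assumes "h \<in> span_of_components H G I"
  shows "\<exists>c. decomposition h c \<and> (\<forall>i. i \<notin> I \<longrightarrow> c i = \<zero>)"
proof -
  obtain F c where F: "h = (\<Oplus>i\<in>F. c i)" "finite F" "F \<subseteq> I" "\<forall>i\<in>F. c i \<in> G i"
    using assms unfolding span_of_components_def by blast
  then show ?thesis using decompositionI[of F c] by (intro exI[of _ "\<lambda>i. if i \<in> F then c i else \<zero>"]) auto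
qed

lemma decomposition_exists: "h \<in> carrier H \<Longrightarrow> \<exists>c. decomposition h c"
  using span_decomposition[of h "{0..}"] Rad_power_span[of 0] by auto

lemma decomposition_add:
  assumes "decomposition g b" "decomposition h c"
  shows "decomposition (g \<oplus> h) (\<lambda>i. b i \<oplus> c i)"
proof -
  obtain F where F: "finite F" "\<And>F'. finite F' \<Longrightarrow> F \<subseteq> F' \<Longrightarrow> g = (\<Oplus>i\<in>F'. b i)" "\<And>i. i \<notin> F \<Longrightarrow> b i = \<zero>"
    by (rule decomposition_support[OF assms(1)]) (rule that)
  obtain F' where F': "finite F'" "\<And>F''. finite F'' \<Longrightarrow> F' \<subseteq> F'' \<Longrightarrow> h = (\<Oplus>i\<in>F''. c i)" "\<And>i. i \<notin> F' \<Longrightarrow> c i = \<zero>"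
    by (rule decomposition_support[OF assms(2)]) (rule that)
  note c = G_carrier[OF decomposition_G(1)[OF assms(1)]] G_carrier[OF decomposition_G(1)[OF assms(2)]]
  have gh: "g = (\<Oplus>i\<in>F \<union> F'. b i)" "h = (\<Oplus>i\<in>F \<union> F'. c i)" by (rule F(2) F'(2); use F(1) F'(1) in auto)+
  have "g \<oplus> h = (\<Oplus>i\<in>F \<union> F'. b i \<oplus> c i)"
    unfolding gh using c by (intro M.finsum_addf[symmetric]) auto
  then show ?thesis
    unfolding decomposition_def using F(1,3) F'(1,3) decomposition_G(1)[OF assms(1)] decomposition_G(1)[OF assms(2)]
    by (intro conjI allI exI[of _ "F \<union> F'"]) (auto intro: G_add)
qed

lemma decomposition_smult:
  assumes "decomposition h c" shows "decomposition (a \<odot> h) (\<lambda>i. a \<odot> c i)"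
proof -
  obtain F where F: "finite F" "\<And>F'. finite F' \<Longrightarrow> F \<subseteq> F' \<Longrightarrow> h = (\<Oplus>i\<in>F'. c i)" "\<And>i. i \<notin> F \<Longrightarrow> c i = \<zero>"
    by (rule decomposition_support[OF assms]) (rule that)
  have "c \<in> F \<rightarrow> carrier H" using G_carrier[OF decomposition_G(1)[OF assms]] by blast
  then have "a \<odot> h = (\<Oplus>i\<in>F. a \<odot> c i)"
    unfolding F(2)[OF F(1) order_refl] by (rule finsum_smult[OF F(1)])
  then show ?thesis
    unfolding decomposition_def using F(1,3) decomposition_G(1)[OF assms]
    by (intro conjI allI exI[of _ F]) (auto intro: G_smult)
qed

text \<open>The difference of two decompositions decomposes 0, and the sum of the components is
  direct.\<close>

lemma decomposition_unique:
  assumes "decomposition h b" "decomposition h c" shows "b = c"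
proof
  fix i
  note c = G_carrier[OF decomposition_G(1)[OF assms(1)], of i] G_carrier[OF decomposition_G(1)[OF assms(2)], of i]
    decomposition_G(2)[OF assms(1)]
  have neg: "y \<oplus> (-1) \<odot> y = \<zero>" if "y \<in> carrier H" for y
    using smult_add_left[OF that, of 1 "-1"] that by simp
  have d: "decomposition \<zero> (\<lambda>i. b i \<oplus> (-1) \<odot> c i)"
    using decomposition_add[OF assms(1) decomposition_smult[OF assms(2), of "-1"]] neg[OF c(3)] by simp
  obtain F where F: "finite F" "\<And>F'. finite F' \<Longrightarrow> F \<subseteq> F' \<Longrightarrow> \<zero> = (\<Oplus>i\<in>F'. b i \<oplus> (-1) \<odot> c i)"
      "\<And>i. i \<notin> F \<Longrightarrow> b i \<oplus> (-1) \<odot> c i = \<zero>"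
    by (rule decomposition_support[OF d]) (rule that)
  have "b i \<oplus> (-1) \<odot> c i = \<zero>"
    using decomposition_G(1)[OF d] F(1) F(2)[OF finite.insertI[OF F(1)] subset_insertI]
    by (intro G_direct[of "insert i F" "\<lambda>i. b i \<oplus> (-1) \<odot> c i"]) auto
  then have "b i \<oplus> (-1) \<odot> c i \<oplus> c i = c i" using c by simp
  moreover have "(-1) \<odot> c i \<oplus> c i = \<zero>" using neg[OF c(2)] c by (simp add: M.add.m_comm)
  ultimately show "b i = c i" using c by (simp add: M.add.m_assoc)
qed

definition proj :: "nat \<Rightarrow> 'a \<Rightarrow> 'a" where "proj k h = (THE c. decomposition h c) k"

lemma proj_eq: "decomposition h c \<Longrightarrow> proj k h = c k"
  unfolding proj_def using decomposition_unique by (metis the_equality)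

lemma proj_decomposition: "h \<in> carrier H \<Longrightarrow> decomposition h (\<lambda>k. proj k h)"
  using decomposition_exists[of h] proj_eq[of h] by (metis ext)

lemma proj_G: "h \<in> carrier H \<Longrightarrow> proj k h \<in> G k"
  using decomposition_G(1)[OF proj_decomposition] .

lemma proj_closed [simp, intro]: "h \<in> carrier H \<Longrightarrow> proj k h \<in> carrier H"
  using proj_G G_carrier by blast

lemma proj_add: "g \<in> carrier H \<Longrightarrow> h \<in> carrier H \<Longrightarrow> proj k (g \<oplus> h) = proj k g \<oplus> proj k h"
  using proj_eq[OF decomposition_add[OF proj_decomposition proj_decomposition]] .

lemma proj_smult: "h \<in> carrier H \<Longrightarrow> proj k (c \<odot> h) = c \<odot> proj k h"
  using proj_eq[OF decomposition_smult[OF proj_decomposition]] .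

lemma proj_homogeneous: "h \<in> G l \<Longrightarrow> proj k h = (if k = l then h else \<zero>)"
  using proj_eq[OF decomposition_homogeneous] .

lemma proj_linear: "linear_map H H (proj k)"
  by (auto simp: linear_map_def proj_add proj_smult)

lemma graded_induct [consumes 1, case_names homogeneous add]:
  assumes h: "h \<in> carrier H" and hom: "\<And>k h. h \<in> G k \<Longrightarrow> P h"
    and add: "\<And>g h. g \<in> carrier H \<Longrightarrow> h \<in> carrier H \<Longrightarrow> P g \<Longrightarrow> P h \<Longrightarrow> P (g \<oplus> h)"
  shows "P h"
proof -
  obtain c F where c: "\<And>i. c i \<in> G i" "finite F" "h = (\<Oplus>i\<in>F. c i)"
    using decomposition_exists[OF h] unfolding decomposition_def by blast
  have "P (\<Oplus>i\<in>F. c i)" using c(2)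
  proof (induction F rule: finite_induct)
    case (insert i F)
    have cc: "c j \<in> carrier H" for j using c(1) G_carrier by blast
    then have "(\<Oplus>i\<in>insert i F. c i) = c i \<oplus> (\<Oplus>i\<in>F. c i)" using insert by simp
    then show ?case using insert cc by (auto intro!: add hom[OF c(1)] M.finsum_closed)
  qed (use hom[OF G_zero] in simp)
  then show ?thesis by (simp add: c)
qed

text \<open>Degrees are natural numbers, so 0 splits in one way only; for \<open>proj_mult_1\<close>
  there are two.\<close>

lemma proj_mult_0:
  assumes "g \<in> carrier H" "h \<in> carrier H"
  shows "proj 0 (g \<otimes> h) = proj 0 g \<otimes> proj 0 h"
  using assms
proof (induction g rule: graded_induct)
  case (homogeneous k g)
  then have "g \<in> carrier H" using G_carrier by blast
  from homogeneous(2) this show ?case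
  proof (induction h rule: graded_induct)
    case h: (homogeneous l h)
    then show ?case using G_mult[OF homogeneous(1) h(1)] homogeneous(1) G_carrier[OF homogeneous(1)] G_carrier[OF h(1)]
      by (auto simp: proj_homogeneous[of _ "k + l"] proj_homogeneous[of _ k] proj_homogeneous[of _ l])
  qed (simp add: proj_add r_distr)
qed (simp add: proj_add l_distr)

lemma proj_mult_1:
  assumes "g \<in> carrier H" "h \<in> carrier H"
  shows "proj 1 (g \<otimes> h) = proj 0 g \<otimes> proj 1 h \<oplus> proj 1 g \<otimes> proj 0 h"
  using assms
proof (induction g rule: graded_induct)
  case (homogeneous k g)
  then have gc: "g \<in> carrier H" using G_carrier by blast
  from homogeneous(2) show ?case
  proof (induction h rule: graded_induct)
    case h: (homogeneous l h)
    then have "h \<in> carrier H" using G_carrier by blast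
    then show ?case using G_mult[OF homogeneous(1) h(1)] homogeneous(1) gc h(1)
      by (auto simp: proj_homogeneous[of _ "k + l"] proj_homogeneous[of _ k] proj_homogeneous[of _ l])
  qed (use gc in \<open>simp add: proj_add r_distr M.add.m_ac\<close>)
qed (simp add: proj_add l_distr M.add.m_ac)

lemma proj_Rad_power: "h \<in> Rad_power H k \<Longrightarrow> h \<in> carrier H \<and> (\<forall>i<k. proj i h = \<zero>)"
  using span_decomposition[of h "{k..}"] proj_eq[of h] decomposition_G(2) Rad_power_span[of k] by auto

lemma G_Rad_power: "h \<in> G k \<Longrightarrow> h \<in> Rad_power H k"
  unfolding Rad_power_span span_of_components_def
  using G_carrier[of h k] by (intro CollectI exI[of _ "{k}"] exI[of _ "\<lambda>_. h"]) auto

text \<open>\<open>Rad_power\<close> starts with the whole algebra, so \<open>h\<close> is taken as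
  the product of \<open>h\<close> and 1.\<close>

lemma Rad_in_Rad_power: "h \<in> Rad H \<Longrightarrow> h \<in> Rad_power H 1"
proof -
  assume h: "h \<in> Rad H"
  then have "h \<otimes> \<one> \<in> Rad_power H 1" by (auto intro: ideal_prod.prod)
  then show ?thesis using h by (simp add: Rad_def)
qed

text \<open>The radical being generated in degree one, \<open>G (k + 1)\<close> is contained in \<open>G 1 \<cdot> G k\<close>.\<close>

lemma proj_Suc_mult_closed:
  assumes S: "\<And>g h. g \<in> G 1 \<Longrightarrow> h \<in> G k \<Longrightarrow> P (g \<otimes> h)" and zero: "P \<zero>"
    and add: "\<And>g h. g \<in> carrier H \<Longrightarrow> h \<in> carrier H \<Longrightarrow> P g \<Longrightarrow> P h \<Longrightarrow> P (g \<oplus> h)"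
    and h: "h \<in> G (Suc k)"
  shows "P h"
proof -
  have sum: "P (proj m (\<Oplus>i\<in>F. c i)) \<and> (\<Oplus>i\<in>F. c i) \<in> carrier H"
    if "finite F" "\<And>i. i \<in> F \<Longrightarrow> c i \<in> carrier H \<and> P (proj m (c i))" for F :: "nat set" and c m
    using that
  proof (induction F rule: finite_induct)
    case (insert i F)
    then have "c \<in> F \<rightarrow> carrier H" by auto
    then show ?case using insert by (auto simp: proj_add intro!: add M.finsum_closed)
  qed (use zero proj_homogeneous[OF G_zero] in simp)
  \<comment> \<open>The factors have degrees at least 1 and at least \<open>k\<close>, so degree
    \<open>k + 1\<close> comes from the pair \<open>(1, k)\<close> alone.\<close>
  have prod: "P (proj (Suc k) (g \<otimes> h))" if g: "g \<in> Rad H" and h: "h \<in> Rad_power H k" for g h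
  proof -
    obtain b where b: "decomposition g b" "\<forall>i. i \<notin> {1..} \<longrightarrow> b i = \<zero>"
      using span_decomposition Rad_in_Rad_power[OF g] Rad_power_span by blast
    obtain c where c: "decomposition h c" "\<forall>i. i \<notin> {k..} \<longrightarrow> c i = \<zero>"
      using span_decomposition h Rad_power_span by blast
    obtain F where F: "finite F" "g = (\<Oplus>i\<in>F. b i)" using b(1) unfolding decomposition_def by blast
    obtain F' where F': "finite F'" "h = (\<Oplus>i\<in>F'. c i)" using c(1) unfolding decomposition_def by blast
    have bc: "b i \<in> G i" "c i \<in> G i" "b i \<in> carrier H" "c i \<in> carrier H" "h \<in> carrier H" for i
      using G_carrier[OF decomposition_G(1)[OF b(1)]] G_carrier[OF decomposition_G(1)[OF c(1)]]
        decomposition_G[OF b(1)] decomposition_G[OF c(1)] by simp_all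
    have t: "P (proj (Suc k) (b i \<otimes> c j))" for i j
    proof (cases "i = 1 \<and> j = k")
      case True
      then show ?thesis using S bc(1)[of 1] bc(2)[of k] G_mult[of "b 1" 1 "c k" k] by (simp add: proj_homogeneous)
    next
      case False
      then have "b i \<otimes> c j = \<zero> \<or> Suc k \<noteq> i + j" using b(2) c(2) bc by (cases "i < 1"; cases "j < k") auto
      then show ?thesis using zero proj_homogeneous[OF G_mult[OF bc(1)[of i] bc(2)[of j]], of "Suc k"]
          proj_homogeneous[OF G_zero] by auto
    qed
    have "g \<otimes> h = (\<Oplus>i\<in>F. b i \<otimes> h)" unfolding F(2) using bc by (intro finsum_ldistr F) auto
    moreover have "P (proj (Suc k) (b i \<otimes> h))" for i
    proof -
      have "b i \<otimes> h = (\<Oplus>j\<in>F'. b i \<otimes> c j)" unfolding F'(2) using bc by (intro finsum_rdistr F') auto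
      then show ?thesis using sum[OF F'(1), of "\<lambda>j. b i \<otimes> c j" "Suc k"] t bc by simp
    qed
    ultimately show ?thesis using sum[OF F(1), of "\<lambda>i. b i \<otimes> h" "Suc k"] bc by simp
  qed
  have ideal: "P (proj (Suc k) v) \<and> v \<in> carrier H" if "v \<in> ideal_prod H (Rad H) (Rad_power H k)" for v
    using that
  proof (induction v rule: ideal_prod.induct)
    case (prod g h)
    then show ?case using proj_Rad_power[of h k] \<open>g \<in> Rad H \<Longrightarrow> h \<in> Rad_power H k \<Longrightarrow> P (proj (Suc k) (g \<otimes> h))\<close>
      by (auto simp: Rad_def)
  next
    case (sum g h)
    then show ?case by (auto simp: proj_add intro: add)
  qed
  \<comment> \<open>\<open>h\<close> lies in the product of the radical and its \<open>k\<close>-th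
    power, and is its own component of degree \<open>k + 1\<close>.\<close>
  show ?thesis using ideal[of h] G_Rad_power[OF h] proj_homogeneous[OF h, of "Suc k"] by simp
qed

text \<open>Each member of a finite spanning set has finitely many nonzero components, so there is a
  degree from which on none of them contributes.\<close>

lemma finite_dim_degree_bound:
  assumes "finite_dim H" obtains M where "\<And>k h. k \<ge> M \<Longrightarrow> h \<in> G k \<Longrightarrow> h = \<zero>"
proof -
  obtain B where B: "finite B" "B \<subseteq> carrier H" "\<And>h. h \<in> carrier H \<Longrightarrow> \<exists>c. h = (\<Oplus>b\<in>B. c b \<odot> b)"
    using assms unfolding finite_dim_def by blast
  have "\<exists>m. \<forall>k\<ge>m. proj k b = \<zero>" if "b \<in> B" for b
  proof -
    have "decomposition b (\<lambda>k. proj k b)" using B(2) that by (intro proj_decomposition) blast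
    then obtain F where F: "finite F" "\<And>k. k \<notin> F \<Longrightarrow> proj k b = \<zero>"
      unfolding decomposition_def by blast
    then have "\<forall>k\<ge>Suc (Max (insert 0 F)). proj k b = \<zero>"
      by (metis Max_ge Suc_n_not_le_n finite_insert insertCI le_trans)
    then show ?thesis by blast
  qed
  then obtain m where m: "\<And>b k. b \<in> B \<Longrightarrow> k \<ge> m b \<Longrightarrow> proj k b = \<zero>" by metis
  have "h = \<zero>" if k: "k \<ge> Max (insert 0 (m ` B))" and h: "h \<in> G k" for k h
  proof -
    obtain c where c: "h = (\<Oplus>b\<in>B. c b \<odot> b)" using B(3) G_carrier[OF h] by blast
    have z: "proj k b = \<zero>" if "b \<in> B" for b
      using m[OF that] k B(1) that by (meson Max_ge finite_imageI finite_insert imageI insertCI le_trans)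
    have "h = proj k h" using h by (simp add: proj_homogeneous)
    also have "\<dots> = (\<Oplus>b\<in>B. proj k (c b \<odot> b))"
      unfolding c using B(1,2) linear_map_finsum[OF complex_algebra_axioms complex_algebra_axioms proj_linear B(1), of "\<lambda>b. c b \<odot> b" k] by auto
    also have "\<dots> = (\<Oplus>b\<in>B. \<zero>)" using B(2) z by (intro M.finsum_cong') (auto simp: proj_smult subsetD)
    finally show ?thesis by simp
  qed
  then show ?thesis using that by blast
qed

end

text \<open>\<open>W\<close> is the scalar by which \<open>a\<close> acts on \<open>G 1\<close>; it is used as the root of unity that indexes
  the primitive idempotents, so that \<open>x e\<^sub>i = e\<^sub>i\<^sub>+\<^sub>1 x\<close>.\<close>

locale cyclic_graded_quasi_hopf = graded_quasi_hopf H G for H :: "'a quasi_hopf" (structure) and G +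
  fixes n :: nat and a :: 'a and W :: complex and x :: 'a
  assumes n_gt: "n > 1" and group_algebra: "is_cyclic_group_algebra (restrict_quasi_hopf H (G 0)) n a"
    and W: "primitive_root_of_unity n W"
    and x_G: "x \<in> G 1" and free: "bij_betw (\<lambda>h. h \<otimes> x) (G 0) (G 1)"
    and Ad: "a \<otimes> x \<otimes> inv a = W \<odot> x"
begin

abbreviation "K \<equiv> restrict_quasi_hopf H (G 0)"
abbreviation "e \<equiv> idem H n a W"

sublocale K: retract K H "proj 0"
  by (rule restrict_retract[OF G_sub one_G G_add _ G_smult])
    (use G_mult[of _ 0 _ 0] proj_G proj_homogeneous[of _ 0 0] proj_add proj_smult in auto)

text \<open>Natural degrees with sum 0 are all 0.\<close>

lemma graded_tensors_0:
  assumes "t \<in> graded_tensors H G k 0" "k > 0"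
  shows "\<exists>u\<in>tensors K k. tensor_eq H k u t"
proof -
  obtain L where L: "\<And>xs. xs \<in> set L \<Longrightarrow> length xs = k \<and>
      (\<exists>ds. length ds = k \<and> sum_list ds = 0 \<and> (\<forall>i<k. xs ! i \<in> G (ds ! i)))" "tensor_eq H k t (tensor_sum L)"
    using assms(1) unfolding graded_tensors_def by blast
  have "length xs = k \<and> set xs \<subseteq> G 0" if xs: "xs \<in> set L" for xs
  proof -
    obtain ds where ds: "length xs = k" "length ds = k" "sum_list ds = 0" "\<forall>i<k. xs ! i \<in> G (ds ! i)"
      using L(1)[OF xs] by blast
    then have "ds ! i = 0" if "i < k" for i using that nth_mem[of i ds] by (simp add: sum_list_eq_0_iff)
    then show ?thesis using ds by (auto simp: in_set_conv_nth)
  qed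
  then have "tensor_sum L \<in> tensors K k" unfolding tensors_def by (auto intro!: exI[of _ L])
  then show ?thesis using L(2) tensor_eq_sym by blast
qed

lemma K_pre_bialgebra: "pre_bialgebra K"
  by (rule restrict_pre_bialgebra[OF K.retract_axioms]) (use graded_tensors_0[OF comult_G[of _ 0]] in auto)

lemma a_G: "a \<in> G 0" and a_pow_n: "a [^] n = \<one>"
  and group_basis: "bij_betw (\<lambda>c. \<Oplus>i\<in>{..<n}. c i \<odot> a [^] i) ({..<n} \<rightarrow>\<^sub>E UNIV) (G 0)"
  and comult_a: "tensor_eq H 2 (comult H a) (pure_tensor [a, a])" and counit_a: "counit H a = 1"
proof -
  note g = group_algebra[unfolded is_cyclic_group_algebra_def]
  show a: "a \<in> G 0" using g by simp
  show "a [^] n = \<one>" using g by (simp add: K.pow_eq)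
  have fs: "(\<Oplus>\<^bsub>K\<^esub>i\<in>{..<n}. c i \<odot> a [^] i) = (\<Oplus>i\<in>{..<n}. c i \<odot> a [^] i)" for c
    by (rule K.finsum_eq) (auto intro: G_smult G_pow_0 a)
  have "bij_betw (\<lambda>c. \<Oplus>\<^bsub>K\<^esub>i\<in>{..<n}. c i \<odot> a [^] i) ({..<n} \<rightarrow>\<^sub>E UNIV) (G 0)" using g by (simp add: K.pow_eq)
  then show "bij_betw (\<lambda>c. \<Oplus>i\<in>{..<n}. c i \<odot> a [^] i) ({..<n} \<rightarrow>\<^sub>E UNIV) (G 0)" by (simp only: fs)
  obtain t where t: "t \<in> tensors K 2" "tensor_eq H 2 t (comult H a)"
    using graded_tensors_0[OF comult_G[OF a]] by auto
  have "tensor_eq K 2 (comult K a) (pure_tensor [a, a])" using g by simp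
  then show "tensor_eq H 2 (comult H a) (pure_tensor [a, a])"
    using restrict_comult(2)[OF t] K.tensor_eq_extend by (meson tensor_eq_sym tensor_eq_trans)
  show "counit H a = 1" using g by simp
qed

lemma a_carrier [simp]: "a \<in> carrier H" using G_carrier[OF a_G] .

lemma e_weight_system: "weight_system H n e"
  by (rule weight_system_idem[OF a_carrier a_pow_n W comult_a counit_a])

sublocale weight_system H n e by (rule e_weight_system)

lemma e_G: "e i \<in> G 0"
  unfolding idem_def by (intro G_finsum G_smult G_pow_0 a_G) simp

lemma K_weight_system: "weight_system K n e"
proof -
  interpret K': pre_bialgebra K by (rule K_pre_bialgebra)
  have "idem K n a W i = e i" for i
    unfolding idem_def K.pow_eq by (simp, rule K.finsum_eq) (auto intro: G_smult G_pow_0 a_G)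
  then have "idem K n a W = e" by (rule ext)
  moreover have "weight_system K n (idem K n a W)"
    using group_algebra[unfolded is_cyclic_group_algebra_def] W by (intro K'.weight_system_idem) simp_all
  ultimately show ?thesis by simp
qed

text \<open>In the basis of powers of \<open>a\<close> the coefficient of \<open>e i\<close> at
  \<open>k = 0\<close> is \<open>1/n\<close>.\<close>

lemma e_nz: "e i \<noteq> \<zero>"
proof
  assume "e i = \<zero>"
  let ?c = "\<lambda>k\<in>{..<n}. inverse W ^ (i * k) / of_nat n" and ?z = "\<lambda>k\<in>{..<n}. 0::complex"
  have ac: "a [^] (k::nat) \<in> carrier H" for k by simp
  have "(\<Oplus>k\<in>{..<n}. ?c k \<odot> a [^] k) = e i"
    unfolding idem_def by (intro M.finsum_cong') auto
  moreover have "(\<Oplus>k\<in>{..<n}. ?z k \<odot> a [^] k) = (\<Oplus>k\<in>{..<n}. \<zero>)" by (intro M.finsum_cong') auto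
  ultimately have eq: "(\<Oplus>k\<in>{..<n}. ?c k \<odot> a [^] k) = (\<Oplus>k\<in>{..<n}. ?z k \<odot> a [^] k)" using \<open>e i = \<zero>\<close> by simp
  have "?c = ?z" by (rule inj_onD[OF bij_betw_imp_inj_on[OF group_basis], of ?c ?z]) (use eq in auto)
  then have "?c 0 = ?z 0" by (rule fun_cong)
  then show False using n_gt by simp
qed

lemma a_pow_e: "a [^] k \<otimes> e i = (W ^ (i * k)) \<odot> e i"
  by (rule power_mult_idem[OF a_carrier a_pow_n W])

text \<open>Elements of \<open>G 0\<close> are polynomials in \<open>a\<close>, and \<open>a\<close>
  acts on \<open>e j\<close> by a scalar.\<close>

lemma G0_e: "h \<in> G 0 \<Longrightarrow> \<exists>c. h \<otimes> e j = c \<odot> e j"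
proof -
  assume "h \<in> G 0"
  then obtain c where c: "h = (\<Oplus>k\<in>{..<n}. c k \<odot> a [^] k)" using group_basis unfolding bij_betw_def by blast
  have "h \<otimes> e j = (\<Oplus>k\<in>{..<n}. c k \<odot> a [^] k \<otimes> e j)" unfolding c by (intro finsum_ldistr) auto
  also have "\<dots> = (\<Oplus>k\<in>{..<n}. (c k * W ^ (j * k)) \<odot> e j)"
    by (intro M.finsum_cong') (auto simp: smult_mult_left a_pow_e smult_smult)
  also have "\<dots> = (\<Sum>k<n. c k * W ^ (j * k)) \<odot> e j" by (rule sum_smult) auto
  finally show ?thesis by blast
qed

lemma x_carrier: "x \<in> carrier H" using G_carrier[OF x_G] .

lemma x_e': "x \<otimes> e i = e (Suc i) \<otimes> x"
proof (rule skew_idem[OF a_carrier x_carrier])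
  \<comment> \<open>\<open>a\<close> has to be exhibited as a unit before \<open>inv a\<close> in
    the hypothesis on \<open>Ad\<close> can be cancelled.\<close>
  have "a \<otimes> a [^] (n - 1) = \<one>" "a [^] (n - 1) \<otimes> a = \<one>"
    using nat_pow_Suc2[OF a_carrier, of "n - 1"] nat_pow_Suc[of a "n - 1"] a_pow_n n_gt by simp_all
  then have u: "a \<in> Units H" unfolding Units_def by (auto intro!: bexI[of _ "a [^] (n - 1)"])
  have "a \<otimes> x = (a \<otimes> x \<otimes> inv a) \<otimes> a" using u x_carrier by (simp add: m_assoc)
  also have "\<dots> = W \<odot> (x \<otimes> a)" using x_carrier by (simp add: Ad smult_mult_left)
  finally show "x \<otimes> a = inverse W \<odot> (a \<otimes> x)"
    using primitive_root_nonzero[OF W] x_carrier by (simp add: smult_smult)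
qed

text \<open>Freeness says that right multiplication by \<open>x\<close> is injective on
  \<open>G 0\<close>; it is applied to \<open>e (Suc i)\<close>, as \<open>x\<close> can be moved
  past \<open>e i\<close>.\<close>

lemma x_e_nz: "x \<otimes> e i \<noteq> \<zero>"
proof
  assume "x \<otimes> e i = \<zero>"
  then have "e (Suc i) \<otimes> x = \<zero> \<otimes> x" using x_carrier by (simp add: x_e')
  then have "e (Suc i) = \<zero>" using bij_betw_imp_inj_on[OF free] e_G by (auto dest: inj_onD)
  then show False using e_nz by simp
qed

text \<open>The properties of \<open>x\<close> that survive rescaling: it shifts weights by one, and
  \<open>G 1 e\<^sub>j\<close> consists of multiples of \<open>y e\<^sub>j\<close>. The final model
  uses a rescaled generator.\<close>

definition generates :: "'a \<Rightarrow> bool" where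
  "generates y \<longleftrightarrow> y \<in> G 1 \<and> (\<forall>i. y \<otimes> e i = e (Suc i) \<otimes> y) \<and> (\<forall>h\<in>G 1. \<forall>j. \<exists>c. h \<otimes> e j = c \<odot> (y \<otimes> e j))"

lemma generates_x: "generates x"
  unfolding generates_def
proof (intro conjI ballI allI x_G x_e')
  fix h j assume "h \<in> G 1"
  then obtain g where g: "g \<in> G 0" "h = g \<otimes> x" using free unfolding bij_betw_def by blast
  obtain c where "g \<otimes> e (Suc j) = c \<odot> e (Suc j)" using G0_e[OF g(1)] by blast
  then have "h \<otimes> e j = c \<odot> (x \<otimes> e j)"
    using G_carrier[OF g(1)] x_carrier g(2) by (simp add: m_assoc x_e' smult_mult_left m_assoc[symmetric])
  then show "\<exists>c. h \<otimes> e j = c \<odot> (x \<otimes> e j)" by blast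
qed

lemma generates_pow_e:
  assumes "generates y" shows "y [^] (k::nat) \<otimes> e i = e (i + k) \<otimes> y [^] k"
proof (induction k arbitrary: i)
  case (Suc k)
  have y: "y \<in> carrier H" "\<And>i. y \<otimes> e i = e (Suc i) \<otimes> y" using assms G_carrier unfolding generates_def by blast+
  have "y [^] Suc k \<otimes> e i = y [^] k \<otimes> (y \<otimes> e i)" using y by (simp add: m_assoc)
  also have "\<dots> = y [^] k \<otimes> e (Suc i) \<otimes> y" using y by (simp add: m_assoc)
  also have "\<dots> = e (Suc i + k) \<otimes> y [^] k \<otimes> y" using Suc[of "Suc i"] by simp
  finally show ?case using y by (simp add: m_assoc)
qed (use assms G_carrier in \<open>auto simp: generates_def\<close>)

text \<open>\<open>G (k + 1)\<close> is generated by products of \<open>G 1\<close> and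
  \<open>G k\<close>; by induction on the degree each \<open>G k e\<^sub>j\<close> contains
  multiples of one monomial only.\<close>

lemma component_e:
  assumes y: "generates y" and h: "h \<in> G k"
  shows "\<exists>c. h \<otimes> e j = c \<odot> (y [^] k \<otimes> e j)"
  using h
proof (induction k arbitrary: h j)
  case 0 then show ?case using G0_e by simp
next
  case (Suc k)
  have yc: "y \<in> carrier H" using y G_carrier unfolding generates_def by blast
  have "\<forall>j. \<exists>c. h \<otimes> e j = c \<odot> (y [^] Suc k \<otimes> e j)"
  proof (rule proj_Suc_mult_closed[OF _ _ _ Suc.prems])
    fix g h assume g: "g \<in> G 1" and h: "h \<in> G k"
    show "\<forall>j. \<exists>c. g \<otimes> h \<otimes> e j = c \<odot> (y [^] Suc k \<otimes> e j)"
    proof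
      fix j
      obtain c where c: "h \<otimes> e j = c \<odot> (y [^] k \<otimes> e j)" using Suc.IH[OF h] by blast
      obtain d where d: "g \<otimes> e (j + k) = d \<odot> (y \<otimes> e (j + k))" using y g unfolding generates_def by blast
      have gc: "g \<in> carrier H" "h \<in> carrier H" using g h G_carrier by blast+
      have "g \<otimes> h \<otimes> e j = c \<odot> (g \<otimes> e (j + k) \<otimes> y [^] k)"
        using gc yc by (simp add: m_assoc c smult_mult_right generates_pow_e[OF y])
      also have "\<dots> = (c * d) \<odot> (y \<otimes> (y [^] k \<otimes> e j))"
        using gc yc by (simp add: d smult_mult_left smult_smult m_assoc generates_pow_e[OF y])
      also have "y \<otimes> (y [^] k \<otimes> e j) = y [^] Suc k \<otimes> e j"
        using yc by (simp add: m_assoc[symmetric] nat_pow_Suc2[symmetric] del: nat_pow_Suc)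
      finally show "\<exists>c. g \<otimes> h \<otimes> e j = c \<odot> (y [^] Suc k \<otimes> e j)" by blast
    qed
  next
    show "\<forall>j. \<exists>c. \<zero> \<otimes> e j = c \<odot> (y [^] Suc k \<otimes> e j)" using yc by (intro allI exI[of _ 0]) simp
  next
    fix g h assume gh: "g \<in> carrier H" "h \<in> carrier H"
      "\<forall>j. \<exists>c. g \<otimes> e j = c \<odot> (y [^] Suc k \<otimes> e j)" "\<forall>j. \<exists>c. h \<otimes> e j = c \<odot> (y [^] Suc k \<otimes> e j)"
    show "\<forall>j. \<exists>c. (g \<oplus> h) \<otimes> e j = c \<odot> (y [^] Suc k \<otimes> e j)"
    proof
      fix j
      obtain c d where "g \<otimes> e j = c \<odot> (y [^] Suc k \<otimes> e j)" "h \<otimes> e j = d \<odot> (y [^] Suc k \<otimes> e j)" using gh(3,4) by metis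
      then have "(g \<oplus> h) \<otimes> e j = (c + d) \<odot> (y [^] Suc k \<otimes> e j)"
        using gh yc by (simp add: l_distr smult_add_left del: nat_pow_Suc)
      then show "\<exists>c. (g \<oplus> h) \<otimes> e j = c \<odot> (y [^] Suc k \<otimes> e j)" by blast
    qed
  qed
  then show ?case by blast
qed

text \<open>The coefficient functional of a single monomial, obtained from grading and weights. It
  makes sense as soon as that monomial is nonzero, before anything is known about a basis.\<close>

definition coord :: "'a \<Rightarrow> nat \<Rightarrow> nat \<Rightarrow> 'a \<Rightarrow> complex" where
  "coord y k i h = (THE c. proj k h \<otimes> e i = c \<odot> (y [^] k \<otimes> e i))"

context
  fixes y k i
  assumes y: "generates y" and nz: "y [^] (k::nat) \<otimes> e i \<noteq> \<zero>"
begin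

lemma y_carrier: "y \<in> carrier H" using y G_carrier unfolding generates_def by blast

lemma coord_unique: "proj k h \<otimes> e i = c \<odot> (y [^] k \<otimes> e i) \<Longrightarrow> coord y k i h = c"
  unfolding coord_def using nz y_carrier by (intro the_equality) (auto simp: smult_left_cancel)

lemma coord_eq: "h \<in> carrier H \<Longrightarrow> proj k h \<otimes> e i = coord y k i h \<odot> (y [^] k \<otimes> e i)"
  using component_e[OF y proj_G, of h k i] coord_unique by metis

lemma coord_linear: "linear_form H (coord y k i)"
  unfolding linear_form_def
proof (intro conjI ballI allI)
  fix g h assume "g \<in> carrier H" "h \<in> carrier H"
  then show "coord y k i (g \<oplus> h) = coord y k i g + coord y k i h"
    using y_carrier by (intro coord_unique) (simp add: proj_add l_distr coord_eq smult_add_left)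
next
  fix h c assume "h \<in> carrier H"
  then show "coord y k i (c \<odot> h) = c * coord y k i h"
    using y_carrier by (intro coord_unique) (simp add: proj_smult smult_mult_left coord_eq smult_smult)
qed

lemma coord_monomial:
  assumes "i < n" "j < n"
  shows "coord y k i (y [^] (l::nat) \<otimes> e j) = (if l = k \<and> j = i then 1 else 0)"
proof (rule coord_unique)
  have "y [^] l \<otimes> e j \<in> G l" using G_mult[OF G_pow e_G, of y l j] y unfolding generates_def by simp
  then have p: "proj k (y [^] l \<otimes> e j) = (if k = l then y [^] l \<otimes> e j else \<zero>)" by (rule proj_homogeneous)
  show "proj k (y [^] l \<otimes> e j) \<otimes> e i = (if l = k \<and> j = i then 1 else 0) \<odot> (y [^] k \<otimes> e i)"
    unfolding p using assms y_carrier by (auto simp: m_assoc e_mult)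
qed

end

end

section \<open>Characters, skew derivations and structure constants of H\<close>

context cyclic_graded_quasi_hopf
begin

definition chi :: "nat \<Rightarrow> 'a \<Rightarrow> complex" where "chi i = coord x 0 i"
definition der :: "nat \<Rightarrow> 'a \<Rightarrow> complex" where "der i = coord x 1 i"

lemma x_pow_0_e: "x [^] (0::nat) \<otimes> e i = e i" and x_pow_1_e: "x [^] (1::nat) \<otimes> e i = x \<otimes> e i"
  using x_carrier by simp_all

lemma x_pow_e_nz: "x [^] (0::nat) \<otimes> e i \<noteq> \<zero>" "x [^] (1::nat) \<otimes> e i \<noteq> \<zero>"
  unfolding x_pow_0_e x_pow_1_e by (rule e_nz x_e_nz)+

lemma chi_linear: "linear_form H (chi i)" and der_linear: "linear_form H (der i)"
  unfolding chi_def der_def by (intro coord_linear generates_x x_pow_e_nz)+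

lemma chi_eq: "h \<in> carrier H \<Longrightarrow> proj 0 h \<otimes> e i = chi i h \<odot> e i"
  and der_eq: "h \<in> carrier H \<Longrightarrow> proj 1 h \<otimes> e i = der i h \<odot> (x \<otimes> e i)"
  unfolding chi_def der_def
  using coord_eq[OF generates_x x_pow_e_nz(1)] coord_eq[OF generates_x x_pow_e_nz(2)]
  unfolding x_pow_0_e x_pow_1_e by simp_all

lemma chi_unique: "proj 0 h \<otimes> e i = c \<odot> e i \<Longrightarrow> chi i h = c"
  and der_unique: "proj 1 h \<otimes> e i = c \<odot> (x \<otimes> e i) \<Longrightarrow> der i h = c"
  unfolding chi_def der_def
  using coord_unique[OF generates_x x_pow_e_nz(1)] coord_unique[OF generates_x x_pow_e_nz(2)]
  unfolding x_pow_0_e x_pow_1_e by simp_all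

lemma chi_mod: "chi (i mod n) = chi i"
  by (rule ext) (simp add: chi_def coord_def e_mod)

lemma forms_monomial:
  assumes "i < n" "j < n"
  shows "chi i (e j) = (if i = j then 1 else 0)" "der i (e j) = 0"
    "chi i (x \<otimes> e j) = 0" "der i (x \<otimes> e j) = (if i = j then 1 else 0)"
  using coord_monomial[OF generates_x x_pow_e_nz(1)[of i] assms, of 0] coord_monomial[OF generates_x x_pow_e_nz(1)[of i] assms, of 1]
    coord_monomial[OF generates_x x_pow_e_nz(2)[of i] assms, of 0] coord_monomial[OF generates_x x_pow_e_nz(2)[of i] assms, of 1]
  unfolding chi_def der_def x_pow_0_e x_pow_1_e by auto

lemma chi_mult:
  assumes "g \<in> carrier H" "h \<in> carrier H" shows "chi i (g \<otimes> h) = chi i g * chi i h"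
proof (rule chi_unique)
  have "proj 0 (g \<otimes> h) \<otimes> e i = proj 0 g \<otimes> (proj 0 h \<otimes> e i)" using assms by (simp add: proj_mult_0 m_assoc)
  then show "proj 0 (g \<otimes> h) \<otimes> e i = (chi i g * chi i h) \<odot> e i"
    using assms by (simp add: chi_eq smult_mult_right smult_smult mult.commute)
qed

text \<open>The degree 1 part of a product has two terms; in the first,
  \<open>x e\<^sub>i = e\<^sub>i\<^sub>+\<^sub>1 x\<close> turns the action of \<open>g\<close> into
  the character at \<open>i + 1\<close>.\<close>

lemma der_mult:
  assumes "g \<in> carrier H" "h \<in> carrier H"
  shows "der i (g \<otimes> h) = chi (Suc i mod n) g * der i h + der i g * chi i h"
proof (rule der_unique)
  note [simp] = x_carrier
  have "proj 0 g \<otimes> (x \<otimes> e i) = proj 0 g \<otimes> e (Suc i) \<otimes> x" using assms by (simp add: x_e' m_assoc)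
  also have "\<dots> = chi (Suc i) g \<odot> (x \<otimes> e i)" using assms by (simp add: chi_eq smult_mult_left x_e')
  finally have 1: "proj 0 g \<otimes> (x \<otimes> e i) = chi (Suc i) g \<odot> (x \<otimes> e i)" .
  have "proj 1 (g \<otimes> h) \<otimes> e i = proj 0 g \<otimes> (proj 1 h \<otimes> e i) \<oplus> proj 1 g \<otimes> (proj 0 h \<otimes> e i)"
    using assms by (simp only: proj_mult_1 l_distr m_assoc m_closed proj_closed e_closed)
  also have "\<dots> = (der i h * chi (Suc i) g) \<odot> (x \<otimes> e i) \<oplus> (chi i h * der i g) \<odot> (x \<otimes> e i)"
    using assms by (simp only: chi_eq der_eq smult_mult_right smult_smult 1 proj_closed e_closed x_carrier m_closed)
  also have "\<dots> = (chi (Suc i mod n) g * der i h + der i g * chi i h) \<odot> (x \<otimes> e i)"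
    by (simp add: smult_add_left chi_mod mult.commute)
  finally show "proj 1 (g \<otimes> h) \<otimes> e i = \<dots>" .
qed

lemma linear_form_sum_e:
  assumes "h \<in> carrier H" "linear_form H f" shows "f h = (\<Sum>i<n. f (h \<otimes> e i))"
proof -
  have "h \<otimes> (\<Oplus>i\<in>{..<n}. e i) = (\<Oplus>i\<in>{..<n}. h \<otimes> e i)" using assms(1) by (intro finsum_rdistr) auto
  then have "f h = f (\<Oplus>i\<in>{..<n}. h \<otimes> e i)" using assms(1) e_sum by simp
  also have "\<dots> = (\<Sum>i<n. f (h \<otimes> e i))" using assms by (intro linear_form_finsum) auto
  finally show ?thesis .
qed

lemma linear_form_G0:
  assumes "linear_form H f" "h \<in> G 0" shows "f h = (\<Sum>i<n. chi i h * f (e i))"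
proof -
  note h = G_carrier[OF assms(2)]
  have "h \<otimes> e i = chi i h \<odot> e i" for i using chi_eq[OF h] proj_homogeneous[OF assms(2), of 0] by simp
  then show ?thesis using linear_form_sum_e[OF h assms(1)] assms(1) by (simp add: linear_form_def)
qed

lemma linear_form_G1:
  assumes "linear_form H f" "h \<in> G 1" shows "f h = (\<Sum>i<n. der i h * f (x \<otimes> e i))"
proof -
  note h = G_carrier[OF assms(2)]
  have "h \<otimes> e i = der i h \<odot> (x \<otimes> e i)" for i using der_eq[OF h] proj_homogeneous[OF assms(2), of 1] by simp
  then show ?thesis using linear_form_sum_e[OF h assms(1)] assms(1) x_carrier by (simp add: linear_form_def)
qed

lemma forms_homogeneous: "h \<in> G 0 \<Longrightarrow> der i h = 0" "h \<in> G 1 \<Longrightarrow> chi i h = 0"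
  using chi_unique[of h i 0] der_unique[of h i 0] x_carrier by (simp_all add: proj_homogeneous)

lemma counit_chi: "h \<in> carrier H \<Longrightarrow> counit H h = chi 0 h"
proof (induction h rule: graded_induct)
  case (homogeneous k h)
  show ?case
  proof (cases "k = 0")
    case True
    then have "counit H h = (\<Sum>i<n. chi i h * counit H (e i))"
      using linear_form_G0[OF counit_linear, of h] homogeneous by simp
    also have "\<dots> = (\<Sum>i<n. if i = 0 then chi i h else 0)"
      by (intro sum.cong refl) (auto simp: counit_e)
    finally show ?thesis using n_pos by simp
  next
    case False
    then have "chi 0 h = 0" using proj_homogeneous[OF homogeneous, of 0] by (intro chi_unique) simp
    then show ?thesis using counit_G[OF _ homogeneous] False by simp
  qed
next
  case (add g h)
  then show ?case using chi_linear[of 0] by (simp add: counit_add linear_form_def)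
qed

text \<open>On \<open>G 0\<close> the characters \<open>chi i\<close> are dual to the spanning
  idempotents, so every form restricted to \<open>G 0\<close> expands in products of
  characters.\<close>

lemma tensor_K_diag2:
  assumes t: "t \<in> tensors K 2"
  shows "tensor_eq H 2 t (dg2 (\<lambda>i j. t (prod2 (chi i) (chi j))))"
  unfolding tensor_eq_def
proof (intro allI impI)
  fix f assume f: "multilinear H 2 f"
  interpret K': complex_algebra K by (rule K.K)
  note tH = K.tensors_extend[OF t]
  have ml: "multilinear H 2 (prod2 (chi i) (chi j))" for i j by (intro prod2_multilinear chi_linear)
  let ?S = "\<lambda>xs. \<Sum>i<n. \<Sum>j<n. f [e i, e j] * prod2 (chi i) (chi j) xs"
  have S: "multilinear H 2 ?S" by (intro multilinear_sum multilinear_times ml)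
  have "t f = t ?S"
  proof (rule tensors_cong_on[OF t K.multilinear_restrict[OF f] K.multilinear_restrict[OF S]])
    fix xs assume "xs \<in> vlists K 2"
    then obtain y z where xs: "xs = [y, z]" "y \<in> G 0" "z \<in> G 0" by (rule K'.vlists2E) simp
    have "f [y, z] = (\<Sum>i<n. chi i y * f [e i, z])"
      using linear_form_G0[of "\<lambda>y. f [y, z]", OF _ xs(2)] f G_carrier[OF xs(3)] by (simp add: multilinear2_iff)
    also have "\<dots> = (\<Sum>i<n. chi i y * (\<Sum>j<n. chi j z * f [e i, e j]))"
      using f by (intro sum.cong refl arg_cong2[where f = "(*)"] linear_form_G0[OF _ xs(3)]) (simp add: multilinear2_iff)
    finally show "f xs = ?S xs" by (simp add: xs sum_distrib_left mult_ac)
  qed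
  also have "\<dots> = dg2 (\<lambda>i j. t (prod2 (chi i) (chi j))) f"
    using ml by (simp add: tensors_apply_sum[OF tH] tensors_apply_times[OF tH] multilinear_sum multilinear_times diag2_def mult.commute)
  finally show "t f = dg2 (\<lambda>i j. t (prod2 (chi i) (chi j))) f" .
qed

lemma tensor_K_diag3:
  assumes t: "t \<in> tensors K 3"
  shows "tensor_eq H 3 t (dg3 (\<lambda>i j k. t (prod3 (chi i) (chi j) (chi k))))"
  unfolding tensor_eq_def
proof (intro allI impI)
  fix f assume f: "multilinear H 3 f"
  interpret K': complex_algebra K by (rule K.K)
  note tH = K.tensors_extend[OF t]
  have ml: "multilinear H 3 (prod3 (chi i) (chi j) (chi k))" for i j k by (intro prod3_multilinear chi_linear)
  let ?S = "\<lambda>xs. \<Sum>i<n. \<Sum>j<n. \<Sum>k<n. f [e i, e j, e k] * prod3 (chi i) (chi j) (chi k) xs"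
  have S: "multilinear H 3 ?S" by (intro multilinear_sum multilinear_times ml)
  have "t f = t ?S"
  proof (rule tensors_cong_on[OF t K.multilinear_restrict[OF f] K.multilinear_restrict[OF S]])
    fix xs assume "xs \<in> vlists K 3"
    then obtain y z v where xs: "xs = [y, z, v]" "y \<in> G 0" "z \<in> G 0" "v \<in> G 0" by (rule K'.vlists3E) simp
    have "f [y, z, v] = (\<Sum>i<n. chi i y * f [e i, z, v])"
      using linear_form_G0[of "\<lambda>y. f [y, z, v]", OF _ xs(2)] f G_carrier[OF xs(3)] G_carrier[OF xs(4)] by (simp add: multilinear3_iff)
    also have "\<dots> = (\<Sum>i<n. chi i y * (\<Sum>j<n. chi j z * f [e i, e j, v]))"
      using f G_carrier[OF xs(4)] by (intro sum.cong refl arg_cong2[where f = "(*)"] linear_form_G0[OF _ xs(3)]) (simp add: multilinear3_iff)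
    also have "\<dots> = (\<Sum>i<n. chi i y * (\<Sum>j<n. chi j z * (\<Sum>k<n. chi k v * f [e i, e j, e k])))"
      using f by (intro sum.cong refl arg_cong2[where f = "(*)"] linear_form_G0[OF _ xs(4)]) (simp add: multilinear3_iff)
    finally show "f xs = ?S xs" by (simp add: xs sum_distrib_left mult_ac)
  qed
  also have "\<dots> = dg3 (\<lambda>i j k. t (prod3 (chi i) (chi j) (chi k))) f"
    using ml by (simp add: tensors_apply_sum[OF tH] tensors_apply_times[OF tH] multilinear_sum multilinear_times diag3_def mult.commute)
  finally show "t f = dg3 (\<lambda>i j k. t (prod3 (chi i) (chi j) (chi k))) f" .
qed

text \<open>Total degree 1 admits the bidegrees \<open>(1, 0)\<close> and \<open>(0, 1)\<close>
  only, which is the shape of \<open>skew2\<close>.\<close>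

lemma tensor_degree_1:
  assumes t: "t \<in> tensors H 2" "t \<in> graded_tensors H G 2 1"
  shows "tensor_eq H 2 t (skew2 H n e x (\<lambda>i j. t (prod2 (der i) (chi j))) (\<lambda>i j. t (prod2 (chi i) (der j))))"
  unfolding tensor_eq_def
proof (intro allI impI)
  fix f assume f: "multilinear H 2 f"
  note [simp] = x_carrier
  have ml: "multilinear H 2 (prod2 (chi i) (der j))" "multilinear H 2 (prod2 (der i) (chi j))" for i j
    by (intro prod2_multilinear chi_linear der_linear)+
  let ?S = "\<lambda>xs. \<Sum>i<n. \<Sum>j<n. f [x \<otimes> e i, e j] * prod2 (der i) (chi j) xs + f [e i, x \<otimes> e j] * prod2 (chi i) (der j) xs"
  have S: "multilinear H 2 ?S" by (intro multilinear_sum multilinear_plus multilinear_times ml)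
  obtain L where L: "\<And>xs. xs \<in> set L \<Longrightarrow> length xs = 2 \<and>
      (\<exists>ds. length ds = 2 \<and> sum_list ds = 1 \<and> (\<forall>i<2. xs ! i \<in> G (ds ! i)))" "tensor_eq H 2 t (tensor_sum L)"
    using t(2) unfolding graded_tensors_def by blast
  have fS: "f xs = ?S xs" if xsL: "xs \<in> set L" for xs
  proof -
    obtain ds where ds: "length xs = 2" "length ds = 2" "sum_list ds = 1" "\<forall>i<2. xs ! i \<in> G (ds ! i)"
      using L(1)[OF xsL] by blast
    obtain y z k l where yz: "xs = [y, z]" "ds = [k, l]"
      using ds(1,2) by (auto simp: numeral_2_eq_2 length_Suc_conv)
    have d: "k + l = 1" "y \<in> G k" "z \<in> G l" using ds(3) ds(4)[rule_format, of 0] ds(4)[rule_format, of 1] yz by simp_all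
    have c: "y \<in> carrier H" "z \<in> carrier H" using d G_carrier by blast+
    consider "k = 1" "l = 0" | "k = 0" "l = 1" using d(1) by linarith
    then have "f [y, z] = ?S [y, z]"
    proof cases
      case 1
      then have yz': "y \<in> G 1" "z \<in> G 0" using d by simp_all
      have "f [y, z] = (\<Sum>i<n. der i y * f [x \<otimes> e i, z])"
        using linear_form_G1[of "\<lambda>y. f [y, z]", OF _ yz'(1)] f c by (simp add: multilinear2_iff)
      also have "\<dots> = (\<Sum>i<n. der i y * (\<Sum>j<n. chi j z * f [x \<otimes> e i, e j]))"
        using f by (intro sum.cong refl arg_cong2[where f = "(*)"] linear_form_G0[OF _ yz'(2)]) (simp add: multilinear2_iff)
      finally show ?thesis using forms_homogeneous(2)[OF yz'(1)] by (simp add: sum_distrib_left mult_ac)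
    next
      case 2
      then have yz': "y \<in> G 0" "z \<in> G 1" using d by simp_all
      have "f [y, z] = (\<Sum>i<n. chi i y * f [e i, z])"
        using linear_form_G0[of "\<lambda>y. f [y, z]", OF _ yz'(1)] f c by (simp add: multilinear2_iff)
      also have "\<dots> = (\<Sum>i<n. chi i y * (\<Sum>j<n. der j z * f [e i, x \<otimes> e j]))"
        using f by (intro sum.cong refl arg_cong2[where f = "(*)"] linear_form_G1[OF _ yz'(2)]) (simp add: multilinear2_iff)
      finally show ?thesis using forms_homogeneous(1)[OF yz'(1)] by (simp add: sum_distrib_left mult_ac)
    qed
    then show ?thesis by (simp only: yz)
  qed
  have "t f = tensor_sum L f" "t ?S = tensor_sum L ?S" using L(2) f S unfolding tensor_eq_def by blast+
  moreover have "tensor_sum L f = tensor_sum L ?S"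
    unfolding tensor_sum_def by (intro arg_cong[where f = sum_list] map_cong refl fS)
  ultimately have "t f = t ?S" by simp
  also have "\<dots> = (\<Sum>i<n. \<Sum>j<n. f [x \<otimes> e i, e j] * t (prod2 (der i) (chi j)) + f [e i, x \<otimes> e j] * t (prod2 (chi i) (der j)))"
    using ml by (simp add: tensors_apply_sum[OF t(1)] tensors_apply_times[OF t(1)] tensors_apply_plus[OF t(1)]
      multilinear_sum multilinear_times multilinear_plus)
  also have "\<dots> = skew2 H n e x (\<lambda>i j. t (prod2 (der i) (chi j))) (\<lambda>i j. t (prod2 (chi i) (der j))) f"
    by (simp add: skew2_def mult.commute)
  finally show "t f = \<dots>" .
qed

definition alpha :: "nat \<Rightarrow> nat \<Rightarrow> complex" where "alpha i j = comult H x (prod2 (der i) (chi j))"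
definition beta :: "nat \<Rightarrow> nat \<Rightarrow> complex" where "beta i j = comult H x (prod2 (chi i) (der j))"
definition omega :: "nat \<Rightarrow> nat \<Rightarrow> nat \<Rightarrow> complex" where
  "omega i j k = associator H (prod3 (chi i) (chi j) (chi k))"

lemma associator_K: "associator K \<in> tensors K 3" "tensor_eq H 3 (associator K) (associator H)"
proof -
  obtain u where "u \<in> tensors K 3" "tensor_eq H 3 u (associator H)"
    using graded_tensors_0[OF associator_G] by auto
  then show "associator K \<in> tensors K 3" "tensor_eq H 3 (associator K) (associator H)"
    by (rule restrict_associator)+
qed

lemma x_shift_system: "shift_system H n e x alpha beta omega"
proof (intro shift_system.intro shift_system_axioms.intro e_weight_system x_carrier x_e')
  show "tensor_eq H 2 (comult H x) (skew2 H n e x alpha beta)"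
    using tensor_degree_1[OF comult_closed[OF x_carrier] comult_G[OF x_G]] unfolding alpha_def beta_def .
  show "counit H x = 0" by (rule counit_G[OF _ x_G]) simp
  show "associator H \<in> tensors H 3"
    using quasi_hopf_algebra.associator_invertible[OF quasi_hopf] by (simp add: tensor_invertible_def)
  have "omega = (\<lambda>i j k. associator K (prod3 (chi i) (chi j) (chi k)))"
    using associator_K(2) prod3_multilinear[OF chi_linear chi_linear chi_linear]
    by (auto simp: tensor_eq_def omega_def fun_eq_iff)
  then show "tensor_eq H 3 (associator H) (dg3 omega)"
    using tensor_eq_trans[OF tensor_eq_sym[OF associator_K(2)] tensor_K_diag3[OF associator_K(1)]] by simp
qed

sublocale shift_system H n e x alpha beta omega by (rule x_shift_system)

lemma x_shift_forms: "shift_forms H n e x alpha beta omega chi der"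
  by (intro shift_forms.intro shift_forms_axioms.intro x_shift_system)
    (assumption | rule chi_linear der_linear forms_monomial chi_mult der_mult)+

text \<open>A product of characters is multiplicative on tensors, so it takes the invertible
  associator to a nonzero scalar.\<close>

lemma omega_nz:
  assumes "i < n" "j < n" "k < n" shows "omega i j k \<noteq> 0"
proof -
  interpret s: shift_forms H n e x alpha beta omega chi der by (rule x_shift_forms)
  obtain u where u: "u \<in> tensors H 3" "tensor_eq H 3 (associator H \<star> u) (tensor_one H 3)"
    using quasi_hopf_algebra.associator_invertible[OF quasi_hopf]
    unfolding tensor_invertible_def is_tensor_inverse_def by blast
  have "omega i j k * u (prod3 (chi i) (chi j) (chi k)) = tensor_one H 3 (prod3 (chi i) (chi j) (chi k))"
    using s.tensor_mult_forms3(1)[OF associator_closed u(1) assms] u(2) by (simp add: omega_def tensor_eq_def)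
  then show ?thesis using assms by (auto simp: tensor_one_def pure_tensor_def numeral_3_eq_3 s.chi_one)
qed

end

section \<open>Associators of cyclic groups\<close>

lemma powi_mod:
  assumes "primitive_root_of_unity n Q" shows "Q powi m = Q ^ nat (m mod int n)"
proof -
  have Q: "Q ^ n = 1" "n > 0" "Q \<noteq> 0"
    using assms primitive_root_nonzero[OF assms] by (auto simp: primitive_root_of_unity_def)
  have "Q powi m = Q powi (m mod int n + int n * (m div int n))" by simp
  also have "\<dots> = Q powi (m mod int n) * (Q powi int n) powi (m div int n)"
    using Q(3) by (simp only: power_int_add power_int_mult simp_thms)
  also have "Q powi int n = 1" using Q(1) by simp
  also have "Q powi (m mod int n) = Q ^ nat (m mod int n)" using Q(2) by (simp add: power_int_def)
  finally show ?thesis by simp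
qed

lemma powi_cong:
  assumes "primitive_root_of_unity n Q" "l - m = int n * k" shows "Q powi l = Q powi m"
proof -
  have "l = m + int n * k" using assms(2) by simp
  then have "l mod int n = m mod int n" by simp
  then show ?thesis by (simp add: powi_mod[OF assms(1)])
qed

lemma primitive_root_coprime_powi:
  assumes Q: "primitive_root_of_unity n Q" and m: "coprime m (int n)"
  shows "primitive_root_of_unity n (Q powi m)"
proof -
  define k where "k = nat (m mod int n)"
  have n: "n > 0" using Q by (simp add: primitive_root_of_unity_def)
  have "coprime (int k) (int n)" using m n by (simp add: k_def coprime_mod_left_iff)
  then have k: "coprime k n" by simp
  have "(Q ^ k) ^ l \<noteq> 1" if "0 < l" "l < n" for l
  proof
    assume "(Q ^ k) ^ l = 1"
    then have "n dvd k * l" using primitive_root_mod_eq_iff[OF Q, of "k * l" 0] by (simp add: power_mult mod_eq_0_iff_dvd)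
    then have "n dvd l" using k by (simp add: coprime_dvd_mult_right_iff coprime_commute)
    then show False using that by (auto dest: dvd_imp_le)
  qed
  moreover have "(Q ^ k) ^ n = 1"
    using Q by (simp add: primitive_root_of_unity_def power_mult[symmetric] mult.commute[of k]) (simp add: power_mult)
  ultimately show ?thesis unfolding powi_mod[OF Q] k_def[symmetric] primitive_root_of_unity_def using n by blast
qed

text \<open>From \<open>q\<^sup>k = 1\<close> follows that the \<open>k\<close>-th power of
  \<open>q\<^sup>n\<close> is 1, hence \<open>k = n l\<close>; then the \<open>l\<close>-th power of
  \<open>q\<^sup>n\<close> is 1 with \<open>0 < l < n\<close>.\<close>

lemma primitive_root_square:
  assumes "primitive_root_of_unity n (q ^ n)" "n > 0" shows "primitive_root_of_unity (n\<^sup>2) q"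
  unfolding primitive_root_of_unity_def
proof (intro conjI allI impI notI)
  show "q ^ (n\<^sup>2) = 1" using assms(1) by (simp add: primitive_root_of_unity_def power2_eq_square power_mult)
  fix k assume k: "0 < k \<and> k < n\<^sup>2" and q: "q ^ k = 1"
  have "(q ^ n) ^ k = 1" using q by (simp add: power_mult[symmetric] mult.commute[of n]) (simp add: power_mult)
  then have "n dvd k" using primitive_root_mod_eq_iff[OF assms(1), of k 0] by (simp add: mod_eq_0_iff_dvd)
  then obtain l where l: "k = n * l" by blast
  then have "(q ^ n) ^ l = 1" using q by (simp add: power_mult)
  moreover have "0 < l" "l < n" using k l by (auto simp: power2_eq_square)
  ultimately show False using assms(1) by (simp add: primitive_root_of_unity_def)
qed (use assms in simp)

text \<open>The associator \<open>\<Phi>\<^sub>s\<close> is written with respect to \<open>Q\<close>, while \<open>A(q)\<close> uses the root of unity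
  \<open>Q\<^sup>r\<close>; the two normal forms differ by a coboundary.\<close>

lemma cyclic_cocycle_twist3:
  fixes r :: nat and s :: int
  assumes Q: "primitive_root_of_unity n Q" and ijk: "i < n" "j < n" "k < n"
  defines "F \<equiv> \<lambda>i j. Q powi (s * int (r * i * ((r * j) div n)))"
  shows "Q powi (s * int ((r * i) mod n) *
      ((int ((r * j) mod n + (r * k) mod n) - int (((r * j) mod n + (r * k) mod n) mod n)) div int n)) =
    twist3 n F (A_omega n (Q powi (- s * int (r * r)))) i j k"
proof -
  have n: "n > 0" using ijk by simp
  have Q0: "Q \<noteq> 0" using primitive_root_nonzero[OF Q] .
  \<comment> \<open>Quotients of \<open>r j\<close> by \<open>n\<close>. As an integral cochain,
    \<open>m\<close> has a coboundary that compares \<open>r\<close> times the carry of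
    \<open>j + k\<close> with the carry of the remainders; this is where \<open>F\<close> comes
    from.\<close>
  define m where "m j = int ((r * j) div n)" for j
  define \<rho> where "\<rho> j = int ((r * j) mod n)" for j
  have rm: "int r * int j = int n * m j + \<rho> j" for j
    unfolding m_def \<rho>_def of_nat_mult[symmetric] of_nat_add[symmetric] by (metis mult_div_mod_eq)
  define c where "c = int ((j + k) div n)"
  have jk: "int j + int k = int n * c + int ((j + k) mod n)"
    unfolding c_def of_nat_mult[symmetric] of_nat_add[symmetric] by (metis mult_div_mod_eq)
  define d where "d = int ((i + j) div n)"
  have ij: "int i + int j = int n * d + int ((i + j) mod n)"
    unfolding d_def of_nat_mult[symmetric] of_nat_add[symmetric] by (metis mult_div_mod_eq)
  \<comment> \<open>This turns out to be the carry of the remainders of \<open>r j\<close> and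
    \<open>r k\<close>.\<close>
  define D where "D = m ((j + k) mod n) + int r * c - m j - m k"
  have "int n * D + \<rho> ((j + k) mod n) = \<rho> j + \<rho> k"
  proof -
    have "int n * D + \<rho> ((j + k) mod n) =
        (int n * m ((j + k) mod n) + \<rho> ((j + k) mod n)) + int r * (int n * c) - int n * m j - int n * m k"
      by (simp add: D_def algebra_simps)
    also have "\<dots> = int r * (int n * c + int ((j + k) mod n)) - int n * m j - int n * m k"
      using rm[of "(j + k) mod n"] by (simp add: algebra_simps)
    also have "\<dots> = \<rho> j + \<rho> k" unfolding jk[symmetric] distrib_left rm by simp
    finally show ?thesis .
  qed
  moreover have "0 \<le> \<rho> ((j + k) mod n)" "\<rho> ((j + k) mod n) < int n" using n by (simp_all add: \<rho>_def)
  ultimately have "(\<rho> j + \<rho> k) div int n = D" "(\<rho> j + \<rho> k) mod int n = \<rho> ((j + k) mod n)"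
    by (metis div_pos_pos_trivial div_mult_self4 add.commute add_0 n of_nat_0_less_iff less_irrefl,
        metis mod_mult_self4 mod_pos_pos_trivial)
  then have D: "(\<rho> j + \<rho> k - (\<rho> j + \<rho> k) mod int n) div int n = D"
    unfolding minus_mod_eq_mult_div using n by simp
  have F: "F i j = Q powi (s * (int r * int i * m j))" for i j by (simp add: F_def m_def)
  have om: "A_omega n (Q powi (- s * int (r * r))) i j k = Q powi (s * (int r * int r * int i * c))"
  proof -
    have "inverse (Q powi (- s * int (r * r))) = Q powi (s * int (r * r))" by (simp add: power_int_minus[symmetric])
    then have "A_omega n (Q powi (- s * int (r * r))) i j k = (Q powi (s * int (r * r))) powi int (i * ((j + k) div n))"
      using ijk by (simp only: A_omega_def power_int_of_nat mod_less)
    also have "\<dots> = Q powi (s * (int r * int r * int i * c))"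
      unfolding power_int_mult[symmetric] by (simp add: c_def algebra_simps)
    finally show ?thesis .
  qed
  have inv: "1 / Q powi l = Q powi (- l)" for l by (simp add: power_int_minus divide_inverse)
  have mult: "Q powi a * Q powi b = Q powi (a + b)" for a b using Q0 by (simp add: power_int_add)
  have "twist3 n F (A_omega n (Q powi (- s * int (r * r)))) i j k =
      Q powi (s * (int r * int j * m k) + s * (int r * int i * m ((j + k) mod n)) + s * (int r * int r * int i * c)
        + - (s * (int r * int ((i + j) mod n) * m k)) + - (s * (int r * int i * m j)))"
    unfolding twist3_def om F inv mult by simp
  \<comment> \<open>The exponents agree only modulo \<open>n\<close>: reducing \<open>r i\<close>
    and \<open>i + j\<close> costs multiples of \<open>n\<close>, which the witness below
    collects.\<close>
  also have "\<dots> = Q powi (s * \<rho> i * D)"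
  proof (rule powi_cong[OF Q])
    have "\<rho> i = int r * int i - int n * m i" "int ((i + j) mod n) = int i + int j - int n * d" using rm[of i] ij by simp_all
    then show "s * (int r * int j * m k) + s * (int r * int i * m ((j + k) mod n)) + s * (int r * int r * int i * c)
        + - (s * (int r * int ((i + j) mod n) * m k)) + - (s * (int r * int i * m j)) - s * \<rho> i * D =
      int n * (s * int r * d * m k + s * m i * D)"
      by (simp only: D_def) (simp add: algebra_simps)
  qed
  finally show ?thesis unfolding D[symmetric] by (simp add: \<rho>_def zmod_int)
qed

text \<open>Coboundaries are multiplicative, so the twist by \<open>F\<close> passes to the other
  side as a division.\<close>

lemma twist3_quotient:
  assumes "\<And>i j. i < n \<Longrightarrow> j < n \<Longrightarrow> F i j \<noteq> 0" "i < n" "j < n" "k < n"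
    and "twist3 n F w i j k = twist3 n F' w' i j k"
  shows "w i j k = twist3 n (\<lambda>i j. F' i j / F i j) w' i j k"
proof -
  have "F j k \<noteq> 0" "F i j \<noteq> 0" "F i ((j + k) mod n) \<noteq> 0" "F ((i + j) mod n) k \<noteq> 0" using assms(1-4) by simp_all
  then have "w i j k = twist3 n F w i j k * (F ((i + j) mod n) k * F i j) / (F j k * F i ((j + k) mod n))"
    by (simp add: twist3_def)
  then show ?thesis unfolding assms(5) by (simp add: twist3_def divide_inverse mult_ac)
qed

lemma shift_system_cong:
  assumes "shift_system H n e x \<alpha> \<beta> \<omega>"
    and "\<And>i j. i < n \<Longrightarrow> j < n \<Longrightarrow> \<alpha> i j = \<alpha>' i j" "\<And>i j. i < n \<Longrightarrow> j < n \<Longrightarrow> \<beta> i j = \<beta>' i j"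
    "\<And>i j k. i < n \<Longrightarrow> j < n \<Longrightarrow> k < n \<Longrightarrow> \<omega> i j k = \<omega>' i j k"
  shows "shift_system H n e x \<alpha>' \<beta>' \<omega>'"
proof -
  interpret shift_system H n e x \<alpha> \<beta> \<omega> by fact
  have "skew2 H n e x \<alpha> \<beta> = skew2 H n e x \<alpha>' \<beta>'" "dg3 \<omega> = dg3 \<omega>'"
    using assms(2-4) by (intro skew2_cong diag3_cong; simp)+
  then show ?thesis using comult_x associator_eq
    by (intro shift_system.intro shift_system_axioms.intro weight_system_axioms x_closed x_e counit_x associator_closed) simp_all
qed

section \<open>Comparison with the standard cyclic associator\<close>

context cyclic_graded_quasi_hopf
begin

text \<open>\<open>chi i\<close> takes \<open>a\<close> to
  \<open>W\<^sup>i = Q\<^sup>r\<^sup>i\<close>, so it is 1 on the \<open>Q\<close>-idempotent of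
  index \<open>r i\<close> and 0 on the others. This is the change between the two
  indexings.\<close>

lemma chi_idem:
  assumes Q: "primitive_root_of_unity n Q" and WQ: "W = Q ^ r" and i: "i' < n"
  shows "chi i (idem K n a Q i') = (if (r * i) mod n = i' then 1 else 0)"
proof -
  have ak: "chi i (a [^] k) = W ^ (i * k)" for k :: nat
    using a_pow_e[of k i] proj_homogeneous[OF G_pow_0[OF a_G], of 0 k] by (intro chi_unique) simp
  have "idem K n a Q i' = (\<Oplus>k\<in>{..<n}. (inverse Q ^ (i' * k) / of_nat n) \<odot> (a [^] k))"
    unfolding idem_def K.pow_eq by (simp, rule K.finsum_eq) (auto intro: G_smult G_pow_0 a_G)
  then have "chi i (idem K n a Q i') = (\<Sum>k<n. chi i ((inverse Q ^ (i' * k) / of_nat n) \<odot> (a [^] k)))"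
    using linear_form_finsum[OF chi_linear, of "{..<n}" "\<lambda>k. (inverse Q ^ (i' * k) / of_nat n) \<odot> (a [^] k)" i] by simp
  also have "\<dots> = (\<Sum>k<n. inverse Q ^ (i' * k) / of_nat n * W ^ (i * k))"
    using chi_linear[of i] ak by (simp add: linear_form_def)
  also have "\<dots> = (\<Sum>k<n. Q ^ (r * i * k) * inverse Q ^ (i' * k)) / of_nat n"
    unfolding sum_divide_distrib by (intro sum.cong refl) (simp add: WQ power_mult[symmetric] mult_ac)
  also have "\<dots> = (if (r * i) mod n = i' then 1 else 0)"
    unfolding primitive_root_sum[OF Q] using i n_pos by simp
  finally show ?thesis .
qed

lemma cyclic_associator_forms:
  assumes Q: "primitive_root_of_unity n Q" and WQ: "W = Q ^ r"
  shows "cyclic_associator K n a Q s (prod3 (chi i) (chi j) (chi k)) = Q powi (s * int ((r * i) mod n) *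
      ((int ((r * j) mod n + (r * k) mod n) - int (((r * j) mod n + (r * k) mod n) mod n)) div int n))"
proof -
  let ?g = "\<lambda>i j l. Q powi (s * int i * ((int (j + l) - int ((j + l) mod n)) div int n))"
  have "cyclic_associator K n a Q s (prod3 (chi i) (chi j) (chi k)) =
     (\<Sum>i'<n. \<Sum>j'<n. \<Sum>l'<n. if l' = (r * k) mod n then if j' = (r * j) mod n then if i' = (r * i) mod n then ?g i' j' l' else 0 else 0 else 0)"
    unfolding cyclic_associator_def by (intro sum.cong refl) (auto simp: chi_idem[OF Q WQ])
  also have "\<dots> = ?g ((r * i) mod n) ((r * j) mod n) ((r * k) mod n)" using n_pos by simp
  finally show ?thesis .
qed

text \<open>Over \<open>G 0\<close> every twist is diagonal, so twist equivalence becomes an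
  equation of cochains. The retract moves tensor identities between \<open>K\<close> and
  \<open>H\<close>, where the characters read off coefficients.\<close>

lemma twist_equivalent_coefficients:
  assumes "twist_equivalent K (associator K) \<Psi>"
  obtains F where "\<And>i j. i < n \<Longrightarrow> j < n \<Longrightarrow> F i j \<noteq> 0" "\<And>j. j < n \<Longrightarrow> F 0 j = 1" "\<And>i. i < n \<Longrightarrow> F i 0 = 1"
    "\<And>i j k. i < n \<Longrightarrow> j < n \<Longrightarrow> k < n \<Longrightarrow> twist3 n F omega i j k = \<Psi> (prod3 (chi i) (chi j) (chi k))"
proof -
  interpret KW: weight_system K n e by (rule K_weight_system)
  interpret s: shift_forms H n e x alpha beta omega chi der by (rule x_shift_forms)
  obtain J where J: "is_twist K J" "tensor_eq K 3 (twist_associator K J (associator K)) \<Psi>"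
    using assms unfolding twist_equivalent_def by blast
  then obtain u where Ju: "J \<in> tensors K 2" "u \<in> tensors K 2" "tensor_eq K 2 (tensor_mult K J u) (tensor_one K 2)"
    unfolding is_twist_def tensor_invertible_def is_tensor_inverse_def by blast
  define F where "F i j = J (prod2 (chi i) (chi j))" for i j
  have JF: "tensor_eq H 2 J (dg2 F)" using tensor_K_diag2[OF Ju(1)] unfolding F_def[abs_def] .
  have F: "F i j \<noteq> 0" if "i < n" "j < n" for i j
  proof -
    have "tensor_eq H 2 (J \<star> u) (tensor_one H 2)"
      using K.tensor_eq_extend[OF Ju(3)] by (simp add: K.tensor_mult_eq K.tensor_one_eq)
    then have "F i j * u (prod2 (chi i) (chi j)) = tensor_one H 2 (prod2 (chi i) (chi j))"
      using s.tensor_mult_forms(1)[OF K.tensors_extend[OF Ju(1)] K.tensors_extend[OF Ju(2)] that] s.prod2_ml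
      unfolding F_def tensor_eq_def by metis
    then show ?thesis using that by (auto simp: tensor_one_def pure_tensor_def numeral_2_eq_2 s.chi_one)
  qed
  have f1: "multilinear H 1 (\<lambda>xs. chi i (xs ! 0))" for i by (simp add: multilinear1_iff chi_linear del: One_nat_def)
  have cK: "counit_at K i J = counit_at H i J" for i by (simp add: counit_at_def)
  have c: "counit_at H l (dg2 F) (\<lambda>xs. chi i (xs ! 0)) = 1" if l: "l < 2" and i: "i < n" for l i
  proof -
    have "tensor_eq K 1 (counit_at K l J) (tensor_one K 1)"
      using J(1) l unfolding is_twist_def by (cases l) (auto simp: less_Suc_eq numeral_2_eq_2)
    then have "tensor_eq H 1 (counit_at H l J) (tensor_one H 1)"
      using K.tensor_eq_extend by (simp add: cK K.tensor_one_eq)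
    then have "tensor_eq H 1 (counit_at H l (dg2 F)) (tensor_one H 1)"
      using tensor_eq_trans[OF tensor_eq_sym[OF counit_at_cong[OF JF l]]] by blast
    then show ?thesis using f1[of i] i by (simp add: tensor_eq_def tensor_one_def pure_tensor_def s.chi_one)
  qed
  have F0: "F 0 i = 1" if i: "i < n" for i
  proof -
    have "counit_at H 0 (dg2 F) (\<lambda>xs. chi i (xs ! 0)) = (\<Sum>a<n. \<Sum>b<n. if b = i then if a = 0 then F a b else 0 else 0)"
      unfolding counit_at_def diag2_def using i by (intro sum.cong refl) (auto simp: counit_e s.chi_e)
    then show ?thesis using c[of 0 i] i by simp
  qed
  have F1: "F i 0 = 1" if i: "i < n" for i
  proof -
    have "counit_at H 1 (dg2 F) (\<lambda>xs. chi i (xs ! 0)) = (\<Sum>a<n. \<Sum>b<n. if b = 0 then if a = i then F a b else 0 else 0)"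
      unfolding counit_at_def diag2_def using i by (intro sum.cong refl) (auto simp: counit_e s.chi_e)
    then show ?thesis using c[of 1 i] i n_pos by simp
  qed
  have JK: "tensor_eq K 2 J (dg2 F)" using Ju(1) JF by (intro K.tensor_eq_restrict KW.diag2_closed)
  have "tensor_eq H 3 (associator K) (dg3 omega)" using tensor_eq_trans[OF associator_K(2) associator_eq] .
  then have "tensor_eq K 3 (associator K) (dg3 omega)" by (intro K.tensor_eq_restrict KW.diag3_closed associator_K)
  then have "tensor_eq K 3 (twist_associator K J (associator K)) (dg3 (twist3 n F omega))"
    using KW.twist_associator_diag(2)[OF F Ju(1) JK associator_K(1)] by blast
  then have "dg3 (twist3 n F omega) (prod3 (chi i) (chi j) (chi k)) = \<Psi> (prod3 (chi i) (chi j) (chi k))" for i j k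
    using J(2) K.multilinear_restrict[OF s.prod3_ml(1)[of i j k]] unfolding tensor_eq_def by metis
  then show ?thesis using that[of F] F F0 F1 s.diag3_forms(1) by metis
qed

end

section \<open>Classification\<close>

text \<open>Scalar form of the q-commutation of the two summands of \<open>\<Delta>(x)\<close>. At
  the carry \<open>j = n - 1\<close> the first index of \<open>A_alpha\<close> falls back from
  \<open>q\<^sup>n\<close> to 1 on the left, balanced by an extra factor
  \<open>q\<^sup>-\<^sup>n\<close> of \<open>A_beta\<close> on the right.\<close>

lemma A_commutation:
  assumes "i < n" "j < n" "(q ^ n) ^ n = 1" "q \<noteq> 0"
  shows "A_alpha n q i (Suc j mod n) * A_beta n q i j = q * (A_beta n q (Suc i mod n) j * A_alpha n q i j)"
proof (cases "Suc j < n")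
  case True
  then show ?thesis using assms by (simp add: A_alpha_def A_beta_def)
next
  case False
  then have j: "Suc j = n" using assms by simp
  then have jn: "(j mod n + 1) div n = 1" "Suc j mod n = 0" using assms by simp_all
  have q: "q ^ Suc j = q ^ n" by (simp add: j)
  have "inverse (q ^ n) ^ (Suc i mod n) = inverse (q ^ n) ^ Suc i"
  proof (cases "Suc i = n")
    case True
    then show ?thesis using assms(3) by (simp add: power_inverse del: power_Suc)
  qed (use assms in simp)
  moreover have "q * (inverse (q ^ n) ^ Suc i * q ^ j) = inverse (q ^ n) ^ i * (inverse (q ^ n) * q ^ Suc j)"
    by (simp only: power_Suc mult_ac)
  ultimately show ?thesis using assms unfolding A_alpha_def A_beta_def jn q by simp
qed

context cyclic_graded_quasi_hopf
begin

lemma generates_nilpotent: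
  assumes "finite_dim H" "generates y" shows "\<exists>k. y [^] (k::nat) = \<zero>"
proof -
  obtain M where "\<And>k h. k \<ge> M \<Longrightarrow> h \<in> G k \<Longrightarrow> h = \<zero>" using finite_dim_degree_bound[OF assms(1)] by blast
  then show ?thesis using G_pow[of y M] assms(2) unfolding generates_def by blast
qed

text \<open>A homogeneous \<open>h\<close> is the sum of its pieces \<open>h e\<^sub>i\<close>,
  which are multiples of monomials by \<open>component_e\<close>; this is the spanning condition of
  \<open>graded_modelI\<close>.\<close>

lemma graded_model_of_generator:
  assumes y: "generates y" and B: "shift_system H n e y \<alpha>' \<beta>' \<omega>'" and N: "N > 1" and yN: "y [^] N = \<zero>"
    and nz: "\<And>k i. k < N \<Longrightarrow> i < n \<Longrightarrow> y [^] k \<otimes> e i \<noteq> \<zero>"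
  shows "graded_model H n e y \<alpha>' \<beta>' \<omega>' N"
proof -
  interpret B: shift_system H n e y \<alpha>' \<beta>' \<omega>' by (rule B)
  have yG: "y [^] k \<otimes> e i \<in> G k" for k i
    using G_mult[OF G_pow e_G, of y k i] y unfolding generates_def by simp
  show ?thesis
  proof (rule B.graded_modelI[OF n_gt N yN nz proj_linear])
    fix k l i assume "k < N" "l < N" "i < n"
    show "proj k (y [^] l \<otimes> e i) = (if k = l then y [^] l \<otimes> e i else \<zero>)" by (rule proj_homogeneous[OF yG])
  next
    fix h assume "h \<in> carrier H"
    then show "\<exists>c. h = combination H e y N n c"
    proof (induction h rule: graded_induct)
      case (homogeneous k h)
      note h = G_carrier[OF homogeneous]
      have "h \<otimes> (\<Oplus>i\<in>{..<n}. e i) = (\<Oplus>i\<in>{..<n}. h \<otimes> e i)" using h by (intro finsum_rdistr) auto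
      then have "h = (\<Oplus>i\<in>{..<n}. h \<otimes> e i)" using h e_sum by simp
      moreover have "\<exists>c. (\<Oplus>i\<in>{..<n}. h \<otimes> e i) = combination H e y N n c"
      proof (rule B.combination_finsum)
        fix i assume i: "i \<in> {..<n}"
        obtain c where c: "h \<otimes> e i = c \<odot> (y [^] k \<otimes> e i)" using component_e[OF y homogeneous] by blast
        show "\<exists>c. h \<otimes> e i = combination H e y N n c"
        proof (cases "k < N")
          case True
          then show ?thesis using B.combination_smult_mono[of k N i c] i c by auto
        next
          case False
          then have "y [^] k = y [^] N \<otimes> y [^] (k - N)" by (simp add: nat_pow_mult)
          then have "h \<otimes> e i = 0 \<odot> (y [^] (0::nat) \<otimes> e i)" using c by (simp add: yN)
          then show ?thesis using B.combination_smult_mono[of 0 N i 0] i N by auto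
        qed
      qed simp
      ultimately show ?case by simp
    next
      case (add g h)
      then obtain c d where "g = combination H e y N n c" "h = combination H e y N n d" by blast
      then have "g \<oplus> h = combination H e y N n (\<lambda>k i. c k i + d k i)" by (simp add: B.combination_add)
      then show ?case by blast
    qed
  qed
qed

theorem iso_A_algebra:
  assumes fin: "finite_dim H" and Q: "primitive_root_of_unity n Q" and WQ: "W = Q ^ r"
    and r: "coprime (int r) (int n)" and s: "coprime s (int n)"
    and tw: "twist_equivalent K (associator K) (cyclic_associator K n a Q s)"
  shows "\<exists>q. primitive_root_of_unity (n\<^sup>2) q \<and> iso_up_to_twist H (A_algebra n q)"
proof -
  interpret s: shift_forms H n e x alpha beta omega chi der by (rule x_shift_forms)
  have Q0: "Q \<noteq> 0" using primitive_root_nonzero[OF Q] .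
  obtain F where F: "\<And>i j. i < n \<Longrightarrow> j < n \<Longrightarrow> F i j \<noteq> 0" "\<And>j. j < n \<Longrightarrow> F 0 j = 1" "\<And>i. i < n \<Longrightarrow> F i 0 = 1"
    and F\<omega>: "\<And>i j k. i < n \<Longrightarrow> j < n \<Longrightarrow> k < n \<Longrightarrow>
      twist3 n F omega i j k = cyclic_associator K n a Q s (prod3 (chi i) (chi j) (chi k))"
    using twist_equivalent_coefficients[OF tw] by blast
  \<comment> \<open>The sign is due to \<open>A_omega\<close>, which is written with the inverse of
    its parameter.\<close>
  define R where "R = Q powi (- s * int (r * r))"
  define F1 where "F1 = (\<lambda>i j. Q powi (s * int (r * i * ((r * j) div n))))"
  \<comment> \<open>\<open>F\<close> twists \<open>omega\<close> into the standard cocycle and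
    \<open>F1\<close> twists the normal form into it, so the quotient twists the normal form into
    \<open>omega\<close>.\<close>
  define L where "L = (\<lambda>i j. F1 i j / F i j)"
  have R: "primitive_root_of_unity n R"
    unfolding R_def by (rule primitive_root_coprime_powi[OF Q]) (use r s in simp)
  have Rn: "R ^ n = 1" using R by (simp add: primitive_root_of_unity_def)
  have \<omega>: "omega i j k = twist3 n L (A_omega n R) i j k" if ijk: "i < n" "j < n" "k < n" for i j k
    unfolding L_def R_def F1_def
    by (rule twist3_quotient[OF F(1) ijk])
      (simp_all only: F\<omega>[OF ijk] cyclic_associator_forms[OF Q WQ] cyclic_cocycle_twist3[OF Q ijk])
  have L: "L i j \<noteq> 0" "L 0 j = 1" "L i 0 = 1" if "i < n" "j < n" for i j
    using F that Q0 by (simp_all add: L_def F1_def)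
  have L': "\<And>j. j < n \<Longrightarrow> L 0 j = 1" "\<And>i. i < n \<Longrightarrow> L i 0 = 1" using L n_pos by blast+
  note ce = s.coassoc_equations[OF quasi_hopf omega_nz] s.counit_equations[OF quasi_hopf]
  obtain q u where q: "q ^ n = R" and u: "\<And>i. u i \<noteq> 0" "\<And>i. u (i mod n) = u i"
    and s1: "\<And>i j. i < n \<Longrightarrow> j < n \<Longrightarrow> alpha i j * u (i + j) / u i = L (Suc i mod n) j * A_alpha n q i j / L i j"
    and s2: "\<And>i j. i < n \<Longrightarrow> j < n \<Longrightarrow> beta i j * u (i + j) / u j = L i (Suc j mod n) * A_beta n q i j / L i j"
    by (rule twisted_coassoc_equations_solution[OF n_gt Rn \<omega> L(1) L' ce(1) ce(2) ce(3) ce(4) ce(5)]) (assumption | rule that)+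
  have qn2: "primitive_root_of_unity (n\<^sup>2) q" using R n_pos by (intro primitive_root_square) (simp_all add: q)
  interpret AA: A_root n q by (rule A_root.intro[OF qn2 n_gt])
  have q0: "q \<noteq> 0" using primitive_root_nonzero[OF qn2] .
  define U where "U = (\<Oplus>i\<in>{..<n}. u i \<odot> e i)"
  define y where "y = x \<otimes> U"
  let ?a = "\<lambda>i j. L (Suc i mod n) j * A_alpha n q i j / L i j" and ?b = "\<lambda>i j. L i (Suc j mod n) * A_beta n q i j / L i j"
  let ?w = "twist3 n L (A_omega n (q ^ n))"
  have "shift_system H n e y (\<lambda>i j. alpha i j * u (i + j) / u i) (\<lambda>i j. beta i j * u (i + j) / u j) omega"
    unfolding y_def U_def by (rule rescaled_shift_system[of u, OF u])
  then have B: "shift_system H n e y ?a ?b ?w"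
    by (rule shift_system_cong) (simp_all only: s1 s2 \<omega> q)
  interpret B: shift_system H n e y ?a ?b ?w by (rule B)
  have U: "U \<in> G 0" unfolding U_def by (intro G_finsum G_smult e_G) simp
  have ye: "y \<otimes> e j = u j \<odot> (x \<otimes> e j)" for j
    using weight_sum_mult(1)[of u j, OF u(2)] G_carrier[OF U] unfolding y_def U_def[symmetric]
    by (simp add: m_assoc smult_mult_right)
  have y: "generates y"
    unfolding generates_def
  proof (intro conjI ballI allI)
    show "y \<in> G 1" unfolding y_def using G_mult[OF x_G U] by simp
    show "y \<otimes> e i = e (Suc i) \<otimes> y" for i by (rule B.x_e)
    fix h j assume "h \<in> G 1"
    then obtain c where "h \<otimes> e j = c \<odot> (x \<otimes> e j)" using generates_x unfolding generates_def by blast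
    then have "h \<otimes> e j = (c / u j) \<odot> (y \<otimes> e j)" using u(1) by (simp add: ye smult_smult)
    then show "\<exists>c. h \<otimes> e j = c \<odot> (y \<otimes> e j)" by blast
  qed
  have N: "n\<^sup>2 > 1" using AA.N_gt .
  have ynz: "y \<noteq> \<zero>"
  proof
    assume "y = \<zero>"
    then have "u 0 \<odot> (x \<otimes> e 0) = \<zero>" using ye[of 0] by simp
    then show False using u(1) x_e_nz by (simp add: smult_eq_0_iff)
  qed
  \<comment> \<open>\<open>L\<close> contributes the same factor to both sides, so the relation is
    that of the constants of \<open>A(q)\<close>.\<close>
  have comm: "?a i (Suc j mod n) * ?b i j = q * (?b (Suc i mod n) j * ?a i j)" if "i < n" "j < n" for i j
  proof -
    have nz: "L i j \<noteq> 0" "L i (Suc j mod n) \<noteq> 0" "L (Suc i mod n) j \<noteq> 0" using that n_pos by (simp_all add: L(1))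
    have "?a i (Suc j mod n) * ?b i j = (L (Suc i mod n) (Suc j mod n) / L i j) * (A_alpha n q i (Suc j mod n) * A_beta n q i j)"
      using nz by simp
    also have "A_alpha n q i (Suc j mod n) * A_beta n q i j = q * (A_beta n q (Suc i mod n) j * A_alpha n q i j)"
      using that Rn q0 by (intro A_commutation) (simp_all add: q)
    finally show ?thesis using nz by simp
  qed
  have forms: "\<exists>\<phi>. linear_form H \<phi> \<and> (\<forall>l j. j < n \<longrightarrow> \<phi> (y [^] (l::nat) \<otimes> e j) = (if l = k \<and> j = i then 1 else 0))"
    if "i < n" "y [^] (k::nat) \<otimes> e i \<noteq> \<zero>" for k i
    using coord_linear[OF y that(2)] coord_monomial[OF y that(2) that(1)] by blast
  have ab: "?a i j \<noteq> 0" "?b i j \<noteq> 0" if "i < n" "j < n" for i j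
    using that n_pos q0 by (simp_all add: L(1) A_alpha_def A_beta_def)
  note no = B.nilpotency_order[OF qn2 N ab comm forms e_nz ynz generates_nilpotent[OF fin y]]
  have model: "graded_model H n e y ?a ?b ?w (n\<^sup>2)"
    by (rule graded_model_of_generator[OF y B N no])
  interpret A: graded_model "A_algebra n q" n AA.E taft_x "A_alpha n q" "A_beta n q" "A_omega n (q ^ n)" "n\<^sup>2"
    by (rule AA.A_graded_model)
  \<comment> \<open>The constants of \<open>y\<close> are those of \<open>A(q)\<close> after the
    twist by \<open>L\<close>, so the isomorphism goes to the twisted algebra.\<close>
  have "graded_model (twist (A_algebra n q) (diag2 n AA.E L)) n AA.E taft_x ?a ?b ?w (n\<^sup>2)"
    by (rule A.twist_graded_model[OF L(1)])
  from graded_model_iso[OF model this]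
  obtain \<phi> where "quasi_hopf_iso H (twist (A_algebra n q) (diag2 n AA.E L)) \<phi>" by blast
  moreover have "is_twist (A_algebra n q) (diag2 n AA.E L)" by (rule AA.A.diag2_is_twist[of L, OF L(1) L'])
  ultimately show ?thesis using qn2 unfolding iso_up_to_twist_def by blast
qed

end

theorem A_algebra_iso_up_to_twist_eq:
  assumes n: "n > 1" and q: "primitive_root_of_unity (n\<^sup>2) q" "primitive_root_of_unity (n\<^sup>2) q'"
    and iso: "iso_up_to_twist (A_algebra n q) (A_algebra n q')"
  shows "q = q'"
proof -
  interpret A: A_root n q by (rule A_root.intro[OF q(1) n])
  interpret B: A_root n q' by (rule A_root.intro[OF q(2) n])
  have "A_alpha n q 0 1 * A_beta n q' 1 0 = A_alpha n q' 0 1 * A_beta n q 1 0"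
    by (rule graded_model_invariant[OF A.A_graded_model B.A_graded_model iso])
  \<comment> \<open>For \<open>n > 1\<close> the two values of \<open>A_beta\<close> are 1 and those
    of \<open>A_alpha\<close> are \<open>q\<close> and \<open>q'\<close>.\<close>
  then show ?thesis using n by (simp add: A_alpha_def A_beta_def)
qed

theorem theorem3p12:
  fixes n :: nat
  assumes "n > 2"
  shows "(\<forall>(H :: 'a quasi_hopf) G a Q r s.
      quasi_hopf_algebra H \<and> finite_dim H \<and> radically_graded H G \<and>
      is_cyclic_group_algebra (restrict_quasi_hopf H (G 0)) n a \<and>
      \<not> twist_equivalent (restrict_quasi_hopf H (G 0))
          (associator (restrict_quasi_hopf H (G 0))) (tensor_one H 3) \<and>
      (\<exists>x \<in> G 1. bij_betw (\<lambda>h. h \<otimes>\<^bsub>H\<^esub> x) (G 0) (G 1)) \<and>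
      primitive_root_of_unity n Q \<and>
      twist_equivalent (restrict_quasi_hopf H (G 0))
        (associator (restrict_quasi_hopf H (G 0)))
        (cyclic_associator (restrict_quasi_hopf H (G 0)) n a Q s) \<and>
      (\<forall>z \<in> G 1. a \<otimes>\<^bsub>H\<^esub> z \<otimes>\<^bsub>H\<^esub> inv\<^bsub>H\<^esub> a = (Q powi r) \<odot>\<^bsub>H\<^esub> z) \<and>
      coprime r (int n) \<and> coprime s (int n) \<longrightarrow>
      (\<exists>q. primitive_root_of_unity (n^2) q \<and> iso_up_to_twist H (A_algebra n q)))
    \<and> (\<forall>q q'. primitive_root_of_unity (n^2) q \<and> primitive_root_of_unity (n^2) q' \<and> q \<noteq> q' \<longrightarrow>
         \<not> iso_up_to_twist (A_algebra n q) (A_algebra n q'))"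
proof (intro conjI allI impI)
  have n: "n > 1" using assms by simp
  fix H :: "'a quasi_hopf" and G :: "nat \<Rightarrow> 'a set" and a Q r s
  let ?K = "restrict_quasi_hopf H (G 0)"
  assume h: "quasi_hopf_algebra H \<and> finite_dim H \<and> radically_graded H G \<and>
      is_cyclic_group_algebra ?K n a \<and>
      \<not> twist_equivalent ?K (associator ?K) (tensor_one H 3) \<and>
      (\<exists>x \<in> G 1. bij_betw (\<lambda>h. h \<otimes>\<^bsub>H\<^esub> x) (G 0) (G 1)) \<and>
      primitive_root_of_unity n Q \<and>
      twist_equivalent ?K (associator ?K) (cyclic_associator ?K n a Q s) \<and>
      (\<forall>z \<in> G 1. a \<otimes>\<^bsub>H\<^esub> z \<otimes>\<^bsub>H\<^esub> inv\<^bsub>H\<^esub> a = (Q powi r) \<odot>\<^bsub>H\<^esub> z) \<and>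
      coprime r (int n) \<and> coprime s (int n)"
  then obtain x where x: "x \<in> G 1" "bij_betw (\<lambda>h. h \<otimes>\<^bsub>H\<^esub> x) (G 0) (G 1)" by blast
  have Q: "primitive_root_of_unity n Q" and r: "coprime r (int n)" using h by simp_all
  \<comment> \<open>Coprimality of \<open>r\<close> enters here: the eigenvalue of
    \<open>Ad(a)\<close> on \<open>G 1\<close> has to be a primitive root to index the
    idempotents.\<close>
  have "cyclic_graded_quasi_hopf H G n a (Q powi r) x"
    by (intro cyclic_graded_quasi_hopf.intro graded_quasi_hopf.intro graded_quasi_hopf_axioms.intro
        cyclic_graded_quasi_hopf_axioms.intro quasi_hopf_algebra.pre_bialgebra primitive_root_coprime_powi Q r x n)
      (use h x in simp_all)
  note C = this
  have fin: "finite_dim H" and s: "coprime s (int n)"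
    and tw: "twist_equivalent ?K (associator ?K) (cyclic_associator ?K n a Q s)" using h by blast+
  \<comment> \<open>\<open>r\<close> is an integer; its residue modulo \<open>n\<close> gives the
    natural exponent with the same power of \<open>Q\<close>.\<close>
  have r': "coprime (int (nat (r mod int n))) (int n)" using r n by (simp add: coprime_mod_left_iff)
  show "\<exists>q. primitive_root_of_unity (n^2) q \<and> iso_up_to_twist H (A_algebra n q)"
    by (rule cyclic_graded_quasi_hopf.iso_A_algebra[OF C fin Q powi_mod[OF Q] r' s tw])
next
  have n: "n > 1" using assms by simp
  fix q q' :: complex
  assume "primitive_root_of_unity (n^2) q \<and> primitive_root_of_unity (n^2) q' \<and> q \<noteq> q'"
  then show "\<not> iso_up_to_twist (A_algebra n q) (A_algebra n q')"
    using A_algebra_iso_up_to_twist_eq[OF n] by blast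
qed

end
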